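(* Let $k$ be a number field with a fixed algebraic closure $\bar k$, let $\ell$ be a rational prime, and let $n\ge 1$. Suppose $C/k$ is a curve with affine model $$y^{\ell^n} = \lambda f(x), \qquad f(x) \in k[x],$$ where $f(x)$ is monic. Let $S$ be the set of roots of $f(x)$ whose multiplicity is not divisible by $\ell^n$. Suppose that $f$ splits completely over $\mathcal{T}(k,\ell)$ and (a) at least one point of $C$ is totally ramified (in the $x$-coordinate covering $C\to\mathbb{P}^1$); (b) $\lambda$ is an $\ell$-unit and every $s \in S$ is an $\ell$-integer; (c) for all distinct $s, s' \in S$, $s-s'$ is an $\ell$-unit. Then the Jacobian $J$ of $C$ satisfies $k(J[\ell^\infty]) \subseteq \mathcal{T}(k,\ell)$.
   Context: $C$ denotes the complete smooth curve with the given affine model. $\mu_{\ell^\infty}\subset \bar k$ is the group of all roots of unity of $\ell$-power order. $\mathcal{T}(k,\ell)\subset\bar k$ (denoted by a kanji character in the paper) is the maximal pro-$\ell$ extension of $k(\mu_{\ell^\infty})$ which is unramified away from $\ell$. An $\ell$-integer is an algebraic number in $\bar k$ that is integral at all finite places not dividing $\ell$ (i.e. integral over $\mathbb{Z}[1/\ell]$); an $\ell$-unit is a nonzero $\ell$-integer whose inverse is also an $\ell$-integer. $k(J[\ell^\infty])$ is the field generated over $k$ by the coordinates of all $\ell$-power torsion points of $J$. *)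

theory Defs
  imports
    "HOL-Algebra.Algebraic_Closure_Type"
    "HOL-Algebra.Free_Abelian_Groups"
    "HOL-Algebra.Finite_Extensions"
    "HOL-Algebra.Generated_Fields"
begin

text \<open>
  Fields are types of class \<^class>\<open>field\<close>; their subfields are subsets, for which the
  HOL-Algebra notions are used on the record of ring operations of the type.
\<close>

abbreviation FR :: "'a :: field ring"
  where "FR \<equiv> ring_of_type_algebra"

hide_const (open) Divisibility.prime Coset.order

subsection \<open>Galois theory inside a fixed field\<close>

definition algebraic_over :: "'a :: field set \<Rightarrow> 'a \<Rightarrow> bool"
  where "algebraic_over F a \<longleftrightarrow>
    (\<exists>p. p \<noteq> 0 \<and> (\<forall>i. Polynomial.coeff p i \<in> F) \<and> Polynomial.poly p a = 0)"

definition number_field :: "'a :: field_char_0 set \<Rightarrow> bool"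
  where "number_field k \<longleftrightarrow> subfield k FR \<and> ring.finite_dimension FR \<rat> k"

text \<open>
  Automorphisms of a subfield are normalised by \<^const>\<open>extensional\<close> outside of it, so that
  equality and cardinalities of sets of automorphisms have their usual meaning.
\<close>

definition field_auts :: "'a :: field set \<Rightarrow> ('a \<Rightarrow> 'a) set"
  where "field_auts L =
    {\<sigma> \<in> extensional L. \<sigma> \<in> ring_iso (FR\<lparr>carrier := L\<rparr>) (FR\<lparr>carrier := L\<rparr>)}"

definition gal :: "'a :: field set \<Rightarrow> 'a set \<Rightarrow> ('a \<Rightarrow> 'a) set"
  where "gal L F = {\<sigma> \<in> field_auts L. \<forall>a\<in>F. \<sigma> a = a}"

definition galois_ext :: "'a :: field set \<Rightarrow> 'a set \<Rightarrow> bool"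
  where "galois_ext F L \<longleftrightarrow>
    subfield F FR \<and> subfield L FR \<and> F \<subseteq> L \<and> (\<forall>a\<in>L. algebraic_over F a) \<and>
    {a \<in> L. \<forall>\<sigma>\<in>gal L F. \<sigma> a = a} = F"

text \<open>
  The Galois group of \<open>L\<close> over \<open>F\<close> is the inverse limit of the groups of the finite Galois
  subextensions, so it is pro-\<open>ell\<close> iff all of these have \<open>ell\<close>-power order.
\<close>

definition pro_ell_ext :: "nat \<Rightarrow> 'a :: field set \<Rightarrow> 'a set \<Rightarrow> bool"
  where "pro_ell_ext ell F L \<longleftrightarrow> galois_ext F L \<and>
    (\<forall>M. galois_ext F M \<and> M \<subseteq> L \<and> finite (gal M F) \<longrightarrow> (\<exists>m. card (gal M F) = ell ^ m))"

subsection \<open>Places and ramification\<close>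

text \<open>
  Places are given by nontrivial valuation rings. For an algebraic extension \<open>L\<close> of the rationals
  these are the finite places of \<open>L\<close>; for a function field of one variable, those
  containing the constants are the points of the complete smooth curve.
\<close>

definition valuation_ring :: "'a :: field set \<Rightarrow> 'a set \<Rightarrow> bool"
  where "valuation_ring L V \<longleftrightarrow>
    subring V FR \<and> V \<subset> L \<and> (\<forall>z\<in>L. z \<in> V \<or> inverse z \<in> V)"

definition max_ideal :: "'a :: field set \<Rightarrow> 'a set"
  where "max_ideal V = {z \<in> V. z = 0 \<or> inverse z \<notin> V}"

definition inertia_group :: "'a :: field set \<Rightarrow> 'a set \<Rightarrow> 'a set \<Rightarrow> ('a \<Rightarrow> 'a) set"
  where "inertia_group L F V =
    {\<sigma> \<in> gal L F. \<sigma> ` V = V \<and> (\<forall>a\<in>V. \<sigma> a - a \<in> max_ideal V)}"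

text \<open>
  Only finite places appear: below, the base field contains all roots of unity of
  \<open>ell\<close>-power order, hence has no real places.
\<close>

definition unramified_away :: "nat \<Rightarrow> 'a :: field set \<Rightarrow> 'a set \<Rightarrow> bool"
  where "unramified_away ell F L \<longleftrightarrow>
    (\<forall>V. valuation_ring L V \<and> of_nat ell \<notin> max_ideal V \<longrightarrow>
      (\<forall>\<sigma>\<in>inertia_group L F V. \<forall>a\<in>L. \<sigma> a = a))"

definition cyclotomic_ell :: "'a :: field set \<Rightarrow> nat \<Rightarrow> 'a set"
  where "cyclotomic_ell k ell = generate_field FR (k \<union> {z. \<exists>m. z ^ (ell ^ m) = 1})"

definition max_pro_ell :: "'a :: field set \<Rightarrow> nat \<Rightarrow> 'a set"
  where "max_pro_ell k ell = generate_field FR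
    (\<Union>{L. pro_ell_ext ell (cyclotomic_ell k ell) L \<and> unramified_away ell (cyclotomic_ell k ell) L})"

definition ell_integer :: "nat \<Rightarrow> 'a :: field_char_0 \<Rightarrow> bool"
  where "ell_integer ell a \<longleftrightarrow>
    (\<exists>p. Polynomial.lead_coeff p = 1 \<and> (\<forall>i. \<exists>m. of_nat ell ^ m * Polynomial.coeff p i \<in> \<int>) \<and>
      Polynomial.poly p a = 0)"

definition ell_unit :: "nat \<Rightarrow> 'a :: field_char_0 \<Rightarrow> bool"
  where "ell_unit ell a \<longleftrightarrow> a \<noteq> 0 \<and> ell_integer ell a \<and> ell_integer ell (inverse a)"

subsection \<open>The complete smooth curve of an affine plane model\<close>

text \<open>
  An element of \<^typ>\<open>'a poly poly\<close> is a polynomial in \<open>Y\<close> whose coefficients are polynomials in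
  \<open>X\<close>. The embedding \<open>i\<close> of the constant field is applied to its coefficients.
\<close>

definition eval2 :: "('a :: field \<Rightarrow> 'b :: field) \<Rightarrow> 'b \<Rightarrow> 'b \<Rightarrow> 'a poly poly \<Rightarrow> 'b"
  where "eval2 i x y p =
    Polynomial.poly (map_poly (\<lambda>q. Polynomial.poly (map_poly i q) x) p) y"

text \<open>
  Over algebraically closed constants, \<open>plane_model i x y g\<close> says that the ring generated over
  the constants by \<open>x\<close> and \<open>y\<close> is the coordinate ring of the affine curve \<open>g = 0\<close>. In particular
  \<open>g\<close> generates a prime ideal (the curve is geometrically integral), and
  \<open>func_field i x y\<close> is its function field.
\<close>

definition plane_model :: "('a :: field \<Rightarrow> 'b :: field) \<Rightarrow> 'b \<Rightarrow> 'b \<Rightarrow> 'a poly poly \<Rightarrow> bool"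
  where "plane_model i x y g \<longleftrightarrow>
    i \<in> ring_hom FR FR \<and> (\<forall>p. eval2 i x y p = 0 \<longleftrightarrow> g dvd p)"

definition func_field :: "('a :: field \<Rightarrow> 'b :: field) \<Rightarrow> 'b \<Rightarrow> 'b \<Rightarrow> 'b set"
  where "func_field i x y = generate_field FR (range i \<union> {x, y})"

definition points :: "('a :: field \<Rightarrow> 'b :: field) \<Rightarrow> 'b set \<Rightarrow> 'b set set"
  where "points i K = {P. valuation_ring K P \<and> range i \<subseteq> P}"

definition ord_at :: "'b :: field set \<Rightarrow> 'b \<Rightarrow> int"
  where "ord_at P z = (THE m. \<exists>t u. max_ideal P = (\<lambda>a. t * a) ` P \<and>
    u \<in> P \<and> u \<noteq> 0 \<and> inverse u \<in> P \<and> z = t powi m * u)"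

definition value_at :: "('a :: field \<Rightarrow> 'b :: field) \<Rightarrow> 'b set \<Rightarrow> 'b \<Rightarrow> 'a"
  where "value_at i P z = (THE c. z - i c \<in> max_ideal P)"

text \<open>
  The ramification index of the covering given by \<open>x\<close> is the order at \<open>P\<close> of a local
  parameter of the projective line at the image of \<open>P\<close>.
\<close>

definition ram_index :: "('a :: field \<Rightarrow> 'b :: field) \<Rightarrow> 'b \<Rightarrow> 'b set \<Rightarrow> int"
  where "ram_index i x P = ord_at P (if x \<in> P then x - i (value_at i P x) else inverse x)"

definition totally_ramified :: "('a :: field \<Rightarrow> 'b :: field) \<Rightarrow> 'b set \<Rightarrow> 'b \<Rightarrow> 'b set \<Rightarrow> bool"
  where "totally_ramified i K x P \<longleftrightarrow>
    ram_index i x P = int (ring.dim FR (generate_field FR (range i \<union> {x})) K)"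

subsection \<open>Divisor classes\<close>

definition div_degree :: "('b set \<Rightarrow>\<^sub>0 int) \<Rightarrow> int"
  where "div_degree D = (\<Sum>P\<in>Poly_Mapping.keys D. Poly_Mapping.lookup D P)"

definition div0_group :: "('a :: field \<Rightarrow> 'b :: field) \<Rightarrow> 'b set \<Rightarrow> ('b set \<Rightarrow>\<^sub>0 int) monoid"
  where "div0_group i K = (free_Abelian_group (points i K))
    \<lparr>carrier := {D \<in> carrier (free_Abelian_group (points i K)). div_degree D = 0}\<rparr>"

definition principal_divs :: "('a :: field \<Rightarrow> 'b :: field) \<Rightarrow> 'b set \<Rightarrow> ('b set \<Rightarrow>\<^sub>0 int) set"
  where "principal_divs i K = {D \<in> carrier (free_Abelian_group (points i K)).
    \<exists>z\<in>K. z \<noteq> 0 \<and> (\<forall>P\<in>points i K. Poly_Mapping.lookup D P = ord_at P z)}"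

definition pic0 :: "('a :: field \<Rightarrow> 'b :: field) \<Rightarrow> 'b set \<Rightarrow> ('b set \<Rightarrow>\<^sub>0 int) set monoid"
  where "pic0 i K = div0_group i K Mod principal_divs i K"

definition div_class ::
    "('a :: field \<Rightarrow> 'b :: field) \<Rightarrow> 'b set \<Rightarrow> ('b set \<Rightarrow>\<^sub>0 int) \<Rightarrow> ('b set \<Rightarrow>\<^sub>0 int) set"
  where "div_class i K D = principal_divs i K #>\<^bsub>div0_group i K\<^esub> D"

text \<open>
  An automorphism of the constants that fixes the coefficients of the model acts on the function
  field through the coefficients, that is, fixing \<open>x\<close> and \<open>y\<close>.
\<close>

definition lift_aut ::
    "('a :: field \<Rightarrow> 'b :: field) \<Rightarrow> 'b \<Rightarrow> 'b \<Rightarrow> ('a \<Rightarrow> 'a) \<Rightarrow> 'b \<Rightarrow> 'b"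
  where "lift_aut i x y \<sigma> = (THE \<tau>. \<tau> \<in> field_auts (func_field i x y) \<and>
    (\<forall>a. \<tau> (i a) = i (\<sigma> a)) \<and> \<tau> x = x \<and> \<tau> y = y)"

definition pic_act :: "('a :: field \<Rightarrow> 'b :: field) \<Rightarrow> 'b \<Rightarrow> 'b \<Rightarrow> ('a \<Rightarrow> 'a) \<Rightarrow>
    ('b set \<Rightarrow>\<^sub>0 int) set \<Rightarrow> ('b set \<Rightarrow>\<^sub>0 int) set"
  where "pic_act i x y \<sigma> c = frag_extend (\<lambda>P. frag_of (lift_aut i x y \<sigma> ` P)) ` c"

subsection \<open>Projective varieties over an algebraically closed field\<close>

text \<open>
  Homogeneous coordinates are indexed by a finite type \<open>'n\<close>, so the ambient space has dimension
  \<open>CARD('n) - 1\<close>. A point is the set of all its homogeneous coordinate vectors.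
\<close>

definition proj_pt :: "('n \<Rightarrow> 'a :: field) \<Rightarrow> ('n \<Rightarrow> 'a) set"
  where "proj_pt v = {w. \<exists>c. c \<noteq> 0 \<and> w = (\<lambda>j. c * v j)}"

definition proj_space :: "('n \<Rightarrow> 'a :: field) set set"
  where "proj_space = proj_pt ` {v. \<exists>j. v j \<noteq> 0}"

text \<open>
  Over an infinite field, polynomials with coefficients in \<open>k\<close> may be identified with the functions
  they define, and (bi)homogeneity may be read off from the function.
\<close>

inductive_set polyfun :: "'a :: field set \<Rightarrow> (('n \<Rightarrow> 'a) \<Rightarrow> 'a) set" for k :: "'a set" where
  const: "c \<in> k \<Longrightarrow> (\<lambda>v. c) \<in> polyfun k"
| coord: "(\<lambda>v. v j) \<in> polyfun k"
| add: "g \<in> polyfun k \<Longrightarrow> h \<in> polyfun k \<Longrightarrow> (\<lambda>v. g v + h v) \<in> polyfun k"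
| mult: "g \<in> polyfun k \<Longrightarrow> h \<in> polyfun k \<Longrightarrow> (\<lambda>v. g v * h v) \<in> polyfun k"

definition form :: "'a :: field set \<Rightarrow> nat \<Rightarrow> (('n \<Rightarrow> 'a) \<Rightarrow> 'a) \<Rightarrow> bool"
  where "form k d h \<longleftrightarrow> h \<in> polyfun k \<and> (\<forall>c v. h (\<lambda>j. c * v j) = c ^ d * h v)"

definition biform ::
    "'a :: field set \<Rightarrow> nat \<Rightarrow> nat \<Rightarrow> (('n + 'm \<Rightarrow> 'a) \<Rightarrow> 'a) \<Rightarrow> bool"
  where "biform k d e h \<longleftrightarrow> h \<in> polyfun k \<and>
    (\<forall>a b u v. h (case_sum (\<lambda>j. a * u j) (\<lambda>j. b * v j)) = a ^ d * b ^ e * h (case_sum u v))"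

definition zariski_closed :: "'a :: field set \<Rightarrow> ('n \<Rightarrow> 'a) set set \<Rightarrow> bool"
  where "zariski_closed k Z \<longleftrightarrow>
    (\<exists>H. (\<forall>h\<in>H. \<exists>d. form k d h) \<and> Z = {p \<in> proj_space. \<forall>h\<in>H. \<forall>v\<in>p. h v = 0})"

definition proj_variety :: "'a :: field set \<Rightarrow> ('n \<Rightarrow> 'a) set set \<Rightarrow> bool"
  where "proj_variety k Z \<longleftrightarrow> zariski_closed k Z \<and> Z \<noteq> {} \<and>
    (\<forall>A B. zariski_closed UNIV A \<and> zariski_closed UNIV B \<and> Z \<subseteq> A \<union> B \<longrightarrow> Z \<subseteq> A \<or> Z \<subseteq> B)"

definition morphism :: "'a :: field set \<Rightarrow> ('n \<Rightarrow> 'a) set set \<Rightarrow>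
    (('n \<Rightarrow> 'a) set \<Rightarrow> ('m \<Rightarrow> 'a) set) \<Rightarrow> bool"
  where "morphism k Z \<phi> \<longleftrightarrow> (\<forall>p\<in>Z. \<exists>d h. (\<forall>j. form k d (h j)) \<and>
    (\<forall>v\<in>p. \<exists>j. h j v \<noteq> 0) \<and>
    (\<forall>q\<in>Z. \<forall>v\<in>q. (\<exists>j. h j v \<noteq> 0) \<longrightarrow> \<phi> q = proj_pt (\<lambda>j. h j v)))"

definition morphism2 :: "'a :: field set \<Rightarrow> ('n \<Rightarrow> 'a) set set \<Rightarrow> ('m \<Rightarrow> 'a) set set \<Rightarrow>
    (('n \<Rightarrow> 'a) set \<Rightarrow> ('m \<Rightarrow> 'a) set \<Rightarrow> ('r \<Rightarrow> 'a) set) \<Rightarrow> bool"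
  where "morphism2 k Z Y \<phi> \<longleftrightarrow> (\<forall>p\<in>Z. \<forall>p'\<in>Y. \<exists>d e h. (\<forall>j. biform k d e (h j)) \<and>
    (\<forall>u\<in>p. \<forall>v\<in>p'. \<exists>j. h j (case_sum u v) \<noteq> 0) \<and>
    (\<forall>q\<in>Z. \<forall>q'\<in>Y. \<forall>u\<in>q. \<forall>v\<in>q'. (\<exists>j. h j (case_sum u v) \<noteq> 0) \<longrightarrow>
      \<phi> q q' = proj_pt (\<lambda>j. h j (case_sum u v))))"

text \<open>
  Smoothness and commutativity are automatic, as the constants have characteristic zero.
\<close>

definition abelian_variety :: "'a :: field_char_0 set \<Rightarrow> ('n \<Rightarrow> 'a) set monoid \<Rightarrow> bool"
  where "abelian_variety k J \<longleftrightarrow> group J \<and> proj_variety k (carrier J) \<and>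
    (\<exists>v\<in>\<one>\<^bsub>J\<^esub>. \<forall>j. v j \<in> k) \<and>
    morphism2 k (carrier J) (carrier J) (\<lambda>p q. p \<otimes>\<^bsub>J\<^esub> q) \<and>
    morphism k (carrier J) (\<lambda>p. inv\<^bsub>J\<^esub> p)"

definition proj_act :: "('a \<Rightarrow> 'a) \<Rightarrow> ('n \<Rightarrow> 'a) set \<Rightarrow> ('n \<Rightarrow> 'a) set"
  where "proj_act \<sigma> p = (\<lambda>v. \<sigma> \<circ> v) ` p"

subsection \<open>The Jacobian and its torsion\<close>

text \<open>
  A morphism from a smooth curve to projective space is a tuple of functions, evaluated at a point
  after rescaling so that all are regular and not all vanish there.
\<close>

definition curve_morphism :: "('a :: field \<Rightarrow> 'b :: field) \<Rightarrow> 'b set \<Rightarrow>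
    ('b set \<Rightarrow> ('n \<Rightarrow> 'a) set) \<Rightarrow> bool"
  where "curve_morphism i K \<phi> \<longleftrightarrow> (\<exists>g. (\<forall>j. g j \<in> K) \<and>
    (\<forall>P\<in>points i K. \<exists>h\<in>K. (\<forall>j. h * g j \<in> P) \<and> (\<exists>j. h * g j \<notin> max_ideal P) \<and>
      \<phi> P = proj_pt (\<lambda>j. value_at i P (h * g j))))"

text \<open>
  \<open>J\<close> is an abelian variety over \<open>k\<close> whose group of geometric points is identified with the group
  of divisor classes of degree zero, compatibly with the action of the absolute Galois group of
  \<open>k\<close>, such that the Abel--Jacobi maps are morphisms. In characteristic zero, the Albanese property
  of the Jacobian makes this determine \<open>J\<close> up to isomorphism over \<open>k\<close>.
\<close>

definition is_jacobian :: "'a :: field_char_0 set \<Rightarrow> ('a \<Rightarrow> 'b :: field) \<Rightarrow> 'b \<Rightarrow> 'b \<Rightarrow>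
    ('n \<Rightarrow> 'a) set monoid \<Rightarrow> bool"
  where "is_jacobian k i x y J \<longleftrightarrow> abelian_variety k J \<and>
    (\<exists>\<phi>. \<phi> \<in> iso (pic0 i (func_field i x y)) J \<and>
      (\<forall>\<sigma>\<in>gal UNIV k. \<forall>c\<in>carrier (pic0 i (func_field i x y)).
        \<phi> (pic_act i x y \<sigma> c) = proj_act \<sigma> (\<phi> c)) \<and>
      (\<forall>P0\<in>points i (func_field i x y). curve_morphism i (func_field i x y)
        (\<lambda>P. \<phi> (div_class i (func_field i x y) (frag_of P - frag_of P0)))))"

definition ell_torsion :: "nat \<Rightarrow> ('g, 'm) monoid_scheme \<Rightarrow> 'g set"
  where "ell_torsion ell J = {p \<in> carrier J. \<exists>m::nat. p [^]\<^bsub>J\<^esub> (ell ^ m) = \<one>\<^bsub>J\<^esub>}"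

text \<open>The coordinates of a point are the ratios of its homogeneous coordinates.\<close>

definition ell_torsion_field :: "'a :: field set \<Rightarrow> nat \<Rightarrow> ('n \<Rightarrow> 'a) set monoid \<Rightarrow> 'a set"
  where "ell_torsion_field k ell J = generate_field FR
    (k \<union> {v r / v s |p v r s. p \<in> ell_torsion ell J \<and> v \<in> p \<and> v s \<noteq> 0})"

end

theory Submission
  imports Defs "HOL-Algebra.Sylow" "HOL-Computational_Algebra.Formal_Laurent_Series"
begin

text \<open>
  After dividing \<open>y\<close> by a polynomial in \<open>x\<close>, the function field is \<open>K = E(x, y)\<close>, where
  \<open>y ^ N = lam * (\<Prod>s\<in>S. (x - s) ^ e s)\<close>, \<open>N = ell ^ n\<close>, and \<open>E\<close> is algebraically closed. Let \<open>D\<close> be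
  a divisor with \<open>M D = div G\<close>, \<open>M = ell ^ m\<close>. An automorphism \<open>\<sigma>\<close> of the constants over
  \<open>k(\<mu>\<^bsub>ell\<^sup>\<infinity>\<^esub>)\<close> fixes the class of \<open>D\<close> as soon as \<open>\<sigma> G / G\<close> is an \<open>M\<close>-th power, so the claim
  concerns the action of \<open>\<sigma>\<close> on the group \<open>V / K\<^sup>* ^ M\<close>, where \<open>V\<close> consists of the functions all of whose
  orders are divisible by \<open>M\<close>.

  The deck transformation \<open>z\<close>, \<open>z y = \<zeta> y\<close>, commutes with \<open>\<sigma>\<close> and acts unipotently on this group, since
  it has \<open>ell\<close>-power order and the group has exponent \<open>M\<close>. By Hilbert's Theorem 90 the \<open>z\<close>-invariant
  classes are represented by products of powers of \<open>y\<close> and of the \<open>x - s\<close>, \<open>s \<in> S\<close>, on which \<open>\<sigma>\<close>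
  acts trivially once it fixes \<open>S\<close>. Induction along the powers of \<open>z - 1\<close> then gives the two properties
  that define the maximal pro-\<open>ell\<close> extension unramified away from \<open>ell\<close>:

  \<^item> If \<open>\<sigma>\<close> fixes \<open>S\<close>, it acts unipotently, so some \<open>ell\<close>-power of it fixes the class of \<open>D\<close>.
  \<^item> Let \<open>\<sigma>\<close> be in the inertia group of a place \<open>W\<close> not above \<open>ell\<close>. If \<open>\<sigma> G / G\<close> is \<open>z\<close>-invariant, it is
    a product \<open>B\<close> as above times an \<open>M\<close>-th power. As \<open>\<sigma>\<close> is trivial modulo \<open>W\<close>, the reduction of \<open>B\<close>
    is an \<open>M\<close>-th power. The elements of \<open>S\<close> remain distinct modulo \<open>W\<close>, hence \<open>B\<close> itself is an
    \<open>M\<close>-th power.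

  Reduction modulo \<open>W\<close> is carried out in the power series in \<open>T\<close>, \<open>T ^ N = x - s0\<close>, at a totally ramified
  point: a function is scaled such that the coefficients of its numerator lie in \<open>W\<close> but not all in the
  maximal ideal, and then the same holds for its expansion.
\<close>

hide_const (open) Divisibility.prime Coset.order

subsection \<open>Subrings, subfields and homomorphisms\<close>

text \<open>No geometry of the Jacobian and no reduced curve is constructed. A torsion point enters
  through a function \<open>G\<close> alone: constants being \<open>M\<close>-th powers,
  \<open>Vgrp M\<close> modulo \<open>Qgrp M\<close> stands for the \<open>M\<close>-torsion and
  carries both \<open>z\<close> and \<open>\<sigma>\<close>. Instead of forming residue fields,
  congruences modulo prime ideals of polynomials and of power series over \<open>W\<close> are used,
  with Gauss's lemma making these ideals prime. The obstacle is that the maximal extension is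
  defined by finite Galois groups and by inertia groups of a normal subfield, while only
  automorphisms of the whole algebraic closure act on \<open>K\<close>. An inertia element of the
  subfield is lifted up to finitely many congruences modulo \<open>W\<close>. This suffices, since
  the argument for one \<open>G\<close> involves finitely many coefficients, but it dictates the
  form of all statements on ramification: a finite set \<open>A\<close>, chosen before
  \<open>\<sigma>\<close>. A place enters through three facts: \<open>ell\<close> is a unit there,
  which keeps \<open>N\<close>-th roots of series integral and \<open>ell\<close>-power roots of
  unity distinct; \<open>lam\<close> and the differences in \<open>S\<close> are units; and some
  exponent \<open>e s0\<close> is prime to \<open>N\<close>, which irreducibility of the model
  guarantees.\<close>

definition is_subring :: "'a :: comm_ring_1 set \<Rightarrow> bool"
  where "is_subring A \<longleftrightarrow> 1 \<in> A \<and> (\<forall>a\<in>A. \<forall>b\<in>A. a - b \<in> A \<and> a * b \<in> A)"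

definition is_subfield :: "'a :: field set \<Rightarrow> bool"
  where "is_subfield A \<longleftrightarrow> is_subring A \<and> (\<forall>a\<in>A. inverse a \<in> A)"

lemma is_subring_closed:
  assumes "is_subring A"
  shows "1 \<in> A" "0 \<in> A" "a \<in> A \<Longrightarrow> b \<in> A \<Longrightarrow> a - b \<in> A" "a \<in> A \<Longrightarrow> b \<in> A \<Longrightarrow> a * b \<in> A"
    "a \<in> A \<Longrightarrow> - a \<in> A" "a \<in> A \<Longrightarrow> b \<in> A \<Longrightarrow> a + b \<in> A" "a \<in> A \<Longrightarrow> a ^ n \<in> A" "of_nat n \<in> A"
    "of_int m \<in> A"
proof -
  show one: "1 \<in> A" and m: "a \<in> A \<Longrightarrow> b \<in> A \<Longrightarrow> a - b \<in> A" for a b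
    using assms by (auto simp: is_subring_def)
  show t: "a \<in> A \<Longrightarrow> b \<in> A \<Longrightarrow> a * b \<in> A" for a b
    using assms by (auto simp: is_subring_def)
  show z: "0 \<in> A" using m[OF one one] by simp
  show u: "a \<in> A \<Longrightarrow> - a \<in> A" for a using m[OF z, of a] by simp
  show p: "a \<in> A \<Longrightarrow> b \<in> A \<Longrightarrow> a + b \<in> A" for a b using m[OF _ u, of a b] by simp
  show "a \<in> A \<Longrightarrow> a ^ n \<in> A" by (induction n) (auto intro: one t)
  show o: "of_nat n \<in> A" for n by (induction n) (auto intro: z one p)
  show "of_int m \<in> A" by (cases m rule: int_diff_cases) (auto intro: m o)
qed

lemma is_subring_sum: "is_subring A \<Longrightarrow> (\<And>i. i \<in> I \<Longrightarrow> f i \<in> A) \<Longrightarrow> sum f I \<in> A"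
  by (induction I rule: infinite_finite_induct) (auto simp: is_subring_closed)

lemma is_subring_prod: "is_subring A \<Longrightarrow> (\<And>i. i \<in> I \<Longrightarrow> f i \<in> A) \<Longrightarrow> prod f I \<in> A"
  by (induction I rule: infinite_finite_induct) (auto simp: is_subring_closed)

lemma is_subfieldD:
  assumes "is_subfield A"
  shows "is_subring A" "a \<in> A \<Longrightarrow> inverse a \<in> A" "a \<in> A \<Longrightarrow> b \<in> A \<Longrightarrow> a / b \<in> A"
  using assms by (auto simp: is_subfield_def divide_inverse is_subring_closed)

lemmas is_subfield_closed = is_subring_closed[OF is_subfieldD(1)]

lemma is_subring_UNIV [simp]: "is_subring UNIV" by (simp add: is_subring_def)
lemma is_subfield_UNIV [simp]: "is_subfield UNIV" by (simp add: is_subfield_def)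

lemma FR_simps [simp]:
  "carrier FR = UNIV" "monoid.mult FR = (*)" "one FR = 1" "ring.zero FR = 0" "add FR = (+)"
  by (auto simp: ring_of_type_algebra_def)

lemma field_FR: "field (FR :: 'a :: field ring)"
  by (rule field_from_type_algebra)

lemma FR_a_inv [simp]: "a_inv FR (a :: 'a :: field) = - a"
proof -
  interpret field "FR :: 'a ring" by (rule field_FR)
  show ?thesis using minus_equality[of "-a" a] by simp
qed

lemma FR_m_inv: "a \<noteq> 0 \<Longrightarrow> m_inv FR (a :: 'a :: field) = inverse a"
proof -
  interpret field "FR :: 'a ring" by (rule field_FR)
  show "a \<noteq> 0 \<Longrightarrow> ?thesis" using comm_inv_char[of a "inverse a"] by simp
qed

lemma subring_FR_iff: "subring V (FR :: 'a :: field ring) \<longleftrightarrow> is_subring V"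
proof
  assume "subring V (FR :: 'a ring)"
  from subringE[OF this] show "is_subring V"
    unfolding is_subring_def by (auto simp: diff_conv_add_uminus simp del: add_uminus_conv_diff)
next
  interpret field "FR :: 'a ring" by (rule field_FR)
  assume "is_subring V"
  then show "subring V (FR :: 'a ring)"
    by (intro ring.subringI) (auto simp: is_subring_closed ring_axioms)
qed

lemma subfield_FR_iff: "subfield V (FR :: 'a :: field ring) \<longleftrightarrow> is_subfield V"
proof
  interpret field "FR :: 'a ring" by (rule field_FR)
  assume s: "subfield V (FR :: 'a ring)"
  have r: "is_subring V" using subfieldE(1)[OF s] by (simp add: subring_FR_iff)
  moreover have "inverse a \<in> V" if "a \<in> V" for a
    using subfield_m_inv(1)[OF s, of a] FR_m_inv[of a] that r by (cases "a = 0") (auto simp: is_subring_closed)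
  ultimately show "is_subfield V" by (auto simp: is_subfield_def)
next
  interpret field "FR :: 'a ring" by (rule field_FR)
  assume s: "is_subfield V"
  show "subfield V (FR :: 'a ring)"
  proof (rule subfieldI')
    show "subring V (FR :: 'a ring)" using s by (simp add: subring_FR_iff is_subfield_def)
    show "inv\<^bsub>FR\<^esub> k \<in> V" if "k \<in> V - {\<zero>\<^bsub>FR\<^esub>}" for k
      using that s by (auto simp: FR_m_inv is_subfield_def)
  qed
qed

lemma generate_field_FR:
  fixes H :: "'a :: field set"
  shows "is_subfield (generate_field FR H)" "H \<subseteq> generate_field FR H"
    "is_subfield A \<Longrightarrow> H \<subseteq> A \<Longrightarrow> generate_field FR H \<subseteq> A"
proof -
  interpret field "FR :: 'a ring" by (rule field_FR)
  show "is_subfield (generate_field FR H)"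
    using generate_field_is_subfield[of H] by (simp add: subfield_FR_iff)
  show "H \<subseteq> generate_field FR H" by (auto intro: generate_field.incl)
  show "is_subfield A \<Longrightarrow> H \<subseteq> A \<Longrightarrow> generate_field FR H \<subseteq> A"
    by (rule generate_field_min_subfield1) (auto simp: subfield_FR_iff)
qed

text \<open>Additivity and multiplicativity alone would admit the zero map; the condition on 1 makes
  every such map injective on a subfield. Values outside \<open>A\<close> are unconstrained, so
  total functions and restrictions are treated alike.\<close>

definition hom_on :: "'a :: field set \<Rightarrow> ('a \<Rightarrow> 'b :: field) \<Rightarrow> bool"
  where "hom_on A \<tau> \<longleftrightarrow> \<tau> 1 = 1 \<and> (\<forall>a\<in>A. \<forall>b\<in>A. \<tau> (a + b) = \<tau> a + \<tau> b \<and> \<tau> (a * b) = \<tau> a * \<tau> b)"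

lemma hom_on_simps:
  assumes "hom_on A \<tau>" "is_subfield A"
  shows "\<tau> 1 = 1" "\<tau> 0 = 0" "a \<in> A \<Longrightarrow> b \<in> A \<Longrightarrow> \<tau> (a + b) = \<tau> a + \<tau> b"
    "a \<in> A \<Longrightarrow> b \<in> A \<Longrightarrow> \<tau> (a * b) = \<tau> a * \<tau> b" "a \<in> A \<Longrightarrow> \<tau> (- a) = - \<tau> a"
    "a \<in> A \<Longrightarrow> b \<in> A \<Longrightarrow> \<tau> (a - b) = \<tau> a - \<tau> b" "a \<in> A \<Longrightarrow> \<tau> (a ^ n) = \<tau> a ^ n"
    "a \<in> A \<Longrightarrow> \<tau> (inverse a) = inverse (\<tau> a)" "a \<in> A \<Longrightarrow> b \<in> A \<Longrightarrow> \<tau> (a / b) = \<tau> a / \<tau> b"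
    "a \<in> A \<Longrightarrow> \<tau> a = 0 \<longleftrightarrow> a = 0" "a \<in> A \<Longrightarrow> b \<in> A \<Longrightarrow> \<tau> a = \<tau> b \<longleftrightarrow> a = b"
proof -
  note c = is_subfield_closed[OF assms(2)] is_subfieldD(2,3)[OF assms(2)]
  show 1: "\<tau> 1 = 1" and a: "\<And>a b. a \<in> A \<Longrightarrow> b \<in> A \<Longrightarrow> \<tau> (a + b) = \<tau> a + \<tau> b"
    and m: "\<And>a b. a \<in> A \<Longrightarrow> b \<in> A \<Longrightarrow> \<tau> (a * b) = \<tau> a * \<tau> b"
    using assms(1) by (auto simp: hom_on_def)
  have "\<tau> (0 + 0) = \<tau> 0 + \<tau> 0" by (intro a c)
  then have "\<tau> 0 - \<tau> 0 = \<tau> 0" unfolding add_0_left by (metis add_diff_cancel_left')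
  then show 0: "\<tau> 0 = 0" by simp
  show u: "a \<in> A \<Longrightarrow> \<tau> (- a) = - \<tau> a" for a
    using a[of a "- a"] c(5)[of a] 0 by (simp add: eq_neg_iff_add_eq_0 add.commute)
  show d: "a \<in> A \<Longrightarrow> b \<in> A \<Longrightarrow> \<tau> (a - b) = \<tau> a - \<tau> b" for a b
    using a[of a "- b"] u[of b] c(5)[of b] by simp
  show "a \<in> A \<Longrightarrow> \<tau> (a ^ n) = \<tau> a ^ n" by (induction n) (auto simp: 1 m c)
  show i: "a \<in> A \<Longrightarrow> \<tau> (inverse a) = inverse (\<tau> a)" for a
  proof (cases "a = 0")
    case False
    assume "a \<in> A"
    then have "\<tau> a * \<tau> (inverse a) = 1" using m[of a "inverse a"] c 1 False by simp
    then show ?thesis by (metis inverse_unique)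
  qed (simp add: 0)
  show "a \<in> A \<Longrightarrow> b \<in> A \<Longrightarrow> \<tau> (a / b) = \<tau> a / \<tau> b"
    using m[of a "inverse b"] i[of b] c by (simp add: divide_inverse)
  show z: "a \<in> A \<Longrightarrow> \<tau> a = 0 \<longleftrightarrow> a = 0" for a
    using m[of a "inverse a"] c(10)[of a] 0 1
    by (metis right_inverse mult_zero_left zero_neq_one)
  show "a \<in> A \<Longrightarrow> b \<in> A \<Longrightarrow> \<tau> a = \<tau> b \<longleftrightarrow> a = b"
    using z[of "a - b"] d[of a b] c(3)[of a b] by auto
qed

lemma hom_on_sum:
  assumes "hom_on A \<tau>" "is_subfield A" "\<And>j. j \<in> I \<Longrightarrow> f j \<in> A"
  shows "\<tau> (sum f I) = (\<Sum>j\<in>I. \<tau> (f j))"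
  using assms(3)
  by (induction I rule: infinite_finite_induct)
    (auto simp: hom_on_simps[OF assms(1,2)] is_subring_sum[OF is_subfieldD(1)[OF assms(2)]])

lemma hom_on_prod:
  assumes "hom_on A \<tau>" "is_subfield A" "\<And>j. j \<in> I \<Longrightarrow> f j \<in> A"
  shows "\<tau> (prod f I) = (\<Prod>j\<in>I. \<tau> (f j))"
  using assms(3)
  by (induction I rule: infinite_finite_induct)
    (auto simp: hom_on_simps[OF assms(1,2)] is_subring_prod[OF is_subfieldD(1)[OF assms(2)]])

subsection \<open>Extension of homomorphisms to an algebraically closed field\<close>

definition polys :: "'a :: comm_ring_1 set \<Rightarrow> 'a poly set"
  where "polys A = {p. \<forall>j. coeff p j \<in> A}"

lemma polysD: "p \<in> polys A \<Longrightarrow> coeff p j \<in> A" by (simp add: polys_def)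

lemma polys_closed:
  assumes "is_subring A"
  shows "0 \<in> polys A" "1 \<in> polys A" "p \<in> polys A \<Longrightarrow> q \<in> polys A \<Longrightarrow> p + q \<in> polys A"
    "p \<in> polys A \<Longrightarrow> q \<in> polys A \<Longrightarrow> p - q \<in> polys A" "p \<in> polys A \<Longrightarrow> - p \<in> polys A"
    "p \<in> polys A \<Longrightarrow> q \<in> polys A \<Longrightarrow> p * q \<in> polys A" "p \<in> polys A \<Longrightarrow> p ^ n \<in> polys A"
    "a \<in> A \<Longrightarrow> [:a:] \<in> polys A" "a \<in> A \<Longrightarrow> p \<in> polys A \<Longrightarrow> pCons a p \<in> polys A"
    "a \<in> A \<Longrightarrow> p \<in> polys A \<Longrightarrow> smult a p \<in> polys A" "a \<in> A \<Longrightarrow> monom a n \<in> polys A"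
proof -
  note c = is_subring_closed[OF assms]
  show m: "p \<in> polys A \<Longrightarrow> q \<in> polys A \<Longrightarrow> p * q \<in> polys A" for p q
    by (auto simp: polys_def coeff_mult intro!: is_subring_sum[OF assms] c(4))
  show o: "1 \<in> polys A" by (auto simp: polys_def coeff_1 c)
  show "p \<in> polys A \<Longrightarrow> p ^ n \<in> polys A" by (induction n) (auto intro: o m)
  show "a \<in> A \<Longrightarrow> p \<in> polys A \<Longrightarrow> pCons a p \<in> polys A" for a p
    by (auto simp: polys_def coeff_pCons c split: nat.splits)
  show "a \<in> A \<Longrightarrow> [:a:] \<in> polys A"
    by (auto simp: polys_def coeff_pCons c split: nat.splits)
qed (use assms in \<open>auto simp: polys_def is_subring_closed\<close>)

lemma polys_prod: "is_subring A \<Longrightarrow> (\<And>i. i \<in> I \<Longrightarrow> f i \<in> polys A) \<Longrightarrow> prod f I \<in> polys A"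
  by (induction I rule: infinite_finite_induct) (auto simp: polys_closed)

lemma poly_in_subring: "is_subring A \<Longrightarrow> p \<in> polys A \<Longrightarrow> a \<in> A \<Longrightarrow> poly p a \<in> A"
  unfolding poly_altdef by (auto intro!: is_subring_sum simp: is_subring_closed polysD)

lemma polys_pCons_iff: "pCons a p \<in> polys A \<longleftrightarrow> a \<in> A \<and> p \<in> polys A"
  by (auto simp: polys_def coeff_pCons split: nat.splits)

lemma algebraic_over_polys: "algebraic_over F a \<longleftrightarrow> (\<exists>p\<in>polys F. p \<noteq> 0 \<and> poly p a = 0)"
  by (auto simp: algebraic_over_def polys_def)

lemma algebraic_over_mono: "F \<subseteq> F' \<Longrightarrow> algebraic_over F a \<Longrightarrow> algebraic_over F' a"
  unfolding algebraic_over_def by blast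

text \<open>A homomorphism defined on a subring is represented by its graph, so that Zorn's lemma applies
  to the inclusion order.\<close>

definition hom_graph :: "('a :: field \<times> 'b :: field) set \<Rightarrow> bool"
  where "hom_graph R \<longleftrightarrow> (1, 1) \<in> R \<and>
    (\<forall>a b c d. (a, c) \<in> R \<longrightarrow> (b, d) \<in> R \<longrightarrow> (a - b, c - d) \<in> R \<and> (a * b, c * d) \<in> R) \<and>
    (\<forall>a c. (a, c) \<in> R \<longrightarrow> (a = 0 \<longleftrightarrow> c = 0))"

lemma hom_graphD:
  assumes "hom_graph R"
  shows "(1, 1) \<in> R" "(0, 0) \<in> R" "(a, c) \<in> R \<Longrightarrow> (b, d) \<in> R \<Longrightarrow> (a - b, c - d) \<in> R"
    "(a, c) \<in> R \<Longrightarrow> (b, d) \<in> R \<Longrightarrow> (a * b, c * d) \<in> R"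
    "(a, c) \<in> R \<Longrightarrow> (b, d) \<in> R \<Longrightarrow> (a + b, c + d) \<in> R" "(a, c) \<in> R \<Longrightarrow> a = 0 \<longleftrightarrow> c = 0"
    "(a, c) \<in> R \<Longrightarrow> (a, d) \<in> R \<Longrightarrow> c = d"
proof -
  show 1: "(1, 1) \<in> R" and d: "\<And>a b c d. (a, c) \<in> R \<Longrightarrow> (b, d) \<in> R \<Longrightarrow> (a - b, c - d) \<in> R"
    and "(a, c) \<in> R \<Longrightarrow> (b, d) \<in> R \<Longrightarrow> (a * b, c * d) \<in> R"
    and z: "\<And>a c. (a, c) \<in> R \<Longrightarrow> a = 0 \<longleftrightarrow> c = 0"
    using assms by (auto simp: hom_graph_def)
  show 0: "(0, 0) \<in> R" using d[OF 1 1] by simp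
  show "(a, c) \<in> R \<Longrightarrow> (b, d) \<in> R \<Longrightarrow> (a + b, c + d) \<in> R"
    using d[OF _ d[OF 0], of a c b d] by simp
  show "(a, c) \<in> R \<Longrightarrow> (a, d) \<in> R \<Longrightarrow> c = d"
    using d[of a c a d] z[of 0 "c - d"] by simp
qed

text \<open>A graph relates coefficients without a chosen function. Since zeros correspond to zeros,
  related polynomials have the same degree.\<close>

definition poly_rel :: "('a :: field \<times> 'b :: field) set \<Rightarrow> 'a poly \<Rightarrow> 'b poly \<Rightarrow> bool"
  where "poly_rel R p q \<longleftrightarrow> (\<forall>j. (coeff p j, coeff q j) \<in> R)"

lemma poly_rel_closed:
  assumes R: "hom_graph R"
  shows "(a, c) \<in> R \<Longrightarrow> poly_rel R [:a:] [:c:]" "(a, c) \<in> R \<Longrightarrow> poly_rel R (monom a n) (monom c n)"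
    "poly_rel R p p' \<Longrightarrow> poly_rel R q q' \<Longrightarrow> poly_rel R (p - q) (p' - q')"
    "poly_rel R p p' \<Longrightarrow> poly_rel R q q' \<Longrightarrow> poly_rel R (p * q) (p' * q')"
proof -
  note D = hom_graphD[OF R]
  show "(a, c) \<in> R \<Longrightarrow> poly_rel R [:a:] [:c:]" "(a, c) \<in> R \<Longrightarrow> poly_rel R (monom a n) (monom c n)"
    by (auto simp: poly_rel_def coeff_pCons D split: nat.splits)
  show "poly_rel R p p' \<Longrightarrow> poly_rel R q q' \<Longrightarrow> poly_rel R (p - q) (p' - q')"
    by (auto simp: poly_rel_def intro: D)
  have S: "(sum f I, sum g I) \<in> R" if "\<And>j. j \<in> I \<Longrightarrow> (f j, g j) \<in> R" for f g and I :: "nat set"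
    using that by (induction I rule: infinite_finite_induct) (auto intro: D)
  show "poly_rel R p p' \<Longrightarrow> poly_rel R q q' \<Longrightarrow> poly_rel R (p * q) (p' * q')"
    unfolding poly_rel_def coeff_mult by (intro allI S D) auto
qed

lemma poly_rel_degree:
  assumes "hom_graph R" "poly_rel R p q"
  shows "degree p = degree q"
proof -
  have z: "coeff p j = 0 \<longleftrightarrow> coeff q j = 0" for j
    using assms(2) hom_graphD(6)[OF assms(1)] by (auto simp: poly_rel_def)
  have "degree q \<le> degree p" using z coeff_eq_0[of p] by (intro degree_le) metis
  moreover have "degree p \<le> degree q" using z coeff_eq_0[of q] by (intro degree_le) metis
  ultimately show ?thesis by simp
qed

lemma poly_rel_0: "hom_graph R \<Longrightarrow> poly_rel R 0 q \<Longrightarrow> q = 0"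
  using hom_graphD(6)[of R 0] by (auto simp: poly_eq_iff poly_rel_def)

lemma poly_rel_exists:
  assumes "hom_graph R" "p \<in> polys (Domain R)"
  shows "\<exists>q. poly_rel R p q"
proof -
  define f where "f = (\<lambda>a. if a = 0 then 0 else SOME c. (a, c) \<in> R)"
  have "(a, f a) \<in> R" if "a \<in> Domain R" for a
    using that someI_ex[of "\<lambda>c. (a, c) \<in> R"] by (auto simp: f_def hom_graphD[OF assms(1)])
  then have "poly_rel R p (map_poly f p)"
    using assms(2) by (auto simp: poly_rel_def coeff_map_poly f_def polys_def)
  then show ?thesis ..
qed

text \<open>Pseudo-division by the polynomial \<open>p\<close> of least degree: \<open>r\<close>
  cancels the leading term of \<open>q\<close> by multiplications only, because the domain of
  \<open>R\<close> is just a ring. The value of \<open>r\<close> at \<open>b\<close> still vanishes,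
  so induction on the degree applies, and the nonzero factor \<open>lp'\<close> is cancelled at the
  end.\<close>

lemma poly_rel_root:
  assumes R: "hom_graph R" and p: "poly_rel R p p'" "p \<noteq> 0" "poly p b = 0" "poly p' b' = 0"
    and min: "\<And>q q'. poly_rel R q q' \<Longrightarrow> q \<noteq> 0 \<Longrightarrow> poly q b = 0 \<Longrightarrow> degree p \<le> degree q"
    and q: "poly_rel R q q'" "poly q b = 0"
  shows "poly q' b' = 0"
  using q
proof (induction "degree q" arbitrary: q q' rule: less_induct)
  case less
  note D = hom_graphD[OF R]
  show ?case
  proof (cases "q = 0")
    case True
    then have "q' = 0" using less.prems(1) poly_rel_0[OF R] by simp
    then show ?thesis by simp
  next
    case False
    define m where "m = degree q"
    define d where "d = degree p"
    have dm: "d \<le> m" using min[OF less.prems(1) False less.prems(2)] by (simp add: d_def m_def)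
    define lp lp' lq lq' where "lp = coeff p d" and "lp' = coeff p' d"
      and "lq = coeff q m" and "lq' = coeff q' m"
    have l: "(lp, lp') \<in> R" "(lq, lq') \<in> R" using p(1) less.prems(1)
      by (auto simp: poly_rel_def lp_def lp'_def lq_def lq'_def)
    have lp: "lp \<noteq> 0" "lp' \<noteq> 0" using p(2) D(6)[OF l(1)] by (auto simp: lp_def d_def)
    define r where "r = [:lp:] * q - monom lq (m - d) * p"
    define r' where "r' = [:lp':] * q' - monom lq' (m - d) * p'"
    have r: "poly_rel R r r'" unfolding r_def r'_def
      by (intro poly_rel_closed R p less.prems l)
    have r0: "poly r b = 0" using p less.prems by (simp add: r_def poly_monom)
    have "poly r' b' = 0"
    proof (cases "r = 0")
      case True
      then have "r' = 0" using r poly_rel_0[OF R] by simp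
      then show ?thesis by simp
    next
      case F: False
      have "degree r \<le> m"
        unfolding r_def
      proof (rule degree_diff_le)
        show "degree ([:lp:] * q) \<le> m" by (simp add: m_def)
        have "degree (monom lq (m - d) * p) \<le> (m - d) + d"
          unfolding d_def using degree_mult_le[of "monom lq (m - degree p)" p] degree_monom_le[of lq "m - degree p"]
          by linarith
        then show "degree (monom lq (m - d) * p) \<le> m" using dm by simp
      qed
      moreover have "coeff r m = 0"
        using dm by (simp add: r_def coeff_monom_mult lp_def lq_def)
      ultimately have "degree r < m"
        using F by (metis leading_coeff_0_iff order_neq_le_trans)
      then show ?thesis using less.hyps[of r r'] r r0 by (simp add: m_def)
    qed
    then show ?thesis using p lp by (simp add: r'_def poly_monom)
  qed
qed

text \<open>Powers of the variable can be divided out of an annihilating polynomial. The nonzero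
  constant term later prevents a nonzero algebraic element from being sent to zero.\<close>

lemma algebraic_nonzero_const:
  assumes "algebraic_over F (a :: 'a :: field)" "a \<noteq> 0"
  shows "\<exists>p\<in>polys F. coeff p 0 \<noteq> 0 \<and> poly p a = 0"
proof -
  obtain p where "p \<in> polys F" "p \<noteq> 0" "poly p a = 0" using assms by (auto simp: algebraic_over_polys)
  then show ?thesis
  proof (induction p)
    case (pCons c p)
    show ?case
    proof (cases "c = 0")
      case True
      then show ?thesis using pCons assms(2) by (auto simp: polys_pCons_iff)
    next
      case False
      then show ?thesis using pCons.prems by (intro bexI[of _ "pCons c p"]) auto
    qed
  qed simp
qed

text \<open>Sending \<open>b\<close> to \<open>b'\<close> is well defined by
  \<open>poly_rel_root\<close>. Injectivity comes from algebraicity: a nonzero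
  \<open>poly q b\<close> satisfies an equation \<open>h\<close> with nonzero constant term, and if
  \<open>poly q' b'\<close> were zero, the image of that equation would force this constant term to
  be zero.\<close>

lemma hom_graph_adjoin:
  assumes R: "hom_graph R" and alg: "\<And>a. algebraic_over (Domain R) a"
    and p: "poly_rel R p p'" "p \<noteq> 0" "poly p b = 0" "poly p' b' = 0"
    and min: "\<And>q q'. poly_rel R q q' \<Longrightarrow> q \<noteq> 0 \<Longrightarrow> poly q b = 0 \<Longrightarrow> degree p \<le> degree q"
  shows "\<exists>R'. hom_graph R' \<and> R \<subseteq> R' \<and> (b, b') \<in> R'"
proof -
  define R' where "R' = {(poly q b, poly q' b') | q q'. poly_rel R q q'}"
  note D = hom_graphD[OF R] and C = poly_rel_closed[OF R]
  have in': "(poly q b, poly q' b') \<in> R'" if "poly_rel R q q'" for q q'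
    using that by (auto simp: R'_def)
  have z: "poly q b = 0 \<longleftrightarrow> poly q' b' = 0" if q: "poly_rel R q q'" for q q'
  proof
    show "poly q b = 0 \<Longrightarrow> poly q' b' = 0"
      using poly_rel_root[OF R p min q] by auto
    assume q0: "poly q' b' = 0"
    show "poly q b = 0"
    proof (rule ccontr)
      assume "poly q b \<noteq> 0"
      with alg obtain h where h: "h \<in> polys (Domain R)" "coeff h 0 \<noteq> 0" "poly h (poly q b) = 0"
        using algebraic_nonzero_const by metis
      obtain h' where h': "poly_rel R h h'" using poly_rel_exists[OF R h(1)] by auto
      have pc: "poly_rel R (pcompose g q) (pcompose g' q')" if "poly_rel R g g'" for g g'
        using that
      proof (induction g arbitrary: g')
        case 0
        then have "g' = 0" by (rule poly_rel_0[OF R])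
        then show ?case using C(1)[OF D(2)] by simp
      next
        case (pCons c g)
        obtain c' g1 where g': "g' = pCons c' g1" by (cases g')
        have "(c, c') \<in> R" using pCons.prems g' by (auto simp: poly_rel_def dest: spec[of _ 0])
        moreover have "poly_rel R g g1" using pCons.prems g' unfolding poly_rel_def
          by (metis coeff_pCons_Suc)
        then have "poly_rel R (pcompose g q) (pcompose g1 q')" by (rule pCons.IH)
        moreover have "poly_rel R (s + t) (s' + t')" if "poly_rel R s s'" "poly_rel R t t'" for s t s' t'
          using that by (auto simp: poly_rel_def intro: D)
        ultimately show ?case using C(1) C(4) q g' by (simp add: pcompose_pCons)
      qed
      have "poly (pcompose h' q') b' = 0"
        using poly_rel_root[OF R p min pc[OF h']] h(3) by (auto simp: poly_pcompose)
      then have "coeff h' 0 = 0" using q0 by (simp add: poly_pcompose poly_0_coeff_0)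
      moreover have "(coeff h 0, coeff h' 0) \<in> R" using h' by (auto simp: poly_rel_def)
      ultimately show False using h(2) D(6) by blast
    qed
  qed
  have "(a - c, a' - c') \<in> R' \<and> (a * c, a' * c') \<in> R'" if "(a, a') \<in> R'" "(c, c') \<in> R'" for a c a' c'
  proof -
    from that obtain q q' r r' where "a = poly q b" "a' = poly q' b'" "poly_rel R q q'"
      "c = poly r b" "c' = poly r' b'" "poly_rel R r r'" by (auto simp: R'_def)
    then show ?thesis using in'[OF C(3), of q q' r r'] in'[OF C(4), of q q' r r'] by simp
  qed
  moreover have "(a = 0) \<longleftrightarrow> (a' = 0)" if "(a, a') \<in> R'" for a a' using that z by (auto simp: R'_def)
  moreover have "(1, 1) \<in> R'" using in'[OF C(1)[OF D(1)]] by simp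
  ultimately have "hom_graph R'" unfolding hom_graph_def by auto
  moreover have "R \<subseteq> R'" using in'[OF C(1)] by auto
  moreover have "(b, b') \<in> R'" using in'[OF C(2)[OF D(1), of 1]] by (simp add: poly_monom)
  ultimately show ?thesis by blast
qed

lemma minimal_poly_rel:
  assumes "hom_graph R" "algebraic_over (Domain R) b"
  obtains p p' where "poly_rel R p p'" "p \<noteq> 0" "poly p b = 0"
    "\<And>q q'. poly_rel R q q' \<Longrightarrow> q \<noteq> 0 \<Longrightarrow> poly q b = 0 \<Longrightarrow> degree p \<le> degree q"
proof -
  define P where "P = (\<lambda>p. p \<noteq> 0 \<and> poly p b = 0 \<and> (\<exists>p'. poly_rel R p p'))"
  have "\<exists>p. P p" using assms poly_rel_exists[OF assms(1)] by (auto simp: P_def algebraic_over_polys)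
  then obtain p where "P p" "\<And>q. P q \<Longrightarrow> degree p \<le> degree q"
    using ex_has_least_nat[of P _ degree] by blast
  then show thesis using that unfolding P_def by metis
qed

text \<open>A graph maximal under inclusion is total: the polynomial of least degree of a missing
  element has an image of the same positive degree, which has a root in the algebraically closed
  target, so the element could be adjoined.\<close>

lemma extend_hom_graph:
  fixes R :: "('a :: field \<times> 'b :: alg_closed_field) set"
  assumes R: "hom_graph R" and alg: "\<And>a. algebraic_over (Domain R) a"
  shows "\<exists>\<sigma>. hom_on UNIV \<sigma> \<and> (\<forall>(a, c)\<in>R. \<sigma> a = c)"
proof -
  define Hs where "Hs = {R'. hom_graph R' \<and> R \<subseteq> R'}"
  have "\<exists>M\<in>Hs. \<forall>Z\<in>Hs. M \<subseteq> Z \<longrightarrow> Z = M"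
  proof (rule subset_Zorn_nonempty)
    show "Hs \<noteq> {}" using R by (auto simp: Hs_def)
    fix C assume C: "C \<noteq> {}" "subset.chain Hs C"
    then have CR: "\<And>Z. Z \<in> C \<Longrightarrow> hom_graph Z \<and> R \<subseteq> Z" by (auto simp: Hs_def subset.chain_def)
    have two: "\<exists>Z\<in>C. u \<in> Z \<and> v \<in> Z" if "u \<in> \<Union>C" "v \<in> \<Union>C" for u v
      using that C(2) unfolding subset.chain_def by blast
    have "hom_graph (\<Union>C)" unfolding hom_graph_def
    proof (intro conjI allI impI)
      show "(1, 1) \<in> \<Union>C" using C(1) CR hom_graphD(1) by blast
      fix a b c d assume "(a, c) \<in> \<Union>C" "(b, d) \<in> \<Union>C"
      with two obtain Z where "Z \<in> C" "(a, c) \<in> Z" "(b, d) \<in> Z" by blast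
      then show "(a - b, c - d) \<in> \<Union>C" "(a * b, c * d) \<in> \<Union>C"
        using CR hom_graphD(3,4) by blast+
    next
      fix a c assume "(a, c) \<in> \<Union>C"
      then obtain Z where "Z \<in> C" "(a, c) \<in> Z" by blast
      then show "(a = 0) = (c = 0)" using CR[of Z] hom_graphD(6)[of Z a c] by blast
    qed
    then show "\<Union>C \<in> Hs" using C CR by (auto simp: Hs_def)
  qed
  then obtain M where "M \<in> Hs" and Mmax: "\<And>Z. Z \<in> Hs \<Longrightarrow> M \<subseteq> Z \<Longrightarrow> Z = M"
    by metis
  then have M: "hom_graph M" "R \<subseteq> M" "\<And>Z. hom_graph Z \<Longrightarrow> M \<subseteq> Z \<Longrightarrow> Z = M"
    using Mmax by (auto simp: Hs_def)
  have algM: "algebraic_over (Domain M) a" for a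
    by (rule algebraic_over_mono[OF _ alg]) (use M in auto)
  have tot: "b \<in> Domain M" for b
  proof -
    obtain p p' where p: "poly_rel M p p'" "p \<noteq> 0" "poly p b = 0"
      "\<And>q q'. poly_rel M q q' \<Longrightarrow> q \<noteq> 0 \<Longrightarrow> poly q b = 0 \<Longrightarrow> degree p \<le> degree q"
      using minimal_poly_rel[OF M(1) algM] by metis
    have "degree p' \<noteq> 0"
      using poly_rel_degree[OF M(1) p(1)] p(2,3)
      by (metis degree_eq_zeroE mult_zero_right pCons_0_0 poly_const_conv)
    then obtain b' where "poly p' b' = 0" using alg_closed_imp_poly_has_root by blast
    then have "\<exists>R'. hom_graph R' \<and> M \<subseteq> R' \<and> (b, b') \<in> R'"
      by (intro hom_graph_adjoin[OF M(1) algM p(1-3)] p(4)) auto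
    then show ?thesis using M(3) by blast
  qed
  define \<sigma> where "\<sigma> = (\<lambda>a. THE c. (a, c) \<in> M)"
  have \<sigma>: "\<sigma> a = c" if "(a, c) \<in> M" for a c
    unfolding \<sigma>_def using that hom_graphD(7)[OF M(1)] by blast
  have \<sigma>M: "(a, \<sigma> a) \<in> M" for a using tot[of a] \<sigma> by auto
  have "\<sigma> (a + b) = \<sigma> a + \<sigma> b \<and> \<sigma> (a * b) = \<sigma> a * \<sigma> b" for a b
    using \<sigma>[OF hom_graphD(5)[OF M(1) \<sigma>M \<sigma>M]] \<sigma>[OF hom_graphD(4)[OF M(1) \<sigma>M \<sigma>M]] by auto
  then have "hom_on UNIV \<sigma>" using \<sigma>[OF hom_graphD(1)[OF M(1)]] by (auto simp: hom_on_def)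
  then show ?thesis using \<sigma> M(2) by blast
qed

subsection \<open>Automorphisms of an algebraically closed field\<close>

text \<open>\<open>F\<close> may be any set, and \<open>Aut {}\<close> consists of all
  automorphisms. On the whole type the \<open>extensional\<close> normalisation is vacuous, so this
  is \<open>gal UNIV F\<close>.\<close>

definition Aut :: "'a :: field set \<Rightarrow> ('a \<Rightarrow> 'a) set"
  where "Aut F = {\<sigma>. hom_on UNIV \<sigma> \<and> bij \<sigma> \<and> (\<forall>a\<in>F. \<sigma> a = a)}"

lemma ring_hom_FR_iff:
  "\<tau> \<in> ring_hom (FR\<lparr>carrier := L\<rparr>) (FR\<lparr>carrier := L'\<rparr>) \<longleftrightarrow> hom_on L \<tau> \<and> \<tau> ` L \<subseteq> L'"
  by (auto simp: ring_hom_def hom_on_def)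

lemma field_auts_iff:
  fixes L :: "'a :: field set"
  assumes "is_subfield L"
  shows "\<tau> \<in> field_auts L \<longleftrightarrow> \<tau> \<in> extensional L \<and> hom_on L \<tau> \<and> \<tau> ` L = L"
proof -
  have "inj_on \<tau> L" if "hom_on L \<tau>"
    using hom_on_simps(11)[OF that assms] by (auto intro: inj_onI)
  then show ?thesis
    by (auto simp: field_auts_def ring_iso_def ring_hom_FR_iff bij_betw_def)
qed

lemma gal_UNIV: "gal UNIV F = Aut F"
  by (auto simp: gal_def Aut_def field_auts_iff extensional_def bij_def
      dest: hom_on_simps(11)[OF _ is_subfield_UNIV] intro!: injI)

lemmas hom_UNIV = hom_on_simps[OF _ is_subfield_UNIV, simplified]

lemma AutD:
  assumes "\<sigma> \<in> Aut F"
  shows "hom_on UNIV \<sigma>" "bij \<sigma>" "a \<in> F \<Longrightarrow> \<sigma> a = a" "\<sigma> 1 = 1" "\<sigma> 0 = 0" "\<sigma> (a + b) = \<sigma> a + \<sigma> b"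
    "\<sigma> (a * b) = \<sigma> a * \<sigma> b" "\<sigma> (- a) = - \<sigma> a" "\<sigma> (a - b) = \<sigma> a - \<sigma> b" "\<sigma> (a ^ n) = \<sigma> a ^ n"
    "\<sigma> (inverse a) = inverse (\<sigma> a)" "\<sigma> (a / b) = \<sigma> a / \<sigma> b" "\<sigma> a = 0 \<longleftrightarrow> a = 0"
    "\<sigma> a = \<sigma> b \<longleftrightarrow> a = b" "\<sigma> (sum f I) = (\<Sum>j\<in>I. \<sigma> (f j))" "\<sigma> (prod f I) = (\<Prod>j\<in>I. \<sigma> (f j))"
proof -
  show h: "hom_on UNIV \<sigma>" "bij \<sigma>" "a \<in> F \<Longrightarrow> \<sigma> a = a" using assms by (auto simp: Aut_def)
  show "\<sigma> (sum f I) = (\<Sum>j\<in>I. \<sigma> (f j))" "\<sigma> (prod f I) = (\<Prod>j\<in>I. \<sigma> (f j))"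
    by (auto intro: hom_on_sum[OF h(1)] hom_on_prod[OF h(1)])
qed (use assms[unfolded Aut_def] in \<open>auto simp: hom_UNIV[of \<sigma>]\<close>)

lemma Aut_comp: "\<sigma> \<in> Aut F \<Longrightarrow> \<rho> \<in> Aut F \<Longrightarrow> \<sigma> \<circ> \<rho> \<in> Aut F"
  by (auto simp: Aut_def hom_on_def bij_comp)

lemma Aut_id: "id \<in> Aut F"
  by (auto simp: Aut_def hom_on_def)

lemma Aut_funpow: "\<sigma> \<in> Aut F \<Longrightarrow> (\<sigma> ^^ n) \<in> Aut F"
  by (induction n) (auto intro: Aut_comp simp: Aut_id[unfolded id_def] Aut_id)

lemma Aut_inv:
  assumes "\<sigma> \<in> Aut F"
  shows "Hilbert_Choice.inv \<sigma> \<in> Aut F"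
proof -
  note [simp] = AutD[OF assms]
  have s: "\<sigma> (Hilbert_Choice.inv \<sigma> a) = a" "Hilbert_Choice.inv \<sigma> (\<sigma> a) = a" for a
    using AutD(2)[OF assms] by (auto simp: bij_inv_eq_iff bij_is_surj surj_f_inv_f bij_is_inj)
  have "Hilbert_Choice.inv \<sigma> (a + b) = Hilbert_Choice.inv \<sigma> a + Hilbert_Choice.inv \<sigma> b \<and> Hilbert_Choice.inv \<sigma> (a * b) = Hilbert_Choice.inv \<sigma> a * Hilbert_Choice.inv \<sigma> b" for a b
    using s(2)[of "Hilbert_Choice.inv \<sigma> a + Hilbert_Choice.inv \<sigma> b"] s(2)[of "Hilbert_Choice.inv \<sigma> a * Hilbert_Choice.inv \<sigma> b"] by (simp add: s(1))
  moreover have "Hilbert_Choice.inv \<sigma> a = a" if "a \<in> F \<or> a = 1" for a using s(2)[of a] that by auto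
  ultimately show ?thesis
    using AutD(2)[OF assms] by (auto simp: Aut_def hom_on_def bij_imp_bij_inv)
qed

lemma Aut_mono: "F \<subseteq> F' \<Longrightarrow> Aut F' \<subseteq> Aut F"
  by (auto simp: Aut_def)

lemma Aut_generate:
  assumes "\<sigma> \<in> Aut H"
  shows "\<sigma> \<in> Aut (generate_field FR H)"
proof -
  note [simp] = AutD[OF assms]
  have "is_subfield {a. \<sigma> a = a}" by (auto simp: is_subfield_def is_subring_def)
  then have "generate_field FR H \<subseteq> {a. \<sigma> a = a}"
    by (rule generate_field_FR(3)) auto
  then show ?thesis using assms by (auto simp: Aut_def)
qed

lemma map_poly_hom_poly:
  assumes "hom_on UNIV \<sigma>"
  shows "poly (map_poly \<sigma> p) (\<sigma> a) = \<sigma> (poly p a)"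
  by (induction p) (auto simp: hom_UNIV[OF assms] map_poly_pCons)

lemma map_poly_fixed: "\<sigma> 0 = 0 \<Longrightarrow> (\<And>a. a \<in> F \<Longrightarrow> \<sigma> a = a) \<Longrightarrow> p \<in> polys F \<Longrightarrow> map_poly \<sigma> p = p"
  by (intro poly_eqI) (auto simp: coeff_map_poly polysD)

lemma Aut_root:
  assumes "\<sigma> \<in> Aut F" "p \<in> polys F" "poly p a = 0"
  shows "poly p (\<sigma> a) = 0"
  using map_poly_hom_poly[of \<sigma> p a] map_poly_fixed[of \<sigma> F p] AutD[OF assms(1)] assms(2,3) by simp

locale alg_base =
  fixes F :: "'a :: {alg_closed_field, field_char_0} set"
  assumes F: "is_subfield F" and alg: "algebraic_over F a"
begin

lemma finite_conjugates: "finite ((\<lambda>\<sigma>. \<sigma> a) ` Aut F)"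
proof -
  obtain p where "p \<in> polys F" "p \<noteq> 0" "poly p a = 0" using alg[of a] by (auto simp: algebraic_over_polys)
  then have "(\<lambda>\<sigma>. \<sigma> a) ` Aut F \<subseteq> {b. poly p b = 0}" by (auto intro: Aut_root)
  then show ?thesis using poly_roots_finite[OF \<open>p \<noteq> 0\<close>] finite_subset by blast
qed

text \<open>A homomorphism over \<open>F\<close> is injective and maps the finite root set of a
  polynomial over \<open>F\<close> into itself, hence onto itself; every element is such a
  root.\<close>

lemma hom_bij:
  assumes h: "hom_on UNIV \<sigma>" and fix': "\<And>a. a \<in> F \<Longrightarrow> \<sigma> a = a"
  shows "bij \<sigma>"
proof -
  have inj: "inj \<sigma>" using hom_UNIV(11)[OF h] by (auto intro: injI)
  have "b \<in> range \<sigma>" for b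
  proof -
    obtain p where p: "p \<in> polys F" "p \<noteq> 0" "poly p b = 0" using alg[of b] by (auto simp: algebraic_over_polys)
    define Z where "Z = {a. poly p a = 0}"
    have "finite Z" unfolding Z_def by (rule poly_roots_finite[OF p(2)])
    moreover have "\<sigma> ` Z \<subseteq> Z"
      using map_poly_hom_poly[OF h, of p] map_poly_fixed[of \<sigma> F p] fix' p(1) hom_UNIV(2)[OF h]
      by (auto simp: Z_def)
    ultimately have "\<sigma> ` Z = Z" using inj by (metis endo_inj_surj inj_on_subset subset_UNIV)
    moreover have "b \<in> Z" using p by (simp add: Z_def)
    ultimately show ?thesis by blast
  qed
  then show ?thesis using inj by (auto simp: bij_def)
qed

lemma extend_embedding:
  assumes L: "is_subfield L" "F \<subseteq> L" and h: "hom_on L \<tau>" and fix': "\<And>a. a \<in> F \<Longrightarrow> \<tau> a = a"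
  shows "\<exists>\<sigma>\<in>Aut F. \<forall>a\<in>L. \<sigma> a = \<tau> a"
proof -
  note c = is_subfield_closed[OF L(1)] and s = hom_on_simps[OF h L(1)]
  define R where "R = {(a, \<tau> a) | a. a \<in> L}"
  have R: "hom_graph R"
    unfolding hom_graph_def
  proof (intro conjI allI impI)
    show "(1, 1) \<in> R" using c(1) s(1) by (auto simp: R_def intro!: exI[of _ 1])
    fix a b d e assume "(a, d) \<in> R" "(b, e) \<in> R"
    then have "a \<in> L" "b \<in> L" "d = \<tau> a" "e = \<tau> b" by (auto simp: R_def)
    then show "(a - b, d - e) \<in> R" "(a * b, d * e) \<in> R" using s c by (auto simp: R_def)
  next
    fix a d assume "(a, d) \<in> R"
    then show "(a = 0) = (d = 0)" using s(10) by (auto simp: R_def)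
  qed
  have "algebraic_over (Domain R) a" for a
    by (rule algebraic_over_mono[OF _ alg]) (use L in \<open>auto simp: R_def\<close>)
  from extend_hom_graph[OF R this] obtain \<sigma> where \<sigma>: "hom_on UNIV \<sigma>" "\<forall>(a, c)\<in>R. \<sigma> a = c" by blast
  then have "\<forall>a\<in>L. \<sigma> a = \<tau> a" by (auto simp: R_def)
  moreover from this have "\<forall>a\<in>F. \<sigma> a = a" using fix' L by auto
  ultimately show ?thesis using \<sigma>(1) hom_bij[OF \<sigma>(1)] by (auto simp: Aut_def intro!: bexI[of _ \<sigma>])
qed

text \<open>Separability in characteristic zero: the derivative of the minimal polynomial has
  smaller degree, so it does not vanish at \<open>b\<close>. Thus \<open>b\<close> is a simple root
  and any root \<open>b'\<close> of the cofactor differs from it; the assignment of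
  \<open>b'\<close> to \<open>b\<close> extends to an automorphism.\<close>

lemma Aut_moves:
  assumes b: "b \<notin> F"
  shows "\<exists>\<sigma>\<in>Aut F. \<sigma> b \<noteq> b"
proof -
  note c = is_subfield_closed[OF F] is_subfieldD[OF F]
  define R where "R = {(a, a) | a. a \<in> F}"
  have R: "hom_graph R" using c unfolding hom_graph_def by (auto simp: R_def)
  have D: "Domain R = F" by (auto simp: R_def)
  obtain p p' where p: "poly_rel R p p'" "p \<noteq> 0" "poly p b = 0"
      "\<And>q q'. poly_rel R q q' \<Longrightarrow> q \<noteq> 0 \<Longrightarrow> poly q b = 0 \<Longrightarrow> degree p \<le> degree q"
    using minimal_poly_rel[OF R] alg D by metis
  have p': "p' = p" "p \<in> polys F" using p(1) by (auto simp: poly_rel_def R_def poly_eq_iff polys_def)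
  have min: "degree p \<le> degree q" if "q \<in> polys F" "q \<noteq> 0" "poly q b = 0" for q
    using p(4)[of q q] that by (auto simp: poly_rel_def R_def polys_def)
  have deg: "degree p > 0"
    using p(2,3) by (metis degree_eq_zeroE gr0I mult_zero_right pCons_0_0 poly_const_conv)
  have "pderiv p \<in> polys F" using p'(2) c by (auto simp: polys_def coeff_pderiv)
  moreover have "pderiv p \<noteq> 0" using deg by (simp add: pderiv_eq_0_iff)
  moreover have "degree (pderiv p) < degree p" using deg by (simp add: degree_pderiv)
  ultimately have pd: "poly (pderiv p) b \<noteq> 0" using min[of "pderiv p"] by auto
  obtain r where r: "p = [:-b, 1:] * r" using p(3) by (metis poly_eq_0_iff_dvd dvdE)
  \<comment> \<open>A constant cofactor would make \<open>p\<close> linear over \<open>F\<close> and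
    put \<open>b\<close> into \<open>F\<close>.\<close>
  have "degree r \<noteq> 0"
  proof
    assume "degree r = 0"
    then obtain e where e: "r = [:e:]" by (metis degree_eq_zeroE)
    have "e \<noteq> 0" "- b * e \<in> F" "e \<in> F"
      using p(2) polysD[OF p'(2), of 0] polysD[OF p'(2), of 1] by (auto simp: r e mult.commute)
    then have "- (- b * e / e) \<in> F" by (intro c(5) c(12))
    then show False using b \<open>e \<noteq> 0\<close> by simp
  qed
  then obtain b' where b': "poly r b' = 0" using alg_closed_imp_poly_has_root by blast
  have "poly (pderiv p) b = poly r b" unfolding r pderiv_mult by (simp add: pderiv_pCons)
  then have "b' \<noteq> b" using pd b' by auto
  have "\<exists>R'. hom_graph R' \<and> R \<subseteq> R' \<and> (b, b') \<in> R'"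
    by (rule hom_graph_adjoin[OF R _ p(1-3) _ p(4)]) (use b' in \<open>auto simp: D alg p' r\<close>)
  then obtain R' where R': "hom_graph R'" "R \<subseteq> R'" "(b, b') \<in> R'" by blast
  have "algebraic_over (Domain R') a" for a
    by (rule algebraic_over_mono[OF _ alg]) (use R'(2) D in auto)
  from extend_hom_graph[OF R'(1) this] obtain \<sigma> where \<sigma>: "hom_on UNIV \<sigma>" "\<forall>(a, c)\<in>R'. \<sigma> a = c" by blast
  then have f: "\<sigma> a = a" if "a \<in> F" for a using that R'(2) by (auto simp: R_def)
  then have "\<sigma> \<in> Aut F" using \<sigma>(1) hom_bij[OF \<sigma>(1)] by (auto simp: Aut_def)
  moreover have "\<sigma> b = b'" using \<sigma>(2) R'(3) by auto
  ultimately show ?thesis using \<open>b' \<noteq> b\<close> by auto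
qed

lemma polys_fixed: "(\<And>\<sigma>. \<sigma> \<in> Aut F \<Longrightarrow> map_poly \<sigma> p = p) \<Longrightarrow> p \<in> polys F"
proof -
  assume f: "\<And>\<sigma>. \<sigma> \<in> Aut F \<Longrightarrow> map_poly \<sigma> p = p"
  have "\<sigma> (coeff p j) = coeff p j" if "\<sigma> \<in> Aut F" for \<sigma> j
    using arg_cong[OF f[OF that], of "\<lambda>p. coeff p j"] AutD(5)[OF that] by (simp add: coeff_map_poly)
  then show ?thesis unfolding polys_def using Aut_moves by blast
qed

text \<open>The normal closure of \<open>F(a)\<close>. Generating it by the orbit of
  \<open>a\<close> makes its stability immediate and reduces the equality of two automorphisms on it
  to the finitely many conjugates of \<open>a\<close>.\<close>

definition conj_field :: "'a \<Rightarrow> 'a set"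
  where "conj_field a = generate_field FR (F \<union> (\<lambda>\<sigma>. \<sigma> a) ` Aut F)"

lemma conj_field_subfield: "is_subfield (conj_field a)" "F \<subseteq> conj_field a" "a \<in> conj_field a"
proof -
  show "is_subfield (conj_field a)" unfolding conj_field_def by (rule generate_field_FR)
  have "a \<in> (\<lambda>\<sigma>. \<sigma> a) ` Aut F" using Aut_id by (rule rev_image_eqI) simp
  then show "F \<subseteq> conj_field a" "a \<in> conj_field a"
    using generate_field_FR(2)[of "F \<union> (\<lambda>\<sigma>. \<sigma> a) ` Aut F"] by (auto simp: conj_field_def)
qed

lemma Aut_conj_field_subset:
  assumes "\<sigma> \<in> Aut F"
  shows "\<sigma> ` conj_field a \<subseteq> conj_field a"
proof -
  note [simp] = AutD[OF assms]
  note c = is_subfield_closed[OF conj_field_subfield(1)] is_subfieldD[OF conj_field_subfield(1)]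
  have "is_subfield {b. \<sigma> b \<in> conj_field a}" using c by (auto simp: is_subfield_def is_subring_def)
  moreover have "\<sigma> (\<rho> a) \<in> conj_field a" if "\<rho> \<in> Aut F" for \<rho>
    unfolding conj_field_def using Aut_comp[OF assms that]
    by (intro subsetD[OF generate_field_FR(2)] UnI2 image_eqI[of _ _ "\<sigma> \<circ> \<rho>"]) auto
  ultimately have "conj_field a \<subseteq> {b. \<sigma> b \<in> conj_field a}"
    using conj_field_subfield(2)[of a] by (subst (1) conj_field_def, intro generate_field_FR(3)) auto
  then show ?thesis by auto
qed

lemma Aut_stable_image:
  assumes "\<sigma> \<in> Aut F" "\<And>\<rho>. \<rho> \<in> Aut F \<Longrightarrow> \<rho> ` L \<subseteq> L"
  shows "\<sigma> ` L = L"
proof -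
  have "Hilbert_Choice.inv \<sigma> ` L \<subseteq> L" using assms Aut_inv by blast
  then have "\<sigma> ` Hilbert_Choice.inv \<sigma> ` L \<subseteq> \<sigma> ` L" by (rule image_mono)
  then have "L \<subseteq> \<sigma> ` L" using AutD(2)[OF assms(1)] by (simp add: bij_def image_f_inv_f)
  then show ?thesis using assms by blast
qed

lemma restrict_gal:
  assumes "\<sigma> \<in> Aut F" "\<sigma> ` L = L" "is_subfield L" "F \<subseteq> L"
  shows "restrict \<sigma> L \<in> gal L F"
proof -
  note [simp] = AutD[OF assms(1)]
  have "hom_on L (restrict \<sigma> L)"
    using is_subfield_closed[OF assms(3)] by (auto simp: hom_on_def)
  then show ?thesis using assms by (auto simp: gal_def field_auts_iff[OF assms(3)])
qed

lemma galois_ext_stable: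
  assumes L: "is_subfield L" "F \<subseteq> L" and st: "\<And>\<rho>. \<rho> \<in> Aut F \<Longrightarrow> \<rho> ` L = L"
  shows "galois_ext F L"
proof -
  have "{a \<in> L. \<forall>\<sigma>\<in>gal L F. \<sigma> a = a} = F"
  proof (intro equalityI subsetI)
    fix b assume b: "b \<in> {a \<in> L. \<forall>\<sigma>\<in>gal L F. \<sigma> a = a}"
    have "\<sigma> b = b" if "\<sigma> \<in> Aut F" for \<sigma>
      using bspec[of "gal L F" _ "restrict \<sigma> L"] restrict_gal[OF that st[OF that] L] b by auto
    then show "b \<in> F" using Aut_moves by blast
  qed (use L in \<open>auto simp: gal_def\<close>)
  then show ?thesis using F L alg by (auto simp: galois_ext_def subfield_FR_iff)
qed

lemma gal_lift:
  assumes "is_subfield L" "F \<subseteq> L" "\<tau> \<in> gal L F"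
  shows "\<exists>\<sigma>\<in>Aut F. \<forall>a\<in>L. \<sigma> a = \<tau> a"
  using extend_embedding[OF assms(1,2)] assms(3) by (auto simp: gal_def field_auts_iff[OF assms(1)])

end

section \<open>Finite Galois groups and pro-ell extensions\<close>

lemma ell_power_order:
  fixes ell :: nat and G (structure)
  assumes "group G" and fin: "finite (carrier G)" and p: "Factorial_Ring.prime ell"
    and el: "\<And>g. g \<in> carrier G \<Longrightarrow> \<exists>e. g [^] (ell ^ e) = \<one>"
  shows "\<exists>m. card (carrier G) = ell ^ m"
proof -
  interpret group G by fact
  have 0: "Coset.order G \<noteq> 0" using fin order_gt_0_iff_finite by auto
  then obtain r where r: "Coset.order G = ell ^ multiplicity ell (Coset.order G) * r" "\<not> ell dvd r"
    using multiplicity_decompose'[of "Coset.order G" ell] p not_prime_unit by metis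
  have "r = 1"
  proof (rule ccontr)
    assume "r \<noteq> 1"
    then obtain q where q: "Factorial_Ring.prime q" "q dvd r" using prime_factor_nat by blast
    then have "q \<noteq> ell" using r by auto
    from q(2) obtain t where "r = q * t" ..
    then have "Coset.order G = q ^ 1 * (ell ^ multiplicity ell (Coset.order G) * t)" using r(1) by (metis mult.left_commute power_one_right)
    \<comment> \<open>With exponent one this is Cauchy's theorem: it yields a subgroup of prime
      order \<open>q\<close> different from \<open>ell\<close>. A nontrivial element of it has order
      \<open>q\<close>, which would have to divide a power of \<open>ell\<close>.\<close>
    from sylow_thm[OF q(1) is_group this fin] obtain H where H: "subgroup H G" "card H = q" by auto
    then have "\<not> H \<subseteq> {\<one>}" using q(1) card_mono[of "{\<one>}" H] prime_gt_1_nat[of q] by force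
    then obtain g where g: "g \<in> H" "g \<noteq> \<one>" by blast
    then have gc: "g \<in> carrier G" using H(1) by (auto dest: subgroup.subset)
    obtain e where "g [^] (ell ^ e) = \<one>" using el[OF gc] by blast
    then have "ord g dvd ell ^ e" using pow_eq_id[OF gc] by simp
    interpret H: group "G\<lparr>carrier := H\<rparr>" using H(1) by (rule subgroup_imp_group)
    have "g [^]\<^bsub>G\<lparr>carrier := H\<rparr>\<^esub> q = \<one>"
      using H.pow_order_eq_1[of g] g H(2) by (simp add: Coset.order_def)
    then have "g [^] q = \<one>" using nat_pow_consistent[of g q H] by metis
    then have "ord g dvd q" using pow_eq_id[OF gc] by simp
    then have "ord g = 1 \<or> ord g = q" using q(1) by (metis prime_nat_iff)
    moreover have "ord g \<noteq> 1" using g ord_eq_1[OF gc] by blast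
    ultimately have "q dvd ell ^ e" using \<open>ord g dvd ell ^ e\<close> by simp
    then have "q dvd ell" using prime_dvd_power[OF q(1)] by blast
    then show False using \<open>q \<noteq> ell\<close> p q(1) by (simp add: primes_dvd_imp_eq)
  qed
  then show ?thesis using r unfolding Coset.order_def by auto
qed

context alg_base
begin

lemma gal_eq_restrict:
  assumes M: "is_subfield M" "F \<subseteq> M"
  shows "gal M F = {restrict \<sigma> M | \<sigma>. \<sigma> \<in> Aut F \<and> \<sigma> ` M = M}"
proof (intro equalityI subsetI)
  fix g assume g: "g \<in> gal M F"
  then obtain \<sigma> where \<sigma>: "\<sigma> \<in> Aut F" "\<forall>a\<in>M. \<sigma> a = g a" using gal_lift[OF M] by blast
  have "g \<in> extensional M" "g ` M = M" using g by (auto simp: gal_def field_auts_iff[OF M(1)])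
  then have "g = restrict \<sigma> M" "\<sigma> ` M = M" using \<sigma>(2) by (auto simp: extensional_def restrict_def fun_eq_iff)
  then show "g \<in> {restrict \<sigma> M | \<sigma>. \<sigma> \<in> Aut F \<and> \<sigma> ` M = M}" using \<sigma>(1) by blast
qed (use restrict_gal M in blast)

text \<open>Elements of \<open>gal M F\<close> are extensional functions; restricting after
  composition keeps products in that form.\<close>

definition gal_group :: "'a set \<Rightarrow> ('a \<Rightarrow> 'a) monoid"
  where "gal_group M = \<lparr>carrier = gal M F, monoid.mult = (\<lambda>g h. restrict (g \<circ> h) M), one = restrict id M\<rparr>"

lemma restrict_comp: "\<rho> ` M = M \<Longrightarrow> restrict (restrict \<sigma> M \<circ> restrict \<rho> M) M = restrict (\<sigma> \<circ> \<rho>) M"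
  by (auto simp: restrict_def fun_eq_iff)

lemma group_gal_group:
  assumes M: "is_subfield M" "F \<subseteq> M"
  shows "group (gal_group M)"
proof (rule groupI)
  note E = gal_eq_restrict[OF M]
  have car: "carrier (gal_group M) = {restrict \<sigma> M | \<sigma>. \<sigma> \<in> Aut F \<and> \<sigma> ` M = M}"
    by (simp add: gal_group_def E)
  have m: "restrict \<sigma> M \<otimes>\<^bsub>gal_group M\<^esub> restrict \<rho> M = restrict (\<sigma> \<circ> \<rho>) M" if "\<rho> ` M = M" for \<sigma> \<rho>
    using restrict_comp[OF that] by (simp add: gal_group_def)
  have im: "(\<sigma> \<circ> \<rho>) ` M = M" if "\<sigma> ` M = M" "\<rho> ` M = M" for \<sigma> \<rho>
    using that by (metis image_comp)
  have one: "\<one>\<^bsub>gal_group M\<^esub> = restrict id M" by (simp add: gal_group_def)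
  show "\<one>\<^bsub>gal_group M\<^esub> \<in> carrier (gal_group M)"
    unfolding one car using Aut_id by fastforce
  fix g assume "g \<in> carrier (gal_group M)"
  then obtain \<sigma> where \<sigma>: "g = restrict \<sigma> M" "\<sigma> \<in> Aut F" "\<sigma> ` M = M" by (auto simp: car)
  show "\<one>\<^bsub>gal_group M\<^esub> \<otimes>\<^bsub>gal_group M\<^esub> g = g"
    unfolding one \<sigma>(1) by (subst m[OF \<sigma>(3)]) simp
  show "\<exists>h\<in>carrier (gal_group M). h \<otimes>\<^bsub>gal_group M\<^esub> g = \<one>\<^bsub>gal_group M\<^esub>"
  proof
    have b: "bij \<sigma>" using AutD(2)[OF \<sigma>(2)] .
    have "Hilbert_Choice.inv \<sigma> ` M = M" using \<sigma>(3) b by (metis bij_def image_inv_f_f)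
    then show "restrict (Hilbert_Choice.inv \<sigma>) M \<in> carrier (gal_group M)"
      using Aut_inv[OF \<sigma>(2)] by (auto simp: car)
    show "restrict (Hilbert_Choice.inv \<sigma>) M \<otimes>\<^bsub>gal_group M\<^esub> g = \<one>\<^bsub>gal_group M\<^esub>"
      unfolding one \<sigma>(1) m[OF \<sigma>(3)] using b by (simp add: bij_def)
  qed
  fix h assume "h \<in> carrier (gal_group M)"
  then obtain \<rho> where \<rho>: "h = restrict \<rho> M" "\<rho> \<in> Aut F" "\<rho> ` M = M" by (auto simp: car)
  show "g \<otimes>\<^bsub>gal_group M\<^esub> h \<in> carrier (gal_group M)"
    unfolding \<sigma>(1) \<rho>(1) m[OF \<rho>(3)] using Aut_comp[OF \<sigma>(2) \<rho>(2)] im[OF \<sigma>(3) \<rho>(3)] unfolding car by blast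
  fix k assume "k \<in> carrier (gal_group M)"
  then obtain \<eta> where \<eta>: "k = restrict \<eta> M" "\<eta> \<in> Aut F" "\<eta> ` M = M" by (auto simp: car)
  show "g \<otimes>\<^bsub>gal_group M\<^esub> h \<otimes>\<^bsub>gal_group M\<^esub> k = g \<otimes>\<^bsub>gal_group M\<^esub> (h \<otimes>\<^bsub>gal_group M\<^esub> k)"
    unfolding \<sigma>(1) \<rho>(1) \<eta>(1) by (simp only: m[OF \<rho>(3)] m[OF \<eta>(3)] m[OF im[OF \<rho>(3) \<eta>(3)]] comp_assoc)
qed

lemma gal_group_pow:
  assumes "\<sigma> ` M = M"
  shows "restrict \<sigma> M [^]\<^bsub>gal_group M\<^esub> (n :: nat) = restrict (\<sigma> ^^ n) M"
proof (induction n)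
  case 0
  then show ?case by (auto simp: gal_group_def restrict_def)
next
  case (Suc n)
  have "restrict \<sigma> M [^]\<^bsub>gal_group M\<^esub> Suc n = restrict (restrict (\<sigma> ^^ n) M \<circ> restrict \<sigma> M) M"
    by (subst Suc[symmetric]) (simp add: gal_group_def nat_pow_Suc)
  also have "\<dots> = restrict (\<sigma> ^^ n \<circ> \<sigma>) M" by (rule restrict_comp[OF assms])
  finally show ?case unfolding funpow_Suc_right .
qed

lemma funpow_dvd_fixed: "(\<sigma> ^^ r) a = a \<Longrightarrow> r dvd t \<Longrightarrow> (\<sigma> ^^ t) a = a"
proof -
  assume a: "(\<sigma> ^^ r) a = a" "r dvd t"
  have "((\<sigma> ^^ r) ^^ m) a = a" for m by (induction m) (auto simp: a)
  then show ?thesis using a(2) by (auto simp: funpow_mult dvd_def)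
qed

text \<open>An automorphism that fixes all conjugates of \<open>a\<close> is trivial on the whole
  field. There are finitely many conjugates, so one power of \<open>ell\<close> kills a given
  element of a finite quotient, and \<open>ell_power_order\<close> applies.\<close>

lemma pro_ell_ext_conj_field:
  assumes p: "Factorial_Ring.prime ell"
    and el: "\<And>\<rho> \<sigma>. \<rho> \<in> Aut F \<Longrightarrow> \<sigma> \<in> Aut F \<Longrightarrow> \<exists>e. (\<rho> ^^ (ell ^ e)) (\<sigma> a) = \<sigma> a"
  shows "pro_ell_ext ell F (conj_field a)"
proof -
  have st: "\<rho> ` conj_field a = conj_field a" if "\<rho> \<in> Aut F" for \<rho>
    by (rule Aut_stable_image[OF that Aut_conj_field_subset])
  have "galois_ext F (conj_field a)"
    by (rule galois_ext_stable[OF conj_field_subfield(1,2) st])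
  moreover have "\<exists>m. card (gal M F) = ell ^ m" if M: "galois_ext F M" "M \<subseteq> conj_field a" "finite (gal M F)" for M
  proof -
    have M': "is_subfield M" "F \<subseteq> M" using M(1) by (auto simp: galois_ext_def subfield_FR_iff)
    have "\<exists>m. card (carrier (gal_group M)) = ell ^ m"
    proof (rule ell_power_order[OF group_gal_group[OF M'] _ p])
      show "finite (carrier (gal_group M))" using M(3) by (simp add: gal_group_def)
      fix g assume "g \<in> carrier (gal_group M)"
      then obtain \<rho> where \<rho>: "g = restrict \<rho> M" "\<rho> \<in> Aut F" "\<rho> ` M = M"
        unfolding gal_group_def using gal_eq_restrict[OF M'] by auto
      define C0 where "C0 = (\<lambda>\<sigma>. \<sigma> a) ` Aut F"
      have "finite C0" unfolding C0_def by (rule finite_conjugates)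
      moreover have "\<forall>b\<in>C0. \<exists>e. (\<rho> ^^ (ell ^ e)) b = b" using el[OF \<rho>(2)] by (auto simp: C0_def)
      then obtain e where e: "\<And>b. b \<in> C0 \<Longrightarrow> (\<rho> ^^ (ell ^ e b)) b = b" by metis
      \<comment> \<open>The sum is at least each single exponent, so \<open>ell ^ E\<close> is a
        common multiple.\<close>
      define E where "E = (\<Sum>b\<in>C0. e b)"
      have "(\<rho> ^^ (ell ^ E)) b = b" if "b \<in> C0" for b
        using that \<open>finite C0\<close> by (intro funpow_dvd_fixed[OF e[OF that]] le_imp_power_dvd) (auto simp: E_def sum.remove)
      then have "(\<rho> ^^ (ell ^ E)) \<in> Aut (F \<union> C0)"
        using Aut_funpow[OF \<rho>(2)] by (auto simp: Aut_def)
      then have "(\<rho> ^^ (ell ^ E)) \<in> Aut (conj_field a)" unfolding conj_field_def C0_def by (rule Aut_generate)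
      then have "restrict (\<rho> ^^ (ell ^ E)) M = restrict id M"
        using M(2) by (auto simp: restrict_def fun_eq_iff dest: AutD(3))
      then show "\<exists>e. g [^]\<^bsub>gal_group M\<^esub> (ell ^ e) = \<one>\<^bsub>gal_group M\<^esub>"
        unfolding \<rho>(1) gal_group_pow[OF \<rho>(3)] by (auto simp: gal_group_def)
    qed
    then show ?thesis by (simp add: gal_group_def)
  qed
  ultimately show ?thesis by (auto simp: pro_ell_ext_def)
qed

text \<open>The elements fixed by some \<open>ell\<close>-power of \<open>\<rho>\<close> form a
  field, since exponents can be added to treat two elements at once. It therefore suffices to look
  at one pro-\<open>ell\<close> extension \<open>L\<close>, where \<open>b\<close> lies in the
  finite Galois layer \<open>conj_field b\<close>, whose group has order
  \<open>ell ^ m\<close>.\<close>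

lemma max_pro_ell_pow_fixed:
  assumes "F = cyclotomic_ell k ell" and p: "Factorial_Ring.prime ell" and a: "a \<in> max_pro_ell k ell" and \<rho>: "\<rho> \<in> Aut F"
  shows "\<exists>e. (\<rho> ^^ (ell ^ e)) a = a"
proof -
  define T where "T = {a. \<exists>e. (\<rho> ^^ (ell ^ e)) a = a}"
  have two: "\<exists>e. (\<rho> ^^ (ell ^ e)) a = a \<and> (\<rho> ^^ (ell ^ e)) b = b" if "a \<in> T" "b \<in> T" for a b
  proof -
    from that obtain e e' where "(\<rho> ^^ (ell ^ e)) a = a" "(\<rho> ^^ (ell ^ e')) b = b" by (auto simp: T_def)
    then show ?thesis
      by (intro exI[of _ "e + e'"] conjI; elim funpow_dvd_fixed) (auto simp: power_add)
  qed
  have "is_subfield T"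
    unfolding is_subfield_def is_subring_def
  proof (intro conjI ballI)
    show "1 \<in> T" using AutD(4)[OF Aut_funpow[OF \<rho>]] by (auto simp: T_def)
    show "inverse a \<in> T" if "a \<in> T" for a using that AutD(11)[OF Aut_funpow[OF \<rho>]] by (auto simp: T_def)
    show "a - b \<in> T" "a * b \<in> T" if "a \<in> T" "b \<in> T" for a b
    proof -
      from that two obtain e where "(\<rho> ^^ (ell ^ e)) a = a" "(\<rho> ^^ (ell ^ e)) b = b" by blast
      then show "a - b \<in> T" "a * b \<in> T"
        using AutD(7,9)[OF Aut_funpow[OF \<rho>, of "ell ^ e"], of a b] by (auto simp: T_def intro!: exI[of _ e])
    qed
  qed
  moreover have "L \<subseteq> T" if L: "pro_ell_ext ell F L" for L
  proof
    fix b assume b: "b \<in> L"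
    have gL: "galois_ext F L" using L by (simp add: pro_ell_ext_def)
    then have L': "is_subfield L" "F \<subseteq> L" by (auto simp: galois_ext_def subfield_FR_iff)
    \<comment> \<open>\<open>galois_ext\<close> prescribes the fixed field, so normality has to be
      derived: the product of \<open>X - c\<close> over the \<open>gal L F\<close>-orbit of
      \<open>b\<close> has coefficients in the fixed field \<open>F\<close>, hence every conjugate
      of \<open>b\<close> is one of these \<open>c\<close> in \<open>L\<close>.\<close>
    have stL: "\<sigma> b \<in> L" if "\<sigma> \<in> Aut F" for \<sigma>
    proof -
      define C0 where "C0 = {\<tau> b | \<tau>. \<tau> \<in> gal L F}"
      have "C0 \<subseteq> (\<lambda>\<sigma>. \<sigma> b) ` Aut F" 
      proof
        fix c assume "c \<in> C0"
        then obtain \<tau> where \<tau>: "\<tau> \<in> gal L F" "c = \<tau> b" by (auto simp: C0_def)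
        then show "c \<in> (\<lambda>\<sigma>. \<sigma> b) ` Aut F" using gal_lift[OF L' \<tau>(1)] b by (auto simp: image_iff) metis
      qed
      then have fin: "finite C0" using finite_conjugates finite_subset by blast
      have gO: "\<tau> ` C0 = C0" if \<tau>g: "\<tau> \<in> gal L F" for \<tau>
      proof -
        obtain \<sigma>' where s: "\<tau> = restrict \<sigma>' L" "\<sigma>' \<in> Aut F" "\<sigma>' ` L = L" using \<tau>g gal_eq_restrict[OF L'] by auto
        have OL: "C0 \<subseteq> L" using b by (auto simp: C0_def gal_def field_auts_iff[OF L'(1)])
        have "\<tau> ` C0 \<subseteq> C0"
        proof safe
          fix c assume "c \<in> C0"
          then obtain \<tau>' where t: "\<tau>' \<in> gal L F" "c = \<tau>' b" by (auto simp: C0_def)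
          then have "restrict (\<tau> \<circ> \<tau>') L \<in> gal L F"
            using group.is_monoid[OF group_gal_group[OF L']] monoid.m_closed[of "gal_group L" \<tau> \<tau>'] that
            by (simp add: gal_group_def)
          then show "\<tau> c \<in> C0" unfolding C0_def using t(2) b by (auto intro!: exI[of _ "restrict (\<tau> \<circ> \<tau>') L"])
        qed
        moreover have "inj_on \<tau> C0" using OL s AutD(14)[OF s(2)] by (auto intro!: inj_onI split: if_splits)
        ultimately show ?thesis using fin by (metis endo_inj_surj)
      qed
      define P where "P = (\<Prod>c\<in>C0. [:- c, 1:])"
      have OL: "C0 \<subseteq> L" using b by (auto simp: C0_def gal_def field_auts_iff[OF L'(1)])
      have PL: "P \<in> polys L" unfolding P_def
        using OL is_subfield_closed[OF L'(1)] by (intro polys_prod polys_closed is_subfieldD(1)[OF L'(1)]) auto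
      have "coeff P j \<in> F" for j
      proof -
        have "\<tau> (coeff P j) = coeff P j" if t: "\<tau> \<in> gal L F" for \<tau>
        proof -
          obtain \<sigma>' where s: "\<tau> = restrict \<sigma>' L" "\<sigma>' \<in> Aut F" "\<sigma>' ` L = L" using t gal_eq_restrict[OF L'] by auto
          have mp: "map_poly \<sigma>' (\<Prod>c\<in>Z. [:- c, 1:]) = (\<Prod>c\<in>Z. [:- \<sigma>' c, 1:])" for Z
          proof (induction Z rule: infinite_finite_induct)
            case (insert c Z)
            note D = AutD[OF s(2)]
            have "map_poly \<sigma>' ([:- c, 1:] * q) = [:- \<sigma>' c, 1:] * map_poly \<sigma>' q" for q
              by (rule poly_eqI) (auto simp: coeff_map_poly D coeff_pCons split: nat.splits)
            then show ?case using insert by simp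
          qed (auto simp: AutD[OF s(2)])
          have inj: "inj_on \<sigma>' C0" using AutD(14)[OF s(2)] by (auto intro!: inj_onI)
          have "\<sigma>' ` C0 = C0" using gO[OF t] OL s(1) by (auto simp: image_def)
          then have "(\<Prod>c\<in>C0. [:- \<sigma>' c, 1:]) = P"
            unfolding P_def using prod.reindex[OF inj, of "\<lambda>c. [:- c, 1:]"] by simp
          then have "map_poly \<sigma>' P = P" unfolding P_def mp .
          then have "\<sigma>' (coeff P j) = coeff P j" by (metis coeff_map_poly AutD(5)[OF s(2)])
          then show ?thesis using polysD[OF PL] s(1) by simp
        qed
        then show ?thesis using gL polysD[OF PL] by (auto simp: galois_ext_def)
      qed
      then have "P \<in> polys F" by (simp add: polys_def)
      moreover have "b \<in> C0" unfolding C0_def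
        using group.is_monoid[OF group_gal_group[OF L']] monoid.one_closed[of "gal_group L"] b
        by (auto simp: gal_group_def intro!: exI[of _ "restrict id L"])
      then have "poly P b = 0" using fin by (auto simp: P_def poly_prod)
      ultimately have "poly P (\<sigma> b) = 0" using Aut_root that by blast
      then show ?thesis using fin OL by (auto simp: P_def poly_prod)
    qed
    define M where "M = conj_field b"
    note Ms = conj_field_subfield[of b, folded M_def]
    have stM: "\<sigma> ` M = M" if "\<sigma> \<in> Aut F" for \<sigma>
      unfolding M_def by (rule Aut_stable_image[OF that Aut_conj_field_subset])
    have "M \<subseteq> L" unfolding M_def conj_field_def using stL L' by (intro generate_field_FR(3)) auto
    moreover have "galois_ext F M" by (rule galois_ext_stable[OF Ms(1,2) stM])
    \<comment> \<open>An element of the group is determined by its values on the finitely many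
      conjugates of \<open>b\<close>, which generate \<open>M\<close> over \<open>F\<close>.\<close>
    moreover have fin: "finite (gal M F)"
    proof -
      define C0 where "C0 = (\<lambda>\<sigma>. \<sigma> b) ` Aut F"
      have "finite C0" unfolding C0_def by (rule finite_conjugates)
      have "inj_on (\<lambda>g. restrict g C0) (gal M F)"
      proof (rule inj_onI)
        fix g h assume gh: "g \<in> gal M F" "h \<in> gal M F" "restrict g C0 = restrict h C0"
        obtain \<sigma> \<sigma>' where s: "g = restrict \<sigma> M" "\<sigma> \<in> Aut F" "\<sigma> ` M = M"
          "h = restrict \<sigma>' M" "\<sigma>' \<in> Aut F" "\<sigma>' ` M = M" using gh gal_eq_restrict[OF Ms(1,2)] by auto
        note [simp] = AutD(4-14)[OF s(2)] AutD(4-14)[OF s(5)]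
        have OM: "C0 \<subseteq> M" using stM Ms(3) by (auto simp: C0_def)
        have "\<sigma> c = \<sigma>' c" if "c \<in> C0" for c
          using fun_cong[OF gh(3), of c] that OM s(1,4) by (auto simp: restrict_def)
        moreover have "is_subfield {c. \<sigma> c = \<sigma>' c}" by (auto simp: is_subfield_def is_subring_def)
        moreover have "\<sigma> c = \<sigma>' c" if "c \<in> F" for c using AutD(3)[OF s(2) that] AutD(3)[OF s(5) that] by simp
        ultimately have "M \<subseteq> {c. \<sigma> c = \<sigma>' c}"
          unfolding M_def conj_field_def C0_def[symmetric] by (intro generate_field_FR(3)) auto
        then show "g = h" unfolding s by (auto simp: restrict_def fun_eq_iff)
      qed
      moreover have "(\<lambda>g. restrict g C0) ` gal M F \<subseteq> C0 \<rightarrow>\<^sub>E C0"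
      proof safe
        fix g c assume g: "g \<in> gal M F" and c: "c \<in> C0"
        obtain \<sigma> where s: "g = restrict \<sigma> M" "\<sigma> \<in> Aut F" using g gal_eq_restrict[OF Ms(1,2)] by auto
        obtain \<rho> where r: "\<rho> \<in> Aut F" "c = \<rho> b" using c by (auto simp: C0_def)
        have "c \<in> M" using stM[OF r(1)] Ms(3) r(2) by auto
        then have "restrict g C0 c = (\<sigma> \<circ> \<rho>) b" using c s(1) r(2) by simp
        then show "restrict g C0 c \<in> C0" unfolding C0_def using Aut_comp[OF s(2) r(1)] by (rule image_eqI)
      qed auto
      ultimately show ?thesis using \<open>finite C0\<close> by (metis finite_PiE finite_imageD finite_subset)
    qed
    ultimately obtain m where m: "card (gal M F) = ell ^ m" using L by (auto simp: pro_ell_ext_def)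
    interpret G: group "gal_group M" by (rule group_gal_group[OF Ms(1,2)])
    have "restrict \<rho> M \<in> carrier (gal_group M)"
      using restrict_gal[OF \<rho> stM[OF \<rho>] Ms(1,2)] by (simp add: gal_group_def)
    from G.pow_order_eq_1[OF this] have "restrict (\<rho> ^^ (ell ^ m)) M = restrict id M"
      unfolding gal_group_pow[OF stM[OF \<rho>]] Coset.order_def by (simp add: gal_group_def m)
    then have "(\<rho> ^^ (ell ^ m)) b = b" using Ms(3) by (metis id_apply restrict_apply')
    then show "b \<in> T" by (auto simp: T_def)
  qed
  ultimately have "max_pro_ell k ell \<subseteq> T"
    unfolding max_pro_ell_def assms(1)[symmetric] by (intro generate_field_FR(3)) auto
  then show ?thesis using a by (auto simp: T_def)
qed

end

subsection \<open>Ideals and valuation rings\<close>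

text \<open>Ring and ideal are subsets of one type, so that the same facts serve \<open>W\<close>,
  iterated polynomials over \<open>W\<close> and power series over \<open>W\<close>, and no quotient
  has to be formed.\<close>

definition prime_ideal :: "'a :: comm_ring_1 set \<Rightarrow> 'a set \<Rightarrow> bool"
  where "prime_ideal A I \<longleftrightarrow> is_subring A \<and> I \<subseteq> A \<and> 0 \<in> I \<and> 1 \<notin> I \<and> (\<forall>a\<in>I. \<forall>b\<in>I. a + b \<in> I) \<and>
    (\<forall>a\<in>A. \<forall>b\<in>I. a * b \<in> I) \<and> (\<forall>a\<in>A. \<forall>b\<in>A. a * b \<in> I \<longrightarrow> a \<in> I \<or> b \<in> I)"

lemma prime_idealD:
  assumes "prime_ideal A I"
  shows "is_subring A" "a \<in> I \<Longrightarrow> a \<in> A" "0 \<in> I" "1 \<notin> I" "a \<in> I \<Longrightarrow> b \<in> I \<Longrightarrow> a + b \<in> I"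
    "a \<in> A \<Longrightarrow> b \<in> I \<Longrightarrow> a * b \<in> I" "b \<in> A \<Longrightarrow> a \<in> I \<Longrightarrow> a * b \<in> I"
    "a * b \<in> I \<Longrightarrow> a \<in> A \<Longrightarrow> b \<in> A \<Longrightarrow> a \<in> I \<or> b \<in> I" "a \<in> I \<Longrightarrow> - a \<in> I"
    "a \<in> I \<Longrightarrow> b \<in> I \<Longrightarrow> a - b \<in> I" "a - b \<in> I \<Longrightarrow> b - a \<in> I"
    "a - b \<in> I \<Longrightarrow> b - c \<in> I \<Longrightarrow> a - c \<in> I"
proof -
  show s: "is_subring A" and "a \<in> I \<Longrightarrow> a \<in> A" "0 \<in> I" "1 \<notin> I"
    "a * b \<in> I \<Longrightarrow> a \<in> A \<Longrightarrow> b \<in> A \<Longrightarrow> a \<in> I \<or> b \<in> I" for a b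
    using assms by (auto simp: prime_ideal_def)
  show p: "a \<in> I \<Longrightarrow> b \<in> I \<Longrightarrow> a + b \<in> I" for a b using assms by (auto simp: prime_ideal_def)
  show m: "a \<in> A \<Longrightarrow> b \<in> I \<Longrightarrow> a * b \<in> I" for a b using assms by (auto simp: prime_ideal_def)
  show "b \<in> A \<Longrightarrow> a \<in> I \<Longrightarrow> a * b \<in> I" for a b using m[of b a] by (simp add: mult.commute)
  show u: "a \<in> I \<Longrightarrow> - a \<in> I" for a using m[of "- 1" a] is_subring_closed[OF s] by auto
  show d: "a \<in> I \<Longrightarrow> b \<in> I \<Longrightarrow> a - b \<in> I" for a b using p[of a "- b"] u[of b] by simp
  show "a - b \<in> I \<Longrightarrow> b - a \<in> I" for a b using u[of "a - b"] by simp
  show "a - b \<in> I \<Longrightarrow> b - c \<in> I \<Longrightarrow> a - c \<in> I" for a b c using p[of "a - b" "b - c"] by simp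
qed

lemma prime_ideal_sum: "prime_ideal A I \<Longrightarrow> (\<And>j. j \<in> J \<Longrightarrow> f j \<in> I) \<Longrightarrow> sum f J \<in> I"
  by (induction J rule: infinite_finite_induct) (auto simp: prime_idealD)

lemma prime_ideal_prod:
  "prime_ideal A I \<Longrightarrow> prod f J \<in> I \<Longrightarrow> (\<And>j. j \<in> J \<Longrightarrow> f j \<in> A) \<Longrightarrow> \<exists>j\<in>J. f j \<in> I"
proof (induction J rule: infinite_finite_induct)
  case (insert j J)
  then show ?case
    using prime_idealD(8)[OF insert.prems(1), of "f j" "prod f J"] is_subring_prod[OF prime_idealD(1)[OF insert.prems(1)], of J f]
    by auto
qed (auto simp: prime_idealD)

lemma prime_ideal_power: "prime_ideal A I \<Longrightarrow> a ^ n \<in> I \<Longrightarrow> a \<in> A \<Longrightarrow> a \<in> I"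
  using prime_ideal_prod[of A I "\<lambda>_. a" "{..<n}"] by auto

text \<open>Gauss's lemma with bookkeeping: in the sum at \<open>k + l\<close> every product except
  \<open>f k * g l\<close> has a factor of index below \<open>k\<close> or below \<open>l\<close>.
  Sequences are used so that polynomials and power series are covered at once.\<close>

lemma least_coeff_mult:
  fixes f g :: "nat \<Rightarrow> 'a :: comm_ring_1"
  assumes P: "prime_ideal A I" and A: "\<And>j. f j \<in> A" "\<And>j. g j \<in> A"
    and k: "f k \<notin> I" "\<And>j. j < k \<Longrightarrow> f j \<in> I" and l: "g l \<notin> I" "\<And>j. j < l \<Longrightarrow> g j \<in> I"
  shows "(\<Sum>i\<le>k + l. f i * g (k + l - i)) \<notin> I" "n < k + l \<Longrightarrow> (\<Sum>i\<le>n. f i * g (n - i)) \<in> I"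
proof -
  note D = prime_idealD[OF P]
  have "(\<Sum>i\<le>k + l. f i * g (k + l - i)) = f k * g l + (\<Sum>i\<in>{..k + l} - {k}. f i * g (k + l - i))"
    by (subst sum.remove[of _ k]) auto
  moreover have "(\<Sum>i\<in>{..k + l} - {k}. f i * g (k + l - i)) \<in> I"
  proof (rule prime_ideal_sum[OF P])
    fix i assume "i \<in> {..k + l} - {k}"
    then have "i < k \<or> k + l - i < l" by auto
    then show "f i * g (k + l - i) \<in> I" by (auto intro: D(6,7) k(2) l(2) A)
  qed
  ultimately show "(\<Sum>i\<le>k + l. f i * g (k + l - i)) \<notin> I"
    using D(8)[of "f k" "g l"] A k(1) l(1) D(10)[of "f k * g l + (\<Sum>i\<in>{..k + l} - {k}. f i * g (k + l - i))"
        "\<Sum>i\<in>{..k + l} - {k}. f i * g (k + l - i)"] by auto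
  show "(\<Sum>i\<le>n. f i * g (n - i)) \<in> I" if n: "n < k + l"
  proof (rule prime_ideal_sum[OF P])
    fix i assume "i \<in> {..n}"
    then have "i < k \<or> n - i < l" using n by auto
    then show "f i * g (n - i) \<in> I" by (auto intro: D(6,7) k(2) l(2) A)
  qed
qed

lemma least_not_in: "f (j :: nat) \<notin> I \<Longrightarrow> \<exists>k. f k \<notin> I \<and> (\<forall>j<k. f j \<in> I)"
  by (rule exI[of _ "LEAST k. f k \<notin> I"]) (metis (mono_tags, lifting) LeastI not_less_Least)

lemma is_subring_polys: "is_subring A \<Longrightarrow> is_subring (polys A)"
  by (simp add: is_subring_def[of "polys A"] polys_closed)

lemma prime_ideal_polys:
  assumes P: "prime_ideal A I"
  shows "prime_ideal (polys A) (polys I)"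
proof -
  note D = prime_idealD[OF P]
  have "p \<in> polys I \<or> q \<in> polys I" if pq: "p \<in> polys A" "q \<in> polys A" "p * q \<in> polys I" for p q
  proof (rule ccontr)
    assume "\<not> ?thesis"
    then obtain i j where "coeff p i \<notin> I" "coeff q j \<notin> I" by (auto simp: polys_def)
    then obtain k l where "coeff p k \<notin> I \<and> (\<forall>j<k. coeff p j \<in> I)" "coeff q l \<notin> I \<and> (\<forall>j<l. coeff q j \<in> I)"
      using least_not_in[of "coeff p"] least_not_in[of "coeff q"] by metis
    then have "coeff (p * q) (k + l) \<notin> I" unfolding coeff_mult
      using pq by (intro least_coeff_mult[OF P]) (auto simp: polys_def)
    then show False using pq by (auto simp: polys_def)
  qed
  moreover have "p * q \<in> polys I" if "p \<in> polys A" "q \<in> polys I" for p q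
    using that by (auto simp: polys_def coeff_mult intro!: prime_ideal_sum[OF P] D(6))
  moreover have "1 \<notin> polys I" using D(4) by (auto simp: polys_def dest!: spec[of _ 0])
  moreover have "polys I \<subseteq> polys A" "0 \<in> polys I" using D(2,3) by (auto simp: polys_def)
  moreover have "p + q \<in> polys I" if "p \<in> polys I" "q \<in> polys I" for p q
    using that D(5) by (auto simp: polys_def)
  ultimately show ?thesis using is_subring_polys[OF D(1)] by (auto simp: prime_ideal_def)
qed

lemma poly_in_ideal: "prime_ideal A I \<Longrightarrow> p \<in> polys I \<Longrightarrow> a \<in> A \<Longrightarrow> poly p a \<in> I"
  unfolding poly_altdef
  by (auto intro!: prime_ideal_sum prime_idealD(7) simp: polysD is_subring_closed[OF prime_idealD(1)])

section \<open>Valuation rings and their extension to a larger field\<close>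

lemma valuation_ringD:
  assumes "valuation_ring L V"
  shows "is_subring V" "V \<subseteq> L" "V \<noteq> L" "z \<in> L \<Longrightarrow> z \<in> V \<or> inverse z \<in> V"
  using assms by (auto simp: valuation_ring_def subring_FR_iff)

lemma max_idealD: "a \<in> max_ideal V \<Longrightarrow> a \<in> V"
  by (auto simp: max_ideal_def)

lemma not_max_ideal: "a \<in> V \<Longrightarrow> a \<notin> max_ideal V \<longleftrightarrow> a \<noteq> 0 \<and> inverse a \<in> V"
  by (auto simp: max_ideal_def)

lemma inverse_max_ideal:
  assumes "valuation_ring L V" "a \<in> L" "a \<notin> V"
  shows "inverse a \<in> max_ideal V"
  using assms valuation_ringD(4)[OF assms(1), of a] by (auto simp: max_ideal_def)

lemma prime_max_ideal:
  assumes L: "is_subfield L" and V: "valuation_ring L V"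
  shows "prime_ideal V (max_ideal V)"
proof -
  note D = valuation_ringD[OF V] and s = is_subring_closed[OF valuation_ringD(1)[OF V]]
  have m: "a * b \<in> max_ideal V" if "a \<in> V" "b \<in> max_ideal V" for a b
  proof -
    have "b \<in> V" using that by (auto dest: max_idealD)
    then have "a * b \<in> V" using that s by auto
    moreover have "inverse b \<in> V" if "a * b \<noteq> 0" "inverse (a * b) \<in> V"
      using s(4)[OF \<open>a \<in> V\<close> that(2)] that(1) by (simp add: field_simps)
    ultimately show ?thesis using that by (auto simp: max_ideal_def)
  qed
  have "a + b \<in> max_ideal V" if ab: "a \<in> max_ideal V" "b \<in> max_ideal V" for a b
  proof (cases "a = 0 \<or> b = 0")
    case False
    have "a \<in> V" "b \<in> V" using ab by (auto dest: max_idealD)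
    then have "a / b \<in> L" using D(2) by (intro is_subfieldD(3)[OF L]) auto
    then consider "a / b \<in> V" | "b / a \<in> V" using D(4)[of "a / b"] by auto
    then show ?thesis
    proof cases
      case 1
      then have "(a / b + 1) * b \<in> max_ideal V" using ab s by (intro m) auto
      then show ?thesis using False by (simp add: field_simps)
    next
      case 2
      then have "(1 + b / a) * a \<in> max_ideal V" using ab s by (intro m) auto
      then show ?thesis using False by (simp add: field_simps)
    qed
  qed (use ab in auto)
  moreover have "a \<in> max_ideal V \<or> b \<in> max_ideal V" if "a \<in> V" "b \<in> V" "a * b \<in> max_ideal V" for a b
    using that s(4)[of "inverse a" "inverse b"] by (auto simp: max_ideal_def)
  moreover have "1 \<notin> max_ideal V" "0 \<in> max_ideal V" using s by (auto simp: max_ideal_def)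
  ultimately show ?thesis using D(1) m by (auto simp: prime_ideal_def dest: max_idealD)
qed

lemma max_ideal_Int:
  assumes W: "valuation_ring UNIV W" "W \<inter> L = V" and L: "is_subfield L"
  shows "max_ideal V = max_ideal W \<inter> L"
  using W(2) is_subfieldD(2)[OF L] by (auto simp: max_ideal_def)

text \<open>The subring is chosen maximal among those containing \<open>V\<close> but the inverse of no non-unit of \<open>V\<close>.\<close>

theorem valuation_ring_extend:
  fixes V :: "'a :: field set"
  assumes L: "is_subfield L" and V: "valuation_ring L V"
  shows "\<exists>W. valuation_ring UNIV W \<and> W \<inter> L = V"
proof -
  note VD = valuation_ringD[OF V] and MV = prime_idealD[OF prime_max_ideal[OF L V]]
  define N where "N = max_ideal V - {0}"
  have N: "\<pi> \<in> V" "\<pi> \<noteq> 0" "\<pi> \<in> max_ideal V" if "\<pi> \<in> N" for \<pi> using that MV(2) by (auto simp: N_def)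
  define Bs where "Bs = {B. is_subring B \<and> V \<subseteq> B \<and> (\<forall>\<pi>\<in>N. inverse \<pi> \<notin> B)}"
  have "\<exists>M\<in>Bs. \<forall>Z\<in>Bs. M \<subseteq> Z \<longrightarrow> Z = M"
  proof (rule subset_Zorn_nonempty)
    have "V \<in> Bs" using VD(1) by (auto simp: Bs_def N_def max_ideal_def)
    then show "Bs \<noteq> {}" by blast
    fix C assume C: "C \<noteq> {}" "subset.chain Bs C"
    then have CB: "is_subring Z" "V \<subseteq> Z" "\<forall>\<pi>\<in>N. inverse \<pi> \<notin> Z" if "Z \<in> C" for Z
      using that by (auto simp: Bs_def subset.chain_def)
    have two: "\<exists>Z\<in>C. u \<in> Z \<and> v \<in> Z" if "u \<in> \<Union>C" "v \<in> \<Union>C" for u v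
      using that C(2) unfolding subset.chain_def by blast
    have "is_subring (\<Union>C)" unfolding is_subring_def
    proof (intro conjI ballI)
      show "1 \<in> \<Union>C" using C(1) CB is_subring_closed(1) by blast
      fix a b assume "a \<in> \<Union>C" "b \<in> \<Union>C"
      with two obtain Z where "Z \<in> C" "a \<in> Z" "b \<in> Z" by blast
      then show "a - b \<in> \<Union>C" "a * b \<in> \<Union>C"
        using is_subring_closed(3,4)[OF CB(1)[of Z]] by blast+
    qed
    moreover have "V \<subseteq> \<Union>C" using C(1) CB(2) by blast
    ultimately show "\<Union>C \<in> Bs" using CB(3) by (auto simp: Bs_def)
  qed
  then obtain W where "W \<in> Bs" and max: "\<And>Z. Z \<in> Bs \<Longrightarrow> W \<subseteq> Z \<Longrightarrow> Z = W" by metis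
  then have W: "is_subring W" "V \<subseteq> W" "\<And>\<pi>. \<pi> \<in> N \<Longrightarrow> inverse \<pi> \<notin> W" by (auto simp: Bs_def)
  note s = is_subring_closed[OF W(1)]
  define adj where "adj = (\<lambda>z. {poly p z | p. p \<in> polys W})"
  have adj: "\<exists>\<pi>\<in>N. \<exists>p\<in>polys W. inverse \<pi> = poly p z" if "z \<notin> W" for z
  proof (rule ccontr)
    assume neg: "\<not> ?thesis"
    have "is_subring (adj z)" unfolding is_subring_def
    proof (intro conjI ballI)
      show "1 \<in> adj z" using polys_closed(2)[OF W(1)] by (auto simp: adj_def intro!: exI[of _ 1])
      fix a b assume "a \<in> adj z" "b \<in> adj z"
      then obtain p q where "a = poly p z" "b = poly q z" "p \<in> polys W" "q \<in> polys W" by (auto simp: adj_def)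
      then show "a - b \<in> adj z" "a * b \<in> adj z"
        using polys_closed(4,6)[OF W(1), of p q] by (auto simp: adj_def intro: exI[of _ "p - q"] exI[of _ "p * q"])
    qed
    moreover have W': "W \<subseteq> adj z" using polys_closed(8)[OF W(1)] by (force simp: adj_def intro!: exI[of _ "[:_:]"])
    ultimately have "adj z \<in> Bs" using neg W(2) by (auto simp: Bs_def adj_def)
    then have "adj z = W" using max W' by blast
    moreover have "z \<in> adj z" using polys_closed(11)[OF W(1) s(1), of 1]
      by (auto simp: adj_def poly_monom intro!: exI[of _ "monom 1 1"])
    ultimately show False using that by simp
  qed
  \<comment> \<open>Of two non-units of a valuation ring one divides the other; the divisor is taken
    for \<open>\<pi>\<close>.\<close>
  have common: "\<exists>\<pi>\<in>N. \<pi>1 / \<pi> \<in> V \<and> \<pi>2 / \<pi> \<in> V" if "\<pi>1 \<in> N" "\<pi>2 \<in> N" for \<pi>1 \<pi>2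
  proof -
    have "\<pi>1 / \<pi>2 \<in> L" using N[OF that(1)] N[OF that(2)] VD(2) is_subfieldD(3)[OF L] by blast
    then have "\<pi>1 / \<pi>2 \<in> V \<or> \<pi>2 / \<pi>1 \<in> V" using VD(4)[of "\<pi>1 / \<pi>2"] by auto
    then show ?thesis using that N[OF that(1)] N[OF that(2)] is_subring_closed(1)[OF VD(1)] by force
  qed
  \<comment> \<open>If \<open>u = 1 - \<pi> * b\<close> were not invertible, maximality would give
    \<open>inverse \<pi>' = poly p (inverse u)\<close>, and clearing denominators would put
    \<open>u ^ d / \<pi>'\<close> into \<open>W\<close>. As \<open>u ^ d - 1\<close> is divisible by
    a common divisor \<open>\<pi>0\<close> of \<open>\<pi>\<close> and \<open>\<pi>'\<close>, also
    \<open>inverse \<pi>0\<close> would lie in \<open>W\<close>.\<close>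
  have unit: "inverse (1 - \<pi> * b) \<in> W" if \<pi>: "\<pi> \<in> N" and b: "b \<in> W" for \<pi> b
  proof (rule ccontr)
    define u where "u = 1 - \<pi> * b"
    assume "inverse (1 - \<pi> * b) \<notin> W"
    then have uW: "inverse u \<notin> W" and u0: "u \<noteq> 0" using s by (auto simp: u_def)
    from adj[OF uW] obtain \<pi>' p where p: "\<pi>' \<in> N" "p \<in> polys W" "inverse \<pi>' = poly p (inverse u)" by blast
    define d where "d = degree p"
    have "u ^ d * poly p (inverse u) \<in> W"
      unfolding poly_altdef sum_distrib_left
    proof (rule is_subring_sum[OF W(1)])
      fix j assume "j \<in> {..degree p}"
      then have eq: "u ^ d * (coeff p j * inverse u ^ j) = coeff p j * u ^ (d - j)"
        using u0 by (simp add: d_def power_inverse field_simps flip: power_add)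
      have "u \<in> W" using b N(1)[OF \<pi>] W(2) s by (auto simp: u_def)
      then show "u ^ d * (coeff p j * inverse u ^ j) \<in> W" unfolding eq by (intro s(4,7) polysD[OF p(2)])
    qed
    then have c: "u ^ d / \<pi>' \<in> W" using p(3) by (simp add: divide_inverse)
    obtain \<pi>0 where \<pi>0: "\<pi>0 \<in> N" "\<pi> / \<pi>0 \<in> V" "\<pi>' / \<pi>0 \<in> V" using common[OF \<pi> p(1)] by blast
    have "(u ^ m - 1) / \<pi>0 \<in> W" for m
    proof (induction m)
      case (Suc m)
      have eq: "u ^ Suc m - 1 = u * (u ^ m - 1) - \<pi> * b" by (simp add: u_def algebra_simps)
      have eq': "(u ^ Suc m - 1) / \<pi>0 = u * ((u ^ m - 1) / \<pi>0) - \<pi> / \<pi>0 * b"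
        unfolding eq diff_divide_distrib[of "u * (u ^ m - 1)"] by simp
      have "u \<in> W" using b N(1)[OF \<pi>] W(2) s by (auto simp: u_def)
      moreover have "\<pi> / \<pi>0 \<in> W" using \<pi>0 W(2) by auto
      ultimately show ?case unfolding eq' using Suc b by (intro s(3,4)) auto
    qed (use s in auto)
    moreover have "u ^ d / \<pi>0 \<in> W" using s(4)[OF c, of "\<pi>' / \<pi>0"] \<pi>0 W(2) N(2)[OF p(1)] by auto
    ultimately have "u ^ d / \<pi>0 - (u ^ d - 1) / \<pi>0 \<in> W" using s by blast
    then have "inverse \<pi>0 \<in> W" by (simp add: divide_inverse left_diff_distrib)
    then show False using W(3) \<pi>0 by blast
  qed
  text \<open>Of two relations of minimal degree expressing \<open>1\<close> through powers of \<open>z\<close> and of \<open>1 / z\<close>, the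
    shorter one lowers the degree of the longer one.\<close>
  have step: False
    if \<pi>: "\<pi> \<in> N" and z: "z \<noteq> 0" and p: "p \<in> polys W" "\<pi> * poly p z = 1"
      and q: "q \<in> polys W" "\<pi> * poly q (inverse z) = 1"
      and le: "degree q \<le> degree p"
      and min: "\<And>r. r \<in> polys W \<Longrightarrow> \<pi> * poly r z = 1 \<Longrightarrow> degree p \<le> degree r" for \<pi> z p q
  proof -
    define n where "n = degree p"
    obtain q0 q1 where q01: "q = pCons q0 q1" by (cases q)
    have q01W: "q0 \<in> W" "q1 \<in> polys W" using q(1) by (auto simp: q01 polys_pCons_iff)
    have \<pi>W: "\<pi> \<in> W" using N(1)[OF \<pi>] W(2) by auto
    have n0: "n > 0"
    proof (rule ccontr)
      assume "\<not> n > 0"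
      then obtain c where "p = [:c:]" by (metis degree_eq_zeroE gr0I n_def)
      then have "\<pi> * c = 1" "c \<in> W" using p polysD[OF p(1), of 0] by auto
      then show False using W(3)[OF \<pi>] N(2)[OF \<pi>] by (metis inverse_unique)
    qed
    define e where "e = inverse (1 - \<pi> * q0)"
    have eW: "e \<in> W" unfolding e_def by (rule unit[OF \<pi> q01W(1)])
    have ne: "1 - \<pi> * q0 \<noteq> 0"
      using W(3)[OF \<pi>] q01W(1) by (metis eq_iff_diff_eq_0 inverse_unique)
    have "1 - \<pi> * q0 = \<pi> * inverse z * poly q1 (inverse z)" using q(2) by (simp add: q01 algebra_simps)
    then have 1: "1 = e * \<pi> * inverse z * poly q1 (inverse z)"
      using ne by (metis e_def left_inverse mult.assoc)
    have dq1: "degree q1 < n" using le n0 by (auto simp: q01 n_def split: if_splits)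
    \<comment> \<open>Built so that \<open>poly h z = z ^ (n - 1) * poly q1 (inverse z)\<close> has
      degree at most \<open>n - 1\<close>. The relation for \<open>inverse z\<close> then reads
      \<open>z ^ n = e * \<pi> * poly h z\<close> and replaces the top term of \<open>p\<close> by
      lower ones.\<close>
    define h where "h = reflect_poly q1 * monom 1 (n - 1 - degree q1)"
    have hW: "h \<in> polys W"
      unfolding h_def by (intro polys_closed(6,11)[OF W(1)] s(1))
        (use q01W(2) s(2) in \<open>auto simp: polys_def coeff_reflect_poly\<close>)
    have hz: "poly h z = z ^ (n - 1) * poly q1 (inverse z)"
      using z dq1 by (simp add: h_def poly_reflect_poly_nz poly_monom flip: power_add)
    have zn: "z ^ n = e * \<pi> * poly h z"
    proof -
      have "z ^ n = z ^ n * (e * \<pi> * inverse z * poly q1 (inverse z))" using 1 by simp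
      also have "\<dots> = e * \<pi> * (z ^ (n - 1) * poly q1 (inverse z))"
        using n0 z by (cases n) (auto simp: field_simps)
      finally show ?thesis using hz by simp
    qed
    define r where "r = p - monom (coeff p n) n + [:coeff p n * e * \<pi>:] * h"
    have "r \<in> polys W" unfolding r_def using p(1) hW eW \<pi>W s polysD[OF p(1)]
      by (intro polys_closed W(1)) auto
    moreover have "poly r z = poly p z" using zn by (simp add: r_def poly_monom)
    then have "\<pi> * poly r z = 1" using p(2) by simp
    ultimately have "n \<le> degree r" using min by (simp add: n_def)
    moreover have "degree r \<le> n - 1"
    proof (rule degree_le, safe)
      fix j assume j: "n - 1 < j"
      have "degree h \<le> n - 1"
        using degree_mult_le[of "reflect_poly q1" "monom 1 (n - 1 - degree q1)"] degree_reflect_poly_le[of q1]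
          degree_monom_le[of "1 :: 'a" "n - 1 - degree q1"] dq1 unfolding h_def by linarith
      then have "coeff h j = 0" using j by (intro coeff_eq_0) auto
      moreover have "coeff (p - monom (coeff p n) n) j = 0"
        using j by (cases "j = n") (auto simp: n_def intro: coeff_eq_0)
      ultimately show "coeff r j = 0" by (simp add: r_def)
    qed
    ultimately show False using n0 by linarith
  qed
  have "z \<in> W \<or> inverse z \<in> W" for z
  proof (rule ccontr)
    assume "\<not> ?thesis"
    then have zW: "z \<notin> W" "inverse z \<notin> W" and z0: "z \<noteq> 0" using s(2) by auto
    obtain \<pi>1 p1 where 1: "\<pi>1 \<in> N" "p1 \<in> polys W" "inverse \<pi>1 = poly p1 z" using adj[OF zW(1)] by blast
    obtain \<pi>2 p2 where 2: "\<pi>2 \<in> N" "p2 \<in> polys W" "inverse \<pi>2 = poly p2 (inverse z)" using adj[OF zW(2)] by blast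
    obtain \<pi> where \<pi>: "\<pi> \<in> N" "\<pi>1 / \<pi> \<in> V" "\<pi>2 / \<pi> \<in> V" using common[OF 1(1) 2(1)] by blast
    define P where "P = (\<lambda>w r. r \<in> polys W \<and> \<pi> * poly r w = 1)"
    have "P z (Polynomial.smult (\<pi>1 / \<pi>) p1)" "P (inverse z) (Polynomial.smult (\<pi>2 / \<pi>) p2)"
      using 1 2 \<pi> N(2)[OF 1(1)] N(2)[OF 2(1)] N(2)[OF \<pi>(1)] W(2)
      by (auto simp: P_def polys_closed[OF W(1)] simp flip: 1(3) 2(3))
    then obtain p q where p: "P z p" "\<And>r. P z r \<Longrightarrow> degree p \<le> degree r"
      and q: "P (inverse z) q" "\<And>r. P (inverse z) r \<Longrightarrow> degree q \<le> degree r"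
      using ex_has_least_nat[of "P z" _ degree] ex_has_least_nat[of "P (inverse z)" _ degree] by metis
    show False
    proof (cases "degree q \<le> degree p")
      case True
      then show ?thesis using step[OF \<pi>(1) z0, of p q] p q by (auto simp: P_def)
    next
      case False
      then show ?thesis using step[OF \<pi>(1), of "inverse z" q p] p q z0 by (auto simp: P_def)
    qed
  qed
  moreover have WL: "W \<inter> L = V"
  proof
    show "W \<inter> L \<subseteq> V"
    proof
      fix w assume w: "w \<in> W \<inter> L"
      show "w \<in> V"
      proof (rule ccontr)
        assume "w \<notin> V"
        then have "inverse w \<in> N" using inverse_max_ideal[OF V, of w] w is_subring_closed(2)[OF VD(1)]
          by (auto simp: N_def)
        then show False using W(3)[of "inverse w"] w by auto
      qed
    qed
  qed (use W(2) VD(2) in auto)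
  moreover have "W \<noteq> UNIV" using WL VD(3) by auto
  ultimately show ?thesis using W(1)
    by (intro exI[of _ W]) (auto simp: valuation_ring_def subring_FR_iff)
qed


subsection \<open>Lifting inertia\<close>

lemma valuation_ring_image:
  assumes "\<sigma> \<in> Aut F" "valuation_ring UNIV W"
  shows "valuation_ring UNIV (\<sigma> ` W)"
proof -
  note [simp] = AutD[OF assms(1)]
  note W = valuation_ringD[OF assms(2)] and s = is_subring_closed[OF valuation_ringD(1)[OF assms(2)]]
  have "is_subring (\<sigma> ` W)" unfolding is_subring_def
  proof (intro conjI ballI)
    show "1 \<in> \<sigma> ` W" using s(1) by (rule rev_image_eqI) simp
    fix a b assume "a \<in> \<sigma> ` W" "b \<in> \<sigma> ` W"
    then obtain a' b' where "a = \<sigma> a'" "b = \<sigma> b'" "a' \<in> W" "b' \<in> W" by blast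
    then show "a - b \<in> \<sigma> ` W" "a * b \<in> \<sigma> ` W"
      using s(3,4)[of a' b'] by (auto intro: rev_image_eqI)
  qed
  moreover have "z \<in> \<sigma> ` W \<or> inverse z \<in> \<sigma> ` W" for z
  proof -
    obtain a where "z = \<sigma> a" using AutD(2)[OF assms(1)] by (metis bij_pointE)
    then show ?thesis using W(4)[of a] by (auto simp flip: AutD(11)[OF assms(1)])
  qed
  moreover have "\<sigma> ` W \<noteq> UNIV"
    using W(3) AutD(2)[OF assms(1)] by (metis bij_def inj_image_eq_iff)
  ultimately show ?thesis by (auto simp: valuation_ring_def subring_FR_iff)
qed

text \<open>Divisibility in \<open>V\<close> is a total preorder on the coefficients. Division by
  one of least value moves all of them into \<open>V\<close> and makes that one equal to
  \<open>1\<close>.\<close>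

lemma polys_scale:
  assumes L: "is_subfield L" and V: "valuation_ring L V" and p: "p \<in> polys L" "p \<noteq> 0"
  shows "\<exists>c\<in>L. c \<noteq> 0 \<and> smult c p \<in> polys V \<and> (\<exists>j. coeff (smult c p) j = 1)"
proof -
  note LD = is_subfieldD[OF L] and VD = valuation_ringD[OF V]
  have "\<exists>j\<in>J. coeff p j \<noteq> 0 \<and> (\<forall>i\<in>J. coeff p i / coeff p j \<in> V)"
    if "finite J" "\<exists>j\<in>J. coeff p j \<noteq> 0" for J
    using that
  proof (induction J rule: finite_induct)
    case (insert j J)
    show ?case
    proof (cases "\<exists>j\<in>J. coeff p j \<noteq> 0")
      case True
      then obtain k where k: "k \<in> J" "coeff p k \<noteq> 0" "\<forall>i\<in>J. coeff p i / coeff p k \<in> V" using insert.IH by blast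
      have "coeff p j / coeff p k \<in> L" using polysD[OF p(1)] by (intro LD(3))
      then consider "coeff p j / coeff p k \<in> V" | "coeff p j / coeff p k \<notin> V" "coeff p k / coeff p j \<in> V"
        using VD(4)[of "coeff p j / coeff p k"] by auto
      then show ?thesis
      proof cases
        case 1
        then show ?thesis using k by auto
      next
        case 2
        then have j: "coeff p j \<noteq> 0" using is_subring_closed(2)[OF VD(1)] by auto
        have "coeff p i / coeff p j \<in> V" if "i \<in> J" for i
          using is_subring_closed(4)[OF VD(1) _ 2(2), of "coeff p i / coeff p k"] k that by auto
        then show ?thesis using j is_subring_closed(1)[OF VD(1)] by auto
      qed
    next
      case False
      then show ?thesis using insert.prems is_subring_closed(1,2)[OF VD(1)] by force
    qed
  qed simp
  moreover have "\<exists>j\<in>{..degree p}. coeff p j \<noteq> 0" using p(2) by (intro bexI[of _ "degree p"]) auto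
  ultimately obtain k where k: "coeff p k \<noteq> 0" "\<forall>i\<le>degree p. coeff p i / coeff p k \<in> V"
    by (metis atMost_iff finite_atMost)
  have "coeff p i / coeff p k \<in> V" for i
    using k(2) is_subring_closed(2)[OF VD(1)] by (cases "i \<le> degree p") (auto simp: coeff_eq_0)
  then show ?thesis using k(1) LD(2)[OF polysD[OF p(1), of k]]
    by (intro bexI[of _ "inverse (coeff p k)"]) (auto simp: polys_def field_simps intro!: exI[of _ k])
qed

section \<open>Inertia in a Galois layer and in the algebraic closure\<close>

locale decomposition = alg_base F for F :: "'a :: {alg_closed_field, field_char_0} set" +
  fixes L V W :: "'a set"
  assumes L: "is_subfield L" "F \<subseteq> L" and stable: "\<And>\<rho>. \<rho> \<in> Aut F \<Longrightarrow> \<rho> ` L = L"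
    and V: "valuation_ring L V" and W: "valuation_ring UNIV W" and WL: "W \<inter> L = V"
begin

text \<open>The integral closure of \<open>V\<close> in the algebraically closed field, written as
  the intersection of the valuation rings above \<open>V\<close>. In this form its stability under
  automorphisms preserving \<open>V\<close> is visible.\<close>

definition int_closure :: "'a set"
  where "int_closure = \<Inter>{W'. valuation_ring UNIV W' \<and> W' \<inter> L = V}"

lemma int_closure_W: "a \<in> int_closure \<Longrightarrow> a \<in> W"
  using W WL by (auto simp: int_closure_def)

lemma is_subring_int_closure: "is_subring int_closure"
  unfolding is_subring_def int_closure_def
proof (intro conjI ballI InterI)
  fix W' assume "W' \<in> {W'. valuation_ring UNIV W' \<and> W' \<inter> L = V}"
  then show "1 \<in> W'" using is_subring_closed(1)[OF valuation_ringD(1)] by blast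
next
  fix a b W' assume "a \<in> \<Inter>{W'. valuation_ring UNIV W' \<and> W' \<inter> L = V}" "b \<in> \<Inter>{W'. valuation_ring UNIV W' \<and> W' \<inter> L = V}"
    and W': "W' \<in> {W'. valuation_ring UNIV W' \<and> W' \<inter> L = V}"
  then have "a \<in> W'" "b \<in> W'" by blast+
  then show "a - b \<in> W'" "a * b \<in> W'"
    using W' is_subring_closed(3,4)[OF valuation_ringD(1)[of UNIV W'], of a b] by auto
qed

lemma int_closure_stable:
  assumes \<sigma>: "\<sigma> \<in> Aut F" "\<sigma> ` V = V" and a: "a \<in> int_closure"
  shows "\<sigma> a \<in> int_closure"
  unfolding int_closure_def
proof safe
  fix W' assume W': "valuation_ring UNIV W'" "V = W' \<inter> L"
  have b: "bij \<sigma>" using AutD(2)[OF \<sigma>(1)] .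
  have inv: "Hilbert_Choice.inv \<sigma> ` A = A" if "\<sigma> ` A = A" for A
    using that b by (metis bij_def image_inv_f_f)
  have "Hilbert_Choice.inv \<sigma> ` W' \<inter> L = Hilbert_Choice.inv \<sigma> ` (W' \<inter> L)"
    using inv[OF stable[OF \<sigma>(1)]] b by (metis bij_imp_bij_inv bij_is_inj image_Int)
  also have "\<dots> = V" using inv[OF \<sigma>(2)] W'(2) by simp
  finally have "a \<in> Hilbert_Choice.inv \<sigma> ` W'"
    using a valuation_ring_image[OF Aut_inv[OF \<sigma>(1)] W'(1)] by (auto simp: int_closure_def)
  then show "\<sigma> a \<in> W'" using b by (auto simp: bij_is_surj surj_f_inv_f)
qed

lemma max_V_W: "a \<in> max_ideal V \<Longrightarrow> a \<in> max_ideal W"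
  using max_ideal_Int[OF W WL L(1)] by simp

text \<open>The common value of the two ends of an equation for \<open>a\<close>, cut behind the last unit
  coefficient, lies in every valuation ring above \<open>V\<close>, whether that contains \<open>a\<close> or \<open>1 / a\<close>.\<close>

lemma int_closure_fraction:
  assumes a: "a \<in> W"
  shows "\<exists>b\<in>int_closure. \<exists>d\<in>int_closure. d \<notin> max_ideal W \<and> a = b / d"
proof (cases "a = 0")
  case True
  then show ?thesis using is_subring_closed(1,2)[OF is_subring_int_closure]
      prime_idealD(4)[OF prime_max_ideal[OF is_subfield_UNIV W]]
    by (intro bexI[of _ 0] bexI[of _ 1]) auto
next
  case a0: False
  note MW = prime_max_ideal[OF is_subfield_UNIV W] and VD = valuation_ringD[OF V]
  obtain p0 where "p0 \<in> polys L" "p0 \<noteq> 0" "poly p0 a = 0"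
    using algebraic_over_mono[OF L(2) alg[of a]] by (auto simp: algebraic_over_polys)
  with polys_scale[OF L(1) V] obtain c j where "c \<noteq> 0" "smult c p0 \<in> polys V" "coeff (smult c p0) j = 1"
    by metis
  moreover define p where "p = smult c p0"
  ultimately have p: "p \<in> polys V" "coeff p j = 1" "poly p a = 0" using \<open>poly p0 a = 0\<close> by auto
  define n where "n = degree p"
  define U where "U = {i. i \<le> n \<and> coeff p i \<notin> max_ideal V}"
  have jU: "j \<in> U" using p(2) le_degree[of p j] prime_idealD(4)[OF prime_max_ideal[OF L(1) V]]
    by (auto simp: U_def n_def)
  define s where "s = Max U"
  have fU: "finite U" by (simp add: U_def)
  have sU: "s \<in> U" "\<And>i. i \<in> U \<Longrightarrow> i \<le> s" unfolding s_def using fU jU by (auto intro: Max_in)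
  then have sn: "s \<le> n" by (auto simp: U_def)
  define d where "d = (\<Sum>i\<in>{s..n}. coeff p i * a ^ (i - s))"
  have d1: "a ^ s * d = (\<Sum>i\<in>{s..n}. coeff p i * a ^ i)"
    unfolding d_def sum_distrib_left by (intro sum.cong) (auto simp: mult_ac simp flip: power_add)
  have "{..n} = {..<s} \<union> {s..n}" using sn by auto
  then have "(\<Sum>i\<in>{s..n}. coeff p i * a ^ i) = - (\<Sum>i\<in>{..<s}. coeff p i * a ^ i)"
    using p(3) unfolding poly_altdef n_def[symmetric]
    by (metis (no_types, lifting) add_eq_0_iff2 finite_atLeastAtMost finite_lessThan ivl_disj_int_one(4) ivl_disj_un_one(4) sn sum.union_disjoint add.commute add_eq_0_iff)
  then have d2: "a ^ s * d = - (\<Sum>i\<in>{..<s}. coeff p i * a ^ i)" using d1 by simp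
  have d3: "d = - (\<Sum>i\<in>{..<s}. coeff p i * inverse a ^ (s - i))"
  proof -
    have "a ^ s * (\<Sum>i\<in>{..<s}. coeff p i * inverse a ^ (s - i)) = (\<Sum>i\<in>{..<s}. coeff p i * a ^ i)"
      unfolding sum_distrib_left
    proof (intro sum.cong)
      fix i assume "i \<in> {..<s}"
      then have "a ^ s = a ^ i * a ^ (s - i)" by (simp flip: power_add)
      then show "a ^ s * (coeff p i * inverse a ^ (s - i)) = coeff p i * a ^ i"
        using a0 by (simp add: power_inverse)
    qed simp
    then show ?thesis using d2 a0 by (metis (no_types, lifting) minus_mult_right mult_cancel_left power_not_zero)
  qed
  have d4: "a * d = - (\<Sum>i\<in>{..<s}. coeff p i * inverse a ^ (s - i - 1))"
    unfolding d3 minus_mult_right[symmetric] sum_distrib_left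
  proof (intro arg_cong[where f = uminus] sum.cong)
    fix i assume "i \<in> {..<s}"
    then obtain m where "s - i = Suc m" by (metis lessThan_iff Suc_diff_Suc)
    then show "a * (coeff p i * inverse a ^ (s - i)) = coeff p i * inverse a ^ (s - i - 1)" using a0 by simp
  qed simp
  have in': "d \<in> W' \<and> a * d \<in> W'" if W': "valuation_ring UNIV W'" "W' \<inter> L = V" for W'
  proof -
    note sW = is_subring_closed[OF valuation_ringD(1)[OF W'(1)]]
    have v: "coeff p i \<in> W'" for i using polysD[OF p(1), of i] W'(2) by auto
    have "a \<in> W' \<or> inverse a \<in> W'" using valuation_ringD(4)[OF W'(1)] by auto
    then show ?thesis
    proof
      assume "a \<in> W'"
      then show ?thesis unfolding d_def by (auto intro!: sW(4) is_subring_sum[OF valuation_ringD(1)[OF W'(1)]] v sW(7))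
    next
      assume "inverse a \<in> W'"
      then show ?thesis unfolding d4 unfolding d3
        by (auto intro!: sW(4,5) is_subring_sum[OF valuation_ringD(1)[OF W'(1)]] v sW(7))
    qed
  qed
  \<comment> \<open>Behind index \<open>s\<close> all coefficients lie in the maximal ideal, so
    \<open>d\<close> is congruent to the unit \<open>coeff p s\<close>. This is the reason for the
    choice of \<open>s\<close>.\<close>
  have "d - coeff p s = (\<Sum>i\<in>{s..n} - {s}. coeff p i * a ^ (i - s))"
    unfolding d_def using sn by (subst sum.remove[of _ s]) auto
  moreover have "(\<Sum>i\<in>{s..n} - {s}. coeff p i * a ^ (i - s)) \<in> max_ideal W"
  proof (rule prime_ideal_sum[OF MW])
    fix i assume i: "i \<in> {s..n} - {s}"
    then have "i \<notin> U" using sU(2)[of i] by auto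
    then have "coeff p i \<in> max_ideal W" using i max_V_W by (auto simp: U_def)
    then show "coeff p i * a ^ (i - s) \<in> max_ideal W"
      using a is_subring_closed(7)[OF valuation_ringD(1)[OF W]] by (intro prime_idealD(7)[OF MW]) auto
  qed
  ultimately have "d - coeff p s \<in> max_ideal W" by simp
  moreover have "coeff p s \<notin> max_ideal W"
    using sU(1) polysD[OF p(1), of s] VD(2) max_ideal_Int[OF W WL L(1)] by (auto simp: U_def)
  ultimately have "d \<notin> max_ideal W" using prime_idealD(10)[OF MW, of d "d - coeff p s"] by auto
  moreover from this have "d \<noteq> 0" using prime_idealD(3)[OF MW] by auto
  then have "a = a * d / d" by simp
  moreover have "a * d \<in> int_closure" "d \<in> int_closure" using in' by (auto simp: int_closure_def)
  ultimately show ?thesis by blast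
qed

lemma finite_poly_orbit: "finite ((\<lambda>h. map_poly h p) ` Aut F)"
proof (induction p)
  case 0
  then show ?case by (rule finite_subset[of _ "{0}"]) auto
next
  case (pCons a p)
  have "(\<lambda>h. map_poly h (pCons a p)) ` Aut F \<subseteq> (\<lambda>(a, p). pCons a p) ` ((\<lambda>h. h a) ` Aut F \<times> (\<lambda>h. map_poly h p) ` Aut F)"
    by (auto simp: map_poly_pCons AutD(5))
  then show ?case using pCons finite_conjugates finite_subset by blast
qed

lemma map_poly_diff_prod:
  assumes "\<rho> \<in> Aut F" "finite Q"
  shows "map_poly (map_poly \<rho>) (\<Prod>q\<in>Q. [:- q, 1:]) = (\<Prod>q\<in>Q. [:- map_poly \<rho> q, 1:])"
proof -
  note [simp] = AutD[OF assms(1)]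
  have mult: "map_poly \<rho> (p * q) = map_poly \<rho> p * map_poly \<rho> q" for p q
    by (rule poly_eqI) (simp add: coeff_map_poly coeff_mult)
  have add: "map_poly \<rho> (p + q) = map_poly \<rho> p + map_poly \<rho> q" "map_poly \<rho> (- p) = - map_poly \<rho> p"
    "map_poly \<rho> (p - q) = map_poly \<rho> p - map_poly \<rho> q" for p q
    by (auto intro!: poly_eqI simp: coeff_map_poly)
  have step: "map_poly (map_poly \<rho>) ([:- q, 1:] * P) = [:- map_poly \<rho> q, 1:] * map_poly (map_poly \<rho>) P" for q P
    by (rule poly_eqI) (auto simp: coeff_map_poly coeff_pCons add mult split: nat.splits)
  have "map_poly \<rho> 1 = 1" by (rule poly_eqI) (simp add: coeff_map_poly Polynomial.coeff_1)
  then have one: "map_poly (map_poly \<rho>) 1 = 1" by (intro poly_eqI) (simp add: coeff_map_poly Polynomial.coeff_1)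
  from assms(2) show ?thesis by (induction Q rule: finite_induct) (auto simp: one step simp del: mult_pCons_left)
qed

text \<open>Several integral elements are packed into the coefficients of one
  \<open>\<theta>\<close>, so that a single \<open>h\<close> corrects \<open>\<rho>\<close> for all
  of them. The product \<open>R\<close> over the \<open>Aut L\<close>-orbit of
  \<open>\<theta>\<close> has all its coefficients in \<open>V\<close>, where \<open>\<rho>\<close>
  is trivial modulo the maximal ideal. Evaluation of the conjugate of \<open>R\<close> at
  \<open>\<theta>\<close> puts a product of differences into a prime ideal, and one factor provides
  \<open>h\<close>.\<close>

lemma inertia_poly:
  assumes \<rho>: "\<rho> \<in> Aut F" "\<rho> ` V = V" and in': "\<And>a. a \<in> V \<Longrightarrow> \<rho> a - a \<in> max_ideal V"
    and \<theta>: "\<theta> \<in> polys int_closure"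
  shows "\<exists>h\<in>Aut L. \<theta> - map_poly \<rho> (map_poly h \<theta>) \<in> polys (max_ideal W)"
proof -
  interpret AL: alg_base L using L by unfold_locales (auto intro: algebraic_over_mono[OF _ alg])
  note MW = prime_max_ideal[OF is_subfield_UNIV W]
  note MP = prime_ideal_polys[OF MW]
  define Q where "Q = (\<lambda>h. map_poly h \<theta>) ` Aut L"
  have "Q \<subseteq> (\<lambda>h. map_poly h \<theta>) ` Aut F" using Aut_mono[OF L(2)] by (auto simp: Q_def)
  then have fQ: "finite Q" using finite_poly_orbit finite_subset by blast
  have fixV: "h ` V = V" if "h \<in> Aut L" for h
    using AutD(3)[OF that] valuation_ringD(2)[OF V] by (auto simp: image_def) (metis subsetD)+
  have Qint: "q \<in> polys int_closure" if "q \<in> Q" for q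
    using that \<theta> Aut_mono[OF L(2)] fixV int_closure_stable
    by (auto simp: Q_def polys_def coeff_map_poly AutD(5))
  define R where "R = (\<Prod>q\<in>Q. [:- q, 1:])"
  have Rint: "R \<in> polys (polys int_closure)" unfolding R_def
    using Qint is_subring_polys[OF is_subring_int_closure]
    by (intro polys_prod) (auto simp: polys_closed polys_pCons_iff is_subring_polys is_subring_int_closure)
  have RL: "coeff R j \<in> polys L" for j
  proof (rule AL.polys_fixed)
    fix h assume h: "h \<in> Aut L"
    then have hF: "h \<in> Aut F" using Aut_mono[OF L(2)] by auto
    have "map_poly h ` Q \<subseteq> Q"
    proof safe
      fix q assume "q \<in> Q"
      then obtain g where g: "g \<in> Aut L" "q = map_poly g \<theta>" by (auto simp: Q_def)
      have "map_poly h q = map_poly (h \<circ> g) \<theta>"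
        using g AutD(5)[OF h] AutD(5)[OF g(1)] by (auto intro!: poly_eqI simp: coeff_map_poly)
      then show "map_poly h q \<in> Q" using Aut_comp[OF h g(1)] by (auto simp: Q_def)
    qed
    moreover have inj: "inj_on (map_poly h) Q"
      using AutD(5,14)[OF h] by (auto intro!: inj_onI poly_eqI simp: poly_eq_iff coeff_map_poly)
    ultimately have "map_poly h ` Q = Q" using fQ by (metis endo_inj_surj)
    then have "map_poly (map_poly h) R = R"
      unfolding R_def map_poly_diff_prod[OF hF fQ] using prod.reindex[OF inj, of "\<lambda>q. [:- q, 1:]"] by simp
    then show "map_poly h (coeff R j) = coeff R j" by (metis coeff_map_poly map_poly_0)
  qed
  have RV: "coeff (coeff R j) i \<in> V" for i j
    using polysD[OF RL[of j], of i] polysD[OF polysD[OF Rint, of j], of i] int_closure_W WL by auto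
  have \<theta>W: "p \<in> polys W" if "p \<in> polys int_closure" for p using that int_closure_W by (auto simp: polys_def)
  define R' where "R' = map_poly (map_poly \<rho>) R"
  have "R' - R \<in> polys (polys (max_ideal W))"
    using in'[OF RV] max_V_W AutD(5)[OF \<rho>(1)] by (auto simp: polys_def R'_def coeff_map_poly)
  then have "poly (R' - R) \<theta> \<in> polys (max_ideal W)" using poly_in_ideal[OF MP _ \<theta>W[OF \<theta>]] by blast
  moreover have "\<theta> \<in> Q" using Aut_id[of L] by (auto simp: Q_def intro!: image_eqI[of _ _ id])
  then have "poly R \<theta> = 0" using fQ by (auto simp: R_def poly_prod)
  moreover have "poly R' \<theta> = (\<Prod>q\<in>Q. \<theta> - map_poly \<rho> q)"
    unfolding R'_def R_def map_poly_diff_prod[OF \<rho>(1) fQ] by (simp add: poly_prod)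
  ultimately have "(\<Prod>q\<in>Q. \<theta> - map_poly \<rho> q) \<in> polys (max_ideal W)" by simp
  moreover have "\<theta> - map_poly \<rho> q \<in> polys W" if "q \<in> Q" for q
  proof -
    have "map_poly \<rho> q \<in> polys int_closure"
      using Qint[OF that] int_closure_stable[OF \<rho>] AutD(5)[OF \<rho>(1)] by (auto simp: polys_def coeff_map_poly)
    then show ?thesis using \<theta>W \<theta> polys_closed(4)[OF valuation_ringD(1)[OF W]] by blast
  qed
  ultimately obtain q where "q \<in> Q" "\<theta> - map_poly \<rho> q \<in> polys (max_ideal W)"
    using prime_ideal_prod[OF MP, of "\<lambda>q. \<theta> - map_poly \<rho> q" Q] by blast
  then show ?thesis by (auto simp: Q_def)
qed

text \<open>A finite form of the surjectivity of inertia groups under restriction. Elements of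
  \<open>W\<close> are fractions of integral ones with denominators outside the maximal ideal, so
  congruences for numerators and denominators suffice; the correction \<open>h\<close> fixes
  \<open>L\<close> and leaves the prescribed action there unchanged.\<close>

theorem inertia_lift:
  assumes \<tau>: "\<tau> \<in> inertia_group L F V" and A: "finite A" "A \<subseteq> W"
  shows "\<exists>\<sigma>\<in>Aut F. (\<forall>a\<in>L. \<sigma> a = \<tau> a) \<and> (\<forall>a\<in>A. \<sigma> a - a \<in> max_ideal W)"
proof -
  note MW = prime_max_ideal[OF is_subfield_UNIV W]
  have \<tau>': "\<tau> \<in> gal L F" "\<tau> ` V = V" "\<And>a. a \<in> V \<Longrightarrow> \<tau> a - a \<in> max_ideal V"
    using \<tau> by (auto simp: inertia_group_def)
  obtain \<rho> where \<rho>: "\<rho> \<in> Aut F" "\<forall>a\<in>L. \<rho> a = \<tau> a" using gal_lift[OF L \<tau>'(1)] by blast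
  then have \<rho>V: "\<rho> ` V = V" "\<And>a. a \<in> V \<Longrightarrow> \<rho> a - a \<in> max_ideal V"
    using \<tau>'(2,3) valuation_ringD(2)[OF V] by (auto simp: image_def subset_iff)
  obtain b d where bd: "\<And>a. a \<in> A \<Longrightarrow> b a \<in> int_closure \<and> d a \<in> int_closure \<and> d a \<notin> max_ideal W \<and> a = b a / d a"
    using int_closure_fraction A(2) by (metis subsetD)
  obtain xs where xs: "set xs = b ` A \<union> d ` A" using A(1) finite_list[of "b ` A \<union> d ` A"] by auto
  have "Poly xs \<in> polys int_closure"
  proof -
    have "set xs \<subseteq> int_closure" using xs bd by auto
    then have "coeff (Poly xs) j \<in> int_closure" for j
      using is_subring_closed(2)[OF is_subring_int_closure] nth_mem[of j xs] by (auto simp: nth_default_def)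
    then show ?thesis by (simp add: polys_def)
  qed
  from inertia_poly[OF \<rho>(1) \<rho>V this] obtain h
    where h: "h \<in> Aut L" "Poly xs - map_poly \<rho> (map_poly h (Poly xs)) \<in> polys (max_ideal W)" by blast
  have hF: "h \<in> Aut F" using h Aut_mono[OF L(2)] by auto
  have "\<rho> (h c) - c \<in> max_ideal W" if "c \<in> b ` A \<union> d ` A" for c
  proof -
    have "c \<in> set xs" using that xs by simp
    then obtain j where "j < length xs" "xs ! j = c" by (auto simp: in_set_conv_nth)
    then have "c - \<rho> (h c) \<in> max_ideal W"
      using polysD[OF h(2), of j] AutD(5)[OF \<rho>(1)] AutD(5)[OF hF] by (simp add: coeff_map_poly coeff_Poly_eq nth_default_def)
    then show ?thesis by (rule prime_idealD(11)[OF MW])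
  qed
  then have c: "\<rho> (h c) - c \<in> max_ideal W" if "c \<in> b ` A \<or> c \<in> d ` A" for c using that by auto
  have "\<rho> (h a) - a \<in> max_ideal W" if a: "a \<in> A" for a
  proof -
    define b' d' where "b' = \<rho> (h (b a))" and "d' = \<rho> (h (d a))"
    have ba: "b a \<in> W" "d a \<in> W" "d a \<notin> max_ideal W" "a = b a / d a" using bd[OF a] int_closure_W by auto
    have cc: "b' - b a \<in> max_ideal W" "d' - d a \<in> max_ideal W" using c a by (auto simp: b'_def d'_def)
    have d0: "d a \<noteq> 0" "inverse (d a) \<in> W" using ba not_max_ideal by blast+
    have "d' \<notin> max_ideal W" using prime_idealD(10)[OF MW, of d' "d' - d a"] cc ba by auto
    moreover have "d' \<in> W"
      using is_subring_closed(6)[OF valuation_ringD(1)[OF W] prime_idealD(2)[OF MW cc(2)] ba(2)] by simp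
    ultimately have d'0: "d' \<noteq> 0" "inverse d' \<in> W" using not_max_ideal by blast+
    have "\<rho> (h a) = b' / d'" using ba(4) AutD(12)[OF \<rho>(1)] AutD(12)[OF hF] by (metis b'_def d'_def)
    then have "\<rho> (h a) - a = inverse d' * ((b' - b a) - a * (d' - d a))"
      using d0 d'0 ba(4) by (simp add: field_simps)
    moreover have "a \<in> W" using a A by auto
    ultimately show ?thesis
      using cc d'0 by (auto intro!: prime_idealD(6)[OF MW] prime_idealD(10)[OF MW])
  qed
  moreover have "\<rho> (h a) = \<tau> a" if "a \<in> L" for a using AutD(3)[OF h(1) that] \<rho>(2) that by simp
  ultimately show ?thesis using Aut_comp[OF \<rho>(1) hF] by (auto intro!: bexI[of _ "\<rho> \<circ> h"])
qed

end

text \<open>The criterion by which membership is proved later. It speaks of all conjugates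
  \<open>\<sigma> a\<close> because these generate the normal closure that has to be
  pro-\<open>ell\<close> and unramified. The set \<open>A\<close> is finite and independent of
  \<open>\<rho>\<close> because \<open>inertia_lift\<close> provides a lift only after finitely many
  congruences have been named.\<close>

theorem (in alg_base) mem_max_pro_ell:
  assumes F_eq: "F = cyclotomic_ell k ell" and p: "Factorial_Ring.prime ell"
    and el: "\<And>\<rho> \<sigma>. \<rho> \<in> Aut F \<Longrightarrow> \<sigma> \<in> Aut F \<Longrightarrow> \<exists>e. (\<rho> ^^ (ell ^ e)) (\<sigma> a) = \<sigma> a"
    and un: "\<And>W \<sigma>. valuation_ring UNIV W \<Longrightarrow> of_nat ell \<notin> max_ideal W \<Longrightarrow> \<sigma> \<in> Aut F \<Longrightarrow>
      \<exists>A. finite A \<and> A \<subseteq> W \<and> (\<forall>\<rho>\<in>Aut F. (\<forall>c\<in>A. \<rho> c - c \<in> max_ideal W) \<longrightarrow> \<rho> (\<sigma> a) = \<sigma> a)"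
  shows "a \<in> max_pro_ell k ell"
proof -
  define L where "L = conj_field a"
  note Ls = conj_field_subfield[of a, folded L_def]
  have st: "\<rho> ` L = L" if "\<rho> \<in> Aut F" for \<rho>
    unfolding L_def by (rule Aut_stable_image[OF that Aut_conj_field_subset])
  have "unramified_away ell F L"
    unfolding unramified_away_def
  proof safe
    fix V \<tau> b assume VV: "valuation_ring L V" "of_nat ell \<notin> max_ideal V" and \<tau>: "\<tau> \<in> inertia_group L F V" and b: "b \<in> L"
    obtain W0 where W0: "valuation_ring UNIV W0" "W0 \<inter> L = V" using valuation_ring_extend[OF Ls(1) VV(1)] by blast
    interpret decomposition F L V W0 by unfold_locales (use Ls st VV W0 in auto)
    have "of_nat ell \<in> L" using is_subfield_closed(8)[OF Ls(1)] .
    then have ellW: "of_nat ell \<notin> max_ideal W0" using VV(2) max_ideal_Int[OF W0 Ls(1)] by auto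
    obtain \<rho> where \<rho>: "\<rho> \<in> Aut F" "\<forall>a\<in>L. \<rho> a = \<tau> a" using gal_lift[OF Ls(1,2), of \<tau>] \<tau> unfolding inertia_group_def by blast
    have "\<rho> (\<sigma> a) = \<sigma> a" if \<sigma>: "\<sigma> \<in> Aut F" for \<sigma>
    proof -
      obtain A where A: "finite A" "A \<subseteq> W0"
        "\<And>\<rho>. \<rho> \<in> Aut F \<Longrightarrow> (\<forall>c\<in>A. \<rho> c - c \<in> max_ideal W0) \<Longrightarrow> \<rho> (\<sigma> a) = \<sigma> a" using un[OF W0(1) ellW \<sigma>] by blast
      obtain \<eta> where \<eta>: "\<eta> \<in> Aut F" "\<forall>a\<in>L. \<eta> a = \<tau> a" "\<forall>a\<in>A. \<eta> a - a \<in> max_ideal W0"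
        using inertia_lift[OF \<tau> A(1,2)] by blast
      have "\<sigma> a \<in> L" using st[OF \<sigma>] Ls(3) by auto
      then show ?thesis using A(3)[OF \<eta>(1,3)] \<eta>(2) \<rho>(2) by simp
    qed
    then have "\<rho> \<in> Aut (F \<union> (\<lambda>\<sigma>. \<sigma> a) ` Aut F)" using \<rho>(1) by (auto simp: Aut_def)
    then have "\<rho> \<in> Aut L" unfolding L_def conj_field_def by (rule Aut_generate)
    then show "\<tau> b = b" using AutD(3) b \<rho>(2) by metis
  qed
  moreover have "pro_ell_ext ell F L" unfolding L_def by (rule pro_ell_ext_conj_field[OF p]) (rule el)
  ultimately have "L \<subseteq> max_pro_ell k ell"
    unfolding max_pro_ell_def F_eq[symmetric] by (intro order.trans[OF _ generate_field_FR(2)]) blast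
  then show ?thesis using Ls(3) by auto
qed

subsection \<open>The function field\<close>

text \<open>Polynomials and power series form rings that are not fields, so \<open>hom_on\<close>
  does not apply to them.\<close>

definition rhom :: "('a :: comm_ring_1 \<Rightarrow> 'b :: comm_ring_1) \<Rightarrow> bool"
  where "rhom f \<longleftrightarrow> f 1 = 1 \<and> (\<forall>a b. f (a + b) = f a + f b \<and> f (a * b) = f a * f b)"

lemma rhom_simps:
  assumes "rhom f"
  shows "f 0 = 0" "f 1 = 1" "f (a + b) = f a + f b" "f (a * b) = f a * f b" "f (- a) = - f a"
    "f (a - b) = f a - f b" "f (a ^ n) = f a ^ n" "f (sum h J) = (\<Sum>j\<in>J. f (h j))"
    "f (prod h J) = (\<Prod>j\<in>J. f (h j))"
proof -
  show 1: "f 1 = 1" and a: "f (a + b) = f a + f b" and m: "f (a * b) = f a * f b" for a b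
    using assms by (auto simp: rhom_def)
  show z: "f 0 = 0" using a[of 0 0] by (metis add_0 add_cancel_right_right)
  show u: "f (- a) = - f a" for a using a[of a "- a"] z by (simp add: eq_neg_iff_add_eq_0 add.commute)
  show "f (a - b) = f a - f b" using a[of a "- b"] u[of b] by simp
  show "f (a ^ n) = f a ^ n" by (induction n) (auto simp: 1 m)
  show "f (sum h J) = (\<Sum>j\<in>J. f (h j))"
    by (induction J rule: infinite_finite_induct) (auto simp: a z)
  show "f (prod h J) = (\<Prod>j\<in>J. f (h j))"
    by (induction J rule: infinite_finite_induct) (auto simp: m 1)
qed

lemma rhom_map_poly:
  assumes "rhom f"
  shows "rhom (map_poly f)"
proof -
  note [simp] = rhom_simps[OF assms]
  show ?thesis unfolding rhom_def
    by (auto intro!: poly_eqI simp: coeff_map_poly coeff_mult Polynomial.coeff_1)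
qed

lemma rhom_poly: "rhom (\<lambda>p. poly p a)"
  by (simp add: rhom_def)

lemma rhom_comp: "rhom f \<Longrightarrow> rhom g \<Longrightarrow> rhom (\<lambda>a. f (g a))"
  by (simp add: rhom_def)

lemma rhom_pcompose: "rhom (\<lambda>p. pcompose p q)"
  by (simp add: rhom_def pcompose_add pcompose_mult pcompose_1)

lemma rhom_Aut: "\<sigma> \<in> Aut F \<Longrightarrow> rhom \<sigma>"
  by (simp add: rhom_def AutD)

text \<open>The formula of \<open>eval2\<close> with an arbitrary commutative ring as target, since
  polynomials are also evaluated at power series.\<close>

definition bieval :: "('a :: comm_ring_1 \<Rightarrow> 'b :: comm_ring_1) \<Rightarrow> 'b \<Rightarrow> 'b \<Rightarrow> 'a poly poly \<Rightarrow> 'b"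
  where "bieval f u v p = poly (map_poly (\<lambda>q. poly (map_poly f q) u) p) v"

lemma rhom_poly_map: "rhom f \<Longrightarrow> rhom (\<lambda>q. poly (map_poly f q) u)"
  by (intro rhom_comp[OF rhom_poly] rhom_map_poly)

lemma rhom_bieval: "rhom f \<Longrightarrow> rhom (bieval f u v)"
  unfolding bieval_def by (intro rhom_comp[OF rhom_poly] rhom_map_poly rhom_poly_map)

lemma bieval_simps:
  assumes "rhom f"
  shows "bieval f u v [:q:] = poly (map_poly f q) u" "bieval f u v (monom 1 n) = v ^ n"
    "poly (map_poly f [:c:]) u = f c" "poly (map_poly f [:- c, 1:]) u = u - f c"
    "poly (map_poly f [:c, 1:]) u = u + f c" "poly (map_poly f (smult c q)) u = f c * poly (map_poly f q) u"
proof -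
  note [simp] = rhom_simps[OF assms]
  have one: "poly (map_poly f 1) u = 1" using rhom_simps(2)[OF rhom_poly_map[OF assms]] .
  show "bieval f u v [:q:] = poly (map_poly f q) u" by (simp add: bieval_def map_poly_pCons)
  show "bieval f u v (monom 1 n) = v ^ n" by (simp add: bieval_def map_poly_monom poly_monom one)
  show c: "poly (map_poly f [:c:]) u = f c" "poly (map_poly f [:- c, 1:]) u = u - f c"
    "poly (map_poly f [:c, 1:]) u = u + f c" for c by (simp_all add: map_poly_pCons)
  show "poly (map_poly f (smult c q)) u = f c * poly (map_poly f q) u"
    using rhom_simps(4)[OF rhom_poly_map[OF assms], of "[:c:]" q u] c by simp
qed

lemma bieval_altdef:
  assumes "rhom f" "degree p < n"
  shows "bieval f u v p = (\<Sum>j<n. poly (map_poly f (coeff p j)) u * v ^ j)"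
proof -
  have "p = (\<Sum>j<n. [:coeff p j:] * monom 1 j)"
    using assms(2) by (intro poly_eqI) (auto simp: coeff_sum coeff_monom_mult coeff_eq_0 if_distrib cong: if_cong)
  then have "bieval f u v p = bieval f u v (\<Sum>j<n. [:coeff p j:] * monom 1 j)" by simp
  then show ?thesis
    by (simp only: rhom_simps[OF rhom_bieval[OF assms(1)]] bieval_simps[OF assms(1)])
qed

text \<open>The divisor is monic in \<open>Y\<close>, so no inverses occur and the coefficients stay
  in \<open>A\<close>. It is applied to all polynomials and to those with coefficients in
  \<open>polys W\<close>.\<close>

lemma monic_division:
  assumes A: "is_subring A" and F: "F \<in> A" and p: "p \<in> polys A" and N: "N > 0"
  shows "\<exists>d r. d \<in> polys A \<and> r \<in> polys A \<and> p = (monom 1 N - [:F:]) * d + r \<and> degree r < N"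
  using p
proof (induction "degree p" arbitrary: p rule: less_induct)
  case less
  note c = polys_closed[OF A]
  show ?case
  proof (cases "degree p < N")
    case True
    then show ?thesis using less.prems c(1) by (rule_tac exI[of _ 0], rule_tac exI[of _ p]) auto
  next
    case False
    define n where "n = degree p"
    define m where "m = monom (coeff p n) (n - N)"
    have mA: "m \<in> polys A" unfolding m_def by (intro c(11) polysD[OF less.prems])
    define p' where "p' = p - (monom 1 N - [:F:]) * m"
    have p'A: "p' \<in> polys A" unfolding p'_def
      by (intro c(4,6) less.prems mA c(8,11) F) (use is_subring_closed(1)[OF A] in auto)
    have "\<forall>j>n - 1. coeff p' j = 0"
    proof safe
      fix j assume j: "n - 1 < j"
      have "coeff p' j = coeff p j - (if j = n then coeff p n else 0) + F * coeff m j"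
        using False by (auto simp: p'_def m_def n_def algebra_simps coeff_monom_mult)
      moreover have "coeff m j = 0" using j N False by (auto simp: m_def n_def)
      moreover have "coeff p j = 0" if "j \<noteq> n" using j that by (intro coeff_eq_0) (auto simp: n_def)
      ultimately show "coeff p' j = 0" by simp
    qed
    then have "degree p' < degree p" using degree_le[of "n - 1" p'] False N by (auto simp: n_def)
    from less.hyps[OF this p'A] obtain d r where "d \<in> polys A" "r \<in> polys A"
      "p' = (monom 1 N - [:F:]) * d + r" "degree r < N" by blast
    then show ?thesis using mA c(3)[of d m]
      by (rule_tac exI[of _ "d + m"], rule_tac exI[of _ r]) (auto simp: p'_def algebra_simps smult_add_right)
  qed
qed

section \<open>The function field of y^N = F(x) and its deck transformation\<close>

locale superelliptic =
  fixes i :: "'a :: {alg_closed_field, field_char_0} \<Rightarrow> 'b :: field" and x y :: 'b and N :: nat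
    and F :: "'a poly" and \<zeta> :: 'a
  assumes hom_i: "hom_on UNIV i" and N: "N > 0" and y_pow: "y ^ N = poly (map_poly i F) x"
    and F0: "F \<noteq> 0" and indep: "degree p < N \<Longrightarrow> eval2 i x y p = 0 \<Longrightarrow> p = 0"
    and \<zeta>: "\<zeta> ^ N = 1" "0 < j \<Longrightarrow> j < N \<Longrightarrow> \<zeta> ^ j \<noteq> 1"
begin

lemma rhom_i: "rhom i" using hom_i by (simp add: rhom_def hom_on_def)

definition ev :: "'a poly poly \<Rightarrow> 'b" where "ev = bieval i x y"
definition px :: "'a poly \<Rightarrow> 'b" where "px q = poly (map_poly i q) x"
definition g :: "'a poly poly" where "g = monom 1 N - [:F:]"
text \<open>The substitution of \<open>c * Y\<close> for \<open>Y\<close>: for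
  \<open>c ^ N = 1\<close> it preserves \<open>g\<close> and is the deck transformation on the level
  of polynomials.\<close>

definition tw :: "'a \<Rightarrow> 'a poly poly \<Rightarrow> 'a poly poly" where "tw c p = pcompose p [:0, [:c:]:]"

lemma ev_eval2: "ev p = eval2 i x y p" by (simp add: ev_def bieval_def eval2_def)

lemmas i_simps = rhom_simps[OF rhom_i] hom_UNIV(8-)[OF hom_i]
lemma rhom_ev: "rhom ev" unfolding ev_def by (rule rhom_bieval[OF rhom_i])
lemma rhom_px: "rhom px" unfolding px_def by (rule rhom_poly_map[OF rhom_i])
lemma rhom_tw: "rhom (tw c)" unfolding tw_def by (rule rhom_pcompose)
lemmas ev_simps = rhom_simps[OF rhom_ev]
lemmas px_simps = rhom_simps[OF rhom_px]
lemmas tw_simps = rhom_simps[OF rhom_tw]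

lemma ev_const: "ev [:q:] = px q" by (simp add: ev_def px_def bieval_simps[OF rhom_i])
lemma ev_monom: "ev (monom 1 n) = y ^ n" by (simp add: ev_def bieval_simps[OF rhom_i])
lemma px_const: "px [:c:] = i c" "px [:- c, 1:] = x - i c" "px [:c, 1:] = x + i c" "px (smult c q) = i c * px q"
  by (simp_all add: px_def bieval_simps[OF rhom_i] i_simps)
lemma ev_g: "ev g = 0" using y_pow by (simp add: g_def ev_simps ev_const ev_monom px_def)

lemma y_pow': "y ^ N = px F" using y_pow by (simp add: px_def)

lemma ev_eq_0: "degree p < N \<Longrightarrow> ev p = 0 \<Longrightarrow> p = 0" using indep by (simp add: ev_eval2)

lemma px_eq_0: "px q = 0 \<longleftrightarrow> q = 0"
  using ev_eq_0[of "[:q:]"] N px_simps(1) by (auto simp: ev_const)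

lemma division: obtains d r where "p = g * d + r" "degree r < N"
  using monic_division[of UNIV F p N] N by (auto simp: g_def polys_def)

lemma ev_eq_0_iff: "ev p = 0 \<longleftrightarrow> g dvd p"
proof
  assume p: "ev p = 0"
  obtain d r where d: "p = g * d + r" "degree r < N" by (rule division[of p])
  then have "r = 0" using p ev_eq_0 by (auto simp: ev_simps ev_g)
  then show "g dvd p" using d by simp
qed (auto simp: ev_simps ev_g dvd_def)

lemma y_nonzero: "y \<noteq> 0"
  using y_pow' px_eq_0[of F] N F0 by (auto simp: zero_power)

lemma coeff_tw: "coeff (tw c p) j = smult (c ^ j) (coeff p j)"
proof -
  have "coeff (tw c p) j = [:c:] ^ j * coeff p j" by (simp add: tw_def coeff_pcompose_linear)
  also have "[:c:] ^ j = [:c ^ j:]" by (induction j) auto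
  finally show ?thesis by simp
qed

lemma tw_tw: "tw c (tw d p) = tw (c * d) p"
  by (rule poly_eqI) (simp add: coeff_tw power_mult_distrib mult.commute)

lemma tw_1: "tw 1 p = p"
  by (rule poly_eqI) (simp add: coeff_tw)

lemma tw_g: "c ^ N = 1 \<Longrightarrow> tw c g = g"
  by (rule poly_eqI) (auto simp: coeff_tw g_def coeff_pCons split: nat.splits)

lemma degree_tw: "degree p < N \<Longrightarrow> degree (tw c p) < N"
  by (rule le_less_trans[OF degree_le[of "degree p"]]) (auto simp: coeff_tw coeff_eq_0)

lemma ev_tw_eq_0:
  assumes "c ^ N = 1"
  shows "ev (tw c p) = 0 \<longleftrightarrow> ev p = 0"
proof -
  have 1: "ev (tw c p) = 0" if cp: "c ^ N = 1" "ev p = 0" for c p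
  proof -
    obtain d where "p = g * d" using cp by (auto simp: ev_eq_0_iff)
    then show ?thesis using tw_g[OF cp(1)] by (simp add: tw_simps ev_simps ev_g)
  qed
  have c0: "c \<noteq> 0" using assms N by (auto simp: zero_power)
  have "inverse c ^ N = 1" using assms by (simp add: power_inverse)
  from 1[OF this, of "tw c p"] 1[OF assms, of p] show ?thesis
    using c0 by (auto simp: tw_tw tw_1)
qed

lemma \<zeta>_nonzero: "\<zeta> \<noteq> 0" using \<zeta>(1) N by (auto simp: zero_power)
lemma \<zeta>_pow: "(\<zeta> ^ k) ^ N = 1" using \<zeta>(1) by (metis mult.commute power_mult power_one)

lemma \<zeta>_eq_iff: "j < N \<Longrightarrow> k < N \<Longrightarrow> \<zeta> ^ j = \<zeta> ^ k \<longleftrightarrow> j = k"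
proof (induction j k rule: linorder_wlog)
  case (le j k)
  show ?case
  proof (cases "j = k")
    case False
    have "\<zeta> ^ k = \<zeta> ^ j * \<zeta> ^ (k - j)" using le by (simp flip: power_add)
    moreover have "\<zeta> ^ (k - j) \<noteq> 1" using \<zeta>(2)[of "k - j"] le False by auto
    ultimately show ?thesis using \<zeta>_nonzero False by auto
  qed simp
qed auto

lemma \<zeta>_mod: "\<zeta> ^ (k mod N) = \<zeta> ^ k"
proof -
  have "\<zeta> ^ k = \<zeta> ^ (N * (k div N) + k mod N)" by simp
  then show ?thesis using \<zeta>(1) by (simp only: power_add power_mult) simp
qed

lemma fixed_coeffs:
  assumes p: "degree p < N" and k: "k < N" and e: "tw \<zeta> p = smult [:\<zeta> ^ k:] p"
  shows "p = monom (coeff p k) k"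
proof (rule poly_eqI)
  fix j
  have "smult (\<zeta> ^ j) (coeff p j) = smult (\<zeta> ^ k) (coeff p j)"
    using arg_cong[OF e, of "\<lambda>p. coeff p j"] by (simp add: coeff_tw)
  then have "smult (\<zeta> ^ j - \<zeta> ^ k) (coeff p j) = 0" by (simp add: smult_diff_left)
  then show "coeff p j = coeff (monom (coeff p k) k) j"
    using \<zeta>_eq_iff[of j k] k p by (cases "j < N") (auto simp: coeff_eq_0)
qed

text \<open>The norm down to the rational functions in \<open>x\<close>. The product of all twists
  is invariant, hence so is its remainder modulo \<open>g\<close>, and an invariant remainder
  contains no positive power of \<open>Y\<close>. This is what supplies inverses in
  \<open>K\<close>.\<close>

lemma ev_norm:
  assumes "ev p \<noteq> 0"
  shows "\<exists>p' q. q \<noteq> 0 \<and> ev p * ev p' = px q"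
proof -
  define P where "P = (\<Prod>k<N. tw (\<zeta> ^ k) p)"
  have P: "P = p * (\<Prod>k\<in>{..<N} - {0}. tw (\<zeta> ^ k) p)"
    unfolding P_def using N by (subst prod.remove[of _ 0]) (auto simp: tw_1)
  have "tw \<zeta> P = (\<Prod>k<N. tw (\<zeta> ^ Suc k) p)" unfolding P_def tw_simps by (simp add: tw_tw)
  \<comment> \<open>One more twist permutes the exponents cyclically because
    \<open>\<zeta> ^ N = 1\<close>.\<close>
  also have "\<dots> = (\<Prod>k\<in>(\<lambda>k. Suc k mod N) ` {..<N}. tw (\<zeta> ^ k) p)"
  proof (subst prod.reindex)
    show "inj_on (\<lambda>k. Suc k mod N) {..<N}"
      by (rule inj_onI) (metis N Suc_inject lessThan_iff mod_Suc mod_less nat.distinct(1))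
  qed (simp only: o_def \<zeta>_mod)
  also have "(\<lambda>k. Suc k mod N) ` {..<N} = {..<N}"
    by (rule endo_inj_surj) (use N in \<open>auto intro!: inj_onI simp: mod_Suc split: if_splits\<close>)
  finally have tP: "tw \<zeta> P = P" by (simp add: P_def)
  obtain d r where d: "P = g * d + r" "degree r < N" by (rule division[of P])
  have "g * (tw \<zeta> d - d) + (tw \<zeta> r - r) = 0"
    using tP unfolding d(1) by (simp add: tw_simps tw_g[OF \<zeta>(1)] algebra_simps)
  then have "ev (g * (tw \<zeta> d - d) + (tw \<zeta> r - r)) = 0" by (simp add: ev_simps)
  then have "ev (tw \<zeta> r - r) = 0" by (simp add: ev_simps ev_g)
  moreover have "degree (tw \<zeta> r - r) < N" using degree_diff_less[OF degree_tw[OF d(2)] d(2)] .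
  ultimately have "tw \<zeta> r = r" using ev_eq_0 by force
  then have "r = monom (coeff r 0) 0" by (intro fixed_coeffs[OF d(2) N]) (simp flip: one_pCons)
  then have r: "r = [:coeff r 0:]" by (simp add: monom_0)
  have "ev P = px (coeff r 0)" using d(1) r by (metis ev_simps(3,4) ev_g mult_zero_left add_0 ev_const)
  moreover have "ev P \<noteq> 0" unfolding P_def ev_simps using assms ev_tw_eq_0[OF \<zeta>_pow] by auto
  ultimately have "coeff r 0 \<noteq> 0" "ev p * ev (\<Prod>k\<in>{..<N} - {0}. tw (\<zeta> ^ k) p) = px (coeff r 0)"
    using px_eq_0 by (auto simp: P ev_simps)
  then show ?thesis by blast
qed

text \<open>Denominators in \<open>x\<close> alone are enough because \<open>ev_norm\<close> makes
  every denominator rational; numerators can then be reduced modulo \<open>g\<close>.\<close>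

definition K :: "'b set" where "K = {ev p / px q | p q. q \<noteq> 0}"

lemma K_I: "q \<noteq> 0 \<Longrightarrow> w = ev p / px q \<Longrightarrow> w \<in> K" by (auto simp: K_def)

lemma K_E: assumes "w \<in> K" obtains p q where "q \<noteq> 0" "w = ev p / px q" "px q \<noteq> 0" "degree p < N"
proof -
  obtain p q where pq: "q \<noteq> 0" "w = ev p / px q" using assms by (auto simp: K_def)
  obtain d r where "p = g * d + r" "degree r < N" by (rule division[of p])
  then show thesis using that[of q r] pq px_eq_0 by (auto simp: ev_simps ev_g)
qed

lemma ev_K [simp]: "ev p \<in> K" by (rule K_I[of 1 _ p]) (auto simp: px_simps)
lemma px_K [simp]: "px q \<in> K" using ev_K[of "[:q:]"] by (simp add: ev_const)
lemma i_K [simp]: "i c \<in> K" using px_K[of "[:c:]"] by (simp add: px_const)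
lemma x_K [simp]: "x \<in> K" using px_K[of "[:0, 1:]"] px_const(3)[of 0] by (simp add: i_simps)
lemma y_K [simp]: "y \<in> K" using ev_K[of "monom 1 1"] by (simp add: ev_monom)

lemma subfield_K: "is_subfield K"
  unfolding is_subfield_def is_subring_def
proof (intro conjI ballI)
  show "1 \<in> K" using i_K[of 1] by (simp add: i_simps)
  fix a assume "a \<in> K"
  then obtain p q where a: "q \<noteq> 0" "a = ev p / px q" "px q \<noteq> 0" by (rule K_E)
  show "inverse a \<in> K"
  proof (cases "ev p = 0")
    case True
    then show ?thesis using a \<open>a \<in> K\<close> by simp
  next
    case False
    then obtain p' q' where q': "q' \<noteq> 0" "ev p * ev p' = px q'" using ev_norm by blast
    then have "ev p' \<noteq> 0" using px_eq_0 by force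
    then have "inverse a = ev ([:q:] * p') / px q'"
      unfolding q'(2)[symmetric] a(2) ev_simps ev_const by simp
    then show ?thesis by (rule K_I[OF q'(1)])
  qed
  fix b assume "b \<in> K"
  then obtain p' q' where b: "q' \<noteq> 0" "b = ev p' / px q'" "px q' \<noteq> 0" by (rule K_E)
  show "a - b \<in> K" using a b
    by (intro K_I[of "q * q'" _ "p * [:q':] - p' * [:q:]"])
      (simp_all add: px_simps ev_simps ev_const diff_frac_eq del: mult_pCons_right)
  show "a * b \<in> K" using a b
    by (intro K_I[of "q * q'" _ "p * p'"]) (simp_all add: px_simps ev_simps)
qed

lemmas K_closed = is_subfield_closed[OF subfield_K] is_subfieldD(2,3)[OF subfield_K]

lemma ev_in_subring:
  assumes "is_subring A" "range i \<subseteq> A" "x \<in> A" "y \<in> A"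
  shows "ev p \<in> A"
proof -
  have "px q \<in> A" for q unfolding px_def
    by (rule poly_in_subring) (use assms in \<open>auto simp: polys_def coeff_map_poly i_simps\<close>)
  then have "map_poly px p \<in> polys A" by (auto simp: polys_def coeff_map_poly px_simps)
  then have "poly (map_poly px p) y \<in> A" by (rule poly_in_subring[OF assms(1) _ assms(4)])
  then show ?thesis by (simp add: ev_def bieval_def px_def[abs_def])
qed

lemma K_func_field: "func_field i x y = K"
proof
  show "func_field i x y \<subseteq> K" unfolding func_field_def
    by (rule generate_field_FR(3)[OF subfield_K]) auto
  have A: "is_subfield (func_field i x y)" "range i \<subseteq> func_field i x y" "x \<in> func_field i x y" "y \<in> func_field i x y"
    using generate_field_FR(1,2)[of "range i \<union> {x, y}"] by (auto simp: func_field_def)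
  show "K \<subseteq> func_field i x y"
    using ev_in_subring[OF is_subfieldD(1)[OF A(1)] A(2-4)] is_subfieldD(3)[OF A(1)]
    by (auto simp: K_def simp flip: ev_const)
qed

text \<open>The universal property of the function field. As denominators involve \<open>x\<close>
  only, it suffices that \<open>g\<close> is killed and no nonzero polynomial in \<open>x\<close>
  is. It produces \<open>z\<close>, the maps \<open>tau\<close> and the expansions into Laurent
  series.\<close>

lemma hom_extend:
  assumes E: "rhom E" and Eg: "E g = 0" and E0: "\<And>q. q \<noteq> 0 \<Longrightarrow> E [:q:] \<noteq> (0 :: 'c :: field)"
  shows "\<exists>\<psi>. hom_on K \<psi> \<and> (\<forall>p. \<psi> (ev p) = E p)"
proof -
  note [simp] = rhom_simps[OF E]
  have ker: "E p = E p'" if "ev p = ev p'" for p p'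
  proof -
    have "ev (p - p') = 0" using that by (simp add: ev_simps)
    then obtain d where "p - p' = g * d" by (auto simp: ev_eq_0_iff)
    then have "E (p - p') = 0" using Eg by simp
    then show ?thesis by simp
  qed
  define R where "R = (\<lambda>w v. \<exists>p q. q \<noteq> 0 \<and> w = ev p / px q \<and> v = E p / E [:q:])"
  have uniq: "v = v'" if vv: "R w v" "R w v'" for w v v'
  proof -
    obtain p q p' q' where *: "q \<noteq> 0" "w = ev p / px q" "v = E p / E [:q:]"
       "q' \<noteq> 0" "w = ev p' / px q'" "v' = E p' / E [:q':]" using vv unfolding R_def by blast
    then have "ev (p * [:q':]) = ev (p' * [:q:])"
      using px_eq_0 by (simp add: ev_simps ev_const frac_eq_eq del: mult_pCons_right)
    from ker[OF this] show ?thesis using * E0 by (simp add: frac_eq_eq del: mult_pCons_right)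
  qed
  define \<psi> where "\<psi> = (\<lambda>w. THE v. R w v)"
  have \<psi>: "\<psi> w = v" if "R w v" for w v unfolding \<psi>_def using that uniq by blast
  have \<psi>E: "\<psi> (ev p / px q) = E p / E [:q:]" if "q \<noteq> 0" for p q by (rule \<psi>) (use that in \<open>auto simp: R_def\<close>)
  have Eone: "E [:1:] = 1" by (simp flip: one_pCons)
  have \<psi>e: "\<psi> (ev p) = E p" for p using \<psi>E[of 1 p] by (simp add: px_simps Eone)
  have "\<psi> (a + b) = \<psi> a + \<psi> b \<and> \<psi> (a * b) = \<psi> a * \<psi> b" if ab: "a \<in> K" "b \<in> K" for a b
  proof -
    obtain p q where 1: "q \<noteq> 0" "a = ev p / px q" "px q \<noteq> 0" by (rule K_E[OF ab(1)])
    obtain p' q' where 2: "q' \<noteq> 0" "b = ev p' / px q'" "px q' \<noteq> 0" by (rule K_E[OF ab(2)])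
    note * = 1 2
    have "a + b = ev (p * [:q':] + p' * [:q:]) / px (q * q')" "a * b = ev (p * p') / px (q * q')"
      unfolding 1(2) 2(2) ev_simps px_simps ev_const using 1(3) 2(3) by (simp_all add: add_frac_eq)
    moreover have "q * q' \<noteq> 0" using * by simp
    moreover have Em: "E [:q * q':] = E [:q:] * E [:q':]" using rhom_simps(4)[OF E, of "[:q:]" "[:q':]"] by (simp add: mult.commute)
    ultimately have "\<psi> (a + b) = E (p * [:q':] + p' * [:q:]) / E [:q * q':]" "\<psi> (a * b) = E (p * p') / E [:q * q':]"
      using \<psi>E by metis+
    moreover have "\<psi> a = E p / E [:q:]" "\<psi> b = E p' / E [:q':]" using 1 2 \<psi>E by auto
    ultimately show ?thesis using E0[OF 1(1)] E0[OF 2(1)] Em by (simp add: add_frac_eq del: mult_pCons_right)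
  qed
  moreover have "\<psi> 1 = 1" using \<psi>e[of 1] by (simp add: ev_simps)
  ultimately have "hom_on K \<psi>" by (auto simp: hom_on_def)
  then show ?thesis using \<psi>e by blast
qed

text \<open>The constants are algebraically closed, so \<open>p\<close> splits over them and one of
  its linear factors vanishes at \<open>u\<close>.\<close>

lemma poly_root_const:
  assumes "p \<noteq> 0" "poly (map_poly i p) u = 0"
  shows "u \<in> range i"
proof -
  obtain A where A: "p = smult (lead_coeff p) (\<Prod>a\<in>#A. [:- a, 1:])" using alg_closed_imp_factorization[OF assms(1)] by blast
  have P: "poly (map_poly i (\<Prod>a\<in>#B. [:- a, 1:])) u = (\<Prod>a\<in>#B. u - i a)" for B
    by (induction B) (simp_all add: rhom_simps[OF rhom_poly_map[OF rhom_i]] bieval_simps[OF rhom_i] i_simps del: mult_pCons_left)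
  have "poly (map_poly i p) u = i (lead_coeff p) * (\<Prod>a\<in>#A. u - i a)"
    by (subst A) (simp add: bieval_simps[OF rhom_i] P)
  then have "i (lead_coeff p) * (\<Prod>a\<in>#A. u - i a) = 0" using assms(2) by simp
  then have "(\<Prod>a\<in>#A. u - i a) = 0" using assms(1) i_simps by auto
  then obtain a where "a \<in># A" "u - i a = 0" by (auto simp: prod_mset_zero_iff)
  then show ?thesis by auto
qed

lemma power_const:
  assumes "u ^ r = i c" "r > 0"
  shows "u \<in> range i"
proof (rule poly_root_const[of "monom 1 r - [:c:]"])
  have "coeff (monom 1 r - [:c:]) r = 1" using assms(2) by (auto simp: coeff_pCons split: nat.splits)
  then show "monom 1 r - [:c:] \<noteq> 0" by (metis coeff_0 zero_neq_one)
  show "poly (map_poly i (monom 1 r - [:c:])) u = 0"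
    using assms(1) by (simp add: rhom_simps[OF rhom_poly_map[OF rhom_i]] bieval_simps[OF rhom_i] map_poly_monom poly_monom i_simps)
qed

definition z :: "'b \<Rightarrow> 'b" where "z = (SOME \<psi>. hom_on K \<psi> \<and> (\<forall>p. \<psi> (ev p) = ev (tw \<zeta> p)))"

lemma z: "hom_on K z" "z (ev p) = ev (tw \<zeta> p)"
proof -
  have "\<exists>\<psi>. hom_on K \<psi> \<and> (\<forall>p. \<psi> (ev p) = ev (tw \<zeta> p))"
  proof (rule hom_extend)
    show "rhom (\<lambda>p. ev (tw \<zeta> p))" by (rule rhom_comp[OF rhom_ev rhom_tw])
    show "ev (tw \<zeta> g) = 0" by (simp add: tw_g \<zeta> ev_g)
    show "q \<noteq> 0 \<Longrightarrow> ev (tw \<zeta> [:q:]) \<noteq> 0" for q using px_eq_0 by (simp add: ev_tw_eq_0 \<zeta> ev_const)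
  qed
  from someI_ex[OF this, folded z_def] show "hom_on K z" "z (ev p) = ev (tw \<zeta> p)" by auto
qed

lemmas z_simps = hom_on_simps[OF z(1) subfield_K]

lemma z_px [simp]: "z (px q) = px q"
proof -
  have "tw \<zeta> [:q:] = [:q:]" by (rule poly_eqI) (auto simp: coeff_tw coeff_pCons split: nat.splits)
  then show ?thesis using z(2)[of "[:q:]"] by (simp add: ev_const)
qed

lemma z_i [simp]: "z (i c) = i c" using z_px[of "[:c:]"] by (simp add: px_const)

lemma z_y [simp]: "z y = i \<zeta> * y"
proof -
  have "tw \<zeta> (monom 1 1) = [:[:\<zeta>:]:] * monom 1 1" by (rule poly_eqI) (auto simp: coeff_tw)
  then show ?thesis using z(2)[of "monom 1 1"] by (simp add: ev_monom ev_simps ev_const px_const del: mult_pCons_left)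
qed

lemma z_K [simp]: "w \<in> K \<Longrightarrow> z w \<in> K"
  by (elim K_E) (auto simp: z_simps z(2) intro: K_closed(11))

lemma zpow_K [simp]: "w \<in> K \<Longrightarrow> (z ^^ k) w \<in> K"
  by (induction k) auto

lemma zpow_frac: "q \<noteq> 0 \<Longrightarrow> (z ^^ k) (ev p / px q) = ev (tw (\<zeta> ^ k) p) / px q"
  by (induction k) (auto simp: tw_1 z_simps z(2) tw_tw)

lemma zpow_N: "w \<in> K \<Longrightarrow> (z ^^ N) w = w"
  by (elim K_E) (simp add: zpow_frac \<zeta> tw_1)

lemma zpow_hom: "hom_on K (z ^^ k)"
proof (induction k)
  case (Suc k)
  then show ?case using zpow_K by (auto simp: hom_on_def z_simps)
qed (auto simp: hom_on_def)

lemmas zpow_simps = hom_on_simps[OF zpow_hom subfield_K]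

lemma zpow_i [simp]: "(z ^^ k) (i c) = i c" by (induction k) auto

text \<open>The powers \<open>y ^ j\<close>, \<open>j < N\<close>, are independent over the rational
  functions in \<open>x\<close> and are scaled by distinct constants, so an eigenvector has a single
  term.\<close>

lemma z_eigen:
  assumes w: "w \<in> K" and k: "k < N" and e: "z w = i (\<zeta> ^ k) * w"
  shows "\<exists>p q. q \<noteq> 0 \<and> w = y ^ k * px p / px q"
proof -
  obtain p q where pq: "q \<noteq> 0" "w = ev p / px q" "px q \<noteq> 0" "degree p < N" using w by (rule K_E)
  have "ev (tw \<zeta> p) = i (\<zeta> ^ k) * ev p" using e pq by (simp add: z_simps z(2))
  then have "ev (tw \<zeta> p - smult [:\<zeta> ^ k:] p) = 0"
    using ev_simps(4)[of "[:[:\<zeta> ^ k:]:]" p] by (simp add: ev_simps(6) ev_const px_const)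
  moreover have "degree (tw \<zeta> p - smult [:\<zeta> ^ k:] p) < N"
    by (intro degree_diff_less degree_tw pq le_less_trans[OF degree_smult_le])
  ultimately have "tw \<zeta> p = smult [:\<zeta> ^ k:] p" using ev_eq_0 by force
  from fixed_coeffs[OF pq(4) k this] have "p = [:coeff p k:] * monom 1 k" by (simp add: smult_monom)
  then have "ev p = px (coeff p k) * y ^ k" by (metis ev_simps(4) ev_const ev_monom)
  then show ?thesis using pq by (auto simp: mult.commute)
qed

lemma z_invariant: "w \<in> K \<Longrightarrow> z w = w \<Longrightarrow> \<exists>p q. q \<noteq> 0 \<and> w = px p / px q"
  using z_eigen[of w 0] N by (simp add: i_simps)

text \<open>Hilbert's Theorem 90: some power of \<open>y\<close> has a nonzero Lagrange resolvent.\<close>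

lemma hilbert_90:
  assumes u: "u \<in> K" and norm: "(\<Prod>k<N. (z ^^ k) u) = 1"
  shows "\<exists>w\<in>K. w \<noteq> 0 \<and> u * w = z w"
proof -
  define c where "c = (\<lambda>n. \<Prod>k<n. (z ^^ k) u)"
  have cK: "c n \<in> K" for n unfolding c_def by (intro is_subring_prod is_subfieldD(1)[OF subfield_K]) (use u in auto)
  have zc: "u * z (c n) = c (Suc n)" for n
    unfolding c_def using u by (simp only: prod.lessThan_Suc_shift) (simp add: hom_on_prod[OF z(1) subfield_K])
  \<comment> \<open>The Lagrange resolvent of \<open>y ^ j\<close>, formed with the cocycle
    \<open>c\<close> generated by \<open>u\<close>.\<close>
  define \<beta> where "\<beta> = (\<lambda>j. \<Sum>n<N. c n * (z ^^ n) (y ^ j))"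
  have zy: "(z ^^ n) (y ^ j) = i (\<zeta> ^ (n * j)) * y ^ j" for n j
    by (induction n) (auto simp: z_simps K_closed i_simps power_add power_mult_distrib mult_ac simp flip: power_mult)
  have \<beta>K: "\<beta> j \<in> K" for j unfolding \<beta>_def
    by (intro is_subring_sum is_subfieldD(1)[OF subfield_K] K_closed(4,7) zpow_K y_K cK)
  have "u * z (\<beta> j) = \<beta> j" for j
  proof -
    have "u * z (\<beta> j) = (\<Sum>n<N. c (Suc n) * (z ^^ Suc n) (y ^ j))"
      unfolding \<beta>_def using cK
      by (subst hom_on_sum[OF z(1) subfield_K]) (auto simp: K_closed sum_distrib_left z_simps zc[symmetric] mult.assoc)
    also have "\<dots> = \<beta> j"
    proof -
      have "(\<Sum>n<N. c (Suc n) * (z ^^ Suc n) (y ^ j)) + c 0 * (z ^^ 0) (y ^ j) = (\<Sum>n<Suc N. c n * (z ^^ n) (y ^ j))"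
        by (simp only: sum.lessThan_Suc_shift add.commute)
      also have "\<dots> = \<beta> j + c N * (z ^^ N) (y ^ j)" by (simp add: \<beta>_def)
      finally show ?thesis using norm zpow_N[of "y ^ j"] by (simp add: c_def K_closed)
    qed
    finally show ?thesis .
  qed
  moreover have "\<exists>j<N. \<beta> j \<noteq> 0"
  proof (rule ccontr)
    assume "\<not> ?thesis"
    then have "(\<Sum>n<N. c n * i (\<zeta> ^ (n * j))) * y ^ j = 0" if "j < N" for j
      using that by (simp add: \<beta>_def zy sum_distrib_right mult.assoc)
    then have "(\<Sum>n<N. c n * i (\<zeta> ^ (n * j))) = 0" if "j < N" for j using that y_nonzero by auto
    \<comment> \<open>Summing the relations over \<open>j\<close> isolates the term
      \<open>n = 0\<close> by orthogonality of the characters. There \<open>c 0 = 1\<close>, so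
      \<open>N\<close> would vanish in characteristic zero.\<close>
    then have "0 = (\<Sum>j<N. \<Sum>n<N. c n * i (\<zeta> ^ (n * j)))" by simp
    also have "\<dots> = (\<Sum>n<N. c n * i (\<Sum>j<N. (\<zeta> ^ n) ^ j))"
      by (subst sum.swap) (simp add: sum_distrib_left i_simps power_mult)
    also have "\<dots> = (\<Sum>n<N. if n = 0 then i (of_nat N) else 0)"
    proof (intro sum.cong refl)
      fix n assume n: "n \<in> {..<N}"
      show "c n * i (\<Sum>j<N. (\<zeta> ^ n) ^ j) = (if n = 0 then i (of_nat N) else 0)"
      proof (cases "n = 0")
        case False
        then have "\<zeta> ^ n \<noteq> 1" using \<zeta>(2) n by auto
        then have "(\<Sum>j<N. (\<zeta> ^ n) ^ j) = 0" using \<zeta>_pow[of n] by (simp add: sum_gp_strict)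
        then show ?thesis using False by (simp add: i_simps)
      qed (simp add: c_def)
    qed
    also have "\<dots> = i (of_nat N)" using N by simp
    finally show False using N i_simps(12)[of "of_nat N"] by simp
  qed
  ultimately obtain j where j: "u * z (\<beta> j) = \<beta> j" "\<beta> j \<noteq> 0" by blast
  then show ?thesis using \<beta>K[of j]
    by (intro bexI[of _ "inverse (\<beta> j)"]) (auto simp: z_simps field_simps K_closed)
qed

end

subsection \<open>Points of the curve are discrete valuation rings\<close>

definition units_of_ring :: "'a :: field set \<Rightarrow> 'a set"
  where "units_of_ring P = {w \<in> P. w \<noteq> 0 \<and> inverse w \<in> P}"

lemma units_of_ring:
  assumes "is_subring P"
  shows "1 \<in> units_of_ring P" "a \<in> units_of_ring P \<Longrightarrow> b \<in> units_of_ring P \<Longrightarrow> a * b \<in> units_of_ring P"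
    "a \<in> units_of_ring P \<Longrightarrow> inverse a \<in> units_of_ring P" "a \<in> units_of_ring P \<Longrightarrow> a \<noteq> 0"
    "a \<in> units_of_ring P \<Longrightarrow> b \<in> units_of_ring P \<Longrightarrow> a / b \<in> units_of_ring P"
    "a \<in> units_of_ring P \<Longrightarrow> a powi m \<in> units_of_ring P" "a \<in> units_of_ring P \<Longrightarrow> a ^ n \<in> units_of_ring P"
proof -
  note s = is_subring_closed[OF assms]
  show 1: "1 \<in> units_of_ring P" and m: "a \<in> units_of_ring P \<Longrightarrow> b \<in> units_of_ring P \<Longrightarrow> a * b \<in> units_of_ring P"
    and i: "a \<in> units_of_ring P \<Longrightarrow> inverse a \<in> units_of_ring P" and "a \<in> units_of_ring P \<Longrightarrow> a \<noteq> 0" for a b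
    using s by (auto simp: units_of_ring_def)
  show "a \<in> units_of_ring P \<Longrightarrow> b \<in> units_of_ring P \<Longrightarrow> a / b \<in> units_of_ring P"
    unfolding divide_inverse by (intro m i)
  show p: "a \<in> units_of_ring P \<Longrightarrow> a ^ n \<in> units_of_ring P" for a n by (induction n) (auto intro: 1 m)
  show "a \<in> units_of_ring P \<Longrightarrow> a powi m \<in> units_of_ring P" unfolding power_int_def by (auto intro: p i)
qed

lemma units_iff_max_ideal: "w \<in> units_of_ring P \<longleftrightarrow> w \<in> P \<and> w \<notin> max_ideal P"
  by (auto simp: units_of_ring_def max_ideal_def)

lemma power_in_units:
  assumes V: "valuation_ring L P" "w \<in> L" and "w ^ n \<in> units_of_ring P" "n > 0"
  shows "w \<in> units_of_ring P"
proof -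
  note s = is_subring_closed[OF valuation_ringD(1)[OF V(1)]]
  have wn: "w ^ n \<in> P" "inverse (w ^ n) \<in> P" "w ^ n \<noteq> 0" using assms(3) by (auto simp: units_of_ring_def)
  obtain k where n: "n = Suc k" using assms(4) by (cases n) auto
  have w0: "w \<noteq> 0" using wn(3) n by auto
  have "w \<in> P \<and> inverse w \<in> P"
  proof (cases "w \<in> P")
    case True
    have "inverse w = w ^ k * inverse (w ^ n)" using w0 by (simp add: n)
    moreover have "w ^ k * inverse (w ^ n) \<in> P" by (intro s(4,7) True wn)
    ultimately show ?thesis using True by simp
  next
    case False
    then have iw: "inverse w \<in> P" using valuation_ringD(4)[OF V] by auto
    have "w = inverse w ^ k * w ^ n" using w0 by (simp add: n power_inverse)
    moreover have "inverse w ^ k * w ^ n \<in> P" by (intro s(4,7) iw wn)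
    ultimately show ?thesis using iw by simp
  qed
  then show ?thesis using w0 by (simp add: units_of_ring_def)
qed

text \<open>Inside its \<open>THE\<close>, \<open>ord_at\<close> admits every generator of the
  maximal ideal. Two generators differ by a unit, and no nonzero power of a generator is a unit, so
  the exponent is determined.\<close>

lemma ord_at_eqI:
  assumes V: "valuation_ring L P" and t: "max_ideal P = (\<lambda>a. t * a) ` P" "t \<noteq> 0"
    and u: "w / t powi m \<in> units_of_ring P"
  shows "ord_at P w = m"
  unfolding ord_at_def
proof (rule the_equality)
  note sP = valuation_ringD(1)[OF V]
  note s = is_subring_closed[OF sP] and U = units_of_ring[OF sP]
  show "\<exists>t u. max_ideal P = (\<lambda>a. t * a) ` P \<and> u \<in> P \<and> u \<noteq> 0 \<and> inverse u \<in> P \<and> w = t powi m * u"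
    using t u by (intro exI[of _ t] exI[of _ "w / t powi m"]) (auto simp: units_of_ring_def)
  fix m' assume "\<exists>t u. max_ideal P = (\<lambda>a. t * a) ` P \<and> u \<in> P \<and> u \<noteq> 0 \<and> inverse u \<in> P \<and> w = t powi m' * u"
  then obtain t' u' where t': "max_ideal P = (\<lambda>a. t' * a) ` P" "u' \<in> units_of_ring P" "w = t' powi m' * u'"
    by (auto simp: units_of_ring_def)
  have tm: "t \<in> max_ideal P" "t' \<in> max_ideal P"
    using imageI[OF s(1), of "\<lambda>a. t * a"] imageI[OF s(1), of "\<lambda>a. t' * a"] t(1) t'(1) by simp_all
  obtain a where a: "t' = t * a" "a \<in> P" using tm(2) t(1) by auto
  obtain b where b: "t = t' * b" "b \<in> P" using tm(1) t'(1) by auto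
  note ab = a(1) b(1) a(2) b(2)
  have "t * (a * b) = t" using ab by (simp add: mult.assoc[symmetric])
  then have "a * b = 1" using t(2) by simp
  then have "a \<in> units_of_ring P" using ab by (auto simp: units_of_ring_def inverse_unique)
  have w: "w = t powi m' * (a powi m' * u')" using t'(3) ab(1) by (simp add: power_int_mult_distrib)
  have "w / t powi m = t powi (m' - m) * (a powi m' * u')"
    using t(2) by (simp add: w power_int_diff)
  then have "t powi (m' - m) = (w / t powi m) / (a powi m' * u')"
    using U(4)[OF U(2)[OF U(6)[OF \<open>a \<in> units_of_ring P\<close>] t'(2)]] by simp
  then have tu: "t powi (m' - m) \<in> units_of_ring P"
    using U(5)[OF u U(2)[OF U(6)[OF \<open>a \<in> units_of_ring P\<close>] t'(2)]] by simp
  have "m' - m = 0"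
  proof (rule ccontr)
    assume d: "m' - m \<noteq> 0"
    have "t ^ nat \<bar>m' - m\<bar> \<in> units_of_ring P"
      using tu U(3)[OF tu] by (cases "m' - m \<ge> 0") (auto simp: power_int_def power_inverse split: if_splits)
    moreover have tP: "t \<in> P" using tm(1) by (rule max_idealD)
    moreover obtain k where "nat \<bar>m' - m\<bar> = Suc k" using d by (cases "nat \<bar>m' - m\<bar>") auto
    ultimately have "inverse (t ^ Suc k) \<in> P" by (simp add: units_of_ring_def)
    moreover have "inverse t = t ^ k * inverse (t ^ Suc k)" using t(2) by (simp add: field_simps)
    ultimately have "inverse t \<in> P" using s tP by metis
    then show False using tm(1) t(2) by (simp add: max_ideal_def)
  qed
  then show "m' = m" by simp
qed

lemma fps_of_pcompose: "poly (map_poly fps_const q) (fps_of_poly s) = fps_of_poly (pcompose q s)"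
  by (induction q) (simp_all add: map_poly_pCons pcompose_pCons fps_of_poly_add fps_of_poly_mult fps_of_poly_const)

lemma rhom_fps_const: "rhom (fps_const :: 'a :: comm_ring_1 \<Rightarrow> _)"
  by (simp add: rhom_def fps_const_add[symmetric] fps_const_mult[symmetric] del: fps_const_add fps_const_mult)

lemma fps_nth_root:
  fixes H :: "'c :: {alg_closed_field, field_char_0} fps"
  assumes "fps_nth H 0 \<noteq> 0" "n > 0"
  shows "\<exists>Y. Y ^ n = H"
proof -
  obtain m where m: "n = Suc m" using assms(2) by (cases n) auto
  obtain c where c: "c ^ n = fps_nth H 0" using nth_root_exists[OF assms(2)] by blast
  then show ?thesis using power_radical[OF assms(1), of "\<lambda>_ _. c" m] m by auto
qed

context superelliptic
begin

lemma pointsD: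
  assumes "P \<in> points i K"
  shows "valuation_ring K P" "i c \<in> P" "c \<noteq> 0 \<Longrightarrow> i c \<in> units_of_ring P"
proof -
  show V: "valuation_ring K P" and "i c \<in> P" for c using assms by (auto simp: points_def)
  then show "c \<noteq> 0 \<Longrightarrow> i c \<in> units_of_ring P"
    using i_simps(10)[of c] i_simps(12)[of c] by (auto simp: units_of_ring_def simp flip: i_simps(10))
qed

text \<open>\<open>R\<close> may exceed the root set, so that numerator and denominator of a
  rational function can be factored over a common set.\<close>

lemma px_factor:
  assumes "q \<noteq> 0" "finite R" "{a. poly q a = 0} \<subseteq> R"
  shows "px q = i (lead_coeff q) * (\<Prod>a\<in>R. (x - i a) ^ order a q)"
proof -
  obtain A where A: "q = smult (lead_coeff q) (\<Prod>a\<in>#A. [:- a, 1:])" using alg_closed_imp_factorization[OF assms(1)] by blast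
  have pr: "proots (\<Prod>a\<in>#B. [:- a, 1:]) = B" for B :: "'a multiset"
  proof (induction B)
    case (add b B)
    have "(\<Prod>a\<in>#B. [:- a, 1:]) \<noteq> 0" by (auto simp: prod_mset_zero_iff)
    then have "proots ([:- b, 1:] * (\<Prod>a\<in>#B. [:- a, 1:])) = {#b#} + B"
      using add by (subst proots_mult) (auto simp del: mult_pCons_left)
    then show ?case by simp
  qed simp
  have "proots q = A" using assms(1) by (subst A) (simp add: pr)
  then have cA: "count A a = order a q" for a using assms(1) by auto
  have "px (\<Prod>a\<in>#B. [:- a, 1:]) = (\<Prod>a\<in>#B. x - i a)" for B
    by (induction B) (simp_all add: px_simps px_const i_simps del: mult_pCons_left)
  then have "px q = i (lead_coeff q) * (\<Prod>a\<in>#A. x - i a)" by (subst A) (simp add: px_const)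
  also have "(\<Prod>a\<in>#A. x - i a) = (\<Prod>a\<in>set_mset A. (x - i a) ^ count A a)"
    by (rule image_prod_mset_multiplicity)
  also have "\<dots> = (\<Prod>a\<in>R. (x - i a) ^ count A a)"
  proof (rule prod.mono_neutral_left)
    show "set_mset A \<subseteq> R" using assms(1,3) cA by (auto simp: order_root simp flip: count_greater_zero_iff)
    show "\<forall>a\<in>R - set_mset A. (x - i a) ^ count A a = 1" by (auto simp: not_in_iff)
  qed (rule assms(2))
  finally show ?thesis by (simp add: cA)
qed

lemma x_diff_nonzero: "x - i a \<noteq> 0"
  using px_eq_0[of "[:- a, 1:]"] by (simp add: px_const i_simps)

text \<open>The trace of \<open>P\<close> on the projective line. A parameter is
  \<open>x - i a\<close> for the value \<open>a\<close> of \<open>x\<close>, or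
  \<open>inverse x\<close> at a pole; if every \<open>x - i a\<close> is a unit of \<open>P\<close>,
  then \<open>t = 1\<close> serves.\<close>

lemma rational_uniformizer:
  assumes P: "P \<in> points i K"
  shows "\<exists>t\<in>K. t \<noteq> 0 \<and> (\<forall>q. q \<noteq> 0 \<longrightarrow> (\<exists>m. px q / t powi m \<in> units_of_ring P))"
proof -
  note V = pointsD(1)[OF P]
  note sP = valuation_ringD(1)[OF V]
  note s = is_subring_closed[OF sP] and U = units_of_ring[OF sP] and MP = prime_max_ideal[OF subfield_K V]
  have main: ?thesis if t: "t \<in> K" "t \<noteq> 0" and lin: "\<And>a. \<exists>m. (x - i a) / t powi m \<in> units_of_ring P" for t
  proof (intro bexI[OF _ t(1)] conjI allI impI t(2))
    fix q :: "'a poly" assume q: "q \<noteq> 0"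
    define R where "R = {a. poly q a = 0}"
    have fR: "finite R" unfolding R_def by (rule poly_roots_finite[OF q])
    obtain m where m: "\<And>a. (x - i a) / t powi m a \<in> units_of_ring P" using lin by metis
    have "\<exists>k. (\<Prod>a\<in>Z. (x - i a) ^ e a) / t powi k \<in> units_of_ring P" if "finite Z" for Z e
      using that
    proof (induction Z rule: finite_induct)
      case empty
      then show ?case using U(1) by (auto intro: exI[of _ 0])
    next
      case (insert a Z)
      then obtain k where k: "(\<Prod>a\<in>Z. (x - i a) ^ e a) / t powi k \<in> units_of_ring P" by blast
      have "((x - i a) / t powi m a) ^ e a * ((\<Prod>a\<in>Z. (x - i a) ^ e a) / t powi k) \<in> units_of_ring P"
        by (intro U(2,7) m k)
      also have "((x - i a) / t powi m a) ^ e a * ((\<Prod>a\<in>Z. (x - i a) ^ e a) / t powi k)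
        = (\<Prod>a\<in>insert a Z. (x - i a) ^ e a) / t powi (m a * int (e a) + k)"
        using insert t(2) by (simp add: power_divide power_int_add power_int_mult)
      finally show ?case by blast
    qed
    from this[OF fR, of "\<lambda>a. order a q"] obtain k where k: "(\<Prod>a\<in>R. (x - i a) ^ order a q) / t powi k \<in> units_of_ring P" by blast
    have "i (lead_coeff q) * ((\<Prod>a\<in>R. (x - i a) ^ order a q) / t powi k) \<in> units_of_ring P"
      using q by (intro U(2) k pointsD(3)[OF P]) auto
    then show "\<exists>m. px q / t powi m \<in> units_of_ring P"
      using px_factor[OF q fR] by (auto simp: R_def)
  qed
  show ?thesis
  proof (cases "x \<in> P")
    case True
    show ?thesis
    proof (cases "\<exists>a. x - i a \<in> max_ideal P")
      case True
      then obtain a where a: "x - i a \<in> max_ideal P" by blast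
      have "\<exists>m. (x - i b) / (x - i a) powi m \<in> units_of_ring P" for b
      proof (cases "b = a")
        case True
        then show ?thesis using U(1) x_diff_nonzero by (intro exI[of _ 1]) auto
      next
        case False
        have "i (a - b) \<in> units_of_ring P" using False by (intro pointsD(3)[OF P]) auto
        moreover have "x - i b = (x - i a) + i (a - b)" by (simp add: i_simps)
        moreover have "x - i b \<in> P" using \<open>x \<in> P\<close> pointsD(2)[OF P] s by auto
        ultimately have "x - i b \<in> units_of_ring P"
          using prime_idealD(10)[OF MP, of "x - i b" "x - i a"] a by (auto simp: units_iff_max_ideal)
        then show ?thesis by (intro exI[of _ 0]) simp
      qed
      then show ?thesis using x_diff_nonzero by (intro main[of "x - i a"]) (auto intro!: K_closed)
    next
      case False
      then have "x - i b \<in> units_of_ring P" for b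
        using \<open>x \<in> P\<close> pointsD(2)[OF P] s by (auto simp: units_iff_max_ideal)
      then show ?thesis using K_closed by (intro main[of 1]) auto
    qed
  next
    case False
    then have ix: "inverse x \<in> max_ideal P" by (intro inverse_max_ideal[OF V]) auto
    have x0: "x \<noteq> 0" using False s by auto
    have A: "(x - i b) / inverse x powi (-1) \<in> units_of_ring P" for b
    proof -
      have e: "(x - i b) / inverse x powi (-1) = 1 - i b * inverse x" using x0 by (simp add: field_simps)
      have m: "i b * inverse x \<in> max_ideal P" using ix pointsD(2)[OF P] by (intro prime_idealD(6)[OF MP])
      then have "1 - i b * inverse x \<notin> max_ideal P"
        using prime_idealD(4)[OF MP] prime_idealD(5)[OF MP, of "1 - i b * inverse x" "i b * inverse x"] by auto
      moreover have "1 - i b * inverse x \<in> P" using m s by (auto dest: max_idealD)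
      ultimately show ?thesis unfolding e by (auto simp: units_iff_max_ideal)
    qed
    show ?thesis
    proof (rule main[of "inverse x"])
      show "\<exists>m. (x - i b) / inverse x powi m \<in> units_of_ring P" for b using A by blast
    qed (use x0 in \<open>auto intro: K_closed\<close>)
  qed
qed

lemma poly_hom_on_mult:
  assumes "hom_on K \<tau>" "p \<in> polys K" "q \<in> polys K"
  shows "map_poly \<tau> (p * q) = map_poly \<tau> p * map_poly \<tau> q"
proof (rule poly_eqI)
  fix n
  note s = hom_on_simps[OF assms(1) subfield_K]
  show "coeff (map_poly \<tau> (p * q)) n = coeff (map_poly \<tau> p * map_poly \<tau> q) n"
    using assms(2,3) by (simp add: coeff_map_poly s(2) coeff_mult hom_on_sum[OF assms(1) subfield_K] s(4) polysD K_closed)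
qed

text \<open>Two terms of the characteristic equation of \<open>w\<close> over the rational functions in \<open>x\<close> have the
  same value at \<open>P\<close>.\<close>

lemma power_rational_value:
  assumes P: "P \<in> points i K" and t: "t \<noteq> 0" "\<And>q. q \<noteq> 0 \<Longrightarrow> \<exists>m. px q / t powi m \<in> units_of_ring P"
    and w: "w \<in> K" "w \<noteq> 0"
  shows "\<exists>d m. 0 < d \<and> d \<le> N \<and> w ^ d / t powi m \<in> units_of_ring P"
proof -
  note V = pointsD(1)[OF P]
  note sP = valuation_ringD(1)[OF V]
  note s = is_subring_closed[OF sP] and U = units_of_ring[OF sP] and MP = prime_max_ideal[OF subfield_K V]
  note rK = is_subfieldD(1)[OF subfield_K]
  define f where "f = (\<lambda>k. [:- (z ^^ k) w, 1:])"
  \<comment> \<open>The characteristic polynomial of \<open>w\<close>. It is invariant under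
    \<open>z\<close>, so its coefficients are rational functions in \<open>x\<close>, and those that
    are nonzero have the value of a power of \<open>t\<close>.\<close>
  define C where "C = (\<Prod>k<N. f k)"
  have fK: "f k \<in> polys K" for k using w K_closed by (auto simp: f_def polys_pCons_iff polys_closed[OF rK])
  have CK: "C \<in> polys K" unfolding C_def by (intro polys_prod rK fK)
  have zf: "map_poly z (f k) = f (Suc k)" for k
    using w by (simp add: f_def map_poly_pCons z_simps)
  have "map_poly z (\<Prod>k<n. f k) = (\<Prod>k<n. f (Suc k))" for n
  proof (induction n)
    case (Suc n)
    have "map_poly z ((\<Prod>k<n. f k) * f n) = map_poly z (\<Prod>k<n. f k) * map_poly z (f n)"
      by (rule poly_hom_on_mult[OF z(1) polys_prod[OF rK fK] fK])
    then show ?case by (simp add: Suc zf)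
  qed (simp add: map_poly_1' z_simps)
  then have "f 0 * map_poly z C = (\<Prod>k<Suc N. f k)" by (simp only: C_def prod.lessThan_Suc_shift)
  also have "\<dots> = f 0 * C" using zpow_N[OF w(1)] by (simp add: C_def f_def)
  finally have "f 0 * map_poly z C = f 0 * C" .
  moreover have "f 0 \<noteq> 0" by (simp add: f_def)
  ultimately have zC: "map_poly z C = C" using mult_left_cancel by blast
  have cC: "coeff C j = 0 \<or> (\<exists>m. coeff C j / t powi m \<in> units_of_ring P)" for j
  proof -
    have "z (coeff C j) = coeff C j" using zC by (metis coeff_map_poly z_simps(2))
    then obtain p q where pq: "q \<noteq> 0" "coeff C j = px p / px q" using z_invariant[OF polysD[OF CK]] by blast
    show ?thesis
    proof (cases "p = 0")
      case True
      then show ?thesis by (simp add: pq px_simps)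
    next
      case False
      obtain m m' where "px p / t powi m \<in> units_of_ring P" "px q / t powi m' \<in> units_of_ring P"
        using t(2) False pq(1) by blast
      then have "(px p / t powi m) / (px q / t powi m') \<in> units_of_ring P" by (rule U(5))
      then have "coeff C j / t powi (m - m') \<in> units_of_ring P" using t(1) by (simp add: pq(2) power_int_diff mult.commute)
      then show ?thesis by blast
    qed
  qed
  have dC: "degree C = N"
    unfolding C_def by (subst degree_prod_eq_sum_degree) (auto simp: f_def)
  have lC: "lead_coeff C = 1" unfolding C_def by (simp add: lead_coeff_prod f_def)
  \<comment> \<open>Substituting \<open>w\<close> times the variable turns the terms of the equation
    of \<open>w\<close> into coefficients with sum \<open>poly D 1 = 0\<close>. After scaling by
    \<open>c\<close> they lie in \<open>P\<close> and one of them is \<open>1\<close>, so a second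
    one must be a unit.\<close>
  define D where "D = pcompose C [:0, w:]"
  have cD: "coeff D j = w ^ j * coeff C j" for j by (simp add: D_def coeff_pcompose_linear)
  have "D \<in> polys K" using polysD[OF CK] w K_closed by (auto simp: polys_def cD)
  moreover have "D \<noteq> 0" using cD[of N] dC lC w by auto
  ultimately obtain c j0 where c: "c \<in> K" "c \<noteq> 0" "smult c D \<in> polys P" "coeff (smult c D) j0 = 1"
    using polys_scale[OF subfield_K V] by metis
  define e where "e = coeff (smult c D)"
  have eP: "e j \<in> P" for j unfolding e_def by (rule polysD[OF c(3)])
  have e0: "e j = 0" if "j > N" for j using that dC by (simp add: e_def cD coeff_eq_0)
  have j0: "j0 \<le> N" using c(4) e0[of j0] by (auto simp: e_def not_le intro: ccontr)
  have "poly C w = 0" unfolding C_def poly_prod using N by (auto simp: f_def intro!: bexI[of _ 0])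
  moreover have "poly D 1 = poly C w" by (simp add: D_def poly_pcompose)
  moreover have "poly (smult c D) 1 = (\<Sum>j\<le>N. e j)"
    unfolding poly_altdef e_def using dC by (intro sum.mono_neutral_cong_left) (auto simp: D_def degree_pcompose w coeff_eq_0)
  ultimately have "(\<Sum>j\<le>N. e j) = 0" by simp
  then have "1 = - (\<Sum>j\<in>{..N} - {j0}. e j)"
    using c(4) j0 by (simp add: sum.remove[of "{..N}" j0] e_def eq_neg_iff_add_eq_0)
  then have "(\<Sum>j\<in>{..N} - {j0}. e j) \<notin> max_ideal P"
    using prime_idealD(4)[OF MP] prime_idealD(9)[OF MP] by metis
  then obtain j where j: "j \<le> N" "j \<noteq> j0" "e j \<notin> max_ideal P" using prime_ideal_sum[OF MP] by (metis DiffE atMost_iff singletonI)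
  then have ju: "e j \<in> units_of_ring P" using eP by (simp add: units_iff_max_ideal)
  have ej: "c * w ^ j * coeff C j \<in> units_of_ring P" "c * w ^ j0 * coeff C j0 \<in> units_of_ring P"
    using ju c(4) U(1) by (auto simp: e_def cD mult.assoc)
  then have "coeff C j \<noteq> 0" "coeff C j0 \<noteq> 0" using U(4)[of 0] by auto
  then obtain m m' where m: "coeff C j / t powi m \<in> units_of_ring P" "coeff C j0 / t powi m' \<in> units_of_ring P"
    using cC by blast
  have "(c * w ^ j * coeff C j) / (coeff C j / t powi m) \<in> units_of_ring P"
    "(c * w ^ j0 * coeff C j0) / (coeff C j0 / t powi m') \<in> units_of_ring P"
    by (rule U(5)[OF ej(1) m(1)], rule U(5)[OF ej(2) m(2)])
  moreover have "a * b / (b / c) = a * c" if "b \<noteq> 0" for a b c :: 'b using that by simp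
  ultimately have q: "c * w ^ j * t powi m \<in> units_of_ring P" "c * w ^ j0 * t powi m' \<in> units_of_ring P"
    using \<open>coeff C j \<noteq> 0\<close> \<open>coeff C j0 \<noteq> 0\<close> by metis+
  show ?thesis
  proof (cases "j < j0")
    case True
    have "(c * w ^ j0 * t powi m') / (c * w ^ j * t powi m) \<in> units_of_ring P" by (intro U(5) q)
    also have "(c * w ^ j0 * t powi m') / (c * w ^ j * t powi m) = w ^ (j0 - j) / t powi (m - m')"
      using c(2) t(1) w(2) True by (simp add: power_int_diff power_diff)
    finally show ?thesis using True j0 by (intro exI[of _ "j0 - j"]) auto
  next
    case False
    have "(c * w ^ j * t powi m) / (c * w ^ j0 * t powi m') \<in> units_of_ring P" by (intro U(5) q)
    also have "(c * w ^ j * t powi m) / (c * w ^ j0 * t powi m') = w ^ (j - j0) / t powi (m' - m)"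
      using c(2) t(1) w(2) False by (simp add: power_int_diff power_diff)
    finally show ?thesis using False j by (intro exI[of _ "j - j0"]) auto
  qed
qed

text \<open>The exponent \<open>d\<close> of \<open>power_rational_value\<close> divides
  \<open>fact N\<close>, so every \<open>w ^ fact N\<close> has an integer value with respect to
  \<open>t0\<close>. An element of least positive value generates all values, by division with
  remainder; hence \<open>P\<close> is discrete.\<close>

lemma uniformizer:
  assumes P: "P \<in> points i K"
  shows "\<exists>t\<in>K. t \<noteq> 0 \<and> max_ideal P = (\<lambda>a. t * a) ` P \<and> (\<forall>w\<in>K. w \<noteq> 0 \<longrightarrow> (\<exists>m. w / t powi m \<in> units_of_ring P))"
proof -
  note V = pointsD(1)[OF P]
  note sP = valuation_ringD(1)[OF V]
  note s = is_subring_closed[OF sP] and U = units_of_ring[OF sP] and MP = prime_max_ideal[OF subfield_K V]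
  have PK: "P \<subseteq> K" using valuation_ringD(2)[OF V] .
  obtain t0 where t0: "t0 \<in> K" "t0 \<noteq> 0" "\<And>q. q \<noteq> 0 \<Longrightarrow> \<exists>m. px q / t0 powi m \<in> units_of_ring P"
    using rational_uniformizer[OF P] by blast
  define R where "R = (\<lambda>w v. w ^ fact N / t0 powi v \<in> units_of_ring P)"
  have ex: "\<exists>v. R w v" if w: "w \<in> K" "w \<noteq> 0" for w
  proof -
    obtain d m where d: "0 < d" "d \<le> N" "w ^ d / t0 powi m \<in> units_of_ring P"
      using power_rational_value[OF P t0(2,3) w] by blast
    then have "d dvd fact N" by (intro dvd_fact) auto
    then obtain k :: nat where k: "fact N = d * k" ..
    have "(w ^ d / t0 powi m) ^ k \<in> units_of_ring P" by (rule U(7)[OF d(3)])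
    also have "(w ^ d / t0 powi m) ^ k = w ^ fact N / t0 powi (m * int k)"
      by (simp add: k power_divide power_mult power_int_mult)
    finally show ?thesis by (auto simp: R_def)
  qed
  have Rdiv: "R (w / w' powi e) (v - e * v')" if "R w v" "R w' v'" for w w' v v' e
  proof -
    have "(w ^ fact N / t0 powi v) / (w' ^ fact N / t0 powi v') powi e \<in> units_of_ring P"
      by (rule U(5)[OF _ U(6)]) (use that in \<open>auto simp: R_def\<close>)
    also have "(w ^ fact N / t0 powi v) / (w' ^ fact N / t0 powi v') powi e
      = (w / w' powi e) ^ fact N / t0 powi (v - e * v')"
      using t0(2) by (simp add: power_divide power_int_divide_distrib power_int_diff power_int_mult
          mult.commute[of e] power_int_power' power_int_power)
    finally show ?thesis by (simp add: R_def)
  qed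
  have R0: "w \<in> units_of_ring P" if "R w 0" "w \<in> K" for w
    using power_in_units[OF V that(2), of "fact N"] that(1) by (simp add: R_def)
  have RU: "R w 0" if "w \<in> units_of_ring P" for w using U(7)[OF that] by (simp add: R_def)
  obtain w1 where w1: "w1 \<in> K" "w1 \<notin> P" using valuation_ringD(2,3)[OF V] by blast
  then have w10: "w1 \<noteq> 0" using s by auto
  define Sv where "Sv = {n :: nat. n > 0 \<and> (\<exists>w\<in>K. w \<noteq> 0 \<and> R w (int n))}"
  have "Sv \<noteq> {}"
  proof -
    obtain v where v: "R w1 v" using ex[OF w1(1) w10] by blast
    have "v \<noteq> 0" using R0[of w1] v w1 by (auto simp: units_of_ring_def)
    moreover have "R (1 / w1 powi 1) (0 - 1 * v)" by (rule Rdiv[OF RU[OF U(1)] v])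
    then have "R (inverse w1) (- v)" by (simp add: field_simps)
    ultimately have "nat v \<in> Sv \<or> nat (- v) \<in> Sv"
      using w1(1) w10 v K_closed(10)[OF w1(1)] by (cases "v > 0") (auto simp: Sv_def intro: bexI[of _ "inverse w1"])
    then show ?thesis by blast
  qed
  define n where "n = (LEAST n. n \<in> Sv)"
  have n: "n \<in> Sv" "\<And>m. m \<in> Sv \<Longrightarrow> n \<le> m" unfolding n_def using \<open>Sv \<noteq> {}\<close> by (auto intro: LeastI_ex Least_le)
  then obtain t1 where t1: "t1 \<in> K" "t1 \<noteq> 0" "R t1 (int n)" and n0: "n > 0" by (auto simp: Sv_def)
  have key: "\<exists>m. w / t1 powi m \<in> units_of_ring P" if w: "w \<in> K" "w \<noteq> 0" for w
  proof -
    obtain v where v: "R w v" using ex[OF w] by blast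
    define m where "m = v div int n"
    have "R (w / t1 powi m) (v - m * int n)" by (rule Rdiv[OF v t1(3)])
    moreover have "v - m * int n = v mod int n" by (simp add: m_def minus_div_mult_eq_mod)
    ultimately have r: "R (w / t1 powi m) (v mod int n)" by simp
    have wK: "w / t1 powi m \<in> K" "w / t1 powi m \<noteq> 0"
      using w t1 K_closed by (auto simp: power_int_def)
    have "v mod int n = 0"
    proof (rule ccontr)
      assume "v mod int n \<noteq> 0"
      then have "nat (v mod int n) \<in> Sv" using wK r n0 by (auto simp: Sv_def intro!: bexI[of _ "w / t1 powi m"] le_neq_trans)
      then have "n \<le> nat (v mod int n)" by (rule n(2))
      moreover have "v mod int n < int n" "0 \<le> v mod int n" using n0 by auto
      ultimately show False by linarith
    qed
    then show ?thesis using R0[OF _ wK(1)] r by auto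
  qed
  have t1u: "t1 \<notin> units_of_ring P"
  proof
    assume "t1 \<in> units_of_ring P"
    moreover obtain m where "w1 / t1 powi m \<in> units_of_ring P" using key[OF w1(1) w10] by blast
    ultimately have "(w1 / t1 powi m) * t1 powi m \<in> units_of_ring P" by (intro U(2,6))
    then show False using t1(2) w1(2) by (simp add: units_of_ring_def)
  qed
  \<comment> \<open>The value of \<open>t1\<close> is positive only relative to \<open>t0\<close>,
    which need not lie in \<open>P\<close>; so either \<open>t1\<close> or its inverse is the
    non-unit.\<close>
  define t where "t = (if t1 \<in> P then t1 else inverse t1)"
  have t: "t \<in> K" "t \<noteq> 0" using t1 K_closed(10) by (auto simp: t_def)
  have tm: "t \<in> max_ideal P" using t1u inverse_max_ideal[OF V t1(1)] by (auto simp: t_def units_iff_max_ideal)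
  have key': "\<exists>m. w / t powi m \<in> units_of_ring P" if w: "w \<in> K" "w \<noteq> 0" for w
  proof -
    obtain m where "w / t1 powi m \<in> units_of_ring P" using key[OF w] by blast
    then have "w / t powi (if t1 \<in> P then m else - m) \<in> units_of_ring P"
      by (auto simp: t_def power_int_inverse power_int_minus)
    then show ?thesis by blast
  qed
  have "max_ideal P = (\<lambda>a. t * a) ` P"
  proof
    show "(\<lambda>a. t * a) ` P \<subseteq> max_ideal P" using prime_idealD(7)[OF MP] tm by auto
    show "max_ideal P \<subseteq> (\<lambda>a. t * a) ` P"
    proof
      fix w assume w: "w \<in> max_ideal P"
      show "w \<in> (\<lambda>a. t * a) ` P"
      proof (cases "w = 0")
        case True
        then show ?thesis using s by (intro image_eqI[of _ _ 0]) auto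
      next
        case False
        have wP: "w \<in> P" using w by (rule max_idealD)
        then obtain m where m: "w / t powi m \<in> units_of_ring P" using key'[of w] PK False by blast
        have "m > 0"
        proof (rule ccontr)
          assume "\<not> m > 0"
          have "t ^ nat (- m) \<in> P" by (rule s(7)[OF max_idealD[OF tm]])
          moreover have "inverse (w / t powi m) \<in> P" using m unfolding units_of_ring_def by blast
          ultimately have "t ^ nat (- m) * inverse (w / t powi m) \<in> P" by (rule s(4))
          moreover have "t ^ nat (- m) * inverse (w / t powi m) = inverse w"
            using \<open>\<not> m > 0\<close> t(2) by (cases "m = 0") (auto simp: power_int_def field_simps)
          ultimately show False using w False by (simp add: max_ideal_def)
        qed
        then obtain k where k: "m = int (Suc k)" by (metis zero_less_imp_eq_int Suc_pred)
        have "w = t * (t ^ k * (w / t powi m))" using t(2) unfolding k power_int_of_nat by simp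
        moreover have "t ^ k * (w / t powi m) \<in> P"
          using m by (intro s(4,7) max_idealD[OF tm]) (simp add: units_of_ring_def)
        ultimately show ?thesis by blast
      qed
    qed
  qed
  then show ?thesis using t key' by blast
qed

lemma ord_at_unit:
  assumes P: "P \<in> points i K" and w: "w \<in> K" "w \<noteq> 0"
    and t: "max_ideal P = (\<lambda>a. t * a) ` P" "t \<noteq> 0"
  shows "w / t powi ord_at P w \<in> units_of_ring P"
proof -
  note V = pointsD(1)[OF P]
  note sP = valuation_ringD(1)[OF V]
  note s = is_subring_closed[OF sP] and U = units_of_ring[OF sP]
  obtain t' where t': "t' \<noteq> 0" "max_ideal P = (\<lambda>a. t' * a) ` P"
    "\<And>w. w \<in> K \<Longrightarrow> w \<noteq> 0 \<Longrightarrow> \<exists>m. w / t' powi m \<in> units_of_ring P" using uniformizer[OF P] by blast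
  obtain m where m: "w / t' powi m \<in> units_of_ring P" using t'(3)[OF w] by blast
  have tm: "t \<in> max_ideal P" "t' \<in> max_ideal P"
    using imageI[OF s(1), of "\<lambda>a. t * a"] imageI[OF s(1), of "\<lambda>a. t' * a"] t(1) t'(2) by simp_all
  obtain a where a: "t' = t * a" "a \<in> P" using tm(2) t(1) by auto
  obtain b where b: "t = t' * b" "b \<in> P" using tm(1) t'(2) by auto
  note ab = a(1) b(1) a(2) b(2)
  have "t * (a * b) = t" using ab by (simp add: mult.assoc[symmetric])
  then have "a * b = 1" using t(2) by simp
  then have au: "a \<in> units_of_ring P" using ab by (auto simp: units_of_ring_def inverse_unique)
  have "(w / t' powi m) * a powi m \<in> units_of_ring P" by (intro U(2,6) m au)
  moreover have "(w / t' powi m) * a powi m = w / t powi m"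
    using U(4)[OF au] by (simp add: ab(1) power_int_mult_distrib)
  ultimately have "w / t powi m \<in> units_of_ring P" by simp
  with ord_at_eqI[OF V t this] show ?thesis by simp
qed

lemma ord_at_simps:
  assumes P: "P \<in> points i K"
  shows "w \<in> K \<Longrightarrow> w \<noteq> 0 \<Longrightarrow> w' \<in> K \<Longrightarrow> w' \<noteq> 0 \<Longrightarrow> ord_at P (w * w') = ord_at P w + ord_at P w'"
    "w \<in> K \<Longrightarrow> w \<noteq> 0 \<Longrightarrow> ord_at P (inverse w) = - ord_at P w"
    "w \<in> K \<Longrightarrow> w \<noteq> 0 \<Longrightarrow> ord_at P (w ^ n) = int n * ord_at P w"
    "w \<in> units_of_ring P \<Longrightarrow> ord_at P w = 0" "c \<noteq> 0 \<Longrightarrow> ord_at P (i c) = 0"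
    "w \<in> K \<Longrightarrow> w \<noteq> 0 \<Longrightarrow> w' \<in> K \<Longrightarrow> w' \<noteq> 0 \<Longrightarrow> ord_at P (w / w') = ord_at P w - ord_at P w'"
proof -
  note V = pointsD(1)[OF P]
  note U = units_of_ring[OF valuation_ringD(1)[OF V]]
  obtain t where t: "max_ideal P = (\<lambda>a. t * a) ` P" "t \<noteq> 0" using uniformizer[OF P] by blast
  note o = ord_at_unit[OF P _ _ t] and e = ord_at_eqI[OF V t]
  show m: "ord_at P (w * w') = ord_at P w + ord_at P w'" if "w \<in> K" "w \<noteq> 0" "w' \<in> K" "w' \<noteq> 0" for w w'
    using U(2)[OF o o, OF that] t(2) by (intro e) (simp add: power_int_add)
  show i: "ord_at P (inverse w) = - ord_at P w" if "w \<in> K" "w \<noteq> 0" for w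
    using U(3)[OF o, OF that] t(2) by (intro e) (simp add: power_int_minus field_simps)
  show "ord_at P (w ^ n) = int n * ord_at P w" if "w \<in> K" "w \<noteq> 0" for w
    using U(7)[OF o, OF that, of n] t(2)
    by (intro e) (simp add: power_divide power_int_mult mult.commute[of "int n"])
  show u: "ord_at P w = 0" if "w \<in> units_of_ring P" for w using that by (intro e) simp
  show "c \<noteq> 0 \<Longrightarrow> ord_at P (i c) = 0" by (intro u pointsD(3)[OF P])
  show "ord_at P (w / w') = ord_at P w - ord_at P w'" if "w \<in> K" "w \<noteq> 0" "w' \<in> K" "w' \<noteq> 0" for w w'
    using m[of w "inverse w'"] i[of w'] that K_closed(10) by (simp add: divide_inverse)
qed

lemma points_image:
  assumes P: "P \<in> points i K" and \<tau>: "hom_on K \<tau>" "\<tau> ` K = K" "\<tau> ` range i = range i"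
  shows "\<tau> ` P \<in> points i K" "w \<in> K \<Longrightarrow> w \<noteq> 0 \<Longrightarrow> ord_at (\<tau> ` P) (\<tau> w) = ord_at P w"
proof -
  note V = pointsD(1)[OF P]
  note VD = valuation_ringD[OF V]
  note s = is_subring_closed[OF VD(1)]
  note h = hom_on_simps[OF \<tau>(1) subfield_K]
  have PK: "w \<in> K" if "w \<in> P" for w using that VD(2) by auto
  have mem: "\<tau> w \<in> \<tau> ` P \<longleftrightarrow> w \<in> P" if "w \<in> K" for w using h(11)[OF that] PK by auto
  have "valuation_ring K (\<tau> ` P)"
    unfolding valuation_ring_def subring_FR_iff
  proof (intro conjI ballI psubsetI)
    show "is_subring (\<tau> ` P)" unfolding is_subring_def
    proof (intro conjI ballI)
      show "1 \<in> \<tau> ` P" using s(1) h(1) by (metis image_eqI)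
      fix a b assume "a \<in> \<tau> ` P" "b \<in> \<tau> ` P"
      then obtain a' b' where "a = \<tau> a'" "b = \<tau> b'" "a' \<in> P" "b' \<in> P" by blast
      then show "a - b \<in> \<tau> ` P" "a * b \<in> \<tau> ` P"
        using s(3,4)[of a' b'] by (auto simp: h PK simp flip: h(6) h(4))
    qed
    show "\<tau> ` P \<subseteq> K" using \<tau>(2) VD(2) by auto
    show "\<tau> ` P \<noteq> K" using mem VD(2,3) \<tau>(2) by blast
    fix a assume "a \<in> K"
    then obtain w where w: "a = \<tau> w" "w \<in> K" using \<tau>(2) by auto
    then show "a \<in> \<tau> ` P \<or> inverse a \<in> \<tau> ` P"
      using VD(4)[OF w(2)] mem[OF w(2)] mem[OF K_closed(10)[OF w(2)]] by (auto simp: h)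
  qed
  moreover have "range i \<subseteq> \<tau> ` P" using \<tau>(3) pointsD(2)[OF P] by (metis image_mono image_subsetI)
  ultimately show 1: "\<tau> ` P \<in> points i K" by (simp add: points_def)
  note V' = pointsD(1)[OF 1]
  have unit: "\<tau> w \<in> units_of_ring (\<tau> ` P)" if "w \<in> units_of_ring P" for w
    using that mem by (auto simp: units_of_ring_def h PK simp flip: h(8))
  have max: "max_ideal (\<tau> ` P) = \<tau> ` max_ideal P"
    using mem K_closed(10) PK by (auto simp: max_ideal_def h simp flip: h(8))
  obtain t where t: "t \<in> K" "max_ideal P = (\<lambda>a. t * a) ` P" "t \<noteq> 0" using uniformizer[OF P] by blast
  have t': "max_ideal (\<tau> ` P) = (\<lambda>a. \<tau> t * a) ` \<tau> ` P"
    unfolding max t(2) image_image using h(4)[OF t(1)] PK by (intro image_cong) auto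
  assume w: "w \<in> K" "w \<noteq> 0"
  have tp: "\<tau> (t powi m) = \<tau> t powi m" for m
    using t(1) K_closed by (auto simp: power_int_def h power_inverse[symmetric])
  have tk: "t powi m \<in> K" for m using t(1) K_closed by (auto simp: power_int_def)
  have "\<tau> (w / t powi ord_at P w) \<in> units_of_ring (\<tau> ` P)" by (rule unit[OF ord_at_unit[OF P w t(2,3)]])
  then have "\<tau> w / \<tau> t powi ord_at P w \<in> units_of_ring (\<tau> ` P)" using w tk by (simp add: h tp)
  then show "ord_at (\<tau> ` P) (\<tau> w) = ord_at P w"
    using h(10)[OF t(1)] t(3) by (intro ord_at_eqI[OF V' t']) auto
qed

subsection \<open>Unramified points\<close>

text \<open>The point above \<open>a\<close> is obtained by expanding \<open>x\<close> and \<open>y\<close> into power series in \<open>x - a\<close>.\<close>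

lemma unramified_point:
  assumes a: "poly F a \<noteq> 0"
  shows "\<exists>P\<in>points i K. ord_at P (x - i a) = 1 \<and> ord_at P y = 0 \<and> (\<forall>q. poly q a \<noteq> 0 \<longrightarrow> ord_at P (px q) = 0)"
proof -
  define T where "T = fps_of_poly [:a, 1:]"
  define ex where "ex = (\<lambda>q. poly (map_poly fps_const q) T)"
  have ex: "ex q = fps_of_poly (pcompose q [:a, 1:])" for q by (simp add: ex_def T_def fps_of_pcompose)
  have ex0: "fps_nth (ex q) 0 = poly q a" for q by (simp add: ex coeff_pcompose_0 poly_0_coeff_0[symmetric] poly_pcompose)
  obtain Y where Y: "Y ^ N = ex F" using fps_nth_root[of "ex F" N] a N by (auto simp: ex0)
  have Y0: "fps_nth Y 0 \<noteq> 0" using arg_cong[OF Y, of "\<lambda>f. fps_nth f 0"] a N by (auto simp: ex0 fps_nth_power_0 zero_power)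
  define E where "E = (\<lambda>p. fps_to_fls (bieval fps_const T Y p))"
  have rf: "rhom (fps_to_fls :: 'a fps \<Rightarrow> _)" by (simp add: rhom_def fls_times_fps_to_fls)
  have rE: "rhom E" unfolding E_def by (rule rhom_comp[OF rf rhom_bieval[OF rhom_fps_const]])
  have Ec: "E [:q:] = fps_to_fls (ex q)" for q by (simp add: E_def ex_def bieval_simps[OF rhom_fps_const])
  have Em: "E (monom 1 n) = fps_to_fls (Y ^ n)" for n by (simp add: E_def bieval_simps[OF rhom_fps_const])
  have "E g = 0" by (simp add: g_def rhom_simps[OF rE] Ec Em Y)
  moreover have "E [:q:] \<noteq> 0" if "q \<noteq> 0" for q using that by (simp add: Ec ex pcompose_eq_0_iff fps_of_poly_eq_iff[of _ 0, simplified])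
  ultimately obtain \<psi> where \<psi>: "hom_on K \<psi>" "\<And>p. \<psi> (ev p) = E p" using hom_extend[OF rE] by blast
  note h = hom_on_simps[OF \<psi>(1) subfield_K]
  have \<psi>p: "\<psi> (px q) = fps_to_fls (ex q)" for q using \<psi>(2)[of "[:q:]"] by (simp add: ev_const Ec)
  have \<psi>y: "\<psi> y = fps_to_fls Y" using \<psi>(2)[of "monom 1 1"] Em[of 1] by (simp add: ev_monom)
  have \<psi>x: "\<psi> (x - i a) = fls_X"
  proof -
    have "ex [:- a, 1:] = fps_X" by (simp add: ex pcompose_pCons)
    then show ?thesis using \<psi>p[of "[:- a, 1:]"] by (simp add: px_const i_simps)
  qed
  have \<psi>i: "\<psi> (i c) = fps_to_fls (fps_const c)" for c using \<psi>p[of "[:c:]"] by (simp add: px_const ex fps_of_poly_const)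
  \<comment> \<open>The preimage of the ring of power series under the expansion: orders at
    \<open>P\<close> become subdegrees of Laurent series.\<close>
  define P where "P = {w \<in> K. 0 \<le> fls_subdegree (\<psi> w)}"
  have reg: "0 \<le> fls_subdegree f \<longleftrightarrow> f \<in> range fps_to_fls" for f :: "'a fls"
    using fls_regpart_to_fls_trivial[of f] fls_subdegree_fls_to_fps_gt0 by (metis rangeE rangeI)
  have V: "valuation_ring K P"
    unfolding valuation_ring_def subring_FR_iff
  proof (intro conjI ballI psubsetI)
    show "is_subring P" unfolding is_subring_def
    proof (intro conjI ballI)
      show "1 \<in> P" by (simp add: P_def K_closed h)
      fix u v assume "u \<in> P" "v \<in> P"
      then obtain f f' where "\<psi> u = fps_to_fls f" "\<psi> v = fps_to_fls f'" "u \<in> K" "v \<in> K" by (auto simp: P_def reg)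
      then show "u - v \<in> P" "u * v \<in> P" by (auto simp: P_def reg h K_closed simp flip: fps_to_fls_minus fls_times_fps_to_fls)
    qed
    show "P \<subseteq> K" by (auto simp: P_def)
    have "inverse (x - i a) \<notin> P" by (simp add: P_def h K_closed \<psi>x fls_inverse_X)
    then show "P \<noteq> K" by (auto simp: K_closed)
    fix w assume w: "w \<in> K"
    have "fls_subdegree (inverse f) = - fls_subdegree f" for f :: "'a fls"
      using fls_subdegree_power_int[of f "-1"] by (simp add: power_int_minus)
    then show "w \<in> P \<or> inverse w \<in> P" using w by (auto simp: P_def K_closed h)
  qed
  have inv: "fls_subdegree (inverse f) = - fls_subdegree f" for f :: "'a fls"
    using fls_subdegree_power_int[of f "-1"] by (simp add: power_int_minus)
  have "range i \<subseteq> P" by (auto simp: P_def \<psi>i fls_subdegree_fls_to_fps)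
  then have P: "P \<in> points i K" using V by (simp add: points_def)
  have unit: "w \<in> units_of_ring P" if "w \<in> K" "w \<noteq> 0" "fls_subdegree (\<psi> w) = 0" for w
    using that by (auto simp: units_of_ring_def P_def h K_closed inv)
  have max: "max_ideal P = (\<lambda>w. (x - i a) * w) ` P"
  proof (intro equalityI subsetI)
    fix w assume w: "w \<in> max_ideal P"
    then have wK: "w \<in> K" by (auto simp: max_ideal_def P_def)
    have "fls_subdegree (\<psi> w) > 0 \<or> w = 0"
      using w wK by (auto simp: max_ideal_def P_def h K_closed inv)
    then have "w / (x - i a) \<in> P"
    proof
      assume d: "fls_subdegree (\<psi> w) > 0"
      then have "\<psi> w \<noteq> 0" by auto
      then have "fls_subdegree (\<psi> w * inverse fls_X) = fls_subdegree (\<psi> w) - 1"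
        by (subst fls_subdegree_mult) (auto simp: inv)
      then show ?thesis using d wK by (simp add: P_def h K_closed \<psi>x divide_inverse)
    qed (simp add: P_def h K_closed)
    then show "w \<in> (\<lambda>w. (x - i a) * w) ` P" using x_diff_nonzero by (intro image_eqI[of _ _ "w / (x - i a)"]) auto
  next
    fix v assume "v \<in> (\<lambda>w. (x - i a) * w) ` P"
    then obtain w where w: "v = (x - i a) * w" "w \<in> K" "0 \<le> fls_subdegree (\<psi> w)" by (auto simp: P_def)
    show "v \<in> max_ideal P"
    proof (cases "w = 0")
      case True
      then show ?thesis using w by (simp add: max_ideal_def P_def K_closed h)
    next
      case False
      then have "\<psi> w \<noteq> 0" using w h by auto
      then have "fls_subdegree (\<psi> v) = 1 + fls_subdegree (\<psi> w)" using w by (simp add: h K_closed \<psi>x)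
      moreover have "v \<in> K" using w K_closed by auto
      ultimately show ?thesis using w(3) by (simp add: max_ideal_def P_def K_closed h(8) inv)
    qed
  qed
  have "ord_at P (x - i a) = 1"
    using x_diff_nonzero units_of_ring(1)[OF valuation_ringD(1)[OF V]] by (intro ord_at_eqI[OF V max]) auto
  moreover have "ord_at P y = 0"
    using Y0 by (intro ord_at_simps(4)[OF P] unit) (auto simp: \<psi>y fls_subdegree_fls_to_fps y_nonzero intro!: subdegreeI)
  moreover have "ord_at P (px q) = 0" if "poly q a \<noteq> 0" for q
    using that px_eq_0[of q] by (intro ord_at_simps(4)[OF P] unit) (auto simp: \<psi>p fls_subdegree_fls_to_fps ex0 intro!: subdegreeI)
  ultimately show ?thesis using P by blast
qed

end

subsection \<open>Unipotent operators on multiplicative groups\<close>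

definition mult_group :: "'a :: field set \<Rightarrow> bool"
  where "mult_group H \<longleftrightarrow> 1 \<in> H \<and> 0 \<notin> H \<and> (\<forall>a\<in>H. \<forall>b\<in>H. a * b \<in> H \<and> inverse a \<in> H)"

lemma mult_groupD:
  assumes "mult_group H"
  shows "1 \<in> H" "a \<in> H \<Longrightarrow> a \<noteq> 0" "a \<in> H \<Longrightarrow> b \<in> H \<Longrightarrow> a * b \<in> H" "a \<in> H \<Longrightarrow> inverse a \<in> H"
    "a \<in> H \<Longrightarrow> b \<in> H \<Longrightarrow> a / b \<in> H" "a \<in> H \<Longrightarrow> a ^ n \<in> H" "(\<And>j. j \<in> J \<Longrightarrow> f j \<in> H) \<Longrightarrow> prod f J \<in> H"
proof -
  show 1: "1 \<in> H" and "a \<in> H \<Longrightarrow> a \<noteq> 0" and m: "a \<in> H \<Longrightarrow> b \<in> H \<Longrightarrow> a * b \<in> H" and i: "a \<in> H \<Longrightarrow> inverse a \<in> H" for a b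
    using assms by (auto simp: mult_group_def)
  show "a \<in> H \<Longrightarrow> b \<in> H \<Longrightarrow> a / b \<in> H" unfolding divide_inverse by (intro m i)
  show "a \<in> H \<Longrightarrow> a ^ n \<in> H" by (induction n) (auto intro: 1 m)
  show "(\<And>j. j \<in> J \<Longrightarrow> f j \<in> H) \<Longrightarrow> prod f J \<in> H"
    by (induction J rule: infinite_finite_induct) (auto intro: 1 m)
qed

text \<open>The product of \<open>j\<close> and the binomial is divisible by
  \<open>p ^ (a + r)\<close>, and \<open>j\<close>, being smaller than \<open>p ^ r\<close>,
  accounts for at most \<open>r - 1\<close> of these factors.\<close>

lemma prime_power_dvd_choose:
  fixes p :: nat
  assumes p: "Factorial_Ring.prime p" and j: "0 < j" "j < p ^ r"
  shows "p ^ Suc a dvd (p ^ (a + r)) choose j"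
proof -
  obtain j' where j': "j = Suc j'" using j(1) by (cases j) auto
  have "p ^ (a + r) > 0" using p prime_gt_0_nat by simp
  then obtain L where L: "p ^ (a + r) = Suc L" using gr0_implies_Suc by blast
  have "p ^ (a + r) dvd j * (p ^ (a + r) choose j)"
    unfolding L j' using Suc_times_binomial_eq[of L j'] by (metis dvd_triv_left mult.commute)
  then obtain r1 r2 where r: "r1 + r2 = a + r" "p ^ r1 dvd j" "p ^ r2 dvd (p ^ (a + r) choose j)"
    using prime_elem_power_dvd_prod[of p "a + r" j] p by (metis prime_imp_prime_elem)
  have "p ^ r1 < p ^ r" using dvd_imp_le[OF r(2) j(1)] j(2) by simp
  then have "r1 < r" using p prime_gt_1_nat by (metis power_less_imp_less_exp)
  then have "Suc a \<le> r2" using r(1) by simp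
  then show ?thesis using r(3) by (meson dvd_trans le_imp_power_dvd)
qed

text \<open>The element \<open>\<tau> - 1\<close> of the group ring, acting on a multiplicative
  group.\<close>

definition diff_op :: "('a :: field \<Rightarrow> 'a) \<Rightarrow> 'a \<Rightarrow> 'a" where "diff_op \<tau> w = \<tau> w / w"

locale mult_action =
  fixes K :: "'a :: field set" and V :: "'a set" and \<tau> :: "'a \<Rightarrow> 'a"
  assumes K: "is_subfield K" and V: "mult_group V" "V \<subseteq> K" and \<tau>: "hom_on K \<tau>"
    and \<tau>V: "w \<in> V \<Longrightarrow> \<tau> w \<in> V"
begin

lemmas \<tau>_simps = hom_on_simps[OF \<tau> K]
lemmas V_closed = mult_groupD[OF V(1)]

lemma V_K: "w \<in> V \<Longrightarrow> w \<in> K" using V by auto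

lemma diff_op_V: "w \<in> V \<Longrightarrow> (diff_op \<tau> ^^ j) w \<in> V"
  by (induction j) (auto simp: diff_op_def intro: V_closed(5) \<tau>V)

lemma diff_op_power: "w \<in> V \<Longrightarrow> (diff_op \<tau> ^^ j) (w ^ n) = (diff_op \<tau> ^^ j) w ^ n"
  using diff_op_V by (induction j) (auto simp: diff_op_def \<tau>_simps V_K power_divide)

text \<open>The binomial theorem for \<open>\<tau> = 1 + (\<tau> - 1)\<close> in multiplicative
  notation; the induction step is Pascal's rule.\<close>

lemma pow_eq_prod_diff_op:
  assumes w: "w \<in> V"
  shows "(\<tau> ^^ L) w = (\<Prod>j\<le>L. (diff_op \<tau> ^^ j) w ^ (L choose j))"
proof (induction L)
  case (Suc L)
  define f where "f = (\<lambda>j. (diff_op \<tau> ^^ j) w)"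
  have fV: "f j \<in> V" for j unfolding f_def by (rule diff_op_V[OF w])
  have \<tau>f: "\<tau> (f j) = f j * f (Suc j)" for j
    using V_closed(2)[OF fV[of j]] by (simp add: f_def diff_op_def)
  have "(\<tau> ^^ Suc L) w = \<tau> (\<Prod>j\<le>L. f j ^ (L choose j))" using Suc by (simp add: f_def)
  also have "\<dots> = (\<Prod>j\<le>L. \<tau> (f j) ^ (L choose j))"
    using fV by (subst hom_on_prod[OF \<tau> K]) (auto simp: \<tau>_simps V_K V_closed)
  also have "\<dots> = (\<Prod>j\<le>L. f j ^ (L choose j)) * (\<Prod>j\<le>L. f (Suc j) ^ (L choose j))"
    by (simp add: \<tau>f power_mult_distrib prod.distrib)
  also have "(\<Prod>j\<le>L. f j ^ (L choose j)) = (\<Prod>j\<le>Suc L. f j ^ (L choose j))"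
    by (simp add: binomial_eq_0)
  also have "\<dots> = f 0 * (\<Prod>j\<le>L. f (Suc j) ^ (L choose Suc j))"
    by (subst prod.atMost_Suc_shift) simp
  also have "\<dots> * (\<Prod>j\<le>L. f (Suc j) ^ (L choose j)) = f 0 * (\<Prod>j\<le>L. f (Suc j) ^ (Suc L choose Suc j))"
    by (simp add: prod.distrib power_add mult_ac)
  also have "\<dots> = (\<Prod>j\<le>Suc L. f j ^ (Suc L choose j))"
    by (subst prod.atMost_Suc_shift) simp
  finally show ?case by (simp add: f_def)
qed simp

lemma split_ends:
  assumes "(L :: nat) > 0"
  shows "(\<Prod>j\<le>L. f j :: 'a) = f 0 * (\<Prod>j\<in>{0<..<L}. f j) * f L"
proof -
  have "{..L} = insert 0 (insert L {0<..<L})" using assms by auto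
  then show ?thesis using assms by (simp add: mult_ac)
qed

text \<open>In the expansion of the identity \<open>\<tau> ^^ (p ^ n)\<close> all binomials strictly
  between the ends are divisible by \<open>p\<close>, so \<open>p ^ n\<close> applications of
  \<open>diff_op\<close> lead into \<open>p\<close>-th powers. Each of the \<open>m\<close> rounds
  extracts one more factor \<open>p\<close>.\<close>

lemma nilpotent_finite_order:
  assumes p: "Factorial_Ring.prime p" and n: "n > 0" and ord: "\<And>w. w \<in> V \<Longrightarrow> (\<tau> ^^ (p ^ n)) w = w"
    and w: "w \<in> V"
  shows "\<exists>v\<in>V. (diff_op \<tau> ^^ (m * p ^ n)) w = v ^ (p ^ m)"
proof (induction m)
  case 0
  show ?case using w by auto
next
  case (Suc m)
  define L where "L = p ^ n"
  have L0: "L > 0" using p prime_gt_0_nat by (simp add: L_def)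
  have step: "\<exists>v\<in>V. (diff_op \<tau> ^^ L) u = v ^ p" if u: "u \<in> V" for u
  proof -
    define f where "f = (\<lambda>j. (diff_op \<tau> ^^ j) u)"
    have fV: "f j \<in> V" for j unfolding f_def by (rule diff_op_V[OF u])
    define A where "A = (\<Prod>j\<in>{0<..<L}. f j ^ ((L choose j) div p))"
    have AV: "A \<in> V" unfolding A_def by (intro V_closed(6,7) fV)
    have "(\<Prod>j\<in>{0<..<L}. f j ^ (L choose j)) = A ^ p"
      unfolding A_def prod_power_distrib
    proof (intro prod.cong refl)
      fix j assume j: "j \<in> {0<..<L}"
      then have "p dvd (L choose j)" using prime_power_dvd_choose[OF p, of j n 0] by (simp add: L_def)
      then show "f j ^ (L choose j) = (f j ^ ((L choose j) div p)) ^ p" by (simp flip: power_mult)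
    qed
    then have "u = u * A ^ p * f L"
      using pow_eq_prod_diff_op[OF u, of L] ord[OF u] split_ends[OF L0, of "\<lambda>j. f j ^ (L choose j)"]
      by (simp add: f_def L_def)
    then have "A ^ p * f L = 1" using V_closed(2)[OF u] by (simp add: mult.assoc)
    then have "f L = inverse A ^ p" by (metis inverse_unique power_inverse)
    then show ?thesis using V_closed(4)[OF AV] by (auto simp: f_def)
  qed
  from Suc obtain v where v: "v \<in> V" "(diff_op \<tau> ^^ (m * p ^ n)) w = v ^ (p ^ m)" by blast
  obtain v' where v': "v' \<in> V" "(diff_op \<tau> ^^ L) v = v' ^ p" using step[OF v(1)] by blast
  have "(diff_op \<tau> ^^ (Suc m * p ^ n)) w = (diff_op \<tau> ^^ L) ((diff_op \<tau> ^^ (m * p ^ n)) w)"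
    by (simp add: L_def funpow_add)
  also have "\<dots> = v' ^ (p ^ Suc m)" unfolding v(2) diff_op_power[OF v(1)] v'(2) by (simp add: power_mult)
  finally show ?case using v'(1) by blast
qed

text \<open>The exponent \<open>m + R\<close> serves both ranges of the binomial expansion: for
  \<open>0 < j < R\<close> the binomial is divisible by \<open>p ^ m\<close>, because
  \<open>R < p ^ R\<close>, and for \<open>j \<ge> R\<close> the factor lies in \<open>Q\<close> by
  nilpotency.\<close>

lemma unipotent_order:
  assumes p: "Factorial_Ring.prime p" and Q: "mult_group Q" and QV: "\<And>w. w \<in> V \<Longrightarrow> w ^ (p ^ m) \<in> Q"
    and \<tau>Q: "\<And>w. w \<in> Q \<Longrightarrow> \<tau> w \<in> Q"
    and nil: "(diff_op \<tau> ^^ R) w \<in> Q" and w: "w \<in> V"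
  shows "(\<tau> ^^ (p ^ (m + R))) w / w \<in> Q"
proof -
  note Qc = mult_groupD[OF Q]
  define L where "L = p ^ (m + R)"
  have L0: "L > 0" using p prime_gt_0_nat by (simp add: L_def)
  define f where "f = (\<lambda>j. (diff_op \<tau> ^^ j) w)"
  have fV: "f j \<in> V" for j unfolding f_def by (rule diff_op_V[OF w])
  have fQ: "f (j + R) \<in> Q" for j
    using nil by (induction j) (auto simp: f_def diff_op_def[of \<tau>] intro: Qc(5) \<tau>Q)
  have "f (Suc j) ^ (L choose Suc j) \<in> Q" for j
  proof (cases "Suc j < R")
    case True
    moreover have "R < p ^ R" using prime_gt_1_nat[OF p] by (simp add: power_gt_expt)
    ultimately have "p ^ m dvd (L choose Suc j)"
      using prime_power_dvd_choose[OF p, of "Suc j" R m] by (auto simp: L_def dest: power_le_dvd[of _ "Suc m"])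
    then obtain k where "L choose Suc j = p ^ m * k" ..
    then show ?thesis using Qc(6)[OF QV[OF fV[of "Suc j"]], of k] by (simp add: power_mult)
  next
    case False
    then show ?thesis using Qc(6)[OF fQ[of "Suc j - R"]] by simp
  qed
  then have "(\<Prod>j<L. f (Suc j) ^ (L choose Suc j)) \<in> Q" by (intro Qc(7))
  moreover have "(\<tau> ^^ L) w = w * (\<Prod>j<L. f (Suc j) ^ (L choose Suc j))"
    unfolding pow_eq_prod_diff_op[OF w]
    by (subst prod.atMost_shift) (simp add: f_def)
  ultimately show ?thesis using V_closed(2)[OF w] by (simp add: L_def)
qed

end

subsection \<open>The action of automorphisms of the constants\<close>

context superelliptic
begin

text \<open>Exactly what is needed for an action on \<open>K\<close> through the coefficients that
  fixes \<open>x\<close> and \<open>y\<close>: the equation of the curve must be preserved.\<close>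

definition stab :: "('a \<Rightarrow> 'a) set" where "stab = {\<sigma> \<in> Aut {}. map_poly \<sigma> F = F}"

definition tau :: "('a \<Rightarrow> 'a) \<Rightarrow> 'b \<Rightarrow> 'b"
  where "tau \<sigma> = (SOME \<psi>. hom_on K \<psi> \<and> (\<forall>p. \<psi> (ev p) = ev (map_poly (map_poly \<sigma>) p)))"

lemma stab_rhom: "\<sigma> \<in> stab \<Longrightarrow> rhom (map_poly (map_poly \<sigma>))"
  by (auto simp: stab_def intro: rhom_map_poly rhom_Aut)

lemma tau:
  assumes \<sigma>: "\<sigma> \<in> stab"
  shows "hom_on K (tau \<sigma>)" "tau \<sigma> (ev p) = ev (map_poly (map_poly \<sigma>) p)"
proof -
  have A: "\<sigma> \<in> Aut {}" "map_poly \<sigma> F = F" using \<sigma> by (auto simp: stab_def)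
  note D = AutD[OF A(1)]
  have "\<exists>\<psi>. hom_on K \<psi> \<and> (\<forall>p. \<psi> (ev p) = ev (map_poly (map_poly \<sigma>) p))"
  proof (rule hom_extend)
    show "rhom (\<lambda>p. ev (map_poly (map_poly \<sigma>) p))" by (rule rhom_comp[OF rhom_ev stab_rhom[OF \<sigma>]])
    have one: "map_poly \<sigma> 1 = 1" using rhom_simps(2)[OF rhom_map_poly[OF rhom_Aut[OF A(1)]]] .
    have "map_poly (map_poly \<sigma>) g = g"
      unfolding g_def rhom_simps[OF stab_rhom[OF \<sigma>]] by (simp add: map_poly_monom map_poly_pCons A(2) one)
    then show "ev (map_poly (map_poly \<sigma>) g) = 0" by (simp add: ev_g)
    fix q :: "'a poly" assume "q \<noteq> 0"
    then have "map_poly \<sigma> q \<noteq> 0" by (simp add: map_poly_eq_0_iff D)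
    then show "ev (map_poly (map_poly \<sigma>) [:q:]) \<noteq> 0" by (simp add: map_poly_pCons ev_const px_eq_0)
  qed
  from someI_ex[OF this, folded tau_def] show "hom_on K (tau \<sigma>)" "tau \<sigma> (ev p) = ev (map_poly (map_poly \<sigma>) p)" by auto
qed

lemma tau_px: "\<sigma> \<in> stab \<Longrightarrow> tau \<sigma> (px q) = px (map_poly \<sigma> q)"
  using tau(2)[of \<sigma> "[:q:]"] by (simp add: map_poly_pCons ev_const)

lemma tau_frac: "\<sigma> \<in> stab \<Longrightarrow> tau \<sigma> (ev p / px q) = ev (map_poly (map_poly \<sigma>) p) / px (map_poly \<sigma> q)"
  using hom_on_simps[OF tau(1) subfield_K] by (simp add: tau(2) tau_px)

lemma tau_simps:
  assumes \<sigma>: "\<sigma> \<in> stab"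
  shows "tau \<sigma> (i c) = i (\<sigma> c)" "tau \<sigma> x = x" "tau \<sigma> y = y" "w \<in> K \<Longrightarrow> tau \<sigma> w \<in> K"
proof -
  have A: "\<sigma> \<in> Aut {}" using \<sigma> by (auto simp: stab_def)
  note D = AutD[OF A] rhom_simps[OF rhom_map_poly[OF rhom_Aut[OF A]]]
  show "tau \<sigma> (i c) = i (\<sigma> c)" using tau_px[OF \<sigma>, of "[:c:]"] by (simp add: px_const map_poly_pCons D)
  show "tau \<sigma> x = x" using tau_px[OF \<sigma>, of "[:- 0, 1:]"] by (simp only: px_const) (simp add: map_poly_pCons D px_const i_simps)
  show "tau \<sigma> y = y" using tau(2)[OF \<sigma>, of "monom 1 1"] by (simp add: map_poly_monom D ev_monom)
  assume "w \<in> K"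
  then obtain p q where pq: "q \<noteq> 0" "w = ev p / px q" by (rule K_E)
  then show "tau \<sigma> w \<in> K" using tau_frac[OF \<sigma>] K_closed(11) by simp
qed

lemma stab_comp:
  assumes "\<sigma> \<in> stab" "\<rho> \<in> stab"
  shows "\<sigma> \<circ> \<rho> \<in> stab"
proof -
  have "\<sigma> 0 = 0" "\<rho> 0 = 0" using assms by (auto simp: stab_def AutD)
  then have "map_poly (\<sigma> \<circ> \<rho>) F = map_poly \<sigma> (map_poly \<rho> F)" by (intro poly_eqI) (simp add: coeff_map_poly)
  then show ?thesis using assms Aut_comp by (auto simp: stab_def)
qed

lemma stab_id: "id \<in> stab"
  by (simp add: stab_def Aut_id map_poly_id)

lemma stab_inv:
  assumes "\<sigma> \<in> stab"
  shows "Hilbert_Choice.inv \<sigma> \<in> stab"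
proof -
  have A: "\<sigma> \<in> Aut {}" "map_poly \<sigma> F = F" using assms by (auto simp: stab_def)
  have inv: "Hilbert_Choice.inv \<sigma> (\<sigma> a) = a" for a using AutD(2)[OF A(1)] by (simp add: bij_is_inj)
  have "map_poly (Hilbert_Choice.inv \<sigma>) (map_poly \<sigma> F) = F"
    using AutD(5)[OF A(1)] AutD(5)[OF Aut_inv[OF A(1)]] by (intro poly_eqI) (simp add: coeff_map_poly inv)
  then show ?thesis using A Aut_inv[OF A(1)] by (simp add: stab_def)
qed

lemma tau_comp:
  assumes "\<sigma> \<in> stab" "\<rho> \<in> stab" "w \<in> K"
  shows "tau (\<sigma> \<circ> \<rho>) w = tau \<sigma> (tau \<rho> w)"
proof -
  obtain p q where pq: "w = ev p / px q" using assms(3) by (rule K_E)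
  have "\<sigma> 0 = 0" "\<rho> 0 = 0" using assms by (auto simp: stab_def AutD)
  then have "map_poly (\<sigma> \<circ> \<rho>) p = map_poly \<sigma> (map_poly \<rho> p)" for p by (intro poly_eqI) (simp add: coeff_map_poly)
  moreover from this have "map_poly (map_poly (\<sigma> \<circ> \<rho>)) p = map_poly (map_poly \<sigma>) (map_poly (map_poly \<rho>) p)" for p
    by (intro poly_eqI) (simp add: coeff_map_poly)
  ultimately show ?thesis using assms by (simp add: pq tau_frac stab_comp)
qed

lemma tau_id: "w \<in> K \<Longrightarrow> tau id w = w"
proof -
  have 1: "map_poly id = (id :: 'a poly \<Rightarrow> 'a poly)" "map_poly id = (id :: 'a poly poly \<Rightarrow> 'a poly poly)"
    by (auto simp: fun_eq_iff map_poly_id)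
  show "w \<in> K \<Longrightarrow> tau id w = w" by (elim K_E) (simp add: tau_frac[OF stab_id] 1)
qed

lemma tau_image:
  assumes "\<sigma> \<in> stab"
  shows "tau \<sigma> ` K = K" "tau \<sigma> ` range i = range i"
proof -
  have b: "bij \<sigma>" using assms by (auto simp: stab_def AutD)
  have "w \<in> tau \<sigma> ` K" if w: "w \<in> K" for w
  proof (rule image_eqI)
    have "\<sigma> \<circ> Hilbert_Choice.inv \<sigma> = id" using b by (auto simp: fun_eq_iff bij_is_surj surj_f_inv_f)
    then show "w = tau \<sigma> (tau (Hilbert_Choice.inv \<sigma>) w)"
      using tau_comp[OF assms stab_inv[OF assms] w] tau_id[OF w] by simp
  qed (use tau_simps(4)[OF stab_inv[OF assms] w] in auto)
  then show "tau \<sigma> ` K = K" using tau_simps(4)[OF assms] by auto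
  have "i c \<in> tau \<sigma> ` range i" for c
    using tau_simps(1)[OF assms, of "Hilbert_Choice.inv \<sigma> c"] b by (auto simp: bij_is_surj surj_f_inv_f intro!: image_eqI[of _ _ "i (Hilbert_Choice.inv \<sigma> c)"])
  then show "tau \<sigma> ` range i = range i" using tau_simps(1)[OF assms] by auto
qed

lemma stab_funpow: "\<sigma> \<in> stab \<Longrightarrow> \<sigma> ^^ n \<in> stab"
  by (induction n) (auto intro: stab_comp simp: stab_id[unfolded id_def] stab_id)

lemma tau_funpow: "\<sigma> \<in> stab \<Longrightarrow> w \<in> K \<Longrightarrow> tau (\<sigma> ^^ n) w = (tau \<sigma> ^^ n) w"
proof (induction n)
  case 0
  then show ?case using tau_id[of w] by (simp add: id_def)
next
  case (Suc n)
  have "tau (\<sigma> ^^ Suc n) w = tau \<sigma> (tau (\<sigma> ^^ n) w)"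
    unfolding funpow.simps by (rule tau_comp[OF Suc.prems(1) stab_funpow[OF Suc.prems(1)] Suc.prems(2)])
  also have "\<dots> = (tau \<sigma> ^^ Suc n) w" unfolding Suc.IH[OF Suc.prems] by simp
  finally show ?case .
qed

lemma tau_z_commute:
  assumes \<sigma>: "\<sigma> \<in> stab" "\<sigma> \<zeta> = \<zeta>" and w: "w \<in> K"
  shows "tau \<sigma> (z w) = z (tau \<sigma> w)"
proof -
  obtain p q where pq: "q \<noteq> 0" "w = ev p / px q" using w by (rule K_E)
  have A: "\<sigma> \<in> Aut {}" using \<sigma> by (auto simp: stab_def)
  note D = AutD[OF A]
  have "map_poly (map_poly \<sigma>) (tw \<zeta> p) = tw \<zeta> (map_poly (map_poly \<sigma>) p)"
    by (intro poly_eqI) (simp add: coeff_map_poly coeff_tw D \<sigma>(2))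
  moreover have "map_poly \<sigma> q \<noteq> 0" using pq by (simp add: map_poly_eq_0_iff D)
  ultimately show ?thesis
    using zpow_frac[of q 1 p] zpow_frac[of "map_poly \<sigma> q" 1 "map_poly (map_poly \<sigma>) p"] pq(1)
    by (simp add: pq(2) tau_frac[OF \<sigma>(1)])
qed

lemma z_image: "z ` K = K" "z ` range i = range i"
proof -
  have "w \<in> z ` K" if w: "w \<in> K" for w
  proof -
    obtain m where m: "N = Suc m" using N by (cases N) auto
    have "w = z ((z ^^ m) w)" using zpow_N[OF w] m by simp
    then show ?thesis using zpow_K[OF w] by blast
  qed
  then show "z ` K = K" by auto
  show "z ` range i = range i" by (simp add: image_image)
qed

lemma root_of_unity:
  assumes "c ^ N = 1"
  shows "\<exists>j<N. c = \<zeta> ^ j"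
proof -
  define p :: "'a poly" where "p = monom 1 N - 1"
  have "coeff p N = 1" using N by (simp add: p_def Polynomial.coeff_1)
  then have p0: "p \<noteq> 0" by auto
  have "degree p \<le> N" unfolding p_def by (rule degree_diff_le) (auto simp: degree_monom_le)
  then have "card {a. poly p a = 0} \<le> N" using card_poly_roots_bound[OF p0] by linarith
  moreover have "(\<lambda>j. \<zeta> ^ j) ` {..<N} \<subseteq> {a. poly p a = 0}" using \<zeta>_pow by (auto simp: p_def poly_monom)
  moreover have "card ((\<lambda>j. \<zeta> ^ j) ` {..<N}) = N"
    using \<zeta>_eq_iff by (subst card_image) (auto intro!: inj_onI)
  ultimately have "(\<lambda>j. \<zeta> ^ j) ` {..<N} = {a. poly p a = 0}"
    using poly_roots_finite[OF p0] by (intro card_seteq) auto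
  moreover have "poly p c = 0" using assms by (simp add: p_def poly_monom)
  ultimately show ?thesis by blast
qed

section \<open>Functions with divisor divisible by M, modulo M-th powers\<close>

definition Vgrp :: "nat \<Rightarrow> 'b set"
  where "Vgrp M = {w \<in> K. w \<noteq> 0 \<and> (\<forall>P\<in>points i K. int M dvd ord_at P w)}"

text \<open>All constants are \<open>M\<close>-th powers, so functions with the same divisor agree
  modulo this group, and the quotient of \<open>Vgrp M\<close> by it corresponds to
  \<open>M\<close>-torsion divisor classes.\<close>

definition Qgrp :: "nat \<Rightarrow> 'b set"
  where "Qgrp M = {u ^ M | u. u \<in> K \<and> u \<noteq> 0}"

lemma mult_group_Vgrp: "mult_group (Vgrp M)" "Vgrp M \<subseteq> K"
proof -
  have "ord_at P 1 = 0" if "P \<in> points i K" for P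
    using ord_at_simps(5)[OF that, of 1] by (simp add: i_simps)
  then show "mult_group (Vgrp M)"
    by (auto simp: mult_group_def Vgrp_def K_closed ord_at_simps)
qed (auto simp: Vgrp_def)

lemma mult_group_Qgrp: "mult_group (Qgrp M)"
  unfolding mult_group_def
proof (intro conjI ballI)
  show "1 \<in> Qgrp M" using K_closed(1) by (force simp: Qgrp_def intro: exI[of _ 1])
  show "0 \<notin> Qgrp M" by (auto simp: Qgrp_def)
  fix a b assume "a \<in> Qgrp M" "b \<in> Qgrp M"
  then obtain u v where *: "a = u ^ M" "b = v ^ M" "u \<in> K" "v \<in> K" "u \<noteq> 0" "v \<noteq> 0" by (auto simp: Qgrp_def)
  then have "a * b = (u * v) ^ M" "inverse a = inverse u ^ M" by (auto simp: power_inverse power_mult_distrib)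
  moreover have "u * v \<in> K" "inverse u \<in> K" "u * v \<noteq> 0" "inverse u \<noteq> 0" using * K_closed by auto
  ultimately show "a * b \<in> Qgrp M" "inverse a \<in> Qgrp M" unfolding Qgrp_def by blast+
qed

lemma Qgrp_power: "w \<in> K \<Longrightarrow> w \<noteq> 0 \<Longrightarrow> w ^ M \<in> Qgrp M"
  by (auto simp: Qgrp_def)

text \<open>The order of \<open>\<tau> w\<close> at \<open>P\<close> is read off at the preimage of
  \<open>P\<close>, which is why a right inverse \<open>\<rho>\<close> of the same kind is
  required.\<close>

lemma Vgrp_image:
  assumes "hom_on K \<tau>" "\<tau> ` K = K" "\<tau> ` range i = range i" "\<rho> ` K = K"
    "hom_on K \<rho>" "\<rho> ` range i = range i" "\<And>w. w \<in> K \<Longrightarrow> \<tau> (\<rho> w) = w" and w: "w \<in> Vgrp M"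
  shows "\<tau> w \<in> Vgrp M"
  unfolding Vgrp_def
proof (intro CollectI conjI ballI)
  have wK: "w \<in> K" "w \<noteq> 0" using w by (auto simp: Vgrp_def)
  show "\<tau> w \<in> K" "\<tau> w \<noteq> 0" using wK assms hom_on_simps(10)[OF assms(1) subfield_K] by auto
  fix P assume P: "P \<in> points i K"
  have R: "\<rho> ` P \<in> points i K" by (rule points_image[OF P assms(5,4,6)])
  have "P \<subseteq> K" using valuation_ringD(2)[OF pointsD(1)[OF P]] .
  then have "\<tau> ` \<rho> ` P = P" using assms(7) by (force simp: image_image)
  then have "ord_at P (\<tau> w) = ord_at (\<rho> ` P) w" using points_image(2)[OF R assms(1-3) wK] by simp
  then show "int M dvd ord_at P (\<tau> w)" using w R by (auto simp: Vgrp_def)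
qed

lemma z_Vgrp: "w \<in> Vgrp M \<Longrightarrow> z w \<in> Vgrp M"
proof (rule Vgrp_image[of z "z ^^ (N - 1)"])
  have im: "(z ^^ k) ` A = A" if "z ` A = A" for k A
  proof (induction k)
    case (Suc k)
    have "(z ^^ Suc k) ` A = z ` ((z ^^ k) ` A)" by (simp add: image_image)
    then show ?case using Suc that by simp
  qed simp
  have *: "(z ^^ k) ` K = K \<and> (z ^^ k) ` range i = range i" for k
    using z_image im by simp
  show "(z ^^ (N - 1)) ` K = K" "(z ^^ (N - 1)) ` range i = range i" using * by auto
  show "z ((z ^^ (N - 1)) w) = w" if "w \<in> K" for w
    using zpow_N[OF that] N by (cases N) auto
qed (use z_image z(1) zpow_hom in auto)

lemma tau_Vgrp:
  assumes "\<sigma> \<in> stab" "w \<in> Vgrp M"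
  shows "tau \<sigma> w \<in> Vgrp M"
proof (rule Vgrp_image[of "tau \<sigma>" "tau (Hilbert_Choice.inv \<sigma>)"])
  note s' = stab_inv[OF assms(1)]
  have b: "bij \<sigma>" using assms by (auto simp: stab_def AutD)
  have "\<sigma> \<circ> Hilbert_Choice.inv \<sigma> = id" using b by (auto simp: fun_eq_iff bij_is_surj surj_f_inv_f)
  then show "tau \<sigma> (tau (Hilbert_Choice.inv \<sigma>) w) = w" if "w \<in> K" for w
    using tau_comp[OF assms(1) s' that] tau_id[OF that] by simp
qed (use tau_image tau(1) assms stab_inv in auto)

lemma hom_Qgrp:
  assumes "hom_on K \<tau>" "\<And>w. w \<in> K \<Longrightarrow> \<tau> w \<in> K" "w \<in> Qgrp M"
  shows "\<tau> w \<in> Qgrp M"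
  using assms hom_on_simps(7,10)[OF assms(1) subfield_K] by (auto simp: Qgrp_def)

end

section \<open>Branch products and the unipotent action of constant automorphisms\<close>

locale kummer = superelliptic i x y N F \<zeta>
  for i :: "'a :: {alg_closed_field, field_char_0} \<Rightarrow> 'b :: field" and x y N F \<zeta> +
  fixes ell n :: nat and S :: "'a set" and lam :: 'a and e :: "'a \<Rightarrow> nat"
  assumes ell: "Factorial_Ring.prime ell" and n: "n > 0" and N_eq: "N = ell ^ n"
    and S: "finite S" and lam: "lam \<noteq> 0" and F_eq: "F = smult lam (\<Prod>s\<in>S. [:- s, 1:] ^ e s)"
begin

definition branch :: "nat \<Rightarrow> ('a \<Rightarrow> nat) \<Rightarrow> 'b"
  where "branch j b = y ^ j * (\<Prod>s\<in>S. (x - i s) ^ b s)"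

lemma branch_K: "branch j b \<in> K" "branch j b \<noteq> 0"
proof -
  show "branch j b \<in> K" unfolding branch_def
    by (intro K_closed(4,7) y_K is_subring_prod[OF is_subfieldD(1)[OF subfield_K]] K_closed(3) x_K i_K)
  show "branch j b \<noteq> 0" using x_diff_nonzero y_nonzero S by (simp add: branch_def)
qed

text \<open>The exponents outside of \<open>S\<close> are divisible by \<open>M\<close>, as seen at the unramified points.\<close>

lemma invariant_classes:
  assumes M: "M > 0" and G: "G \<in> Vgrp M" and u: "u \<in> K" "u \<noteq> 0" and e: "z G = G * u ^ M"
  shows "\<exists>j b v. v \<in> K \<and> v \<noteq> 0 \<and> G = branch j b * v ^ M"
proof -
  have GK: "G \<in> K" "G \<noteq> 0" and GV: "\<And>P. P \<in> points i K \<Longrightarrow> int M dvd ord_at P G" using G by (auto simp: Vgrp_def)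
  \<comment> \<open>Iterating \<open>z G = G * u ^ M\<close> once around the cycle gives
    \<open>nu ^ M = 1\<close> for the norm of \<open>u\<close>, which is therefore a
    constant.\<close>
  define nu where "nu = (\<Prod>k<N. (z ^^ k) u)"
  have zG: "(z ^^ k) G = G * (\<Prod>j<k. (z ^^ j) u) ^ M" for k
  proof (induction k)
    case (Suc k)
    have "(\<Prod>j<k. (z ^^ j) u) \<in> K" by (intro is_subring_prod[OF is_subfieldD(1)[OF subfield_K]] zpow_K u)
    then have "z (G * (\<Prod>j<k. (z ^^ j) u) ^ M) = z G * (\<Prod>j<k. (z ^^ Suc j) u) ^ M"
      using GK u by (simp add: z_simps K_closed hom_on_prod[OF z(1) subfield_K])
    then have "(z ^^ Suc k) G = G * (u * (\<Prod>j<k. (z ^^ Suc j) u)) ^ M" using Suc e by (simp add: power_mult_distrib mult_ac)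
    then show ?case by (simp only: prod.lessThan_Suc_shift funpow_0)
  qed simp
  have "nu ^ M = 1" using zG[of N] zpow_N[OF GK(1)] GK(2) by (simp add: nu_def)
  then obtain c where c: "nu = i c" using power_const[of nu M 1] M by (auto simp: i_simps)
  have c0: "c \<noteq> 0" using \<open>nu ^ M = 1\<close> M c by (auto simp: i_simps zero_power)
  have cM: "c ^ M = 1" using \<open>nu ^ M = 1\<close> by (simp add: c i_simps(13)[of "c ^ M" 1, simplified i_simps, symmetric])
  obtain d where d: "d ^ N = inverse c" using nth_root_exists[OF N] by blast
  have d0: "d \<noteq> 0" using d c0 N by (auto simp: zero_power)
  define u' where "u' = u * i d"
  have u': "u' \<in> K" using u by (auto simp: u'_def K_closed)
  have "(\<Prod>k<N. (z ^^ k) u') = nu * i d ^ N"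
    using u by (simp add: u'_def zpow_simps prod.distrib nu_def)
  also have "\<dots> = 1" using c0 by (simp add: c d i_simps flip: i_simps(7))
  finally obtain w where w: "w \<in> K" "w \<noteq> 0" "u' * w = z w" using hilbert_90[OF u'] by blast
  define G' where "G' = G / w ^ M"
  have G'K: "G' \<in> K" "G' \<noteq> 0" using GK w by (auto simp: G'_def K_closed)
  \<comment> \<open>The price of the rescaling: \<open>G'\<close> is not invariant but an
    eigenvector of \<open>z\<close>. Its eigenvalue is an \<open>N\<close>-th root of unity because
    \<open>c ^ M = 1\<close>, and this is the origin of the factor \<open>y ^ j\<close>.\<close>
  have "(inverse d ^ M) ^ N = (inverse (d ^ N)) ^ M" by (simp add: power_inverse mult.commute flip: power_mult)
  also have "\<dots> = 1" using d cM by simp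
  finally obtain j where j: "j < N" "inverse d ^ M = \<zeta> ^ j" using root_of_unity by blast
  have "z G' = G * u ^ M / (u' * w) ^ M" using GK w e by (simp add: G'_def z_simps K_closed)
  also have "\<dots> = i (inverse d ^ M) * G'"
    using u(2) d0 w(2) by (simp add: G'_def u'_def i_simps field_simps)
  finally have "z G' = i (\<zeta> ^ j) * G'" using j by simp
  from z_eigen[OF G'K(1) j(1) this] obtain p q where pq: "q \<noteq> 0" "G' = y ^ j * px p / px q" by blast
  then have p0: "p \<noteq> 0" using G'K(2) by (auto simp: px_simps)
  define R where "R = {a. poly p a = 0} \<union> {a. poly q a = 0} \<union> S"
  have fR: "finite R" using poly_roots_finite p0 pq(1) S by (auto simp: R_def)
  define ex where "ex = (\<lambda>a. int (order a p) - int (order a q))"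
  have exM: "int M dvd ex a" if a: "a \<notin> S" for a
  proof -
    have "poly F a \<noteq> 0" using lam a S by (auto simp: F_eq poly_prod)
    then obtain P where P: "P \<in> points i K" "ord_at P (x - i a) = 1" "ord_at P y = 0"
      "\<And>q. poly q a \<noteq> 0 \<Longrightarrow> ord_at P (px q) = 0" using unramified_point by blast
    note o = ord_at_simps[OF P(1)]
    have op: "ord_at P (px r) = int (order a r)" if r: "r \<noteq> 0" for r
    proof -
      obtain r' where r': "r = [:- a, 1:] ^ order a r * r'" "\<not> [:- a, 1:] dvd r'"
        using order_decomp[OF r] by blast
      have "poly r' a \<noteq> 0" using r'(2) by (simp add: poly_eq_0_iff_dvd)
      moreover have "px r = (x - i a) ^ order a r * px r'" by (subst r'(1)) (simp add: px_simps px_const i_simps)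
      moreover have "r' \<noteq> 0" using r'(2) by auto
      ultimately show ?thesis using P(2,4) x_diff_nonzero px_eq_0
        by (simp add: o K_closed)
    qed
    have "ord_at P G' = ex a"
      using pq p0 px_eq_0 y_nonzero by (simp add: o K_closed P(3) op ex_def)
    moreover have "ord_at P G' = ord_at P G - int M * ord_at P w"
      using GK w by (simp add: G'_def o K_closed)
    ultimately show ?thesis using GV[OF P(1)] by (metis dvd_diff dvd_triv_left)
  qed
  \<comment> \<open>Division of the exponents by \<open>M\<close>: the quotients go into an
    \<open>M\<close>-th power, and the remainders \<open>b a\<close> vanish outside
    \<open>S\<close>.\<close>
  define r where "r = (\<lambda>a. (x - i a) powi (ex a div int M))"
  define b where "b = (\<lambda>a. nat (ex a mod int M))"
  have fac: "(x - i a) powi ex a = (x - i a) ^ b a * r a ^ M" for a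
  proof -
    have "ex a = int (b a) + (ex a div int M) * int M" using M by (simp add: b_def)
    then have "(x - i a) powi ex a = (x - i a) powi int (b a) * (x - i a) powi ((ex a div int M) * int M)"
      using x_diff_nonzero by (metis power_int_add)
    then show ?thesis by (simp add: r_def power_int_mult)
  qed
  have rK: "r a \<in> K" "r a \<noteq> 0" for a
    using x_diff_nonzero K_closed by (auto simp: r_def power_int_def)
  obtain lc where lc: "lc ^ M = lead_coeff p / lead_coeff q" using nth_root_exists[OF M] by blast
  have lc0: "lc \<noteq> 0" using lc p0 pq(1) M by (auto simp: zero_power)
  have "px p / px q = i (lead_coeff p / lead_coeff q) * (\<Prod>a\<in>R. (x - i a) powi ex a)"
    unfolding px_factor[OF p0 fR, of] px_factor[OF pq(1) fR]
  proof -
    have "px p = i (lead_coeff p) * (\<Prod>a\<in>R. (x - i a) ^ order a p)" by (rule px_factor[OF p0 fR]) (auto simp: R_def)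
    moreover have "px q = i (lead_coeff q) * (\<Prod>a\<in>R. (x - i a) ^ order a q)" by (rule px_factor[OF pq(1) fR]) (auto simp: R_def)
    moreover have "(\<Prod>a\<in>R. (x - i a) powi ex a) = (\<Prod>a\<in>R. (x - i a) ^ order a p) / (\<Prod>a\<in>R. (x - i a) ^ order a q)"
      using x_diff_nonzero by (simp add: ex_def power_int_diff prod_dividef)
    ultimately show "px p / px q = i (lead_coeff p / lead_coeff q) * (\<Prod>a\<in>R. (x - i a) powi ex a)"
      by (simp add: i_simps)
  qed
  also have "(\<Prod>a\<in>R. (x - i a) powi ex a) = (\<Prod>a\<in>R. (x - i a) ^ b a) * (\<Prod>a\<in>R. r a) ^ M"
    by (simp add: fac prod.distrib prod_power_distrib)
  also have "(\<Prod>a\<in>R. (x - i a) ^ b a) = (\<Prod>a\<in>S. (x - i a) ^ b a)"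
  proof (rule prod.mono_neutral_right[OF fR])
    show "\<forall>a\<in>R - S. (x - i a) ^ b a = 1" using exM by (auto simp: b_def)
  qed (auto simp: R_def)
  finally have "G' = branch j b * (i lc * (\<Prod>a\<in>R. r a)) ^ M"
    by (simp add: pq(2) branch_def power_mult_distrib lc[symmetric] i_simps mult_ac flip: times_divide_eq_right)
  then have "G = branch j b * (i lc * (\<Prod>a\<in>R. r a) * w) ^ M"
    using w by (simp add: G'_def power_mult_distrib field_simps)
  moreover have "i lc * (\<Prod>a\<in>R. r a) * w \<in> K"
    by (intro K_closed(4) i_K is_subring_prod[OF is_subfieldD(1)[OF subfield_K]] rK w)
  moreover have "i lc * (\<Prod>a\<in>R. r a) * w \<noteq> 0" using rK w lc0 fR i_simps(12) by auto
  ultimately show ?thesis by blast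
qed

lemma action: "mult_action K (Vgrp M) z" "\<sigma> \<in> stab \<Longrightarrow> mult_action K (Vgrp M) (tau \<sigma>)"
  by (unfold_locales; use subfield_K mult_group_Vgrp z tau z_Vgrp tau_Vgrp in auto)+

text \<open>One block of \<open>N = ell ^ n\<close> applications for each of the \<open>m\<close>
  factors of \<open>ell ^ m\<close>.\<close>

lemma z_nilpotent:
  assumes "G \<in> Vgrp (ell ^ m)"
  shows "(diff_op z ^^ (m * N)) G \<in> Qgrp (ell ^ m)"
proof -
  interpret mult_action K "Vgrp (ell ^ m)" z by (rule action(1))
  have "\<exists>v\<in>Vgrp (ell ^ m). (diff_op z ^^ (m * ell ^ n)) G = v ^ (ell ^ m)"
    by (rule nilpotent_finite_order[OF ell n _ assms]) (use zpow_N N_eq V_K in auto)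
  then show ?thesis unfolding N_eq using V_K V_closed(2) by (auto simp: Qgrp_def)
qed

lemma diff_op_commute:
  assumes "\<sigma> \<in> stab" "\<sigma> \<zeta> = \<zeta>" "G \<in> Vgrp M"
  shows "(diff_op (tau \<sigma>) ^^ j) (diff_op z G) = diff_op z ((diff_op (tau \<sigma>) ^^ j) G)"
proof (induction j)
  case (Suc j)
  interpret T: mult_action K "Vgrp M" "tau \<sigma>" by (rule action(2)[OF assms(1)])
  interpret Z: mult_action K "Vgrp M" z by (rule action(1))
  define w where "w = (diff_op (tau \<sigma>) ^^ j) G"
  have w: "w \<in> Vgrp M" unfolding w_def by (rule T.diff_op_V[OF assms(3)])
  then have wK: "w \<in> K" "z w \<in> K" "tau \<sigma> w \<in> K" "w \<noteq> 0" "z w \<noteq> 0" "tau \<sigma> w \<noteq> 0"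
    using Z.\<tau>V T.\<tau>V T.V_K T.V_closed(2) by blast+
  have "(diff_op (tau \<sigma>) ^^ Suc j) (diff_op z G) = diff_op (tau \<sigma>) (diff_op z w)" using Suc by (simp add: w_def)
  also have "\<dots> = diff_op z (diff_op (tau \<sigma>) w)"
    using wK by (simp add: diff_op_def T.\<tau>_simps Z.\<tau>_simps tau_z_commute[OF assms(1,2)])
  finally show ?case by (simp add: w_def)
qed simp

text \<open>If \<open>j + 1\<close> applications of \<open>z - 1\<close> kill the class of
  \<open>G\<close>, then by commutation \<open>j\<close> applications of \<open>\<sigma> - 1\<close>
  lead to a \<open>z\<close>-invariant class. This is represented by a branch product, which
  \<open>\<sigma>\<close> fixes, so one more application of \<open>\<sigma> - 1\<close> kills it.
  The same exponent therefore works for \<open>\<sigma>\<close>.\<close>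

lemma tau_nilpotent:
  assumes \<sigma>: "\<sigma> \<in> stab" "\<sigma> \<zeta> = \<zeta>" "\<And>s. s \<in> S \<Longrightarrow> \<sigma> s = s" and M: "M > 0"
    and G: "G \<in> Vgrp M" "(diff_op z ^^ j) G \<in> Qgrp M"
  shows "(diff_op (tau \<sigma>) ^^ j) G \<in> Qgrp M"
  using G
proof (induction j arbitrary: G)
  case (Suc j)
  interpret T: mult_action K "Vgrp M" "tau \<sigma>" by (rule action(2)[OF \<sigma>(1)])
  interpret Z: mult_action K "Vgrp M" z by (rule action(1))
  define G' where "G' = (diff_op (tau \<sigma>) ^^ j) G"
  have G'V: "G' \<in> Vgrp M" unfolding G'_def by (rule T.diff_op_V[OF Suc.prems(1)])
  have "(diff_op (tau \<sigma>) ^^ j) (diff_op z G) \<in> Qgrp M"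
    using Suc.prems Z.diff_op_V[OF Suc.prems(1), of 1] by (intro Suc.IH) (auto simp: funpow_Suc_right simp del: funpow.simps)
  then have "diff_op z G' \<in> Qgrp M" unfolding diff_op_commute[OF \<sigma>(1,2) Suc.prems(1)] G'_def .
  then obtain u where u: "u \<in> K" "u \<noteq> 0" "z G' / G' = u ^ M" by (auto simp: Qgrp_def diff_op_def)
  then have "z G' = G' * u ^ M" using T.V_closed(2)[OF G'V] by (simp add: field_simps)
  from invariant_classes[OF M G'V u(1,2) this] obtain l b v where v: "v \<in> K" "v \<noteq> 0" "G' = branch l b * v ^ M" by blast
  have "tau \<sigma> (branch l b) = branch l b"
    unfolding branch_def using \<sigma>(3) x_K y_K i_K
    by (simp add: T.\<tau>_simps hom_on_prod[OF tau(1)[OF \<sigma>(1)] subfield_K] tau_simps[OF \<sigma>(1)] K_closed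
        is_subring_prod[OF is_subfieldD(1)[OF subfield_K]])
  then have "diff_op (tau \<sigma>) G' = (tau \<sigma> v / v) ^ M"
    using v branch_K by (simp add: diff_op_def T.\<tau>_simps K_closed power_divide)
  moreover have "tau \<sigma> v / v \<in> K" "tau \<sigma> v / v \<noteq> 0" using v T.\<tau>_simps(10) by (auto intro: K_closed tau_simps(4)[OF \<sigma>(1)])
  ultimately show ?case using Qgrp_power by (simp add: G'_def)
qed simp

theorem tau_power_trivial:
  assumes \<sigma>: "\<sigma> \<in> stab" "\<sigma> \<zeta> = \<zeta>" "\<And>s. s \<in> S \<Longrightarrow> \<sigma> s = s" and G: "G \<in> Vgrp (ell ^ m)"
  shows "tau (\<sigma> ^^ (ell ^ (m + m * N))) G / G \<in> Qgrp (ell ^ m)"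
proof -
  interpret T: mult_action K "Vgrp (ell ^ m)" "tau \<sigma>" by (rule action(2)[OF \<sigma>(1)])
  have M: "ell ^ m > 0" using ell prime_gt_0_nat by simp
  have "(tau \<sigma> ^^ (ell ^ (m + m * N))) G / G \<in> Qgrp (ell ^ m)"
  proof (rule T.unipotent_order[OF ell mult_group_Qgrp _ _ _ G])
    show "w \<in> Vgrp (ell ^ m) \<Longrightarrow> w ^ (ell ^ m) \<in> Qgrp (ell ^ m)" for w
      using T.V_K T.V_closed(2) by (auto intro: Qgrp_power)
    show "w \<in> Qgrp (ell ^ m) \<Longrightarrow> tau \<sigma> w \<in> Qgrp (ell ^ m)" for w
      by (rule hom_Qgrp[OF tau(1)[OF \<sigma>(1)] tau_simps(4)[OF \<sigma>(1)]])
    show "(diff_op (tau \<sigma>) ^^ (m * N)) G \<in> Qgrp (ell ^ m)"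
      by (rule tau_nilpotent[OF \<sigma> M G z_nilpotent[OF G]])
  qed
  then show ?thesis using tau_funpow[OF \<sigma>(1) T.V_K[OF G]] by simp
qed

end

subsection \<open>Good reduction\<close>

definition fpss :: "'a :: comm_ring_1 set \<Rightarrow> 'a fps set"
  where "fpss A = {f. \<forall>k. fps_nth f k \<in> A}"

text \<open>The order of vanishing of a reduction modulo \<open>I\<close>, expressed without the
  reduction; for prime \<open>I\<close> it is additive on products.\<close>

definition least_at :: "'a set \<Rightarrow> (nat \<Rightarrow> 'a) \<Rightarrow> nat \<Rightarrow> bool"
  where "least_at I f k \<longleftrightarrow> f k \<notin> I \<and> (\<forall>j<k. f j \<in> I)"

lemma fps_mult_nth_atMost: "fps_nth (f * g) k = (\<Sum>j\<le>k. fps_nth f j * fps_nth g (k - j))"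
  by (simp add: fps_mult_nth atLeast0AtMost)

lemma least_at_unique: "least_at I f k \<Longrightarrow> least_at I f l \<Longrightarrow> k = l"
  unfolding least_at_def by (metis linorder_neqE_nat)

lemma is_subring_fpss:
  assumes "is_subring A"
  shows "is_subring (fpss A)"
  unfolding is_subring_def
proof (intro conjI ballI)
  note c = is_subring_closed[OF assms]
  show "1 \<in> fpss A" using c by (auto simp: fpss_def)
  fix f g assume "f \<in> fpss A" "g \<in> fpss A"
  then show "f - g \<in> fpss A" "f * g \<in> fpss A"
    using c by (auto simp: fpss_def fps_mult_nth_atMost intro!: is_subring_sum[OF assms])
qed

lemma prime_ideal_fpss:
  assumes P: "prime_ideal A I"
  shows "prime_ideal (fpss A) (fpss I)"
proof -
  note D = prime_idealD[OF P]
  have "f \<in> fpss I \<or> g \<in> fpss I" if fg: "f \<in> fpss A" "g \<in> fpss A" "f * g \<in> fpss I" for f g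
  proof (rule ccontr)
    assume "\<not> ?thesis"
    then obtain j l where "fps_nth f j \<notin> I" "fps_nth g l \<notin> I" by (auto simp: fpss_def)
    then obtain j l where "fps_nth f j \<notin> I \<and> (\<forall>k<j. fps_nth f k \<in> I)" "fps_nth g l \<notin> I \<and> (\<forall>k<l. fps_nth g k \<in> I)"
      using least_not_in[of "fps_nth f"] least_not_in[of "fps_nth g"] by metis
    then have "fps_nth (f * g) (j + l) \<notin> I" unfolding fps_mult_nth_atMost
      using fg by (intro least_coeff_mult[OF P]) (auto simp: fpss_def)
    then show False using fg by (auto simp: fpss_def)
  qed
  moreover have "f * g \<in> fpss I" if "f \<in> fpss A" "g \<in> fpss I" for f g
    using that by (auto simp: fpss_def fps_mult_nth_atMost intro!: prime_ideal_sum[OF P] D(6))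
  moreover have "1 \<notin> fpss I" using D(4) by (auto simp: fpss_def dest!: spec[of _ 0])
  moreover have "fpss I \<subseteq> fpss A" "0 \<in> fpss I" using D(2,3) by (auto simp: fpss_def)
  moreover have "f + g \<in> fpss I" if "f \<in> fpss I" "g \<in> fpss I" for f g
    using that D(5) by (auto simp: fpss_def)
  ultimately show ?thesis using is_subring_fpss[OF D(1)] by (auto simp: prime_ideal_def)
qed

lemma least_at_mult:
  assumes P: "prime_ideal A I" and A: "\<And>j. f j \<in> A" "\<And>j. g j \<in> A" and "least_at I f k" "least_at I g l"
  shows "least_at I (\<lambda>n. \<Sum>j\<le>n. f j * g (n - j)) (k + l)"
proof -
  have k: "f k \<notin> I" "\<And>j. j < k \<Longrightarrow> f j \<in> I" and l: "g l \<notin> I" "\<And>j. j < l \<Longrightarrow> g j \<in> I"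
    using assms(4,5) by (auto simp: least_at_def)
  show ?thesis unfolding least_at_def
    using least_coeff_mult(1)[of A I f g k l, OF P A k l] least_coeff_mult(2)[of A I f g k l, OF P A k l] by blast
qed

lemma least_at_fps_mult:
  assumes P: "prime_ideal A I" and "f \<in> fpss A" "g \<in> fpss A"
    and "least_at I (fps_nth f) k" "least_at I (fps_nth g) l"
  shows "least_at I (fps_nth (f * g)) (k + l)"
proof -
  have "least_at I (\<lambda>n. \<Sum>j\<le>n. fps_nth f j * fps_nth g (n - j)) (k + l)"
    using assms(2,3) by (intro least_at_mult[OF P _ _ assms(4,5)]) (auto simp: fpss_def)
  then show ?thesis by (simp add: least_at_def fps_mult_nth_atMost)
qed

lemma least_at_poly_mult:
  assumes P: "prime_ideal A I" and "p \<in> polys A" "q \<in> polys A"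
    and "least_at I (coeff p) k" "least_at I (coeff q) l"
  shows "least_at I (coeff (p * q)) (k + l)"
proof -
  have "least_at I (\<lambda>n. \<Sum>j\<le>n. coeff p j * coeff q (n - j)) (k + l)"
    using assms(2,3) by (intro least_at_mult[OF P _ _ assms(4,5)]) (auto simp: polys_def)
  then show ?thesis by (simp add: least_at_def coeff_mult)
qed

lemma least_at_poly_power:
  assumes P: "prime_ideal A I" and p: "p \<in> polys A" "least_at I (coeff p) k"
  shows "least_at I (coeff (p ^ r)) (r * k)"
proof (induction r)
  case 0
  show ?case using prime_idealD(4)[OF P] by (simp add: least_at_def)
next
  case (Suc r)
  then show ?case
    using least_at_poly_mult[OF P p(1) polys_closed(7)[OF prime_idealD(1)[OF P] p(1)] p(2)] by simp
qed

lemma least_at_poly_prod: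
  assumes P: "prime_ideal A I" and "finite J" "\<And>j. j \<in> J \<Longrightarrow> f j \<in> polys A" "\<And>j. j \<in> J \<Longrightarrow> least_at I (coeff (f j)) (k j)"
  shows "least_at I (coeff (\<Prod>j\<in>J. f j)) (\<Sum>j\<in>J. k j)"
  using assms(2-)
proof (induction J rule: finite_induct)
  case empty
  show ?case using prime_idealD(4)[OF P] by (simp add: least_at_def)
next
  case (insert j J)
  then show ?case
    using least_at_poly_mult[OF P, of "f j" "prod f J" "k j" "sum k J"] polys_prod[OF prime_idealD(1)[OF P], of J f] by simp
qed

lemma least_at_cong:
  assumes P: "prime_ideal A I" and "p - q \<in> polys I" "least_at I (coeff p) k"
  shows "least_at I (coeff q) k"
proof -
  have d: "coeff p j - coeff q j \<in> I" for j using polysD[OF assms(2), of j] by simp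
  have "coeff q j \<in> I \<longleftrightarrow> coeff p j \<in> I" for j
    using d[of j] prime_idealD(5)[OF P d[of j], of "coeff q j"] prime_idealD(10)[OF P _ d[of j], of "coeff p j"] by auto
  then show ?thesis using assms(3) by (simp add: least_at_def)
qed

lemma pcompose_in_ideal:
  assumes P: "prime_ideal A I" and "p \<in> polys I" "r \<in> polys A"
  shows "pcompose p r \<in> polys I"
  using assms(2)
proof (induction p)
  case (pCons a p)
  note D = prime_idealD[OF prime_ideal_polys[OF P]]
  have "a \<in> I" "p \<in> polys I" using pCons.prems by (auto simp: polys_pCons_iff)
  moreover have "[:a:] \<in> polys I" using \<open>a \<in> I\<close> prime_idealD(3)[OF P] by (auto simp: polys_def coeff_pCons split: nat.splits)
  ultimately show ?case unfolding pcompose_pCons by (intro D(5,6) assms(3) pCons.IH)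
qed (use prime_idealD(3)[OF P] in \<open>simp add: polys_def\<close>)

lemma pcompose_in_subring:
  assumes A: "is_subring A" and "p \<in> polys A" "r \<in> polys A"
  shows "pcompose p r \<in> polys A"
  using assms(2) by (induction p) (auto simp: pcompose_pCons polys_pCons_iff polys_closed[OF A] assms(3))

lemma rhom_poly_pcompose:
  assumes "rhom f"
  shows "poly (map_poly f (pcompose p r)) u = poly (map_poly f p) (poly (map_poly f r) u)"
proof -
  note h = rhom_simps[OF rhom_map_poly[OF assms]] rhom_simps[OF assms]
  show ?thesis by (induction p) (simp_all add: pcompose_pCons h map_poly_pCons)
qed

section \<open>Expansion at a totally ramified point with coefficients in W\<close>

locale reduction = kummer i x y N F \<zeta> ell n S lam e
  for i :: "'a :: {alg_closed_field, field_char_0} \<Rightarrow> 'b :: field" and x y N F \<zeta> ell n S lam e +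
  fixes W :: "'a set" and s0 :: 'a
  assumes W: "valuation_ring UNIV W" and ellW: "of_nat ell \<notin> max_ideal W"
    and SW: "S \<subseteq> W" and diffW: "s \<in> S \<Longrightarrow> s' \<in> S \<Longrightarrow> s \<noteq> s' \<Longrightarrow> s - s' \<notin> max_ideal W"
    and lamW: "lam \<in> W" "lam \<notin> max_ideal W" and s0: "s0 \<in> S" "coprime (e s0) N"
begin

abbreviation "\<mm> \<equiv> max_ideal W"

lemma MW: "prime_ideal W \<mm>" by (rule prime_max_ideal[OF is_subfield_UNIV W])
lemma sW: "is_subring W" using valuation_ringD(1)[OF W] .
lemmas W_closed = is_subring_closed[OF sW]
lemmas m_simps = prime_idealD[OF MW]

lemma root_in_W:
  assumes "a ^ r \<in> W" "r > 0"
  shows "a \<in> W"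
proof (rule ccontr)
  assume "a \<notin> W"
  then have "inverse a \<in> \<mm>" "a \<noteq> 0" using inverse_max_ideal[OF W] W_closed(2) by auto
  then have "inverse a * inverse a ^ (r - 1) \<in> \<mm>"
    by (intro m_simps(7) W_closed(7)) (auto intro: max_idealD)
  then have "inverse a ^ r \<in> \<mm>" using assms(2) by (simp flip: power_Suc)
  then have "inverse a ^ r * a ^ r \<in> \<mm>" using assms(1) m_simps(7) by blast
  then show False using \<open>a \<noteq> 0\<close> m_simps(4) by (simp flip: power_mult_distrib)
qed

lemma root_not_in_m: "a ^ r \<notin> \<mm> \<Longrightarrow> r > 0 \<Longrightarrow> a \<notin> \<mm>"
  using m_simps(7)[of "a ^ (r - 1)" a] W_closed(7)[of a "r - 1"] max_idealD[of a W]
  by (cases r) auto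

lemma \<zeta>W: "\<zeta> ^ j \<in> W"
  using root_in_W[OF _ N, of "\<zeta> ^ j"] \<zeta>_pow W_closed(1) by simp

lemma ell_pow_not_in_m: "of_nat (ell ^ r) \<notin> \<mm>"
  using ellW prime_ideal_power[OF MW, of "of_nat ell" r] W_closed(8) by auto

text \<open>Here \<open>ell\<close> must be a unit at \<open>W\<close>: if
  \<open>c ^ ell = 1\<close> and \<open>c \<noteq> 1\<close>, the powers of \<open>c\<close> below
  \<open>ell\<close> have sum zero, while \<open>c\<close> congruent to \<open>1\<close> makes this
  sum congruent to \<open>ell\<close>.\<close>

lemma root_of_unity_cong:
  assumes "c ^ (ell ^ r) = 1" "c - 1 \<in> \<mm>"
  shows "c = 1"
  using assms
proof (induction r arbitrary: c)
  case (Suc r)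
  define d where "d = c ^ ell"
  have cW: "c \<in> W" using W_closed(6)[OF m_simps(2)[OF Suc.prems(2)] W_closed(1)] by simp
  have sub: "c ^ k - 1 \<in> \<mm>" for k
  proof (induction k)
    case (Suc k)
    have eq: "c ^ Suc k - 1 = c * (c ^ k - 1) + (c - 1)" by (simp add: algebra_simps)
    show ?case unfolding eq by (intro m_simps(5,6) cW Suc \<open>c - 1 \<in> \<mm>\<close>)
  qed (use m_simps(3) in simp)
  have "d ^ (ell ^ r) = 1" using Suc.prems(1) by (simp add: d_def flip: power_mult)
  then have "c ^ ell = 1" using Suc.IH[of d] sub by (simp add: d_def)
  show ?case
  proof (rule ccontr)
    assume "c \<noteq> 1"
    then have "(\<Sum>k<ell. c ^ k) = 0" using \<open>c ^ ell = 1\<close> by (simp add: sum_gp_strict)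
    then have "- of_nat ell = (\<Sum>k<ell. c ^ k - 1)" by (simp add: sum_subtractf)
    also have "\<dots> \<in> \<mm>" by (intro prime_ideal_sum[OF MW] sub)
    finally show False using ellW m_simps(9)[of "- of_nat ell"] by simp
  qed
qed simp

lemma \<zeta>_cong:
  assumes "a ^ (ell ^ r) = 1" "\<zeta> ^ k - a \<in> \<mm>"
  shows "a = \<zeta> ^ k"
proof -
  have a0: "a \<noteq> 0" using assms(1) ell prime_gt_0_nat by (auto simp: zero_power)
  have aW: "inverse a \<in> W"
    by (rule root_in_W[of _ "ell ^ r"]) (use assms(1) ell prime_gt_0_nat W_closed(1) in \<open>auto simp: power_inverse\<close>)
  have "(\<zeta> ^ k * inverse a) ^ (ell ^ (n + r)) = ((\<zeta> ^ k) ^ N) ^ (ell ^ r) * inverse ((a ^ (ell ^ r)) ^ N)"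
    by (simp add: power_mult_distrib power_add N_eq power_inverse mult_ac flip: power_mult)
  also have "\<dots> = 1" using \<zeta>_pow assms(1) by simp
  finally have "\<zeta> ^ k * inverse a = 1"
  proof (rule root_of_unity_cong)
    have "\<zeta> ^ k * inverse a - 1 = inverse a * (\<zeta> ^ k - a)" using a0 by (simp add: algebra_simps)
    then show "\<zeta> ^ k * inverse a - 1 \<in> \<mm>" using m_simps(6)[OF aW assms(2)] by simp
  qed
  then show ?thesis using a0 by (simp add: field_simps)
qed

lemma F_W: "F \<in> polys W"
  unfolding F_eq using SW lamW W_closed
  by (intro polys_closed(10) polys_prod polys_closed(7) sW) (auto simp: polys_pCons_iff polys_closed[OF sW])

text \<open>The point above \<open>s0\<close> is totally ramified, with parameter \<open>T\<close>, \<open>T ^ N = x - s0\<close>. The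
  expansion of \<open>y\<close> there has coefficients in \<open>W\<close>.\<close>

definition H :: "'a fps"
  where "H = fps_const lam * (\<Prod>s\<in>S - {s0}. (fps_const (s0 - s) + fps_X ^ N) ^ e s)"

lemma H: "H \<in> fpss W" "fps_nth H 0 \<notin> \<mm>"
proof -
  note F = is_subring_fpss[OF sW]
  have "fps_const c \<in> fpss W" if "c \<in> W" for c using that W_closed(2) by (auto simp: fpss_def)
  moreover have "fps_X ^ N \<in> fpss W" using W_closed(1,2) by (auto simp: fpss_def fps_X_power_nth)
  moreover have "s0 - s \<in> W" if "s \<in> S" for s using that s0 SW W_closed(3) by auto
  ultimately show "H \<in> fpss W" unfolding H_def using lamW
    by (intro is_subring_closed(4)[OF F] is_subring_prod[OF F] is_subring_closed(7)[OF F, where a = "_ + _"]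
        is_subring_closed(6)[OF F]) auto
  have prod0: "fps_nth (prod f J) 0 = (\<Prod>j\<in>J. fps_nth (f j) 0)" for f :: "'a \<Rightarrow> 'a fps" and J
    by (induction J rule: infinite_finite_induct) auto
  have "fps_nth H 0 = lam * (\<Prod>s\<in>S - {s0}. (s0 - s) ^ e s)"
    using N by (simp add: H_def prod0 fps_nth_power_0 fps_X_power_nth zero_power)
  moreover have "(\<Prod>s\<in>S - {s0}. (s0 - s) ^ e s) \<notin> \<mm>"
  proof
    assume "(\<Prod>s\<in>S - {s0}. (s0 - s) ^ e s) \<in> \<mm>"
    then obtain s where "s \<in> S - {s0}" "(s0 - s) ^ e s \<in> \<mm>"
      using prime_ideal_prod[OF MW, of "\<lambda>s. (s0 - s) ^ e s"] \<open>\<And>s. s \<in> S \<Longrightarrow> s0 - s \<in> W\<close> W_closed(7) by blast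
    then show False using prime_ideal_power[OF MW] diffW s0 \<open>\<And>s. s \<in> S \<Longrightarrow> s0 - s \<in> W\<close> by blast
  qed
  moreover have "(\<Prod>s\<in>S - {s0}. (s0 - s) ^ e s) \<in> W"
    using \<open>\<And>s. s \<in> S \<Longrightarrow> s0 - s \<in> W\<close> by (intro is_subring_prod[OF sW] W_closed(7)) auto
  ultimately show "fps_nth H 0 \<notin> \<mm>" using m_simps(8)[of lam] lamW by metis
qed

definition \<gamma> :: "'a fps" where "\<gamma> = (SOME Y. Y ^ N = H)"

lemma \<gamma>: "\<gamma> ^ N = H"
  unfolding \<gamma>_def by (rule someI_ex[OF fps_nth_root]) (use H N m_simps(3) in auto)

text \<open>A recursion as in Hensel's lemma. In the coefficient of \<open>\<gamma> ^ N = H\<close>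
  at \<open>k\<close>, the new coefficient of \<open>\<gamma>\<close> occurs with the factor
  \<open>u\<close>, the derivative of the \<open>N\<close>-th power; it is a unit of
  \<open>W\<close> because \<open>N\<close> is a power of \<open>ell\<close> and the constant term
  is a unit.\<close>

lemma \<gamma>_W: "\<gamma> \<in> fpss W" "fps_nth \<gamma> 0 \<notin> \<mm>"
proof -
  have g0: "fps_nth \<gamma> 0 ^ N = fps_nth H 0" using arg_cong[OF \<gamma>, of "\<lambda>f. fps_nth f 0"] by (simp add: fps_nth_power_0)
  have g0W: "fps_nth \<gamma> 0 \<in> W" using root_in_W[OF _ N] g0 H(1) by (simp add: fpss_def)
  show g0m: "fps_nth \<gamma> 0 \<notin> \<mm>" using root_not_in_m[OF _ N] g0 H(2) by simp
  have "fps_nth \<gamma> k \<in> W" for k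
  proof (induction k rule: less_induct)
    case (less k)
    show ?case
    proof (cases "k = 0")
      case False
      \<comment> \<open>The part already known to have coefficients in \<open>W\<close>. As
        \<open>\<gamma> - t\<close> starts at index \<open>k\<close>, only the constant term of
        \<open>A\<close> contributes there.\<close>
      define t where "t = fps_cutoff k \<gamma>"
      have tW: "t \<in> fpss W" using less W_closed(2) by (auto simp: fpss_def t_def)
      define A where "A = (\<Sum>j<N. t ^ (N - Suc j) * \<gamma> ^ j)"
      have "\<gamma> ^ N - t ^ N = (\<gamma> - t) * A" unfolding A_def by (rule power_diff_sumr2)
      then have "fps_nth H k - fps_nth (t ^ N) k = fps_nth ((\<gamma> - t) * A) k" by (simp add: \<gamma>[symmetric] flip: fps_sub_nth)
      also have "\<dots> = (\<Sum>j\<le>k. if j = k then fps_nth \<gamma> k * fps_nth A 0 else 0)"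
        unfolding fps_mult_nth_atMost by (intro sum.cong) (auto simp: t_def)
      also have "\<dots> = fps_nth \<gamma> k * fps_nth A 0" by simp
      also have "fps_nth A 0 = (\<Sum>j<N. fps_nth \<gamma> 0 ^ (N - 1))"
        unfolding A_def fps_sum_nth using False
        by (intro sum.cong) (auto simp: fps_nth_power_0 t_def simp flip: power_add)
      finally have eq: "fps_nth H k - fps_nth (t ^ N) k = fps_nth \<gamma> k * (of_nat N * fps_nth \<gamma> 0 ^ (N - 1))" by simp
      define u where "u = of_nat N * fps_nth \<gamma> 0 ^ (N - 1)"
      have "fps_nth \<gamma> 0 ^ (N - 1) \<notin> \<mm>" using prime_ideal_power[OF MW] g0m g0W by blast
      then have "u \<notin> \<mm>" "u \<in> W" unfolding u_def
        using m_simps(8)[of "of_nat N"] ell_pow_not_in_m[of n] g0W W_closed(4,7,8) by (auto simp: N_eq)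
      then have "inverse u \<in> W" "u \<noteq> 0" using not_max_ideal by blast+
      have "t ^ N \<in> fpss W" using is_subring_closed(7)[OF is_subring_fpss[OF sW] tW] .
      then have "fps_nth H k - fps_nth (t ^ N) k \<in> W" using H(1) W_closed(3) by (auto simp: fpss_def)
      then have "fps_nth \<gamma> k * u * inverse u \<in> W" using eq \<open>inverse u \<in> W\<close> W_closed(4) by (metis u_def)
      then show ?thesis using \<open>u \<noteq> 0\<close> by (simp add: mult.assoc)
    qed (use g0W in simp)
  qed
  then show "\<gamma> \<in> fpss W" by (simp add: fpss_def)
qed

definition xT :: "'a fps" where "xT = fps_const s0 + fps_X ^ N"
definition yT :: "'a fps" where "yT = fps_X ^ e s0 * \<gamma>"
text \<open>The expansion is kept on polynomials instead of on \<open>K\<close>, because the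
  coefficients whose integrality matters are visible there.\<close>

definition \<Psi> :: "'a poly poly \<Rightarrow> 'a fps" where "\<Psi> = bieval fps_const xT yT"

lemma rhom_\<Psi>: "rhom \<Psi>" unfolding \<Psi>_def by (rule rhom_bieval[OF rhom_fps_const])
lemmas \<Psi>_simps = rhom_simps[OF rhom_\<Psi>]
lemmas bieval_\<Psi> = bieval_simps[OF rhom_fps_const]

lemma MF: "prime_ideal (fpss W) (fpss \<mm>)" by (rule prime_ideal_fpss[OF MW])
lemma MPP: "prime_ideal (polys (polys W)) (polys (polys \<mm>))" by (intro prime_ideal_polys MW)
lemma MP: "prime_ideal (polys W) (polys \<mm>)" by (intro prime_ideal_polys MW)
lemma sF: "is_subring (fpss W)" by (rule is_subring_fpss[OF sW])

lemma xyT_W: "xT \<in> fpss W" "yT \<in> fpss W"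
proof -
  have "fps_X ^ k \<in> fpss W" for k using W_closed(1,2) by (auto simp: fpss_def fps_X_power_nth)
  moreover have "fps_const s0 \<in> fpss W" using s0 SW W_closed(2) by (auto simp: fpss_def)
  ultimately show "xT \<in> fpss W" "yT \<in> fpss W"
    using is_subring_closed(4,6)[OF sF] \<gamma>_W by (auto simp: xT_def yT_def)
qed

lemma \<Psi>_g: "\<Psi> g = 0"
proof -
  have "poly (map_poly fps_const F) xT = fps_const lam * (\<Prod>s\<in>S. (xT - fps_const s) ^ e s)"
    unfolding F_eq bieval_\<Psi> by (simp add: rhom_simps[OF rhom_poly_map[OF rhom_fps_const]] bieval_\<Psi>(1-4,6))
  also have "(\<Prod>s\<in>S. (xT - fps_const s) ^ e s) = (xT - fps_const s0) ^ e s0 * (\<Prod>s\<in>S - {s0}. (xT - fps_const s) ^ e s)"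
    using s0 S by (subst prod.remove[of _ s0]) auto
  also have "(\<Prod>s\<in>S - {s0}. (xT - fps_const s) ^ e s) = (\<Prod>s\<in>S - {s0}. (fps_const (s0 - s) + fps_X ^ N) ^ e s)"
    by (intro prod.cong refl arg_cong2[where f = power]) (simp_all add: xT_def flip: fps_const_sub)
  also have "fps_const lam * ((xT - fps_const s0) ^ e s0 * \<dots>) = (fps_X ^ N) ^ e s0 * H"
    by (simp add: xT_def H_def)
  finally have "poly (map_poly fps_const F) xT = (fps_X ^ N) ^ e s0 * \<gamma> ^ N" by (simp add: \<gamma>)
  also have "\<dots> = yT ^ N" by (simp add: yT_def power_mult_distrib mult.commute flip: power_mult)
  finally show ?thesis by (simp add: g_def \<Psi>_simps) (simp add: \<Psi>_def bieval_\<Psi>)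
qed

lemma \<Psi>_const: "\<Psi> [:q:] = poly (map_poly fps_const q) xT" by (simp add: \<Psi>_def bieval_\<Psi>)
lemma \<Psi>_monom: "\<Psi> (monom 1 j) = yT ^ j" by (simp add: \<Psi>_def bieval_\<Psi>)

lemma \<Psi>_F: "\<Psi> [:F:] = yT ^ N"
  using \<Psi>_g by (simp add: g_def \<Psi>_simps \<Psi>_monom)

lemma \<Psi>_smult: "\<Psi> (smult [:c:] p) = fps_const c * \<Psi> p"
proof -
  have "\<Psi> (smult [:c:] p) = \<Psi> ([:[:c:]:] * p)" by simp
  then show ?thesis by (simp only: \<Psi>_simps \<Psi>_const bieval_\<Psi>)
qed

lemma \<Psi>_ev: "ev p = ev q \<Longrightarrow> \<Psi> p = \<Psi> q"
proof -
  assume "ev p = ev q"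
  then have "ev (p - q) = 0" by (simp add: ev_simps)
  then obtain d where "p - q = g * d" by (auto simp: ev_eq_0_iff dvd_def)
  then have "\<Psi> (p - q) = 0" by (simp add: \<Psi>_simps \<Psi>_g)
  then show ?thesis by (simp add: \<Psi>_simps)
qed

lemma \<Psi>_W:
  "p \<in> polys (polys W) \<Longrightarrow> \<Psi> p \<in> fpss W" "p \<in> polys (polys \<mm>) \<Longrightarrow> \<Psi> p \<in> fpss \<mm>"
  "q \<in> polys W \<Longrightarrow> poly (map_poly fps_const q) xT \<in> fpss W"
proof -
  have c: "map_poly fps_const q \<in> polys (fpss A)" if "q \<in> polys A" "0 \<in> A" for q A
    using that by (auto simp: polys_def coeff_map_poly fpss_def)
  show W1: "poly (map_poly fps_const q) xT \<in> fpss W" if "q \<in> polys W" for q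
    by (rule poly_in_subring[OF sF c xyT_W(1)]) (use that W_closed(2) in auto)
  have M1: "poly (map_poly fps_const q) xT \<in> fpss \<mm>" if "q \<in> polys \<mm>" for q
    by (rule poly_in_ideal[OF MF c xyT_W(1)]) (use that m_simps(3) in auto)
  show "\<Psi> p \<in> fpss W" if "p \<in> polys (polys W)"
    unfolding \<Psi>_def bieval_def
    by (rule poly_in_subring[OF sF _ xyT_W(2)]) (use that W1 in \<open>auto simp: polys_def coeff_map_poly\<close>)
  show "\<Psi> p \<in> fpss \<mm>" if "p \<in> polys (polys \<mm>)"
    unfolding \<Psi>_def bieval_def
    by (rule poly_in_ideal[OF MF _ xyT_W(2)]) (use that M1 in \<open>auto simp: polys_def coeff_map_poly\<close>)
qed

lemma least_at_yT: "least_at \<mm> (fps_nth (yT ^ j)) (e s0 * j)"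
proof (induction j)
  case 0
  then show ?case using m_simps(4) by (simp add: least_at_def)
next
  case (Suc j)
  have "least_at \<mm> (fps_nth \<gamma>) 0" using \<gamma>_W by (simp add: least_at_def)
  moreover have "least_at \<mm> (fps_nth (fps_X ^ e s0)) (e s0)" using m_simps(3,4) by (auto simp: least_at_def fps_X_power_nth)
  moreover have "fps_X ^ e s0 \<in> fpss W" using W_closed(1,2) by (auto simp: fpss_def fps_X_power_nth)
  ultimately have "least_at \<mm> (fps_nth yT) (e s0 + 0)" unfolding yT_def
    using \<gamma>_W(1) by (intro least_at_fps_mult[OF MW])
  then show ?case
    using least_at_fps_mult[OF MW xyT_W(2) is_subring_closed(7)[OF sF xyT_W(2)] _ Suc] by simp
qed

text \<open>Expanding \<open>q\<close> at \<open>s0\<close> gives a series in \<open>T ^ N\<close>.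
  The shift of the variable is invertible over \<open>W\<close>, so the shifted polynomial still has
  a coefficient outside \<open>\<mm>\<close>.\<close>

lemma least_at_xT:
  assumes q: "q \<in> polys W" "q \<notin> polys \<mm>"
  shows "\<exists>k. least_at \<mm> (fps_nth (poly (map_poly fps_const q) xT)) (N * k)"
proof -
  define r where "r = pcompose q [:s0, 1:]"
  have "[:- s0, 1:] \<in> polys W" using s0 SW W_closed by (auto simp: polys_pCons_iff polys_closed[OF sW])
  moreover have "pcompose r [:- s0, 1:] = q" by (simp add: r_def pcompose_assoc[symmetric] pcompose_pCons)
  ultimately have "r \<notin> polys \<mm>" using pcompose_in_ideal[OF MW, of r "[:- s0, 1:]"] q(2) by auto
  then obtain k0 where "coeff r k0 \<notin> \<mm>" by (auto simp: polys_def)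
  then obtain k where k: "coeff r k \<notin> \<mm>" "\<forall>j<k. coeff r j \<in> \<mm>" using least_not_in[of "coeff r"] by blast
  have "poly (map_poly fps_const q) xT = poly (map_poly fps_const r) (fps_X ^ N)"
    unfolding r_def rhom_poly_pcompose[OF rhom_fps_const] by (simp add: bieval_\<Psi>(5) map_poly_pCons xT_def)
  also have "\<dots> = (\<Sum>j\<le>degree r. fps_const (coeff r j) * fps_X ^ (N * j))"
    unfolding poly_altdef by (intro sum.mono_neutral_cong_left) (auto simp: coeff_map_poly power_mult degree_map_poly)
  finally have nth: "fps_nth (poly (map_poly fps_const q) xT) t = (\<Sum>j\<le>degree r. if t = N * j then coeff r j else 0)" for t
    by (simp add: fps_sum_nth fps_X_power_nth if_distrib cong: if_cong)
  have "fps_nth (poly (map_poly fps_const q) xT) (N * k) = coeff r k"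
    unfolding nth using N by (auto simp: coeff_eq_0)
  moreover have "fps_nth (poly (map_poly fps_const q) xT) t \<in> \<mm>" if "t < N * k" for t
    unfolding nth using that k(2) m_simps(3) by (intro prime_ideal_sum[OF MW]) auto
  ultimately show ?thesis using k(1) unfolding least_at_def by (intro exI[of _ k]) simp
qed

text \<open>The exponents of \<open>T\<close> in the leading terms of the \<open>p\<^sub>j(x) y ^ j\<close>, \<open>j < N\<close>, are distinct
  modulo \<open>N\<close>.\<close>

lemma \<Psi>_in_m:
  assumes p: "p \<in> polys (polys W)" "degree p < N" and \<Psi>p: "\<Psi> p \<in> fpss \<mm>"
  shows "p \<in> polys (polys \<mm>)"
proof (rule ccontr)
  assume np: "p \<notin> polys (polys \<mm>)"
  define q where "q = coeff p"
  have qW: "q j \<in> polys W" for j using p(1) by (simp add: q_def polysD)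
  define J where "J = {j. j < N \<and> q j \<notin> polys \<mm>}"
  obtain j0 where j0: "q j0 \<notin> polys \<mm>" using np by (auto simp: polys_def[of "polys \<mm>"] q_def)
  moreover have "0 \<in> polys \<mm>" using m_simps(3) by (simp add: polys_def)
  ultimately have "coeff p j0 \<noteq> 0" unfolding q_def by metis
  then have "j0 < N" using p(2) le_degree[of p j0] by linarith
  then have J: "finite J" "J \<noteq> {}" using j0 by (auto simp: J_def)
  define t where "t = (\<lambda>j. poly (map_poly fps_const (q j)) xT * yT ^ j)"
  have "\<forall>j\<in>J. \<exists>k. least_at \<mm> (fps_nth (poly (map_poly fps_const (q j)) xT)) (N * k)"
  proof
    fix j
    assume "j \<in> J"
    then have "q j \<notin> polys \<mm>" unfolding J_def by blast
    then show "\<exists>k. least_at \<mm> (fps_nth (poly (map_poly fps_const (q j)) xT)) (N * k)"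
      using least_at_xT[of "q j"] qW[of j] by blast
  qed
  from bchoice[OF this] obtain k where "\<forall>j\<in>J. least_at \<mm> (fps_nth (poly (map_poly fps_const (q j)) xT)) (N * k j)"
    by (rule exE)
  note k = bspec[OF this]
  define \<omega> where "\<omega> = (\<lambda>j. N * k j + e s0 * j)"
  have t: "least_at \<mm> (fps_nth (t j)) (\<omega> j)" if "j \<in> J" for j
    unfolding t_def \<omega>_def
    by (rule least_at_fps_mult[OF MW \<Psi>_W(3)[OF qW] is_subring_closed(7)[OF sF xyT_W(2)] k[OF that] least_at_yT])
  have tm: "t j \<in> fpss \<mm>" if "j \<notin> J" "j < N" for j
  proof -
    have "[:q j:] \<in> polys (polys \<mm>)" using that m_simps(3) by (auto simp: J_def polys_def coeff_pCons split: nat.splits)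
    then have "poly (map_poly fps_const (q j)) xT \<in> fpss \<mm>" using \<Psi>_W(2)[of "[:q j:]"] by (simp add: \<Psi>_const)
    then show ?thesis unfolding t_def by (intro prime_idealD(7)[OF MF] is_subring_closed(7)[OF sF] xyT_W)
  qed
  have inj: "inj_on \<omega> J"
  proof (rule inj_onI)
    fix a b assume ab: "a \<in> J" "b \<in> J" "\<omega> a = \<omega> b"
    \<comment> \<open>Coprimality of \<open>e s0\<close> and \<open>N\<close> turns equal leading
      exponents into a congruence of \<open>a\<close> and \<open>b\<close> modulo \<open>N\<close>,
      and both are below \<open>N\<close>.\<close>
    have "int (e s0) * (int a - int b) = int N * (int (k b) - int (k a))"
      using ab(3) by (simp add: \<omega>_def algebra_simps flip: of_nat_mult of_nat_add)
    then have "int N dvd int (e s0) * (int a - int b)" by simp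
    moreover have "coprime (int N) (int (e s0))" using s0(2) by (simp add: coprime_commute)
    ultimately have "int N dvd int a - int b" by (simp add: coprime_dvd_mult_right_iff)
    moreover have "\<bar>int a - int b\<bar> < int N" using ab by (auto simp: J_def)
    ultimately show "a = b" using zdvd_imp_le[of "int N" "\<bar>int a - int b\<bar>"] by (cases "int a - int b = 0") auto
  qed
  obtain j where j: "j \<in> J" "\<And>l. l \<in> J \<Longrightarrow> \<omega> j \<le> \<omega> l"
    using J ex_min_if_finite[of "\<omega> ` J"] by (metis (no_types, lifting) finite_imageI image_iff image_is_empty not_le)
  have "\<Psi> p = (\<Sum>l<N. t l)"
    unfolding \<Psi>_def t_def q_def by (rule bieval_altdef[OF rhom_fps_const p(2)])
  also have "\<dots> = t j + (\<Sum>l\<in>{..<N} - {j}. t l)" using j(1) by (subst sum.remove[of _ j]) (auto simp: J_def)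
  finally have "fps_nth (\<Psi> p) (\<omega> j) = fps_nth (t j) (\<omega> j) + (\<Sum>l\<in>{..<N} - {j}. fps_nth (t l) (\<omega> j))"
    by (simp add: fps_sum_nth)
  moreover have "(\<Sum>l\<in>{..<N} - {j}. fps_nth (t l) (\<omega> j)) \<in> \<mm>"
  proof (rule prime_ideal_sum[OF MW])
    fix l assume l: "l \<in> {..<N} - {j}"
    show "fps_nth (t l) (\<omega> j) \<in> \<mm>"
    proof (cases "l \<in> J")
      case True
      then have "\<omega> j < \<omega> l" using j l inj by (metis DiffE inj_onD le_neq_implies_less singletonI)
      then show ?thesis using t[OF True] by (simp add: least_at_def)
    next
      case False
      then show ?thesis using tm l by (auto simp: fpss_def)
    qed
  qed
  moreover have "fps_nth (\<Psi> p) (\<omega> j) \<in> \<mm>" using \<Psi>p by (simp add: fpss_def)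
  ultimately have "fps_nth (t j) (\<omega> j) \<in> \<mm>" using m_simps(10) by (metis add_diff_cancel_right')
  then show False using t[OF j(1)] by (simp add: least_at_def)
qed

lemma tw_W: "p \<in> polys (polys W) \<Longrightarrow> tw (\<zeta> ^ j) p \<in> polys (polys W)" "p \<in> polys (polys \<mm>) \<Longrightarrow> tw (\<zeta> ^ j) p \<in> polys (polys \<mm>)"
  using \<zeta>W W_closed(4) m_simps(6) by (auto simp: polys_def coeff_tw simp flip: power_mult)

text \<open>By division and \<open>\<Psi>_in_m\<close>, the kernel of the reduced expansion is
  generated by \<open>g\<close> and \<open>\<mm>\<close>, and both are stable under the twist. So
  the deck transformation descends to the reduction.\<close>

lemma \<Psi>_tw:
  assumes p: "p \<in> polys (polys W)" and \<Psi>p: "\<Psi> p \<in> fpss \<mm>"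
  shows "\<Psi> (tw \<zeta> p) \<in> fpss \<mm>"
proof -
  obtain d r where d: "r \<in> polys (polys W)" "p = g * d + r" "degree r < N"
    using monic_division[OF is_subring_polys[OF sW] F_W p N] by (auto simp: g_def)
  have "\<Psi> p = \<Psi> r" by (simp add: d(2) \<Psi>_simps \<Psi>_g)
  then have "r \<in> polys (polys \<mm>)" using \<Psi>_in_m[OF d(1,3)] \<Psi>p by simp
  then have "\<Psi> (tw \<zeta> r) \<in> fpss \<mm>" using tw_W(2)[of r 1] \<Psi>_W(2) by simp
  then show ?thesis by (simp add: d(2) tw_simps tw_g[OF \<zeta>(1)] \<Psi>_simps \<Psi>_g)
qed

text \<open>All coefficients are listed as those of one polynomial in a single variable, to which
  \<open>polys_scale\<close> applies.\<close>

lemma scale: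
  assumes "p \<noteq> 0"
  shows "\<exists>c. c \<noteq> 0 \<and> smult [:c:] p \<in> polys (polys W) \<and> smult [:c:] p \<notin> polys (polys \<mm>)"
proof -
  define A where "A = (\<Union>j\<le>degree p. coeff (coeff p j) ` {..degree (coeff p j)})"
  have "finite A" by (simp add: A_def)
  then obtain xs where xs: "set xs = A" using finite_list by blast
  have c: "coeff (coeff p j) k = 0 \<or> coeff (coeff p j) k \<in> A" for j k
    using coeff_eq_0[of p j] coeff_eq_0[of "coeff p j" k] by (force simp: A_def not_le)
  obtain j k where jk: "coeff (coeff p j) k \<noteq> 0" using assms by (metis poly_eqI coeff_0)
  define q where "q = Poly xs"
  have qA: "\<exists>l. coeff q l = a" if "a \<in> A" for a using that xs by (metis q_def coeff_Poly_eq nth_default_nth in_set_conv_nth)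
  have qA': "coeff q l = 0 \<or> coeff q l \<in> A" for l using xs by (auto simp: q_def nth_default_def)
  have "q \<noteq> 0" using qA[of "coeff (coeff p j) k"] c[of j k] jk by auto
  then obtain a l where a: "a \<noteq> 0" "smult a q \<in> polys W" "coeff (smult a q) l = 1"
    using polys_scale[OF is_subfield_UNIV W, of q] by (auto simp: polys_def)
  have "a * b \<in> W" if "b \<in> A" for b using qA[OF that] polysD[OF a(2)] by fastforce
  then have "a * coeff (coeff p j) k \<in> W" for j k using c[of j k] W_closed(2) by auto
  then have 1: "smult [:a:] p \<in> polys (polys W)" by (simp add: polys_def)
  have "coeff q l \<in> A" using qA'[of l] a(3) by auto
  then obtain j k where "coeff (coeff p j) k = coeff q l" by (auto simp: A_def)
  then have "coeff (coeff (smult [:a:] p) j) k = 1" using a(3) by simp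
  then have "smult [:a:] p \<notin> polys (polys \<mm>)" using m_simps(4) by (metis polysD)
  then show ?thesis using 1 a(1) by blast
qed

lemma \<Psi>_not_in_m: "p \<in> polys (polys W) \<Longrightarrow> p \<notin> polys (polys \<mm>) \<Longrightarrow> degree p < N \<Longrightarrow> \<Psi> p \<notin> fpss \<mm>"
  using \<Psi>_in_m by blast

lemma const_W:
  "q \<in> polys W \<Longrightarrow> [:q:] \<in> polys (polys W)" "[:q:] \<in> polys (polys \<mm>) \<longleftrightarrow> q \<in> polys \<mm>"
  using m_simps(3) W_closed(2) by (auto simp: polys_def[of "polys W"] polys_def[of "polys \<mm>"] coeff_pCons polys_closed[OF sW] split: nat.splits)
    (auto simp: polys_def)

text \<open>In Laurent series the polynomial \<open>X ^ M - c\<close> is split and evaluated at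
  \<open>w = \<alpha> / \<beta>\<close>; multiplication by the \<open>M\<close>-th power of
  \<open>\<beta>\<close> leads back to power series.\<close>

lemma homogeneous_factor:
  fixes \<alpha> \<beta> :: "'a fps"
  assumes "\<beta> \<noteq> 0" "M > 0"
  shows "\<exists>A. \<alpha> ^ M - fps_const c * \<beta> ^ M = (\<Prod>a\<in>#A. \<alpha> - fps_const a * \<beta>) \<and> (\<forall>a\<in>#A. a ^ M = c)"
proof -
  define p where "p = monom 1 M - [:c:]"
  have "coeff p M = 1" using assms(2) by (auto simp: p_def coeff_pCons split: nat.splits)
  moreover have "degree p \<le> M" unfolding p_def by (rule degree_diff_le) (auto simp: degree_monom_le)
  ultimately have dp: "degree p = M" "lead_coeff p = 1" "p \<noteq> 0" using le_degree[of p M] by auto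
  obtain A where A: "size A = M" "p = (\<Prod>a\<in>#A. [:- a, 1:])"
    using alg_closed_imp_factorization[OF dp(3)] dp by auto
  define f where "f = (fps_to_fls \<circ> fps_const :: 'a \<Rightarrow> _)"
  have rfls: "rhom (fps_to_fls :: 'a fps \<Rightarrow> _)" by (simp add: rhom_def fls_times_fps_to_fls)
  have rf: "rhom f" unfolding f_def o_def by (rule rhom_comp[OF rfls rhom_fps_const])
  define w where "w = fps_to_fls \<alpha> / fps_to_fls \<beta>"
  have b0: "fps_to_fls \<beta> \<noteq> 0" using assms(1) by simp
  have "poly (map_poly f (\<Prod>a\<in>#B. [:- a, 1:])) w = (\<Prod>a\<in>#B. w - f a)" for B
    by (induction B) (simp_all add: rhom_simps[OF rhom_poly_map[OF rf]] bieval_simps(4)[OF rf] del: mult_pCons_left)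
  then have "poly (map_poly f p) w = (\<Prod>a\<in>#A. w - f a)" using A(2) by simp
  moreover have "poly (map_poly f p) w = w ^ M - f c"
    by (simp add: p_def rhom_simps[OF rhom_poly_map[OF rf]] bieval_simps[OF rf] map_poly_monom poly_monom rhom_simps[OF rf])
  ultimately have "fps_to_fls \<beta> ^ M * (w ^ M - f c) = fps_to_fls \<beta> ^ size A * (\<Prod>a\<in>#A. w - f a)" using A(1) by simp
  also have "\<dots> = (\<Prod>a\<in>#A. fps_to_fls \<beta> * (w - f a))" by (induction A) (simp_all add: mult_ac)
  also have "\<dots> = (\<Prod>a\<in>#A. fps_to_fls (\<alpha> - fps_const a * \<beta>))"
    using b0 by (intro arg_cong[where f = prod_mset] image_mset_cong)
      (simp add: w_def f_def field_simps fls_times_fps_to_fls)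
  also have "\<dots> = fps_to_fls (\<Prod>a\<in>#A. \<alpha> - fps_const a * \<beta>)"
    by (induction A) (simp_all add: fls_times_fps_to_fls)
  also have "fps_to_fls \<beta> ^ M * (w ^ M - f c) = fps_to_fls (\<alpha> ^ M - fps_const c * \<beta> ^ M)"
    using b0 by (simp add: w_def f_def power_divide right_diff_distrib fls_times_fps_to_fls fps_to_fls_power mult.commute)
  finally have "\<alpha> ^ M - fps_const c * \<beta> ^ M = (\<Prod>a\<in>#A. \<alpha> - fps_const a * \<beta>)" by (simp only: fps_to_fls_eq_iff)
  moreover have "a ^ M = c" if "a \<in># A" for a
  proof -
    have "poly (\<Prod>a\<in>#B. [:- a, 1:]) a = (\<Prod>b\<in>#B. a - b)" for B by (induction B) (simp_all add: algebra_simps)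
    then have "poly p a = (\<Prod>b\<in>#A. a - b)" using A(2) by simp
    then have "poly p a = 0" using that by (auto simp: prod_mset_zero_iff)
    then show ?thesis by (simp add: p_def poly_monom)
  qed
  ultimately show ?thesis by blast
qed

lemma prime_ideal_prod_mset:
  "prime_ideal A I \<Longrightarrow> (\<Prod>a\<in>#B. f a) \<in> I \<Longrightarrow> (\<And>a. a \<in># B \<Longrightarrow> f a \<in> A) \<Longrightarrow> \<exists>a\<in>#B. f a \<in> I"
proof (induction B)
  case (add b B)
  have "(\<Prod>a\<in>#C. f a) \<in> A" if "\<And>a. a \<in># C \<Longrightarrow> f a \<in> A" for C
    using that by (induction C) (auto intro: is_subring_closed prime_idealD(1)[OF add.prems(1)])
  then show ?case using add prime_idealD(8)[OF add.prems(1), of "f b" "\<Prod>a\<in>#B. f a"] by auto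
qed (auto simp: prime_idealD)

lemma prime_ideal_power_diff:
  assumes P: "prime_ideal A I" and "a - b \<in> I" "a \<in> A" "b \<in> A"
  shows "a ^ r - b ^ r \<in> I"
  unfolding power_diff_sumr2
  by (intro prime_idealD(7)[OF P] is_subring_sum is_subring_closed(4,7) prime_idealD(1)[OF P] assms)

text \<open>The constant term of \<open>[:s - s', 1:]\<close> is a unit unless
  \<open>s' = s\<close>, because distinct elements of \<open>S\<close> stay distinct modulo
  \<open>W\<close>. Only the factor belonging to \<open>s\<close> contributes to the order of
  vanishing there.\<close>

lemma least_at_branch:
  assumes s: "s \<in> S"
  shows "least_at \<mm> (coeff (pcompose (\<Prod>s\<in>S. [:- s, 1:] ^ b s) [:s, 1:])) (b s)"
    "least_at \<mm> (coeff (pcompose F [:s, 1:])) (e s)"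
    "(\<Prod>s\<in>S. [:- s, 1:] ^ b s) \<in> polys W" "[:s, 1:] \<in> polys W"
    "pcompose (\<Prod>s\<in>S. [:- s, 1:] ^ b s) [:s, 1:] \<in> polys W"
proof -
  have lin: "least_at \<mm> (coeff [:s - s', 1:]) (if s' = s then 1 else 0)" if "s' \<in> S" for s'
    using diffW[OF s that] m_simps(3,4) by (auto simp: least_at_def coeff_pCons split: nat.splits)
  have pw: "[:c, 1:] \<in> polys W" if "c \<in> W" for c
    using that W_closed(1) by (simp add: polys_pCons_iff polys_closed[OF sW])
  show sp: "[:s, 1:] \<in> polys W" using s SW by (auto intro: pw)
  have sw: "[:s - s', 1:] \<in> polys W" if "s' \<in> S" for s' using s SW that W_closed(3) by (intro pw) auto
  show B: "(\<Prod>s\<in>S. [:- s, 1:] ^ b s) \<in> polys W" for b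
    using SW W_closed(5) by (intro polys_prod sW polys_closed(7)[OF sW] pw) auto
  show "pcompose (\<Prod>s\<in>S. [:- s, 1:] ^ b s) [:s, 1:] \<in> polys W" by (rule pcompose_in_subring[OF sW B sp])
  have pc: "pcompose (\<Prod>s\<in>S. [:- s, 1:] ^ b s) [:s, 1:] = (\<Prod>s'\<in>S. [:s - s', 1:] ^ b s')" for b
    by (simp add: rhom_simps[OF rhom_pcompose] pcompose_pCons)
  show L: "least_at \<mm> (coeff (pcompose (\<Prod>s\<in>S. [:- s, 1:] ^ b s) [:s, 1:])) (b s)" for b
  proof -
    have "least_at \<mm> (coeff (\<Prod>s'\<in>S. [:s - s', 1:] ^ b s')) (\<Sum>s'\<in>S. b s' * (if s' = s then 1 else 0))"
      by (intro least_at_poly_prod[OF MW S] least_at_poly_power[OF MW] lin polys_closed(7)[OF sW] sw)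
    moreover have "(\<Sum>s'\<in>S. b s' * (if s' = s then 1 else 0)) = b s"
      using s S by (simp add: if_distrib cong: if_cong)
    ultimately show ?thesis unfolding pc by simp
  qed
  have "least_at \<mm> (coeff [:lam:]) 0" using lamW by (simp add: least_at_def)
  then have "least_at \<mm> (coeff ([:lam:] * pcompose (\<Prod>s\<in>S. [:- s, 1:] ^ e s) [:s, 1:])) (0 + e s)"
    by (intro least_at_poly_mult[OF MW] L pcompose_in_subring[OF sW B sp] polys_closed(8)[OF sW] lamW)
  then show "least_at \<mm> (coeff (pcompose F [:s, 1:])) (e s)" by (simp add: F_eq pcompose_smult)
qed

lemma least_at_shift:
  assumes p: "p \<in> polys W" "p \<notin> polys \<mm>" and s: "s \<in> W"
  shows "\<exists>k. least_at \<mm> (coeff (pcompose p [:s, 1:])) k" "pcompose p [:s, 1:] \<in> polys W"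
proof -
  have pw: "[:c, 1:] \<in> polys W" if "c \<in> W" for c
    using that W_closed(1) by (simp add: polys_pCons_iff polys_closed[OF sW])
  have "pcompose (pcompose p [:s, 1:]) [:- s, 1:] = p" by (simp add: pcompose_assoc[symmetric] pcompose_pCons)
  then have "pcompose p [:s, 1:] \<notin> polys \<mm>"
    using pcompose_in_ideal[OF MW, of "pcompose p [:s, 1:]" "[:- s, 1:]"] pw[of "- s"] W_closed(5)[OF s] p(2) by auto
  then obtain k where "coeff (pcompose p [:s, 1:]) k \<notin> \<mm>" by (auto simp: polys_def)
  then show "\<exists>k. least_at \<mm> (coeff (pcompose p [:s, 1:])) k"
    using least_not_in[of "coeff (pcompose p [:s, 1:])"] unfolding least_at_def by blast
  show "pcompose p [:s, 1:] \<in> polys W" by (rule pcompose_in_subring[OF sW p(1) pw[OF s]])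
qed

text \<open>A branch class that becomes an \<open>M\<close>-th power in the reduction is one already: the
  \<open>M\<close>-th root is an eigenvector of \<open>z\<close> in the reduction, so it is a multiple of a power of \<open>y\<close>, and
  the orders of vanishing at the reductions of the \<open>s\<close>, which are distinct, can be compared.\<close>

lemma branch_reduction:
  assumes R: "R \<in> polys (polys W)" "R \<notin> polys (polys \<mm>)" "degree R < N"
    and q: "q \<in> polys W" "q \<notin> polys \<mm>" and M: "M = ell ^ m"
    and cong: "\<Psi> (R ^ M - monom ((\<Prod>s\<in>S. [:- s, 1:] ^ b s) * q ^ M) j) \<in> fpss \<mm>"
  shows "branch j b \<in> Qgrp M"
proof -
  have M0: "M > 0" using ell prime_gt_0_nat by (simp add: M)
  define h where "h = (\<Prod>s\<in>S. [:- s, 1:] ^ b s)"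
  have hW: "h \<in> polys W" using least_at_branch(3)[OF s0(1)] by (simp add: h_def)
  define Z where "Z = h * q ^ M"
  have ZW: "Z \<in> polys W" unfolding Z_def by (intro polys_closed(6,7)[OF sW] hW q)
  note sWW = is_subring_polys[OF sW]
  have BW: "monom Z j \<in> polys (polys W)" by (rule polys_closed(11)[OF sWW ZW])
  have RM: "R ^ M \<in> polys (polys W)" by (rule polys_closed(7)[OF sWW R(1)])
  have cong: "\<Psi> (R ^ M - monom Z j) \<in> fpss \<mm>" using cong by (simp add: Z_def h_def)
  \<comment> \<open>Modulo \<open>\<mm>\<close> both \<open>\<alpha> ^ M\<close> and
    \<open>\<zeta> ^ j\<close> times \<open>\<beta> ^ M\<close> equal the expansion of the twisted
    branch term. Primality then makes \<open>\<alpha>\<close> congruent to \<open>\<beta>\<close>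
    times some \<open>M\<close>-th root \<open>a\<close> of \<open>\<zeta> ^ j\<close>.\<close>
  define \<alpha> \<beta> where "\<alpha> = \<Psi> (tw \<zeta> R)" and "\<beta> = \<Psi> R"
  have "\<beta> \<notin> fpss \<mm>" unfolding \<beta>_def by (rule \<Psi>_not_in_m[OF R])
  then have b0: "\<beta> \<noteq> 0" using prime_idealD(3)[OF MF] by auto
  have twZ: "tw \<zeta> (monom Z j) = smult [:\<zeta> ^ j:] (monom Z j)" by (rule poly_eqI) (auto simp: coeff_tw)
  have "\<Psi> (tw \<zeta> (R ^ M - monom Z j)) \<in> fpss \<mm>" by (rule \<Psi>_tw[OF polys_closed(4)[OF sWW RM BW] cong])
  then have 1: "\<alpha> ^ M - fps_const (\<zeta> ^ j) * \<Psi> (monom Z j) \<in> fpss \<mm>"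
    by (simp only: tw_simps twZ \<Psi>_simps \<Psi>_smult \<alpha>_def)
  have fc: "fps_const c \<in> fpss W" if "c \<in> W" for c using that W_closed(2) by (auto simp: fpss_def)
  have "fps_const (\<zeta> ^ j) * \<Psi> (R ^ M - monom Z j) \<in> fpss \<mm>" by (rule prime_idealD(6)[OF MF fc[OF \<zeta>W] cong])
  then have 2: "fps_const (\<zeta> ^ j) * \<beta> ^ M - fps_const (\<zeta> ^ j) * \<Psi> (monom Z j) \<in> fpss \<mm>"
    by (simp only: \<Psi>_simps \<beta>_def right_diff_distrib)
  have "\<alpha> ^ M - fps_const (\<zeta> ^ j) * \<beta> ^ M \<in> fpss \<mm>"
    using prime_idealD(12)[OF MF 1 prime_idealD(11)[OF MF 2]] .
  moreover obtain A where A: "\<alpha> ^ M - fps_const (\<zeta> ^ j) * \<beta> ^ M = (\<Prod>a\<in>#A. \<alpha> - fps_const a * \<beta>)" "\<forall>a\<in>#A. a ^ M = \<zeta> ^ j"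
    using homogeneous_factor[OF b0 M0, of \<alpha> "\<zeta> ^ j"] by blast
  ultimately have "(\<Prod>a\<in>#A. \<alpha> - fps_const a * \<beta>) \<in> fpss \<mm>" by simp
  moreover have AW: "a \<in> W" if "a \<in># A" for a using root_in_W[OF _ M0, of a] A(2) that \<zeta>W by auto
  moreover have "\<alpha> - fps_const a * \<beta> \<in> fpss W" if "a \<in># A" for a
    unfolding \<alpha>_def \<beta>_def using tw_W(1)[OF R(1), of 1] AW[OF that]
    by (intro is_subring_closed(3,4)[OF sF] \<Psi>_W R fc) auto
  ultimately obtain a where a: "a \<in># A" "\<alpha> - fps_const a * \<beta> \<in> fpss \<mm>"
    using prime_ideal_prod_mset[OF MF] by blast
  have aM: "a ^ M = \<zeta> ^ j" using A(2) a(1) by auto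
  have "\<Psi> (tw \<zeta> R - smult [:a:] R) \<in> fpss \<mm>" using a(2) by (simp only: \<Psi>_simps \<Psi>_smult \<alpha>_def \<beta>_def)
  moreover have "tw \<zeta> R - smult [:a:] R \<in> polys (polys W)"
    using tw_W(1)[OF R(1), of 1] AW[OF a(1)] by (intro polys_closed(4,10)[OF sWW] polys_closed(8)[OF sW] R) auto
  moreover have "degree (tw \<zeta> R - smult [:a:] R) < N"
    by (intro degree_diff_less degree_tw R le_less_trans[OF degree_smult_le])
  ultimately have "tw \<zeta> R - smult [:a:] R \<in> polys (polys \<mm>)" by (intro \<Psi>_in_m)
  then have c: "[:\<zeta> ^ k - a:] * coeff R k \<in> polys \<mm>" for k
    using polysD[of _ "polys \<mm>" k] by (force simp: coeff_tw smult_diff_left)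
  have RW: "coeff R k \<in> polys W" for k using polysD[OF R(1)] .
  have dich: "\<zeta> ^ k - a \<in> \<mm> \<or> coeff R k \<in> polys \<mm>" for k
  proof -
    have "[:\<zeta> ^ k - a:] \<in> polys W" by (intro polys_closed(8)[OF sW] W_closed(3) \<zeta>W AW a)
    then have "[:\<zeta> ^ k - a:] \<in> polys \<mm> \<or> coeff R k \<in> polys \<mm>" using prime_idealD(8)[OF MP c _ RW] by blast
    then show ?thesis by (auto simp: polys_pCons_iff)
  qed
  have z0: "0 \<in> polys \<mm>" using m_simps(3) by (simp add: polys_def)
  obtain k0 where k0: "coeff R k0 \<notin> polys \<mm>" using R(2) by (auto simp: polys_def[of "polys \<mm>"])
  then have "coeff R k0 \<noteq> 0" using z0 by metis
  then have k0N: "k0 < N" using le_degree[of R k0] R(3) by linarith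
  have "a ^ (ell ^ (m + n)) = (a ^ M) ^ N" by (simp add: M N_eq power_add power_mult)
  then have "a ^ (ell ^ (m + n)) = 1" using aM \<zeta>_pow by simp
  \<comment> \<open>Two congruent roots of unity of \<open>ell\<close>-power order are equal. Hence
    all coefficients of \<open>R\<close> other than the one at \<open>k0\<close> reduce to
    zero.\<close>
  then have ak: "a = \<zeta> ^ k0" using \<zeta>_cong dich[of k0] k0 by blast
  have others: "coeff R k \<in> polys \<mm>" if "k \<noteq> k0" for k
  proof (cases "k < N")
    case True
    have "\<zeta> ^ k - \<zeta> ^ k0 \<notin> \<mm>"
      using \<zeta>_cong[of "\<zeta> ^ k0" n k] \<zeta>_pow[of k0] \<zeta>_eq_iff[OF k0N True] that by (auto simp: N_eq)
    then show ?thesis using dich[of k] by (simp add: ak)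
  next
    case False
    then show ?thesis using R(3) z0 by (simp add: coeff_eq_0)
  qed
  define p where "p = coeff R k0"
  have pW: "p \<in> polys W" "p \<notin> polys \<mm>" using RW k0 by (auto simp: p_def)
  have "R - monom p k0 \<in> polys (polys \<mm>)"
    unfolding polys_def[of "polys \<mm>"] using others z0 by (auto simp: p_def)
  then have "R ^ M - monom p k0 ^ M \<in> polys (polys \<mm>)"
    by (intro prime_ideal_power_diff[OF MPP] R polys_closed(11)[OF sWW] pW)
  then have "\<Psi> (R ^ M - monom p k0 ^ M) \<in> fpss \<mm>" by (rule \<Psi>_W(2))
  then have "\<Psi> (monom p k0 ^ M) - \<Psi> (R ^ M) \<in> fpss \<mm>" using prime_idealD(11)[OF MF] by (simp only: \<Psi>_simps)
  moreover have "\<Psi> (R ^ M) - \<Psi> (monom Z j) \<in> fpss \<mm>" using cong by (simp only: \<Psi>_simps)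
  ultimately have "\<Psi> (monom p k0 ^ M) - \<Psi> (monom Z j) \<in> fpss \<mm>" by (rule prime_idealD(12)[OF MF])
  moreover have \<Psi>m: "\<Psi> (monom Y l) = \<Psi> [:Y:] * yT ^ l" for Y l
  proof -
    have "monom Y l = [:Y:] * monom 1 l" by (simp add: smult_monom)
    then show ?thesis by (simp only: \<Psi>_simps \<Psi>_monom)
  qed
  moreover have "monom p k0 ^ M = monom (p ^ M) (k0 * M)" by (rule monom_power)
  ultimately have 3: "\<Psi> [:p ^ M:] * yT ^ (k0 * M) - \<Psi> [:Z:] * yT ^ j \<in> fpss \<mm>" by simp
  \<comment> \<open>The exponents \<open>j\<close> and \<open>k0 * M\<close> agree modulo
    \<open>N\<close>. By \<open>y ^ N = F(x)\<close> their quotients by \<open>N\<close> become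
    exponents of \<open>F\<close>, and the powers of \<open>y\<close> can be cancelled.\<close>
  define t t' where "t = j div N" and "t' = (k0 * M) div N"
  have "\<zeta> ^ (k0 * M) = \<zeta> ^ j" using aM by (simp add: ak power_mult)
  then have "(k0 * M) mod N = j mod N"
    using \<zeta>_eq_iff[of "(k0 * M) mod N" "j mod N"] N by (simp add: \<zeta>_mod)
  then have tt: "j + t' * N = k0 * M + t * N"
    using div_mult_mod_eq[of j N] div_mult_mod_eq[of "k0 * M" N] unfolding t_def t'_def by linarith
  have \<Psi>p: "\<Psi> [:Y * Y':] = \<Psi> [:Y:] * \<Psi> [:Y':]" "\<Psi> [:Y ^ l:] = \<Psi> [:Y:] ^ l" for Y Y' l
    by (simp_all add: \<Psi>_const rhom_simps[OF rhom_poly_map[OF rhom_fps_const]])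
  have \<Psi>d: "\<Psi> [:Y - Y':] = \<Psi> [:Y:] - \<Psi> [:Y':]" for Y Y'
    by (simp add: \<Psi>_const rhom_simps[OF rhom_poly_map[OF rhom_fps_const]])
  have yW: "yT ^ l \<in> fpss W" for l by (rule is_subring_closed(7)[OF sF xyT_W(2)])
  have "yT ^ (t' * N) * (\<Psi> [:p ^ M:] * yT ^ (k0 * M) - \<Psi> [:Z:] * yT ^ j) \<in> fpss \<mm>"
    by (rule prime_idealD(6)[OF MF yW 3])
  also have "yT ^ (t' * N) * (\<Psi> [:p ^ M:] * yT ^ (k0 * M) - \<Psi> [:Z:] * yT ^ j)
    = yT ^ (t' * N) * \<Psi> [:p ^ M:] * yT ^ (k0 * M) - \<Psi> [:Z:] * yT ^ (j + t' * N)"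
    by (simp add: algebra_simps power_add)
  also have "\<dots> = yT ^ (k0 * M) * \<Psi> [:F ^ t' * p ^ M - F ^ t * Z:]"
    unfolding tt \<Psi>d \<Psi>p \<Psi>_F by (simp add: algebra_simps power_add power_mult[symmetric])
  finally have "yT ^ (k0 * M) * \<Psi> [:F ^ t' * p ^ M - F ^ t * Z:] \<in> fpss \<mm>" .
  moreover have "yT ^ (k0 * M) \<notin> fpss \<mm>" using least_at_yT[of "k0 * M"] by (auto simp: least_at_def fpss_def)
  moreover have FW: "F ^ t' * p ^ M - F ^ t * Z \<in> polys W" by (intro polys_closed(4,6,7)[OF sW] F_W pW ZW)
  ultimately have "\<Psi> [:F ^ t' * p ^ M - F ^ t * Z:] \<in> fpss \<mm>"
    using prime_idealD(8)[OF MF _ yW \<Psi>_W(1)[OF const_W(1)]] by blast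
  then have cg: "F ^ t' * p ^ M - F ^ t * Z \<in> polys \<mm>"
    using \<Psi>_in_m[OF const_W(1)[OF FW]] N const_W(2) by simp
  \<comment> \<open>The orders of vanishing of both sides at the reduction of \<open>s\<close> are
    compared: \<open>t' * e s + M * vp = t * e s + (b s + M * vq)\<close>.\<close>
  have ex: "\<exists>k. int (b s) + (int t - int t') * int (e s) = int M * k" if s: "s \<in> S" for s
  proof -
    have sW': "s \<in> W" using s SW by auto
    note lb = least_at_branch[OF s]
    note pcW = pcompose_in_subring[OF sW _ lb(4)]
    obtain vp where vp: "least_at \<mm> (coeff (pcompose p [:s, 1:])) vp" using least_at_shift(1)[OF pW sW'] by blast
    obtain vq where vq: "least_at \<mm> (coeff (pcompose q [:s, 1:])) vq" using least_at_shift(1)[OF q sW'] by blast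
    have "pcompose (F ^ t' * p ^ M - F ^ t * Z) [:s, 1:] \<in> polys \<mm>" by (rule pcompose_in_ideal[OF MW cg lb(4)])
    then have "pcompose F [:s, 1:] ^ t' * pcompose p [:s, 1:] ^ M
       - pcompose F [:s, 1:] ^ t * (pcompose h [:s, 1:] * pcompose q [:s, 1:] ^ M) \<in> polys \<mm>"
      by (simp only: rhom_simps[OF rhom_pcompose] Z_def)
    moreover have "least_at \<mm> (coeff (pcompose F [:s, 1:] ^ t' * pcompose p [:s, 1:] ^ M)) (t' * e s + M * vp)"
      by (intro least_at_poly_mult[OF MW] least_at_poly_power[OF MW] polys_closed(7)[OF sW] pcW F_W pW lb(2) vp)
    ultimately have "least_at \<mm> (coeff (pcompose F [:s, 1:] ^ t * (pcompose h [:s, 1:] * pcompose q [:s, 1:] ^ M))) (t' * e s + M * vp)"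
      by (rule least_at_cong[OF MW])
    moreover have "least_at \<mm> (coeff (pcompose F [:s, 1:] ^ t * (pcompose h [:s, 1:] * pcompose q [:s, 1:] ^ M))) (t * e s + (b s + M * vq))"
      unfolding h_def
      by (intro least_at_poly_mult[OF MW] least_at_poly_power[OF MW] polys_closed(6,7)[OF sW] pcW F_W q lb(1,2,3) vq)
    ultimately have "t' * e s + M * vp = t * e s + (b s + M * vq)" by (rule least_at_unique)
    then have "int t' * int (e s) + int M * int vp = int t * int (e s) + (int (b s) + int M * int vq)"
      by (metis of_nat_add of_nat_mult)
    then show ?thesis by (intro exI[of _ "int vp - int vq"]) (simp add: algebra_simps)
  qed
  then obtain k where k: "\<And>s. s \<in> S \<Longrightarrow> int (b s) + (int t - int t') * int (e s) = int M * k s" by metis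
  obtain l where l: "l ^ M = lam powi (int t - int t')" using nth_root_exists[OF M0] by blast
  have l0: "l \<noteq> 0" using l lam M0 by (auto simp: zero_power)
  \<comment> \<open>The exact root: \<open>l\<close> takes care of the power of \<open>lam\<close>,
    and \<open>k s\<close> is the total order at \<open>s\<close> divided by
    \<open>M\<close>.\<close>
  define w where "w = y ^ k0 * i l * (\<Prod>s\<in>S. (x - i s) powi k s)"
  have pF: "px F = i lam * (\<Prod>s\<in>S. (x - i s) ^ e s)" unfolding F_eq by (simp add: px_const px_simps i_simps)
  have pF0: "px F \<noteq> 0" using px_eq_0 F0 by simp
  have "y ^ j * px F ^ t' = y ^ (j + t' * N)" by (simp add: y_pow'[symmetric] power_add mult.commute[of t'] power_mult)
  also have "\<dots> = (y ^ k0) ^ M * px F ^ t" unfolding tt by (simp add: y_pow'[symmetric] power_add mult.commute[of t] power_mult)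
  finally have "y ^ j = (y ^ k0) ^ M * px F powi (int t - int t')" using pF0 by (simp add: power_int_diff field_simps)
  moreover have "px F powi (int t - int t') = i l ^ M * (\<Prod>s\<in>S. (x - i s) powi ((int t - int t') * int (e s)))"
  proof -
    have "i lam powi (int t - int t') = i (lam powi (int t - int t'))" by (auto simp: power_int_def i_simps)
    moreover have "(\<Prod>s\<in>S. (x - i s) ^ e s) powi (int t - int t') = (\<Prod>s\<in>S. (x - i s) powi ((int t - int t') * int (e s)))"
    proof -
      have "(\<Prod>s\<in>J. (x - i s) ^ e s) powi r = (\<Prod>s\<in>J. (x - i s) powi (r * int (e s)))" for J r
        by (induction J rule: infinite_finite_induct)
          (simp_all add: power_int_mult_distrib mult.commute[of r] power_int_mult)
      then show ?thesis .
    qed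
    ultimately show ?thesis unfolding pF power_int_mult_distrib by (simp add: l[symmetric] i_simps)
  qed
  ultimately have "branch j b = (y ^ k0) ^ M * i l ^ M * (\<Prod>s\<in>S. (x - i s) powi ((int t - int t') * int (e s)) * (x - i s) ^ b s)"
    by (simp add: branch_def prod.distrib)
  also have "(\<Prod>s\<in>S. (x - i s) powi ((int t - int t') * int (e s)) * (x - i s) ^ b s) = (\<Prod>s\<in>S. ((x - i s) powi k s) ^ M)"
  proof (intro prod.cong refl)
    fix s assume s: "s \<in> S"
    have "(x - i s) powi ((int t - int t') * int (e s)) * (x - i s) ^ b s = (x - i s) powi ((int t - int t') * int (e s) + int (b s))"
      using x_diff_nonzero by (subst power_int_add) auto
    also have "(int t - int t') * int (e s) + int (b s) = k s * int M" using k[OF s] by (simp add: mult.commute)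
    finally show "(x - i s) powi ((int t - int t') * int (e s)) * (x - i s) ^ b s = ((x - i s) powi k s) ^ M"
      by (simp add: power_int_mult)
  qed
  finally have "branch j b = w ^ M" by (simp add: w_def power_mult_distrib prod_power_distrib)
  moreover have "w \<in> K"
  proof -
    have "(x - i s) powi r \<in> K" for s r using K_closed by (auto simp: power_int_def)
    then show ?thesis unfolding w_def
      by (intro K_closed(4,7) i_K y_K is_subring_prod[OF is_subfieldD(1)[OF subfield_K]])
  qed
  moreover have "w \<noteq> 0" using y_nonzero l0 i_simps(12) x_diff_nonzero S by (auto simp: w_def)
  ultimately show ?thesis using Qgrp_power by simp
qed

text \<open>The contents of numerator and denominator are collected in \<open>c\<close>, which need
  not lie in \<open>W\<close>.\<close>

lemma primitive_fraction:
  assumes "G \<in> K" "G \<noteq> 0"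
  shows "\<exists>c P q. c \<noteq> 0 \<and> P \<in> polys (polys W) \<and> P \<notin> polys (polys \<mm>) \<and> degree P < N \<and>
    q \<in> polys W \<and> q \<notin> polys \<mm> \<and> G = i c * ev P / px q"
proof -
  obtain p q where pq: "q \<noteq> 0" "G = ev p / px q" "px q \<noteq> 0" "degree p < N" using assms(1) by (rule K_E)
  have p0: "p \<noteq> 0" using assms(2) pq by (auto simp: ev_simps)
  obtain c where c: "c \<noteq> 0" "smult [:c:] p \<in> polys (polys W)" "smult [:c:] p \<notin> polys (polys \<mm>)" using scale[OF p0] by blast
  obtain d where d: "d \<noteq> 0" "smult [:d:] [:q:] \<in> polys (polys W)" "smult [:d:] [:q:] \<notin> polys (polys \<mm>)" using scale[of "[:q:]"] pq(1) by auto
  have dq: "smult d q \<in> polys W" "smult d q \<notin> polys \<mm>"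
    using d(2,3) const_W(2)[of "smult d q"] polysD[OF d(2), of 0] by auto
  have "ev (smult [:c:] p) = i c * ev p" using ev_simps(4)[of "[:[:c:]:]" p] by (simp add: ev_const px_const)
  then have "G = i (d / c) * ev (smult [:c:] p) / px (smult d q)"
    using c(1) d(1) i_simps(12)[of c] i_simps(12)[of d] pq(3) by (simp add: pq(2) px_const i_simps field_simps)
  moreover have "degree (smult [:c:] p) < N" using degree_smult_le le_less_trans pq(4) by blast
  ultimately show ?thesis using c d dq by (intro exI[of _ "d / c"] exI[of _ "smult [:c:] p"] exI[of _ "smult d q"]) auto
qed

text \<open>\<open>A\<close> depends on \<open>G\<close> alone, so it can be fixed before
  \<open>\<sigma>\<close>. If \<open>\<sigma>\<close> is trivial on \<open>A\<close> modulo
  \<open>\<mm>\<close>, numerator and denominator of \<open>\<sigma> G\<close> are congruent to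
  those of \<open>G\<close> and can be cancelled, which leaves the congruence that
  \<open>branch_reduction\<close> requires.\<close>

lemma good_reduction:
  assumes G: "G \<in> K" "G \<noteq> 0" and M: "M = ell ^ m"
  shows "\<exists>A. finite A \<and> A \<subseteq> W \<and> (\<forall>\<sigma>\<in>stab. (\<forall>a\<in>A. \<sigma> a - a \<in> \<mm>) \<longrightarrow>
    (\<forall>j b v. v \<in> K \<longrightarrow> v \<noteq> 0 \<longrightarrow> tau \<sigma> G / G = branch j b * v ^ M \<longrightarrow> branch j b \<in> Qgrp M))"
proof -
  have M0: "M > 0" using ell prime_gt_0_nat by (simp add: M)
  note sWW = is_subring_polys[OF sW]
  obtain c P q where *: "c \<noteq> 0" "P \<in> polys (polys W)" "P \<notin> polys (polys \<mm>)" "degree P < N"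
    "q \<in> polys W" "q \<notin> polys \<mm>" "G = i c * ev P / px q" using primitive_fraction[OF G] by blast
  define A where "A = (\<Union>j\<le>degree P. coeff (coeff P j) ` {..degree (coeff P j)}) \<union> coeff q ` {..degree q}"
  have A: "finite A" "A \<subseteq> W" using polysD[OF polysD[OF *(2)]] polysD[OF *(5)] by (auto simp: A_def)
  have "branch j b \<in> Qgrp M"
    if \<sigma>: "\<sigma> \<in> stab" and c\<sigma>: "\<forall>a\<in>A. \<sigma> a - a \<in> \<mm>" and v: "v \<in> K" "v \<noteq> 0" and eq: "tau \<sigma> G / G = branch j b * v ^ M" for \<sigma> j b v
  proof -
    have \<sigma>A: "\<sigma> \<in> Aut {}" using \<sigma> by (simp add: stab_def)
    note D = AutD[OF \<sigma>A]
    have dq: "map_poly \<sigma> q - q \<in> polys \<mm>"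
    proof -
      have "\<sigma> (coeff q k) - coeff q k \<in> \<mm>" for k
        using c\<sigma> m_simps(3) D(5) by (cases "k \<le> degree q") (auto simp: A_def coeff_eq_0)
      then show ?thesis by (simp add: polys_def coeff_map_poly D)
    qed
    define P' where "P' = map_poly (map_poly \<sigma>) P"
    have dP: "P' - P \<in> polys (polys \<mm>)"
    proof -
      have "\<sigma> (coeff (coeff P l) k) - coeff (coeff P l) k \<in> \<mm>" for l k
      proof (cases "l \<le> degree P \<and> k \<le> degree (coeff P l)")
        case True
        then have "coeff (coeff P l) k \<in> A" unfolding A_def by blast
        then show ?thesis using c\<sigma> by blast
      next
        case False
        then have "coeff (coeff P l) k = 0" by (metis coeff_0 coeff_eq_0 not_le)
        then show ?thesis using m_simps(3) D(5) by simp
      qed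
      then show ?thesis by (simp add: polys_def P'_def coeff_map_poly D)
    qed
    \<comment> \<open>\<open>v\<close> is inverted so that its polynomial in \<open>y\<close> ends
      up on the side where an \<open>M\<close>-th power is to be exhibited, and only a polynomial in
      \<open>x\<close> joins the branch product.\<close>
    obtain d R r where 2: "d \<noteq> 0" "R \<in> polys (polys W)" "R \<notin> polys (polys \<mm>)" "degree R < N"
      "r \<in> polys W" "r \<notin> polys \<mm>" "inverse v = i d * ev R / px r" using primitive_fraction[of "inverse v"] v K_closed(10) by auto
    define h where "h = (\<Prod>s\<in>S. [:- s, 1:] ^ b s)"
    have hW: "h \<in> polys W" using least_at_branch(3)[OF s0(1)] by (simp add: h_def)
    define Z where "Z = monom (h * r ^ M) j"
    have evZ: "ev Z = branch j b * px r ^ M"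
    proof -
      have "Z = [:h * r ^ M:] * monom 1 j" by (simp add: Z_def smult_monom)
      then have "ev Z = px (h * r ^ M) * y ^ j" by (simp only: ev_simps ev_const ev_monom)
      moreover have "px h = (\<Prod>s\<in>S. (x - i s) ^ b s)" unfolding h_def by (simp only: px_simps) (simp add: px_const i_simps)
      ultimately show ?thesis by (simp add: branch_def px_simps mult_ac)
    qed
    have ZW: "Z \<in> polys (polys W)" unfolding Z_def by (intro polys_closed(11)[OF sWW] polys_closed(6,7)[OF sW] hW 2)
    have nz: "ev P \<noteq> 0" "px q \<noteq> 0" "px r \<noteq> 0" "ev R \<noteq> 0" "px (map_poly \<sigma> q) \<noteq> 0" "i c \<noteq> 0" "i d \<noteq> 0"
    proof -
      have "0 \<in> polys \<mm>" "0 \<in> polys (polys \<mm>)" using m_simps(3) by (auto simp: polys_def)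
      then show "ev P \<noteq> 0" "ev R \<noteq> 0" "px q \<noteq> 0" "px r \<noteq> 0" using * 2 ev_eq_0 px_eq_0 by metis+
      then show "px (map_poly \<sigma> q) \<noteq> 0" using px_eq_0 by (simp add: map_poly_eq_0_iff D)
      show "i c \<noteq> 0" "i d \<noteq> 0" using * 2 i_simps(12) by auto
    qed
    have tG: "tau \<sigma> G = i (\<sigma> c) * ev P' / px (map_poly \<sigma> q)"
      unfolding *(7) P'_def using hom_on_simps[OF tau(1)[OF \<sigma>] subfield_K]
      by (simp add: tau[OF \<sigma>] tau_px[OF \<sigma>] tau_simps[OF \<sigma>] K_closed)
    \<comment> \<open>All constants in one. The congruences do not control
      \<open>\<sigma> c / c\<close>; but the equation \<open>fps_const c' * u1 = u2\<close>, with
      both series outside the prime ideal, forces \<open>c'\<close> to be a unit of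
      \<open>W\<close>, and its \<open>M\<close>-th root is then absorbed into
      \<open>R\<close>.\<close>
    define c' where "c' = \<sigma> c / c * d ^ M"
    have c'0: "c' \<noteq> 0" using *(1) 2(1) D(13) by (simp add: c'_def)
    have v': "v = px r / (i d * ev R)" using 2(7) by (metis inverse_divide inverse_inverse_eq)
    have "i (\<sigma> c) * ev P' * px q * (i d * ev R) ^ M = branch j b * px r ^ M * px (map_poly \<sigma> q) * (i c * ev P)"
    proof -
      have "i (\<sigma> c) * ev P' / px (map_poly \<sigma> q) / (i c * ev P / px q) = branch j b * (px r / (i d * ev R)) ^ M"
        using eq unfolding tG by (simp only: *(7) v')
      then show ?thesis using nz by (simp add: field_simps power_divide)
    qed
    then have "i c' * (ev P' * px q * ev R ^ M) = branch j b * px r ^ M * px (map_poly \<sigma> q) * ev P"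
      using nz by (simp add: c'_def i_simps power_mult_distrib field_simps)
    moreover have "ev (smult [:c':] (P' * [:q:] * R ^ M)) = i c' * (ev P' * px q * ev R ^ M)"
    proof -
      have "smult [:c':] (P' * [:q:] * R ^ M) = [:[:c':]:] * (P' * [:q:] * R ^ M)" by simp
      then show ?thesis by (simp only: ev_simps ev_const px_const)
    qed
    moreover have "ev (Z * [:map_poly \<sigma> q:] * P) = branch j b * px r ^ M * px (map_poly \<sigma> q) * ev P"
      by (simp only: ev_simps ev_const evZ)
    ultimately have "\<Psi> (smult [:c':] (P' * [:q:] * R ^ M)) = \<Psi> (Z * [:map_poly \<sigma> q:] * P)" by (intro \<Psi>_ev) simp
    then have E: "fps_const c' * (\<Psi> P' * \<Psi> [:q:] * \<Psi> R ^ M) = \<Psi> Z * \<Psi> [:map_poly \<sigma> q:] * \<Psi> P"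
      by (simp only: \<Psi>_smult \<Psi>_simps)
    have in_m: "\<Psi> P' - \<Psi> P \<in> fpss \<mm>" "\<Psi> [:map_poly \<sigma> q:] - \<Psi> [:q:] \<in> fpss \<mm>"
      using \<Psi>_W(2)[OF dP] \<Psi>_W(2)[of "[:map_poly \<sigma> q - q:]"] const_W(2) dq \<Psi>_simps(6)[of "[:map_poly \<sigma> q:]" "[:q:]"]
      by (simp_all add: \<Psi>_simps)
    define p\<Psi> q\<Psi> r\<Psi> z\<Psi> where "p\<Psi> = \<Psi> P" and "q\<Psi> = \<Psi> [:q:]" and "r\<Psi> = \<Psi> R" and "z\<Psi> = \<Psi> Z"
    have inW: "p\<Psi> \<in> fpss W" "q\<Psi> \<in> fpss W" "r\<Psi> \<in> fpss W" "z\<Psi> \<in> fpss W"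
      unfolding p\<Psi>_def q\<Psi>_def r\<Psi>_def z\<Psi>_def by (intro \<Psi>_W * 2 ZW const_W)+
    have notm: "p\<Psi> \<notin> fpss \<mm>" "q\<Psi> \<notin> fpss \<mm>" "r\<Psi> \<notin> fpss \<mm>" "z\<Psi> \<notin> fpss \<mm>"
    proof -
      show "p\<Psi> \<notin> fpss \<mm>" "r\<Psi> \<notin> fpss \<mm>" unfolding p\<Psi>_def r\<Psi>_def
        by (rule \<Psi>_not_in_m; fact)+
      have "degree [:q:] < N" using N by simp
      then show "q\<Psi> \<notin> fpss \<mm>" unfolding q\<Psi>_def
        using \<Psi>_not_in_m[of "[:q:]"] const_W[of q] *(5,6) by simp
      have h: "h \<notin> polys \<mm>"
      proof
        assume "h \<in> polys \<mm>"
        then have "pcompose h [:s0, 1:] \<in> polys \<mm>" by (rule pcompose_in_ideal[OF MW _ least_at_branch(4)[OF s0(1)]])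
        then show False using least_at_branch(1)[OF s0(1), of b] by (auto simp: h_def[symmetric] least_at_def polys_def)
      qed
      have "h * r ^ M \<notin> polys \<mm>"
        using prime_idealD(8)[OF MP _ hW polys_closed(7)[OF sW 2(5)]] prime_ideal_power[OF MP _ 2(5)] h 2(6) by blast
      moreover have "h * r ^ M \<in> polys W" by (intro polys_closed(6,7)[OF sW] hW 2)
      ultimately have "\<Psi> [:h * r ^ M:] \<notin> fpss \<mm>" using const_W[of "h * r ^ M"] N \<Psi>_not_in_m[of "[:h * r ^ M:]"] by simp
      moreover have "yT ^ j \<notin> fpss \<mm>" using least_at_yT[of j] by (auto simp: least_at_def fpss_def)
      moreover have "Z = [:h * r ^ M:] * monom 1 j" by (simp add: Z_def smult_monom)
      then have "z\<Psi> = \<Psi> [:h * r ^ M:] * yT ^ j" unfolding z\<Psi>_def by (simp only: \<Psi>_simps \<Psi>_monom)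
      ultimately show "z\<Psi> \<notin> fpss \<mm>"
        using prime_idealD(8)[OF MF _ \<Psi>_W(1)[OF const_W(1)] is_subring_closed(7)[OF sF xyT_W(2)]] \<open>h * r ^ M \<in> polys W\<close> by metis
    qed
    define u1 u2 where "u1 = \<Psi> P' * q\<Psi> * r\<Psi> ^ M" and "u2 = z\<Psi> * \<Psi> [:map_poly \<sigma> q:] * p\<Psi>"
    note Fc = is_subring_closed[OF sF]
    have P'W: "\<Psi> P' \<in> fpss W" "\<Psi> [:map_poly \<sigma> q:] \<in> fpss W"
      using Fc(6)[OF prime_idealD(2)[OF MF in_m(1)] inW(1)] Fc(6)[OF prime_idealD(2)[OF MF in_m(2)] inW(2)]
      by (simp_all add: p\<Psi>_def q\<Psi>_def)
    have u12: "u1 - p\<Psi> * q\<Psi> * r\<Psi> ^ M \<in> fpss \<mm>" "u2 - z\<Psi> * q\<Psi> * p\<Psi> \<in> fpss \<mm>"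
    proof -
      have "(\<Psi> P' - \<Psi> P) * (q\<Psi> * r\<Psi> ^ M) \<in> fpss \<mm>" "(\<Psi> [:map_poly \<sigma> q:] - \<Psi> [:q:]) * (z\<Psi> * p\<Psi>) \<in> fpss \<mm>"
        by (intro prime_idealD(7)[OF MF] in_m Fc inW)+
      then show "u1 - p\<Psi> * q\<Psi> * r\<Psi> ^ M \<in> fpss \<mm>" "u2 - z\<Psi> * q\<Psi> * p\<Psi> \<in> fpss \<mm>"
        by (simp_all add: u1_def u2_def p\<Psi>_def q\<Psi>_def algebra_simps)
    qed
    have rM: "r\<Psi> ^ M \<notin> fpss \<mm>" using prime_ideal_power[OF MF _ inW(3)] notm(3) by blast
    have uW: "u1 \<in> fpss W" "u2 \<in> fpss W" unfolding u1_def u2_def by (intro Fc P'W inW)+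
    have pq\<Psi>: "p\<Psi> * q\<Psi> \<notin> fpss \<mm>" "p\<Psi> * q\<Psi> \<in> fpss W"
      using prime_idealD(8)[OF MF _ inW(1,2)] notm Fc(4)[OF inW(1,2)] by blast+
    have um: "u1 \<notin> fpss \<mm>" "u2 \<notin> fpss \<mm>"
    proof -
      have "p\<Psi> * q\<Psi> * r\<Psi> ^ M \<notin> fpss \<mm>" using prime_idealD(8)[OF MF _ pq\<Psi>(2) Fc(7)[OF inW(3)]] pq\<Psi>(1) rM by blast
      then show "u1 \<notin> fpss \<mm>" using prime_idealD(10)[OF MF, of u1 "u1 - p\<Psi> * q\<Psi> * r\<Psi> ^ M"] u12 by auto
      have "p\<Psi> * q\<Psi> * z\<Psi> \<notin> fpss \<mm>" using prime_idealD(8)[OF MF _ pq\<Psi>(2) inW(4)] pq\<Psi>(1) notm(4) by blast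
      then show "u2 \<notin> fpss \<mm>" using prime_idealD(10)[OF MF, of u2 "u2 - z\<Psi> * q\<Psi> * p\<Psi>"] u12 by (auto simp: mult_ac)
    qed
    have E': "fps_const c' * u1 = u2" using E by (simp add: u1_def u2_def p\<Psi>_def q\<Psi>_def r\<Psi>_def z\<Psi>_def)
    have fc: "fps_const a \<in> fpss W" if "a \<in> W" for a using that W_closed(2) by (auto simp: fpss_def)
    have fm: "fps_const a \<in> fpss \<mm>" if "a \<in> \<mm>" for a using that m_simps(3) by (auto simp: fpss_def)
    have c'W: "c' \<in> W"
    proof (rule ccontr)
      assume "c' \<notin> W"
      then have "inverse c' \<in> \<mm>" using inverse_max_ideal[OF W] by auto
      then have "fps_const (inverse c') * u2 \<in> fpss \<mm>" by (intro prime_idealD(7)[OF MF] fm uW)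
      then show False using um(1) c'0 by (simp flip: E' add: mult.assoc[symmetric])
    qed
    have c'm: "c' \<notin> \<mm>" using um(2) prime_idealD(7)[OF MF uW(1) fm] by (auto simp flip: E')
    obtain d' where d': "d' ^ M = c'" using nth_root_exists[OF M0] by blast
    have d'W: "d' \<in> W" "d' \<notin> \<mm>" using root_in_W[OF _ M0] root_not_in_m[OF _ M0] d' c'W c'm by auto
    define R' where "R' = smult [:d':] R"
    have R'W: "R' \<in> polys (polys W)" unfolding R'_def by (intro polys_closed(10)[OF sWW] polys_closed(8)[OF sW] d'W 2)
    have R'm: "R' \<notin> polys (polys \<mm>)"
    proof
      assume "R' \<in> polys (polys \<mm>)"
      then have "[:[:d':]:] * R \<in> polys (polys \<mm>)" by (simp add: R'_def)
      then have "[:[:d':]:] \<in> polys (polys \<mm>)"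
        using prime_idealD(8)[OF MPP _ const_W(1)[OF polys_closed(8)[OF sW d'W(1)]] 2(2)] 2(3) by blast
      then show False using d'W(2) by (auto simp: const_W(2) polys_pCons_iff)
    qed
    have R'N: "degree R' < N" unfolding R'_def using degree_smult_le le_less_trans 2(4) by blast
    have \<Psi>R': "\<Psi> R' ^ M = fps_const c' * r\<Psi> ^ M"
    proof -
      have "fps_const d' ^ M = fps_const c'" unfolding d'[symmetric] by (rule rhom_simps(7)[OF rhom_fps_const, symmetric])
      then show ?thesis by (simp add: R'_def \<Psi>_smult power_mult_distrib r\<Psi>_def)
    qed
    have "p\<Psi> * q\<Psi> * (\<Psi> R' ^ M - z\<Psi>) = - (fps_const c' * (u1 - p\<Psi> * q\<Psi> * r\<Psi> ^ M)) + (u2 - z\<Psi> * q\<Psi> * p\<Psi>)"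
      unfolding \<Psi>R' E'[symmetric] by (simp add: algebra_simps)
    also have "\<dots> \<in> fpss \<mm>"
      by (intro prime_idealD(5,9)[OF MF] prime_idealD(6)[OF MF] fc c'W u12)
    finally have "\<Psi> R' ^ M - z\<Psi> \<in> fpss \<mm>"
      using prime_idealD(8)[OF MF _ pq\<Psi>(2) Fc(3)[OF Fc(7)[OF \<Psi>_W(1)[OF R'W]] inW(4)]] pq\<Psi>(1) by blast
    then have "\<Psi> (R' ^ M - monom ((\<Prod>s\<in>S. [:- s, 1:] ^ b s) * r ^ M) j) \<in> fpss \<mm>"
      by (simp add: \<Psi>_simps z\<Psi>_def Z_def h_def)
    then show ?thesis by (rule branch_reduction[OF R'W R'm R'N 2(5,6) M])
  qed
  then show ?thesis by (intro exI[of _ A] conjI A ballI allI impI)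
qed

text \<open>Induction on the number of applications of \<open>z - 1\<close> that kill the class of
  \<open>G\<close>. The hypothesis for \<open>diff_op z G\<close> makes
  \<open>\<sigma> G / G\<close> invariant under \<open>z\<close> up to \<open>M\<close>-th powers,
  and \<open>good_reduction\<close> for \<open>G\<close> itself disposes of the branch product. Each
  step adds finitely many elements to \<open>A\<close>.\<close>

theorem inertia_trivial:
  assumes G: "G \<in> Vgrp (ell ^ m)"
  shows "\<exists>A. finite A \<and> A \<subseteq> W \<and> (\<forall>\<sigma>\<in>stab. \<sigma> \<zeta> = \<zeta> \<longrightarrow> (\<forall>a\<in>A. \<sigma> a - a \<in> \<mm>) \<longrightarrow> tau \<sigma> G / G \<in> Qgrp (ell ^ m))"
proof -
  define M where "M = ell ^ m"
  have M0: "M > 0" using ell prime_gt_0_nat by (simp add: M_def)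
  interpret Z: mult_action K "Vgrp M" z by (rule action(1))
  have "\<exists>A. finite A \<and> A \<subseteq> W \<and> (\<forall>\<sigma>\<in>stab. \<sigma> \<zeta> = \<zeta> \<longrightarrow> (\<forall>a\<in>A. \<sigma> a - a \<in> \<mm>) \<longrightarrow> tau \<sigma> G / G \<in> Qgrp M)"
    if "G \<in> Vgrp M" "(diff_op z ^^ j) G \<in> Qgrp M" for j G
    using that
  proof (induction j arbitrary: G)
    case 0
    have "tau \<sigma> G / G \<in> Qgrp M" if "\<sigma> \<in> stab" for \<sigma>
      using 0 mult_groupD(5)[OF mult_group_Qgrp] hom_Qgrp[OF tau(1)[OF that] tau_simps(4)[OF that]] by simp
    then show ?case by (intro exI[of _ "{}"]) auto
  next
    case (Suc j)
    have dV: "diff_op z G \<in> Vgrp M" using Z.diff_op_V[OF Suc.prems(1), of 1] by simp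
    have "(diff_op z ^^ j) (diff_op z G) \<in> Qgrp M" using Suc.prems(2) by (simp only: funpow_Suc_right o_apply)
    from Suc.IH[OF dV this] obtain A1 where A1: "finite A1" "A1 \<subseteq> W"
      "\<forall>\<sigma>\<in>stab. \<sigma> \<zeta> = \<zeta> \<longrightarrow> (\<forall>a\<in>A1. \<sigma> a - a \<in> \<mm>) \<longrightarrow> tau \<sigma> (diff_op z G) / diff_op z G \<in> Qgrp M" by blast
    have GK: "G \<in> K" "G \<noteq> 0" using Suc.prems(1) by (auto simp: Vgrp_def)
    obtain A2 where A2: "finite A2" "A2 \<subseteq> W" "\<forall>\<sigma>\<in>stab. (\<forall>a\<in>A2. \<sigma> a - a \<in> \<mm>) \<longrightarrow>
      (\<forall>j b v. v \<in> K \<longrightarrow> v \<noteq> 0 \<longrightarrow> tau \<sigma> G / G = branch j b * v ^ M \<longrightarrow> branch j b \<in> Qgrp M)"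
      using good_reduction[OF GK M_def] by blast
    have "tau \<sigma> G / G \<in> Qgrp M" if \<sigma>: "\<sigma> \<in> stab" "\<sigma> \<zeta> = \<zeta>" "\<forall>a\<in>A1 \<union> A2. \<sigma> a - a \<in> \<mm>" for \<sigma>
    proof -
      interpret T: mult_action K "Vgrp M" "tau \<sigma>" by (rule action(2)[OF \<sigma>(1)])
      define G' where "G' = tau \<sigma> G / G"
      have G'V: "G' \<in> Vgrp M" using T.diff_op_V[OF Suc.prems(1), of 1] by (simp add: G'_def diff_op_def)
      have "diff_op z G' = diff_op (tau \<sigma>) (diff_op z G)"
        using diff_op_commute[OF \<sigma>(1,2) Suc.prems(1), of 1] by (simp add: G'_def diff_op_def[of "tau \<sigma>" G])
      then have "diff_op z G' \<in> Qgrp M" using A1(3) \<sigma> by (simp add: diff_op_def[of "tau \<sigma>"])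
      then obtain u where u: "u \<in> K" "u \<noteq> 0" "z G' / G' = u ^ M" by (auto simp: Qgrp_def diff_op_def)
      then have "z G' = G' * u ^ M" using T.V_closed(2)[OF G'V] by (simp add: field_simps)
      from invariant_classes[OF M0 G'V u(1,2) this] obtain l b v where v: "v \<in> K" "v \<noteq> 0" "G' = branch l b * v ^ M" by blast
      then have "branch l b \<in> Qgrp M" using A2(3) \<sigma> unfolding G'_def by blast
      then show ?thesis using mult_groupD(3)[OF mult_group_Qgrp _ Qgrp_power[OF v(1,2)]] v(3) by (simp add: G'_def)
    qed
    then show ?case using A1(1,2) A2(1,2) by (intro exI[of _ "A1 \<union> A2"]) auto
  qed
  from this[of G "m * N"] show ?thesis using G z_nilpotent[OF G] by (simp add: M_def)
qed

end

subsection \<open>Torsion divisor classes\<close>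

context superelliptic
begin

lemma tau_inv:
  assumes \<sigma>: "\<sigma> \<in> stab" and w: "w \<in> K"
  shows "tau (Hilbert_Choice.inv \<sigma>) (tau \<sigma> w) = w" "tau \<sigma> (tau (Hilbert_Choice.inv \<sigma>) w) = w"
proof -
  have "bij \<sigma>" using \<sigma> by (auto simp: stab_def AutD)
  then have "Hilbert_Choice.inv \<sigma> \<circ> \<sigma> = id" "\<sigma> \<circ> Hilbert_Choice.inv \<sigma> = id"
    by (auto simp: bij_is_inj bij_is_surj surj_iff[symmetric])
  then show "tau (Hilbert_Choice.inv \<sigma>) (tau \<sigma> w) = w" "tau \<sigma> (tau (Hilbert_Choice.inv \<sigma>) w) = w"
    using tau_comp[OF stab_inv[OF \<sigma>] \<sigma> w] tau_comp[OF \<sigma> stab_inv[OF \<sigma>] w] tau_id[OF w] by simp_all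
qed

lemma tau_points:
  assumes \<sigma>: "\<sigma> \<in> stab" and P: "P \<in> points i K"
  shows "tau \<sigma> ` P \<in> points i K" "w \<in> K \<Longrightarrow> w \<noteq> 0 \<Longrightarrow> ord_at (tau \<sigma> ` P) (tau \<sigma> w) = ord_at P w"
    "tau (Hilbert_Choice.inv \<sigma>) ` tau \<sigma> ` P = P" "tau \<sigma> ` tau (Hilbert_Choice.inv \<sigma>) ` P = P"
proof -
  show "tau \<sigma> ` P \<in> points i K" "w \<in> K \<Longrightarrow> w \<noteq> 0 \<Longrightarrow> ord_at (tau \<sigma> ` P) (tau \<sigma> w) = ord_at P w"
    using points_image[OF P tau(1)[OF \<sigma>] tau_image[OF \<sigma>]] by auto
  have "P \<subseteq> K" using pointsD(1)[OF P] valuation_ringD(2) by blast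
  then show "tau (Hilbert_Choice.inv \<sigma>) ` tau \<sigma> ` P = P" "tau \<sigma> ` tau (Hilbert_Choice.inv \<sigma>) ` P = P"
    using tau_inv[OF \<sigma>] by (auto simp: image_image subset_iff cong: image_cong_simp)
qed

text \<open>Uses \<open>tau \<sigma>\<close> as a total function, whereas \<open>pic_act\<close>
  works with its extensional restriction to \<open>K\<close>.\<close>

definition push :: "('a \<Rightarrow> 'a) \<Rightarrow> ('b set \<Rightarrow>\<^sub>0 int) \<Rightarrow> ('b set \<Rightarrow>\<^sub>0 int)"
  where "push \<sigma> D = frag_extend (\<lambda>P. frag_of (tau \<sigma> ` P)) D"

lemma push:
  assumes \<sigma>: "\<sigma> \<in> stab" and D: "Poly_Mapping.keys D \<subseteq> points i K"
  shows "Poly_Mapping.keys (push \<sigma> D) \<subseteq> points i K"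
    "Q \<in> points i K \<Longrightarrow> Poly_Mapping.lookup (push \<sigma> D) (tau \<sigma> ` Q) = Poly_Mapping.lookup D Q"
    "push \<sigma> (push (Hilbert_Choice.inv \<sigma>) D) = D"
proof -
  show "Poly_Mapping.keys (push \<sigma> D) \<subseteq> points i K"
    using keys_frag_extend[of "\<lambda>P. frag_of (tau \<sigma> ` P)" D] tau_points(1)[OF \<sigma>] D by (auto simp: push_def)
  show "Poly_Mapping.lookup (push \<sigma> D) (tau \<sigma> ` Q) = Poly_Mapping.lookup D Q" if Q: "Q \<in> points i K"
    using D unfolding push_def
  proof (induction D rule: frag_induction)
    case (one P)
    have "tau \<sigma> ` P = tau \<sigma> ` Q \<longleftrightarrow> P = Q" using tau_points(3)[OF \<sigma> one] tau_points(3)[OF \<sigma> Q] by metis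
    then show ?case by (auto simp: lookup_single when_def)
  qed (auto simp: frag_extend_diff lookup_minus)
  show "push \<sigma> (push (Hilbert_Choice.inv \<sigma>) D) = D"
    using D unfolding push_def
    by (induction D rule: frag_induction) (auto simp: frag_extend_diff tau_points(4)[OF \<sigma>])
qed

lemma push_add: "push \<sigma> (D + E) = push \<sigma> D + push \<sigma> E"
  by (simp add: push_def frag_extend_add)

lemma principal_divs_iff: "D \<in> principal_divs i K \<longleftrightarrow> Poly_Mapping.keys D \<subseteq> points i K \<and>
    (\<exists>u\<in>K. u \<noteq> 0 \<and> (\<forall>P\<in>points i K. Poly_Mapping.lookup D P = ord_at P u))"
  by (simp add: principal_divs_def free_Abelian_group_def)

lemma principal_divs_closed:
  "0 \<in> principal_divs i K"
  "D \<in> principal_divs i K \<Longrightarrow> E \<in> principal_divs i K \<Longrightarrow> D + E \<in> principal_divs i K"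
  "D \<in> principal_divs i K \<Longrightarrow> E \<in> principal_divs i K \<Longrightarrow> D - E \<in> principal_divs i K"
  "\<sigma> \<in> stab \<Longrightarrow> D \<in> principal_divs i K \<Longrightarrow> push \<sigma> D \<in> principal_divs i K"
proof -
  have "ord_at P 1 = 0" if "P \<in> points i K" for P
    using ord_at_simps(5)[OF that, of 1] by (simp add: i_simps)
  then show "0 \<in> principal_divs i K" unfolding principal_divs_iff
    using K_closed(1) by (intro conjI bexI[of _ 1]) auto
  show "D + E \<in> principal_divs i K" "D - E \<in> principal_divs i K"
    if DE: "D \<in> principal_divs i K" "E \<in> principal_divs i K" for D E
  proof -
    obtain u v where u: "u \<in> K" "u \<noteq> 0" "\<forall>P\<in>points i K. Poly_Mapping.lookup D P = ord_at P u"
      and v: "v \<in> K" "v \<noteq> 0" "\<forall>P\<in>points i K. Poly_Mapping.lookup E P = ord_at P v"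
      and k: "Poly_Mapping.keys D \<subseteq> points i K" "Poly_Mapping.keys E \<subseteq> points i K"
      using DE unfolding principal_divs_iff by (elim conjE bexE) (rule that)
    show "D + E \<in> principal_divs i K" unfolding principal_divs_iff
    proof (intro conjI bexI[of _ "u * v"] ballI)
      show "Poly_Mapping.keys (D + E) \<subseteq> points i K" using keys_add[of D E] k by blast
      show "u * v \<in> K" by (intro K_closed u v)
    qed (use u v ord_at_simps(1) in \<open>auto simp: lookup_add\<close>)
    show "D - E \<in> principal_divs i K" unfolding principal_divs_iff
    proof (intro conjI bexI[of _ "u / v"] ballI)
      show "Poly_Mapping.keys (D - E) \<subseteq> points i K" using keys_diff[of D E] k by blast
      show "u / v \<in> K" by (intro K_closed u v)
    qed (use u v ord_at_simps(6) in \<open>auto simp: lookup_minus\<close>)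
  qed
  show "push \<sigma> D \<in> principal_divs i K" if \<sigma>: "\<sigma> \<in> stab" and D: "D \<in> principal_divs i K"
  proof -
    obtain u where u: "u \<in> K" "u \<noteq> 0" "\<forall>P\<in>points i K. Poly_Mapping.lookup D P = ord_at P u"
      and k: "Poly_Mapping.keys D \<subseteq> points i K" using D by (auto simp: principal_divs_iff)
    show ?thesis unfolding principal_divs_iff
    proof (intro conjI bexI[of _ "tau \<sigma> u"] ballI)
      show "Poly_Mapping.keys (push \<sigma> D) \<subseteq> points i K" by (rule push(1)[OF \<sigma> k])
      show "tau \<sigma> u \<noteq> 0" using hom_on_simps(10)[OF tau(1)[OF \<sigma>] subfield_K u(1)] u(2) by simp
      show "tau \<sigma> u \<in> K" by (rule tau_simps(4)[OF \<sigma> u(1)])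
      fix P assume P: "P \<in> points i K"
      define Q where "Q = tau (Hilbert_Choice.inv \<sigma>) ` P"
      have "Q \<in> points i K" "P = tau \<sigma> ` Q"
        using tau_points(1)[OF stab_inv[OF \<sigma>] P] tau_points(4)[OF \<sigma> P] by (auto simp: Q_def)
      then show "Poly_Mapping.lookup (push \<sigma> D) P = ord_at P (tau \<sigma> u)"
        using push(2)[OF \<sigma> k, of Q] tau_points(2)[OF \<sigma>, of Q u] u by simp
    qed
  qed
qed

lemma div_class_eq: "div_class i K D = {E + D | E. E \<in> principal_divs i K}"
  by (auto simp: div_class_def r_coset_def div0_group_def free_Abelian_group_def)

lemma div_class_zero_iff: "div_class i K D = div_class i K 0 \<longleftrightarrow> D \<in> principal_divs i K"
proof
  assume "div_class i K D = div_class i K 0"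
  moreover have "D \<in> div_class i K D" unfolding div_class_eq using principal_divs_closed(1) by force
  ultimately show "D \<in> principal_divs i K" by (auto simp: div_class_eq)
next
  assume D: "D \<in> principal_divs i K"
  have "E \<in> div_class i K D" if "E \<in> principal_divs i K" for E
    unfolding div_class_eq using principal_divs_closed(3)[OF that D] by (auto intro!: exI[of _ "E - D"])
  then show "div_class i K D = div_class i K 0"
    using principal_divs_closed(2)[OF _ D] by (auto simp: div_class_eq)
qed

text \<open>If \<open>M D\<close> is the divisor of \<open>G\<close>, then \<open>M (\<sigma> D - D)\<close> is the divisor of \<open>\<sigma> G / G\<close>.\<close>

lemma push_div_class:
  assumes \<sigma>: "\<sigma> \<in> stab" and D: "Poly_Mapping.keys D \<subseteq> points i K" and M: "M > 0"
    and G: "G \<in> K" "G \<noteq> 0" "\<And>P. P \<in> points i K \<Longrightarrow> int M * Poly_Mapping.lookup D P = ord_at P G"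
    and Q: "tau \<sigma> G / G \<in> Qgrp M"
  shows "push \<sigma> ` div_class i K D = div_class i K D"
proof -
  obtain u where u: "u \<in> K" "u \<noteq> 0" "tau \<sigma> G / G = u ^ M" using Q by (auto simp: Qgrp_def)
  have \<sigma>G: "tau \<sigma> G \<in> K" "tau \<sigma> G \<noteq> 0"
    using tau_simps(4)[OF \<sigma> G(1)] hom_on_simps(10)[OF tau(1)[OF \<sigma>] subfield_K G(1)] G(2) by auto
  have "Poly_Mapping.lookup (push \<sigma> D - D) P = ord_at P u" if P: "P \<in> points i K" for P
  proof -
    define R where "R = tau (Hilbert_Choice.inv \<sigma>) ` P"
    have R: "R \<in> points i K" "P = tau \<sigma> ` R"
      using tau_points(1)[OF stab_inv[OF \<sigma>] P] tau_points(4)[OF \<sigma> P] by (auto simp: R_def)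
    have "int M * Poly_Mapping.lookup (push \<sigma> D - D) P = ord_at R G - ord_at P G"
      using push(2)[OF \<sigma> D R(1)] G(3)[OF P] G(3)[OF R(1)] R(2) by (simp add: lookup_minus right_diff_distrib)
    also have "\<dots> = ord_at P (tau \<sigma> G / G)"
      using tau_points(2)[OF \<sigma> R(1) G(1,2)] ord_at_simps(6)[OF P \<sigma>G G(1,2)] R(2) by simp
    also have "\<dots> = int M * ord_at P u" unfolding u(3) by (rule ord_at_simps(3)[OF P u(1,2)])
    finally show ?thesis using M by simp
  qed
  moreover have "Poly_Mapping.keys (push \<sigma> D - D) \<subseteq> points i K" using keys_diff[of "push \<sigma> D" D] push(1)[OF \<sigma> D] D by blast
  ultimately have d: "push \<sigma> D - D \<in> principal_divs i K" unfolding principal_divs_iff using u(1,2) by blast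
  show ?thesis
  proof (intro equalityI subsetI)
    fix E assume "E \<in> push \<sigma> ` div_class i K D"
    then obtain E' where E': "E' \<in> principal_divs i K" "E = push \<sigma> (E' + D)" by (auto simp: div_class_eq)
    have "E = (push \<sigma> E' + (push \<sigma> D - D)) + D" by (simp add: E' push_add)
    then show "E \<in> div_class i K D"
      unfolding div_class_eq using principal_divs_closed(2)[OF principal_divs_closed(4)[OF \<sigma> E'(1)] d] by blast
  next
    fix E assume "E \<in> div_class i K D"
    then obtain E' where E': "E' \<in> principal_divs i K" "E = E' + D" by (auto simp: div_class_eq)
    define E'' where "E'' = push (Hilbert_Choice.inv \<sigma>) (E' - (push \<sigma> D - D))"
    have e: "E' - (push \<sigma> D - D) \<in> principal_divs i K" by (rule principal_divs_closed(3)[OF E'(1) d])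
    then have "Poly_Mapping.keys (E' - (push \<sigma> D - D)) \<subseteq> points i K" by (simp add: principal_divs_iff)
    then have "push \<sigma> E'' = E' - (push \<sigma> D - D)" unfolding E''_def by (rule push(3)[OF \<sigma>])
    then have "E = push \<sigma> (E'' + D)" by (simp add: E'(2) push_add)
    moreover have "E'' \<in> principal_divs i K" unfolding E''_def by (rule principal_divs_closed(4)[OF stab_inv[OF \<sigma>] e])
    ultimately show "E \<in> push \<sigma> ` div_class i K D" unfolding div_class_eq by blast
  qed
qed

text \<open>\<open>y'\<close> stands for another generator: in the application it is the coordinate
  of the given model, while \<open>y\<close> of the locale has been divided by a polynomial. An
  automorphism is determined by its values on generators, so both descriptions give the same
  action.\<close>

lemma lift_aut_eq:
  assumes \<sigma>: "\<sigma> \<in> stab" and y': "func_field i x y' = K" "tau \<sigma> y' = y'"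
  shows "lift_aut i x y' \<sigma> = restrict (tau \<sigma>) K"
  unfolding lift_aut_def y'(1)
proof (rule the_equality)
  have y'K: "y' \<in> K" using generate_field_FR(2)[of "range i \<union> {x, y'}"] y'(1) by (auto simp: func_field_def)
  have "hom_on K (restrict (tau \<sigma>) K)" using tau(1)[OF \<sigma>] K_closed by (auto simp: hom_on_def)
  then show "restrict (tau \<sigma>) K \<in> field_auts K \<and> (\<forall>a. restrict (tau \<sigma>) K (i a) = i (\<sigma> a)) \<and>
      restrict (tau \<sigma>) K x = x \<and> restrict (tau \<sigma>) K y' = y'"
    using tau_simps[OF \<sigma>] y'K y'(2) tau_image(1)[OF \<sigma>] by (auto simp: field_auts_iff[OF subfield_K])
  fix \<tau> assume \<tau>: "\<tau> \<in> field_auts K \<and> (\<forall>a. \<tau> (i a) = i (\<sigma> a)) \<and> \<tau> x = x \<and> \<tau> y' = y'"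
  then have h: "hom_on K \<tau>" and ext: "\<tau> \<in> extensional K" by (auto simp: field_auts_iff[OF subfield_K])
  define A where "A = {w \<in> K. \<tau> w = tau \<sigma> w}"
  note [simp] = hom_on_simps[OF h subfield_K] hom_on_simps[OF tau(1)[OF \<sigma>] subfield_K]
  have "is_subfield A" unfolding is_subfield_def is_subring_def A_def by (auto simp: K_closed)
  then have "func_field i x y' \<subseteq> A" unfolding func_field_def
    by (rule generate_field_FR(3)) (use \<tau> y'K tau_simps[OF \<sigma>] y'(2) in \<open>auto simp: A_def\<close>)
  then have "\<tau> w = tau \<sigma> w" if "w \<in> K" for w using that y'(1) by (auto simp: A_def)
  then show "\<tau> = restrict (tau \<sigma>) K" using ext by (auto simp: fun_eq_iff extensional_def)
qed

lemma pic_act_eq: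
  assumes \<sigma>: "\<sigma> \<in> stab" and y': "func_field i x y' = K" "tau \<sigma> y' = y'"
    and D: "Poly_Mapping.keys D \<subseteq> points i K"
  shows "pic_act i x y' \<sigma> (div_class i K D) = push \<sigma> ` div_class i K D"
  unfolding pic_act_def lift_aut_eq[OF \<sigma> y']
proof (rule image_cong[OF refl])
  fix E assume "E \<in> div_class i K D"
  then have E: "Poly_Mapping.keys E \<subseteq> points i K"
    using D keys_add[of _ D] by (fastforce simp: div_class_eq principal_divs_iff)
  show "frag_extend (\<lambda>P. frag_of (restrict (tau \<sigma>) K ` P)) E = push \<sigma> E"
    unfolding push_def
  proof (rule frag_extend_eq)
    fix P assume "P \<in> Poly_Mapping.keys E"
    then have "P \<subseteq> K" using E pointsD(1) valuation_ringD(2) by blast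
    then show "frag_of (restrict (tau \<sigma>) K ` P) = frag_of (tau \<sigma> ` P)" by (auto intro!: arg_cong[where f = frag_of] image_cong)
  qed
qed

text \<open>The isomorphism pulls \<open>p\<close> back to the class of some \<open>D\<close>. A
  suitable multiple of this class is zero, and a function whose divisor is that multiple of
  \<open>D\<close> has all its orders divisible.\<close>

lemma torsion_class:
  assumes \<phi>: "\<phi> \<in> iso (pic0 i K) J" and J: "group J" and p: "p \<in> ell_torsion ell J" and ell: "ell > 0"
  shows "\<exists>m D G. Poly_Mapping.keys D \<subseteq> points i K \<and> div_class i K D \<in> carrier (pic0 i K) \<and> p = \<phi> (div_class i K D) \<and>
    G \<in> Vgrp (ell ^ m) \<and> (\<forall>P\<in>points i K. int (ell ^ m) * Poly_Mapping.lookup D P = ord_at P G)"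
proof -
  interpret J: group J by (rule J)
  define D0 where "D0 = {D. Poly_Mapping.keys D \<subseteq> points i K \<and> div_degree D = 0}"
  have carr: "carrier (pic0 i K) = div_class i K ` D0"
    by (auto simp: pic0_def FactGroup_def RCOSETS_def div_class_def div0_group_def free_Abelian_group_def D0_def)
  have hom: "\<phi> \<in> hom (pic0 i K) J" and bij: "bij_betw \<phi> (carrier (pic0 i K)) (carrier J)" using \<phi> by (auto simp: iso_def)
  have mult: "div_class i K D \<otimes>\<^bsub>pic0 i K\<^esub> div_class i K E = div_class i K (D + E)" for D E
  proof (intro equalityI subsetI)
    fix C assume "C \<in> div_class i K D \<otimes>\<^bsub>pic0 i K\<^esub> div_class i K E"
    then obtain D' E' where C: "D' \<in> principal_divs i K" "E' \<in> principal_divs i K" "C = D' + D + (E' + E)"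
      by (auto simp: pic0_def FactGroup_def set_mult_def div0_group_def free_Abelian_group_def div_class_eq)
    then have "C = (D' + E') + (D + E)" by (simp add: algebra_simps)
    then show "C \<in> div_class i K (D + E)" unfolding div_class_eq using principal_divs_closed(2)[OF C(1,2)] by blast
  next
    fix C assume "C \<in> div_class i K (D + E)"
    then obtain D' where C: "D' \<in> principal_divs i K" "C = D' + (D + E)" by (auto simp: div_class_eq)
    then have "C = (D' + D) + (0 + E)" by (simp add: algebra_simps)
    moreover have "D' + D \<in> div_class i K D" "0 + E \<in> div_class i K E" unfolding div_class_eq
      using C(1) principal_divs_closed(1) by blast+
    ultimately show "C \<in> div_class i K D \<otimes>\<^bsub>pic0 i K\<^esub> div_class i K E"
      unfolding pic0_def FactGroup_def set_mult_def div0_group_def free_Abelian_group_def by auto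
  qed
  have D0: "frag_cmul (int r) D \<in> D0" if "D \<in> D0" for r D
  proof (cases "r = 0")
    case False
    then have "Poly_Mapping.keys (frag_cmul (int r) D) = Poly_Mapping.keys D" by auto
    then show ?thesis using that by (auto simp: D0_def div_degree_def sum_distrib_left[symmetric])
  qed (auto simp: D0_def div_degree_def)
  have zero: "\<phi> (div_class i K 0) = \<one>\<^bsub>J\<^esub>"
  proof -
    have "0 \<in> D0" by (auto simp: D0_def div_degree_def)
    then have c: "div_class i K 0 \<in> carrier (pic0 i K)" by (simp add: carr)
    then have "\<phi> (div_class i K 0) \<otimes>\<^bsub>J\<^esub> \<phi> (div_class i K 0) = \<phi> (div_class i K 0)"
      using hom_mult[OF hom c c] mult[of 0 0] by simp
    then show ?thesis using J.r_cancel_one hom_in_carrier[OF hom c] by metis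
  qed
  obtain m where m: "p \<in> carrier J" "p [^]\<^bsub>J\<^esub> (ell ^ m) = \<one>\<^bsub>J\<^esub>" using p by (auto simp: ell_torsion_def)
  obtain D where D: "D \<in> D0" "p = \<phi> (div_class i K D)" using bij m(1) unfolding carr by (auto simp: bij_betw_def image_image)
  have pow: "p [^]\<^bsub>J\<^esub> r = \<phi> (div_class i K (frag_cmul (int r) D))" for r :: nat
  proof (induction r)
    case (Suc r)
    have "frag_cmul (int (Suc r)) D = frag_cmul (int r) D + D" by (simp add: frag_cmul_distrib add.commute)
    then have "\<phi> (div_class i K (frag_cmul (int (Suc r)) D)) = \<phi> (div_class i K (frag_cmul (int r) D)) \<otimes>\<^bsub>J\<^esub> p"
      using hom_mult[OF hom, of "div_class i K (frag_cmul (int r) D)" "div_class i K D"] D D0[OF D(1)] mult by (auto simp: carr)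
    then show ?case using Suc by simp
  qed (simp add: zero)
  have "\<phi> (div_class i K (frag_cmul (int (ell ^ m)) D)) = \<phi> (div_class i K 0)" using m(2) pow zero by simp
  moreover have "0 \<in> D0" by (auto simp: D0_def div_degree_def)
  ultimately have "div_class i K (frag_cmul (int (ell ^ m)) D) = div_class i K 0"
    using inj_onD[OF bij_betw_imp_inj_on[OF bij]] D0[OF D(1), of "ell ^ m"] unfolding carr by blast
  then have "frag_cmul (int (ell ^ m)) D \<in> principal_divs i K" by (simp only: div_class_zero_iff)
  then obtain G where G: "G \<in> K" "G \<noteq> 0" "\<forall>P\<in>points i K. int (ell ^ m) * Poly_Mapping.lookup D P = ord_at P G"
    by (auto simp: principal_divs_iff)
  have "int (ell ^ m) dvd ord_at P G" if "P \<in> points i K" for P using G(3) that by (metis dvd_triv_left)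
  then have "G \<in> Vgrp (ell ^ m)" using G by (simp add: Vgrp_def)
  then show ?thesis using D G carr by (intro exI[of _ m] exI[of _ D] exI[of _ G]) (auto simp: D0_def)
qed

end

subsection \<open>The superelliptic model\<close>

text \<open>A root \<open>\<theta>\<close> of the sum of the powers of \<open>X\<close> below
  \<open>ell\<close> differs from \<open>1\<close> in characteristic zero, and
  \<open>\<zeta>\<close> is an iterated \<open>ell\<close>-th root of it. An exponent
  \<open>j\<close> killing \<open>\<zeta>\<close> could be replaced by its gcd with
  \<open>ell ^ n\<close>, a smaller power of \<open>ell\<close>, which would make
  \<open>\<theta>\<close> equal to \<open>1\<close>.\<close>

lemma primitive_root_exists:
  assumes ell: "Factorial_Ring.prime ell" and n: "n \<ge> 1"
  obtains \<zeta> :: "'a :: {alg_closed_field, field_char_0}"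
  where "\<zeta> ^ (ell ^ n) = 1" "\<And>j. 0 < j \<Longrightarrow> j < ell ^ n \<Longrightarrow> \<zeta> ^ j \<noteq> 1"
proof -
  have e2: "ell > 1" using ell prime_gt_1_nat by blast
  obtain \<theta> :: 'a where \<theta>: "(\<Sum>k\<le>ell - 1. 1 * \<theta> ^ k) = 0" using alg_closed[of "ell - 1" "\<lambda>_. 1"] e2 by auto
  have "{..ell - 1} = {..<ell}" using e2 by auto
  then have s0: "(\<Sum>k<ell. \<theta> ^ k) = 0" using \<theta> by simp
  then have \<theta>1: "\<theta> \<noteq> 1" using e2 by auto
  have \<theta>e: "\<theta> ^ ell = 1" using s0 power_diff_1_eq[of \<theta> ell] by simp
  obtain \<zeta> where \<zeta>: "\<zeta> ^ (ell ^ (n - 1)) = \<theta>" using nth_root_exists[of "ell ^ (n - 1)" \<theta>] e2 by auto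
  have "ell ^ n = ell ^ (n - 1) * ell" using n by (metis One_nat_def Suc_pred less_eq_Suc_le power_Suc2)
  then have 1: "\<zeta> ^ (ell ^ n) = 1" using \<zeta> \<theta>e by (simp add: power_mult)
  moreover have "\<zeta> ^ j \<noteq> 1" if j: "0 < j" "j < ell ^ n" for j
  proof
    assume \<zeta>j: "\<zeta> ^ j = 1"
    obtain u v where uv: "j * u = ell ^ n * v + gcd j (ell ^ n)" using bezout_nat[of j "ell ^ n"] j(1) by auto
    obtain r where r: "gcd j (ell ^ n) = ell ^ r" "r \<le> n" using divides_primepow_nat[OF ell] by (meson gcd_dvd2)
    have "ell ^ r \<le> j" using r(1) j(1) by (metis gcd_le1_nat less_not_refl)
    then have "r < n" using j(2) e2 by (metis le_less_trans power_less_imp_less_exp)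
    have "\<zeta> ^ (j * u) = \<zeta> ^ (ell ^ n * v) * \<zeta> ^ (ell ^ r)" unfolding uv r(1) by (rule power_add)
    then have "\<zeta> ^ (ell ^ r) = 1" using \<zeta>j 1 by (simp add: power_mult)
    moreover have "ell ^ r dvd ell ^ (n - 1)" using \<open>r < n\<close> by (intro le_imp_power_dvd) simp
    then obtain t where "ell ^ (n - 1) = ell ^ r * t" by blast
    ultimately have "\<zeta> ^ (ell ^ (n - 1)) = 1" by (simp add: power_mult)
    then show False using \<zeta> \<theta>1 by simp
  qed
  ultimately show thesis by (rule that)
qed

lemma order_factorization:
  fixes f :: "'a :: idom poly"
  assumes "f = (\<Prod>a\<in>#A. [:- a, 1:])"
  shows "f = (\<Prod>s | poly f s = 0. [:- s, 1:] ^ order s f)"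
proof -
  have "proots (\<Prod>a\<in>#B. [:- a, 1:]) = B" for B :: "'a multiset"
  proof (induction B)
    case (add b B)
    have "(\<Prod>a\<in>#B. [:- a, 1:]) \<noteq> 0" by (auto simp: prod_mset_zero_iff)
    then show ?case using add by (simp add: proots_mult del: mult_pCons_left)
  qed auto
  moreover have "f \<noteq> 0" using assms by (auto simp: prod_mset_zero_iff)
  ultimately have c: "count A s = order s f" for s using assms count_proots by metis
  have "s \<in># A \<longleftrightarrow> poly f s = 0" for s
    using c[of s] \<open>f \<noteq> 0\<close> order_root[of f s] by (metis count_eq_zero_iff)
  then have A: "set_mset A = {s. poly f s = 0}" by blast
  have "(\<Prod>a\<in>#A. [:- a, 1:]) = (\<Prod>s | poly f s = 0. [:- s, 1:] ^ order s f)"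
    by (simp only: image_prod_mset_multiplicity A c)
  with assms show ?thesis by (rule trans)
qed

lemma order_le_image:
  assumes \<sigma>: "\<sigma> \<in> Aut F" and f: "map_poly \<sigma> f = f" "f \<noteq> 0"
  shows "order s f \<le> order (\<sigma> s) f"
proof -
  note h = rhom_simps[OF rhom_map_poly[OF rhom_Aut[OF \<sigma>]]]
  obtain q where "f = [:- s, 1:] ^ order s f * q" using order_1[of s f] by (auto simp: dvd_def)
  then have "map_poly \<sigma> f = map_poly \<sigma> [:- s, 1:] ^ order s f * map_poly \<sigma> q" by (metis h(4,7))
  also have "map_poly \<sigma> [:- s, 1:] = [:- \<sigma> s, 1:]" by (simp add: map_poly_pCons AutD[OF \<sigma>])
  finally have "[:- \<sigma> s, 1:] ^ order s f dvd f" unfolding f(1) by (rule dvdI)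
  then show ?thesis using f(2) order_divides by blast
qed

text \<open>An automorphism that fixes \<open>f\<close> preserves the multiplicities of its roots.
  Index set and exponents are therefore allowed to depend on multiplicities only; the radicand and
  the divisor \<open>h\<close> of \<open>y\<close> are both of this form.\<close>

lemma map_poly_root_product:
  assumes \<sigma>: "\<sigma> \<in> Aut F" and f: "map_poly \<sigma> f = f" "f \<noteq> 0" and T: "T = {s. poly f s = 0 \<and> R (order s f)}"
  shows "map_poly \<sigma> (\<Prod>s\<in>T. [:- s, 1:] ^ r (order s f)) = (\<Prod>s\<in>T. [:- s, 1:] ^ r (order s f))"
proof -
  note h = rhom_simps[OF rhom_map_poly[OF rhom_Aut[OF \<sigma>]]]
  have inv: "Hilbert_Choice.inv \<sigma> \<in> Aut F" by (rule Aut_inv[OF \<sigma>])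
  have b: "bij \<sigma>" by (rule AutD(2)[OF \<sigma>])
  have f': "map_poly (Hilbert_Choice.inv \<sigma>) f = f"
  proof -
    have "map_poly (Hilbert_Choice.inv \<sigma>) (map_poly \<sigma> f) = f"
      using b AutD(5)[OF \<sigma>] AutD(5)[OF inv] by (intro poly_eqI) (simp add: coeff_map_poly bij_is_inj)
    then show ?thesis using f(1) by simp
  qed
  have o: "order (\<sigma> s) f = order s f" for s
    using order_le_image[OF \<sigma> f, of s] order_le_image[OF inv f' f(2), of "\<sigma> s"] b by (simp add: bij_is_inj)
  have T': "T = {s. 0 < order s f \<and> R (order s f)}" using f(2) by (auto simp: T order_root)
  have "\<sigma> ` T = T"
  proof (intro equalityI subsetI)
    fix s assume "s \<in> T"
    moreover have "s = \<sigma> (Hilbert_Choice.inv \<sigma> s)" using b by (simp add: bij_is_surj surj_f_inv_f)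
    ultimately show "s \<in> \<sigma> ` T" using o[of "Hilbert_Choice.inv \<sigma> s"] by (auto simp: T' intro!: image_eqI[of _ _ "Hilbert_Choice.inv \<sigma> s"])
  qed (auto simp: T' o)
  have "map_poly \<sigma> (\<Prod>s\<in>T. [:- s, 1:] ^ r (order s f)) = (\<Prod>s\<in>T. [:- \<sigma> s, 1:] ^ r (order (\<sigma> s) f))"
    by (simp add: h map_poly_pCons AutD[OF \<sigma>] o)
  also have "\<dots> = (\<Prod>s\<in>\<sigma> ` T. [:- s, 1:] ^ r (order s f))"
    using b by (subst prod.reindex) (auto simp: bij_def inj_on_def)
  finally show ?thesis unfolding \<open>\<sigma> ` T = T\<close> .
qed

text \<open>Dividing \<open>y\<close> by a polynomial in \<open>x\<close> removes the roots whose multiplicity is divisible by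
  \<open>ell ^ n\<close>.\<close>

lemma kummer_model:
  fixes i :: "'a :: {alg_closed_field, field_char_0} \<Rightarrow> 'b :: field"
  assumes ell: "Factorial_Ring.prime ell" and n: "n \<ge> 1" and lam: "lam \<noteq> 0"
    and f: "f = (\<Prod>s | poly f s = 0. [:- s, 1:] ^ order s f)" "f \<noteq> 0"
    and pm: "plane_model i x y (monom 1 (ell ^ n) - [:smult lam f:])"
    and S: "S = {s. poly f s = 0 \<and> \<not> ell ^ n dvd order s f}"
    and h: "h = (\<Prod>s | poly f s = 0 \<and> ell ^ n dvd order s f. [:- s, 1:] ^ (order s f div ell ^ n))"
    and \<zeta>: "\<zeta> ^ (ell ^ n) = 1" "\<And>j. 0 < j \<Longrightarrow> j < ell ^ n \<Longrightarrow> \<zeta> ^ j \<noteq> 1"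
  shows "kummer i x (y / poly (map_poly i h) x) (ell ^ n) (smult lam (\<Prod>s\<in>S. [:- s, 1:] ^ order s f)) \<zeta> ell n S lam (\<lambda>s. order s f)"
    and "func_field i x (y / poly (map_poly i h) x) = func_field i x y" and "poly (map_poly i h) x \<noteq> 0"
proof -
  define N g where "N = ell ^ n" and "g = monom 1 N - [:smult lam f:]"
  define px where "px = (\<lambda>q. poly (map_poly i q) x)"
  define F where "F = smult lam (\<Prod>s\<in>S. [:- s, 1:] ^ order s f)"
  define y' where "y' = y / px h"
  have N: "N > 0" using ell prime_gt_0_nat by (simp add: N_def)
  have hom: "hom_on UNIV i" using pm by (auto simp: plane_model_def hom_on_def ring_hom_def)
  then have ri: "rhom i" by (simp add: rhom_def hom_on_def)
  have ev0: "eval2 i x y p = 0 \<longleftrightarrow> g dvd p" for p using pm by (simp add: plane_model_def g_def N_def)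
  have eval2: "eval2 i x u p = bieval i x u p" for u p by (simp add: eval2_def bieval_def)
  note rpx = rhom_poly_map[OF ri, of x, folded px_def]
  note px_simps = rhom_simps[OF rpx]
  have dg: "degree g = N"
  proof -
    have "coeff g N = 1" using N by (auto simp: g_def coeff_pCons split: nat.splits)
    moreover have "degree g \<le> N" unfolding g_def by (intro degree_diff_le degree_monom_le) simp
    ultimately show ?thesis using le_degree[of g N] by simp
  qed
  have small: "p = 0" if "degree p < N" "eval2 i x y p = 0" for p
    using that dvd_imp_degree_le[of g p] by (auto simp: ev0 dg)
  have px0: "px q = 0 \<longleftrightarrow> q = 0" for q
    using small[of "[:q:]"] N px_simps(1) by (auto simp: eval2 bieval_simps(1)[OF ri] px_def)
  have fin: "finite {s. poly f s = 0}" using f(2) by (rule poly_roots_finite)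
  then have finS: "finite S" and fin': "finite {s. poly f s = 0 \<and> N dvd order s f}" by (auto simp: S intro: finite_subset[rotated])
  have h0: "h \<noteq> 0" using fin' by (auto simp: h N_def)
  then show hx: "poly (map_poly i h) x \<noteq> 0" using px0 by (simp add: px_def)
  have F0: "F \<noteq> 0" using finS lam by (simp add: F_def)
  have "f = (\<Prod>s\<in>S \<union> {s. poly f s = 0 \<and> N dvd order s f}. [:- s, 1:] ^ order s f)"
    by (subst f(1)) (auto intro!: prod.cong simp: S N_def)
  also have "\<dots> = (\<Prod>s\<in>S. [:- s, 1:] ^ order s f) * (\<Prod>s | poly f s = 0 \<and> N dvd order s f. [:- s, 1:] ^ order s f)"
    using finS fin' by (intro prod.union_disjoint) (auto simp: S N_def)
  also have "(\<Prod>s | poly f s = 0 \<and> N dvd order s f. [:- s, 1:] ^ order s f) = h ^ N"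
    unfolding h prod_power_distrib N_def[symmetric] by (intro prod.cong refl) (simp add: power_mult[symmetric])
  finally have fF: "smult lam f = F * h ^ N" unfolding F_def by (metis mult_smult_left)
  have "eval2 i x y g = 0" by (simp add: ev0)
  then have "y ^ N = px (smult lam f)"
    unfolding g_def eval2 rhom_simps(6)[OF rhom_bieval[OF ri]] by (simp add: bieval_simps(1,2)[OF ri] px_def)
  then have "y ^ N = px F * px h ^ N" by (simp only: fF px_simps)
  then have y'N: "y' ^ N = px F" using px0 h0 by (simp add: y'_def power_divide)
  have indep: "p = 0" if p: "degree p < N" "eval2 i x y' p = 0" for p
  proof -
    \<comment> \<open>Multiplication by \<open>h ^ (N - 1)\<close> clears the denominators in a
      relation for \<open>y' = y / h\<close> and turns it into one for \<open>y\<close>.\<close>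
    define q where "q = (\<Sum>j<N. monom (coeff p j * h ^ (N - 1 - j)) j)"
    have cq: "coeff q j = coeff p j * h ^ (N - 1 - j)" if "j < N" for j
      using that by (simp add: q_def coeff_sum)
    have dq: "degree q < N" unfolding q_def using N by (intro degree_sum_less) (auto intro: le_less_trans[OF degree_monom_le])
    have "bieval i x y q = (\<Sum>j<N. px (coeff q j) * y ^ j)"
      unfolding bieval_altdef[OF ri dq] px_def ..
    also have "\<dots> = (\<Sum>j<N. px h ^ (N - 1) * (px (coeff p j) * y' ^ j))"
    proof (rule sum.cong[OF refl])
      fix j assume "j \<in> {..<N}"
      then have j: "j < N" and e: "N - 1 = (N - 1 - j) + j" by auto
      have "y = px h * y'" using hx by (simp add: y'_def px_def)
      then have "px (coeff q j) * y ^ j = px (coeff p j) * (px h ^ (N - 1 - j) * px h ^ j) * y' ^ j"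
        by (simp add: cq[OF j] px_simps power_mult_distrib mult_ac)
      also have "px h ^ (N - 1 - j) * px h ^ j = px h ^ (N - 1)" using e by (metis power_add)
      finally show "px (coeff q j) * y ^ j = px h ^ (N - 1) * (px (coeff p j) * y' ^ j)" by (simp add: mult_ac)
    qed
    also have "\<dots> = px h ^ (N - 1) * bieval i x y' p"
      unfolding bieval_altdef[OF ri p(1)] px_def by (simp add: sum_distrib_left)
    finally have "q = 0" using small[OF dq] p(2) by (simp add: eval2)
    then have "coeff p j = 0" if "j < N" for j using cq[OF that] h0 by simp
    then show "p = 0" using p(1) by (intro poly_eqI) (metis coeff_0 coeff_eq_0 le_less_trans not_le)
  qed
  have y'_eq: "y / poly (map_poly i h) x = y'" by (simp add: y'_def px_def)
  show "kummer i x (y / poly (map_poly i h) x) (ell ^ n) (smult lam (\<Prod>s\<in>S. [:- s, 1:] ^ order s f)) \<zeta> ell n S lam (\<lambda>s. order s f)"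
    unfolding y'_eq F_def[symmetric]
  proof unfold_locales
    show "y' ^ (ell ^ n) = poly (map_poly i F) x" using y'N by (simp add: N_def px_def)
  qed (use hom N F0 indep \<zeta> ell n finS lam in \<open>auto simp: N_def F_def\<close>)
  have sub: "func_field i x u \<subseteq> func_field i x v" if "u = v * px q \<or> u = v / px q" for u v q
  proof -
    note s = generate_field_FR[of "range i \<union> {x, v}", folded func_field_def]
    have mem: "range i \<subseteq> func_field i x v" "x \<in> func_field i x v" "v \<in> func_field i x v" using s(2) by auto
    have "px q \<in> func_field i x v" unfolding px_def
      using mem rhom_simps(1)[OF ri] by (intro poly_in_subring is_subfieldD(1)[OF s(1)]) (auto simp: polys_def coeff_map_poly)
    then have "u \<in> func_field i x v" using that mem(3) is_subfield_closed(4)[OF s(1)] is_subfieldD(3)[OF s(1)] by auto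
    then show ?thesis unfolding func_field_def[of i x u] using mem by (intro generate_field_FR(3)[OF s(1)]) auto
  qed
  have "y = y' * px h" using hx by (simp add: y'_def px_def)
  then show "func_field i x (y / poly (map_poly i h) x) = func_field i x y"
    using sub[of y y' h] sub[of y' y h] unfolding y'_eq by (auto simp: y'_def)
qed

text \<open>Irreducibility of the model. If \<open>ell\<close> divided all exponents,
  \<open>F\<close> would be \<open>q ^ ell\<close>, and \<open>y ^ (N / ell)\<close> divided by
  \<open>q\<close> would be a root of unity, hence a constant; this contradicts the independence of
  the powers of \<open>y\<close> below \<open>N\<close>.\<close>

lemma (in kummer) exists_coprime_exponent: "\<exists>s\<in>S. coprime (e s) N"
proof (rule ccontr)
  assume "\<not> ?thesis"
  then have d: "ell dvd e s" if "s \<in> S" for s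
    using that prime_imp_coprime[OF ell, of "e s"] by (auto simp: N_eq coprime_commute)
  have e2: "ell > 1" using ell prime_gt_1_nat by blast
  obtain c where c: "c ^ ell = lam" using nth_root_exists[of ell lam] e2 by auto
  define q where "q = smult c (\<Prod>s\<in>S. [:- s, 1:] ^ (e s div ell))"
  have "(\<Prod>s\<in>S. [:- s, 1:] ^ (e s div ell)) ^ ell = (\<Prod>s\<in>S. [:- s, 1:] ^ e s)"
    unfolding prod_power_distrib using d by (intro prod.cong refl) (simp add: power_mult[symmetric])
  then have F: "F = q ^ ell" by (simp add: q_def smult_power c F_eq)
  define M where "M = ell ^ (n - 1)"
  have NM: "N = M * ell" using n by (simp add: N_eq M_def flip: power_Suc2)
  have M: "0 < M" "M < N" using N e2 by (auto simp: NM)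
  have q0: "q \<noteq> 0" using F F0 e2 by auto
  have "(y ^ M / px q) ^ ell = i 1"
    using y_pow' q0 F0 by (simp add: power_divide power_mult[symmetric] NM[symmetric] F px_simps px_eq_0 i_simps)
  then obtain d where "y ^ M / px q = i d" using power_const[of _ ell 1] e2 by auto
  then have "y ^ M = px (smult d q)" using q0 px_eq_0 by (simp add: px_const field_simps)
  then have "ev (monom 1 M - [:smult d q:]) = 0" by (simp add: ev_simps ev_const ev_monom)
  moreover have "degree (monom (1 :: 'a poly) M - [:smult d q:]) < N"
    using M by (intro le_less_trans[OF degree_diff_le[of _ M]]) (auto simp: degree_monom_eq)
  ultimately have "monom 1 M - [:smult d q:] = 0" by (rule ev_eq_0[rotated])
  moreover have "coeff (monom 1 M - [:smult d q:]) M = 1" using M by (auto simp: coeff_pCons split: nat.splits)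
  ultimately show False by simp
qed

text \<open>Powers of \<open>ell\<close> in the denominators are units at \<open>W\<close>. If
  \<open>a\<close> were outside \<open>W\<close>, its inverse would lie in the maximal ideal, and
  the reversed monic equation would exhibit \<open>1\<close> as a multiple of it.\<close>

lemma ell_integer_in_valuation_ring:
  fixes a :: "'a :: field_char_0"
  assumes W: "valuation_ring UNIV W" and ell: "of_nat ell \<notin> max_ideal W" "ell > 0" and a: "ell_integer ell a"
  shows "a \<in> W"
proof (rule ccontr)
  assume aW: "a \<notin> W"
  note sW = valuation_ringD(1)[OF W]
  note c = is_subring_closed[OF sW]
  have nat: "of_nat m \<in> W" for m by (induction m) (auto intro: c)
  have int: "of_int m \<in> W" for m using nat c(5) by (cases m rule: int_cases2) auto
  have "inverse (of_nat ell) \<in> W" using ell not_max_ideal[OF nat] by auto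
  then have inv: "inverse (of_nat ell ^ m) \<in> W" for m using c(7) by (simp add: power_inverse[symmetric])
  obtain p where p: "lead_coeff p = 1" "\<And>j. \<exists>m. of_nat ell ^ m * coeff p j \<in> \<int>" "poly p a = 0"
    using a by (auto simp: ell_integer_def)
  have cW: "coeff p j \<in> W" for j
  proof -
    obtain m where "of_nat ell ^ m * coeff p j \<in> \<int>" using p(2) by blast
    then have "of_nat ell ^ m * coeff p j \<in> W" using int by (auto elim: Ints_cases)
    then have "inverse (of_nat ell ^ m) * (of_nat ell ^ m * coeff p j) \<in> W" by (rule c(4)[OF inv])
    moreover have "inverse (of_nat ell ^ m) * (of_nat ell ^ m * coeff p j) = coeff p j" using ell(2) by (simp add: field_simps)
    ultimately show ?thesis by simp
  qed
  have a0: "inverse a \<in> max_ideal W" "a \<noteq> 0" using inverse_max_ideal[OF W _ aW] aW c(2) by auto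
  obtain b q where q: "reflect_poly p = pCons b q" by (cases "reflect_poly p") auto
  have "b = 1" using p(1) q by (metis coeff_0_reflect_poly coeff_pCons_0)
  have "reflect_poly p \<in> polys W" using cW c(2) by (simp add: polys_def coeff_reflect_poly)
  then have "poly q (inverse a) \<in> W"
    using q max_idealD[OF a0(1)] by (intro poly_in_subring[OF sW]) (auto simp: polys_pCons_iff)
  moreover have "poly (reflect_poly p) (inverse a) = 0" using a0(2) p(3) by (simp add: poly_reflect_poly_nz)
  then have "1 = - (inverse a * poly q (inverse a))" using \<open>b = 1\<close> by (simp add: q eq_neg_iff_add_eq_0)
  ultimately have "1 \<in> max_ideal W"
    using prime_idealD[OF prime_max_ideal[OF is_subfield_UNIV W]] a0(1) by metis
  then show False using c(1) by (simp add: max_ideal_def)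
qed


section \<open>Conjugation and membership of a single coordinate\<close>

lemma valuation_ring_vimage:
  assumes W: "valuation_ring UNIV W" and \<sigma>: "\<sigma> \<in> Aut F"
  shows "valuation_ring UNIV (\<sigma> -` W)" "max_ideal (\<sigma> -` W) = \<sigma> -` max_ideal W"
proof -
  note c = is_subring_closed[OF valuation_ringD(1)[OF W]]
  note D = AutD[OF \<sigma>]
  obtain w where "w \<notin> W" using valuation_ringD(3)[OF W] by blast
  then have "Hilbert_Choice.inv \<sigma> w \<notin> \<sigma> -` W" using D(2) by (simp add: bij_is_surj surj_f_inv_f)
  then have "\<sigma> -` W \<noteq> UNIV" by blast
  moreover have "is_subring (\<sigma> -` W)" unfolding is_subring_def by (auto simp: D(4-9) intro: c)
  ultimately show "valuation_ring UNIV (\<sigma> -` W)"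
    using valuation_ringD(4)[OF W] by (auto simp: valuation_ring_def subring_FR_iff D(11))
  show "max_ideal (\<sigma> -` W) = \<sigma> -` max_ideal W" by (auto simp: max_ideal_def D(5,11,13))
qed

lemma Aut_conjugate:
  assumes "\<sigma> \<in> Aut F" "\<rho> \<in> Aut F"
  shows "Hilbert_Choice.inv \<sigma> \<circ> \<rho> \<circ> \<sigma> \<in> Aut F"
    "((Hilbert_Choice.inv \<sigma> \<circ> \<rho> \<circ> \<sigma>) ^^ t) a = a \<longleftrightarrow> (\<rho> ^^ t) (\<sigma> a) = \<sigma> a"
proof -
  have b: "bij \<sigma>" by (rule AutD(2)[OF assms(1)])
  then have inv: "\<sigma> (Hilbert_Choice.inv \<sigma> c) = c" for c by (simp add: bij_is_surj surj_f_inv_f)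
  show "Hilbert_Choice.inv \<sigma> \<circ> \<rho> \<circ> \<sigma> \<in> Aut F" by (intro Aut_comp Aut_inv assms)
  have "\<sigma> (((Hilbert_Choice.inv \<sigma> \<circ> \<rho> \<circ> \<sigma>) ^^ t) a) = (\<rho> ^^ t) (\<sigma> a)"
    by (induction t) (simp_all add: inv)
  then show "((Hilbert_Choice.inv \<sigma> \<circ> \<rho> \<circ> \<sigma>) ^^ t) a = a \<longleftrightarrow> (\<rho> ^^ t) (\<sigma> a) = \<sigma> a"
    using AutD(14)[OF assms(1)] by metis
qed

lemma (in alg_base) max_pro_ell_pow_fixes_finite:
  assumes F: "F = cyclotomic_ell k ell" "Factorial_Ring.prime ell" and \<rho>: "\<rho> \<in> Aut F"
    and T: "finite T" "T \<subseteq> max_pro_ell k ell"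
  shows "\<exists>r. \<forall>s\<in>T. (\<rho> ^^ (ell ^ r)) s = s"
  using T
proof (induction T rule: finite_induct)
  case (insert s T)
  obtain r where r: "\<forall>s\<in>T. (\<rho> ^^ (ell ^ r)) s = s" using insert by auto
  obtain r' where r': "(\<rho> ^^ (ell ^ r')) s = s" using max_pro_ell_pow_fixed[OF F _ \<rho>, of s] insert.prems by auto
  have "ell ^ r dvd ell ^ (r + r')" "ell ^ r' dvd ell ^ (r + r')" by (simp_all add: power_add)
  then have "\<forall>s\<in>insert s T. (\<rho> ^^ (ell ^ (r + r'))) s = s" using r r' by (auto intro: funpow_dvd_fixed)
  then show ?case by blast
qed simp

text \<open>An element of \<open>k(J[ell ^ m])\<close> is fixed by every \<open>\<sigma>\<close> for which \<open>\<sigma> G / G\<close> is an \<open>ell ^ m\<close>-th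
  power.\<close>

lemma (in kummer) coordinate_in_max_pro_ell:
  assumes base: "alg_base (cyclotomic_ell k ell)" and st: "Aut (cyclotomic_ell k ell) \<subseteq> stab"
    and \<zeta>k: "\<zeta> \<in> cyclotomic_ell k ell" and Sk: "S \<subseteq> max_pro_ell k ell"
    and Si: "\<And>s. s \<in> S \<Longrightarrow> ell_integer ell s" and Sd: "\<And>s s'. s \<in> S \<Longrightarrow> s' \<in> S \<Longrightarrow> s \<noteq> s' \<Longrightarrow> ell_unit ell (s - s')"
    and lamu: "ell_unit ell lam" and G: "G \<in> Vgrp (ell ^ m)"
    and fix_a: "\<And>\<sigma>. \<sigma> \<in> Aut (cyclotomic_ell k ell) \<Longrightarrow> tau \<sigma> G / G \<in> Qgrp (ell ^ m) \<Longrightarrow> \<sigma> a = a"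
  shows "a \<in> max_pro_ell k ell"
proof -
  define E where "E = cyclotomic_ell k ell"
  interpret alg_base E using base by (simp add: E_def)
  note fix_a = fix_a[folded E_def]
  have st: "\<sigma> \<in> stab" "\<sigma> \<zeta> = \<zeta>" if "\<sigma> \<in> Aut E" for \<sigma>
    using that st \<zeta>k AutD(3)[OF that] by (auto simp: E_def)
  show ?thesis
  proof (rule mem_max_pro_ell[OF E_def ell])
    fix \<rho> \<sigma> assume \<rho>: "\<rho> \<in> Aut E" and \<sigma>: "\<sigma> \<in> Aut E"
    \<comment> \<open>The criterion asks about a conjugate \<open>\<sigma> a\<close>; conjugating
      \<open>\<rho>\<close> by \<open>\<sigma>\<close> brings the question back to \<open>a\<close>,
      about which \<open>fix_a\<close> speaks.\<close>
    define \<tau> where "\<tau> = Hilbert_Choice.inv \<sigma> \<circ> \<rho> \<circ> \<sigma>"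
    note conj = Aut_conjugate[OF \<sigma> \<rho>, folded \<tau>_def]
    \<comment> \<open>Unipotence is available only for automorphisms that fix \<open>S\<close>.
      Since \<open>S\<close> lies in the maximal extension, some \<open>ell\<close>-power of
      \<open>\<tau>\<close> does so.\<close>
    obtain r where r: "\<forall>s\<in>S. (\<tau> ^^ (ell ^ r)) s = s" using max_pro_ell_pow_fixes_finite[OF E_def ell conj(1) S Sk] by blast
    define \<tau>' where "\<tau>' = \<tau> ^^ (ell ^ r)"
    have \<tau>': "\<tau>' \<in> Aut E" unfolding \<tau>'_def by (rule Aut_funpow[OF conj(1)])
    have "tau (\<tau>' ^^ (ell ^ (m + m * N))) G / G \<in> Qgrp (ell ^ m)"
      using r by (intro tau_power_trivial st[OF \<tau>'] G) (simp add: \<tau>'_def)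
    then have "(\<tau>' ^^ (ell ^ (m + m * N))) a = a" by (rule fix_a[OF Aut_funpow[OF \<tau>']])
    then have "(\<tau> ^^ (ell ^ (r + (m + m * N)))) a = a" by (simp add: \<tau>'_def funpow_mult power_add mult_ac)
    then show "\<exists>r. (\<rho> ^^ (ell ^ r)) (\<sigma> a) = \<sigma> a" unfolding conj(2) by blast
  next
    fix W :: "'a set" and \<sigma> assume W: "valuation_ring UNIV W" "of_nat ell \<notin> max_ideal W" and \<sigma>: "\<sigma> \<in> Aut E"
    \<comment> \<open>Conjugation again: the place is pulled back along \<open>\<sigma>\<close>. It
      still does not lie above \<open>ell\<close>, so \<open>ell\<close>-integers are integral and
      \<open>ell\<close>-units are units there.\<close>
    note V = valuation_ring_vimage[OF W(1) \<sigma>]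
    have "\<sigma> (of_nat t) = of_nat t" for t by (induction t) (simp_all add: AutD[OF \<sigma>])
    then have ellV: "of_nat ell \<notin> max_ideal (\<sigma> -` W)" using W(2) by (simp add: V(2))
    have int: "b \<in> \<sigma> -` W" if "ell_integer ell b" for b
      by (rule ell_integer_in_valuation_ring[OF V(1) ellV _ that]) (use ell prime_gt_0_nat in blast)
    have unit: "b \<in> \<sigma> -` W" "b \<notin> max_ideal (\<sigma> -` W)" if "ell_unit ell b" for b
      using that int[of b] int[of "inverse b"] not_max_ideal[of b "\<sigma> -` W"] by (auto simp: ell_unit_def)
    obtain s0 where s0: "s0 \<in> S" "coprime (e s0) N" using exists_coprime_exponent by blast
    interpret R: reduction i x y N F \<zeta> ell n S lam e "\<sigma> -` W" s0
      using V(1) ellV int Si unit lamu Sd s0 by unfold_locales auto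
    obtain A where A: "finite A" "A \<subseteq> \<sigma> -` W"
      "\<And>\<tau>. \<tau> \<in> stab \<Longrightarrow> \<tau> \<zeta> = \<zeta> \<Longrightarrow> (\<forall>c\<in>A. \<tau> c - c \<in> max_ideal (\<sigma> -` W)) \<Longrightarrow> tau \<tau> G / G \<in> Qgrp (ell ^ m)"
      using R.inertia_trivial[OF G] by (elim exE conjE) blast
    have "\<rho> (\<sigma> a) = \<sigma> a" if \<rho>: "\<rho> \<in> Aut E" and c: "\<forall>c\<in>\<sigma> ` A. \<rho> c - c \<in> max_ideal W" for \<rho>
    proof -
      define \<tau> where "\<tau> = Hilbert_Choice.inv \<sigma> \<circ> \<rho> \<circ> \<sigma>"
      note conj = Aut_conjugate[OF \<sigma> \<rho>, folded \<tau>_def]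
      have "\<sigma> (\<tau> b) = \<rho> (\<sigma> b)" for b using AutD(2)[OF \<sigma>] by (simp add: \<tau>_def bij_is_surj surj_f_inv_f)
      then have "\<forall>b\<in>A. \<tau> b - b \<in> max_ideal (\<sigma> -` W)" using c by (simp add: V(2) AutD(9)[OF \<sigma>])
      then have "\<tau> a = a" by (intro fix_a[OF conj(1)] A(3) st[OF conj(1)])
      then show ?thesis using conj(2)[of 1] by simp
    qed
    then show "\<exists>A. finite A \<and> A \<subseteq> W \<and> (\<forall>\<rho>\<in>Aut E. (\<forall>c\<in>A. \<rho> c - c \<in> max_ideal W) \<longrightarrow> \<rho> (\<sigma> a) = \<sigma> a)"
      using A(1,2) by (intro exI[of _ "\<sigma> ` A"]) auto
  qed
qed

lemma cyclotomic_ell_props: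
  assumes k: "is_subfield k" and alg: "\<And>a :: 'a :: {alg_closed_field, field_char_0}. algebraic_over k a"
  shows "alg_base (cyclotomic_ell k ell)" "k \<subseteq> cyclotomic_ell k ell" "z ^ (ell ^ m) = 1 \<Longrightarrow> z \<in> cyclotomic_ell k ell"
proof -
  note g = generate_field_FR[of "k \<union> {z. \<exists>m. z ^ (ell ^ m) = 1}", folded cyclotomic_ell_def]
  show kc: "k \<subseteq> cyclotomic_ell k ell" and "z ^ (ell ^ m) = 1 \<Longrightarrow> z \<in> cyclotomic_ell k ell" using g(2) by auto
  show "alg_base (cyclotomic_ell k ell)" using g(1) algebraic_over_mono[OF kc alg] by unfold_locales
qed

lemma base_in_max_pro_ell:
  assumes base: "alg_base (cyclotomic_ell k ell)" and ell: "Factorial_Ring.prime ell" and a: "a \<in> cyclotomic_ell k ell"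
  shows "a \<in> max_pro_ell k ell"
proof -
  interpret alg_base "cyclotomic_ell k ell" by (rule base)
  show ?thesis
  proof (rule mem_max_pro_ell[OF refl ell])
    fix W \<sigma> assume "\<sigma> \<in> Aut (cyclotomic_ell k ell)"
    then show "\<exists>A. finite A \<and> A \<subseteq> W \<and> (\<forall>\<rho>\<in>Aut (cyclotomic_ell k ell). (\<forall>c\<in>A. \<rho> c - c \<in> max_ideal W) \<longrightarrow> \<rho> (\<sigma> a) = \<sigma> a)"
      using a by (intro exI[of _ "{}"]) (simp add: AutD(3))
  qed (use a in \<open>auto simp: AutD(3) intro!: exI[of _ 0]\<close>)
qed

theorem theoremC:
  fixes k :: "'a :: {alg_closed_field, field_char_0} set"
    and ell n :: nat
    and f :: "'a poly" and lam :: 'a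
    and i :: "'a \<Rightarrow> 'b :: field" and x y :: 'b
    and S :: "'a set"
    and J :: "('n :: finite \<Rightarrow> 'a) set monoid"
  assumes "number_field k"
    and "\<forall>a :: 'a. algebraic_over k a"
    and "Factorial_Ring.prime ell"
    and "n \<ge> 1"
    and "\<forall>j. Polynomial.coeff f j \<in> k"
    and "Polynomial.lead_coeff f = 1"
    and "lam \<in> k"
    and "plane_model i x y (Polynomial.monom 1 (ell ^ n) - [:Polynomial.smult lam f:])"
    and "S = {s. Polynomial.poly f s = 0 \<and> \<not> ell ^ n dvd Polynomial.order s f}"
    and "\<exists>A. set_mset A \<subseteq> max_pro_ell k ell \<and> f = (\<Prod>s\<in>#A. [:- s, 1:])"
    and "\<exists>P\<in>points i (func_field i x y). totally_ramified i (func_field i x y) x P"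
    and "ell_unit ell lam"
    and "\<forall>s\<in>S. ell_integer ell s"
    and "\<forall>s\<in>S. \<forall>s'\<in>S. s \<noteq> s' \<longrightarrow> ell_unit ell (s - s')"
    and "is_jacobian k i x y J"
  shows "ell_torsion_field k ell J \<subseteq> max_pro_ell k ell"
proof -
  define E where "E = cyclotomic_ell k ell"
  note ell = assms(3)
  have k: "is_subfield k" using assms(1) by (simp add: number_field_def subfield_FR_iff)
  note E = cyclotomic_ell_props[OF k assms(2)[rule_format], where ell = ell, folded E_def]
  obtain A where A: "set_mset A \<subseteq> max_pro_ell k ell" "f = (\<Prod>s\<in>#A. [:- s, 1:])" using assms(10) by blast
  have f0: "f \<noteq> 0" using assms(6) by auto
  have lam0: "lam \<noteq> 0" using assms(12) by (simp add: ell_unit_def)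
  obtain \<zeta> :: 'a where \<zeta>: "\<zeta> ^ (ell ^ n) = 1" "\<And>j. 0 < j \<Longrightarrow> j < ell ^ n \<Longrightarrow> \<zeta> ^ j \<noteq> 1"
    using primitive_root_exists[OF ell assms(4)] by metis
  define h where "h = (\<Prod>s | poly f s = 0 \<and> ell ^ n dvd order s f. [:- s, 1:] ^ (order s f div ell ^ n))"
  define F where "F = smult lam (\<Prod>s\<in>S. [:- s, 1:] ^ order s f)"
  define y' where "y' = y / poly (map_poly i h) x"
  note model = kummer_model[OF ell assms(4) lam0 order_factorization[OF A(2)] f0 assms(8,9) h_def \<zeta>, folded F_def y'_def]
  interpret kummer i x y' "ell ^ n" F \<zeta> ell n S lam "\<lambda>s. order s f" by (rule model(1))
  have Kf: "func_field i x y = K" using model(2) K_func_field by simp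
  \<comment> \<open>The Galois action on divisor classes refers to the given coordinate
    \<open>y\<close>, the computation in \<open>K\<close> to \<open>y'\<close>. Galois also fixes
    \<open>h\<close>, so \<open>tau \<sigma>\<close> fixes both.\<close>
  have y: "y = y' * px h" using model(3) by (simp add: y'_def px_def)
  have Aut_k: "\<sigma> \<in> Aut k" if "\<sigma> \<in> Aut E" for \<sigma> using that Aut_mono[OF E(2)] by blast
  have st: "\<sigma> \<in> stab" "tau \<sigma> y = y" if "\<sigma> \<in> Aut E" for \<sigma>
  proof -
    have f: "map_poly \<sigma> f = f"
      using AutD[OF Aut_k[OF that]] assms(5) by (intro map_poly_fixed[of _ k]) (auto simp: polys_def)
    define P where "P = (\<Prod>s\<in>S. [:- s, 1:] ^ order s f)"
    have "map_poly \<sigma> P = P"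
      unfolding P_def by (rule map_poly_root_product[OF that f f0 assms(9), where r = "\<lambda>r. r"])
    then have "\<sigma> (coeff P j) = coeff P j" for j
      using coeff_map_poly[of \<sigma> P j] AutD(5)[OF that] by simp
    then have "map_poly \<sigma> F = F"
      using AutD(3,5,7)[OF Aut_k[OF that]] assms(7) by (intro poly_eqI) (simp add: F_def P_def[symmetric] coeff_map_poly)
    then show \<sigma>: "\<sigma> \<in> stab" using that Aut_mono[of "{}" E] by (auto simp: stab_def)
    have "map_poly \<sigma> h = h" unfolding h_def by (rule map_poly_root_product[OF that f f0 refl])
    then show "tau \<sigma> y = y"
      unfolding y using hom_on_simps(4)[OF tau(1)[OF \<sigma>] subfield_K y_K px_K] tau_px[OF \<sigma>] tau_simps(3)[OF \<sigma>] by simp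
  qed
  have J: "group J" "carrier J \<subseteq> proj_space"
    using assms(15) by (auto simp: is_jacobian_def abelian_variety_def proj_variety_def zariski_closed_def)
  obtain \<phi> where \<phi>: "\<phi> \<in> iso (pic0 i K) J"
    "\<forall>\<sigma>\<in>Aut k. \<forall>c\<in>carrier (pic0 i K). \<phi> (pic_act i x y \<sigma> c) = proj_act \<sigma> (\<phi> c)"
    using assms(15) unfolding is_jacobian_def Kf gal_UNIV by (elim conjE exE)
  have ell0: "ell > 0" using ell prime_gt_0_nat by blast
  have "v r / v s \<in> max_pro_ell k ell" if p: "p \<in> ell_torsion ell J" and v: "v \<in> p" "v s \<noteq> 0" for p v r s
  proof -
    obtain m D G where D: "Poly_Mapping.keys D \<subseteq> points i K" "div_class i K D \<in> carrier (pic0 i K)"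
      "p = \<phi> (div_class i K D)" and G: "G \<in> Vgrp (ell ^ m)"
      "\<And>P. P \<in> points i K \<Longrightarrow> int (ell ^ m) * Poly_Mapping.lookup D P = ord_at P G"
      using torsion_class[OF \<phi>(1) J(1) p ell0] by blast
    have GK: "G \<in> K" "G \<noteq> 0" using G(1) by (auto simp: Vgrp_def)
    have "\<sigma> (v r / v s) = v r / v s" if \<sigma>: "\<sigma> \<in> Aut E" and Q: "tau \<sigma> G / G \<in> Qgrp (ell ^ m)" for \<sigma>
    proof -
      have "pic_act i x y \<sigma> (div_class i K D) = div_class i K D"
        using pic_act_eq[OF st(1)[OF \<sigma>] Kf st(2)[OF \<sigma>] D(1)] push_div_class[OF st(1)[OF \<sigma>] D(1) _ GK G(2) Q] ell0 by simp
      then have "proj_act \<sigma> p = p" using bspec[OF bspec[OF \<phi>(2) Aut_k[OF \<sigma>]] D(2)] D(3) by simp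
      then have "\<sigma> \<circ> v \<in> p" using v(1) by (auto simp: proj_act_def)
      moreover have "p \<in> proj_space" using p J(2) by (auto simp: ell_torsion_def)
      then obtain w where "p = proj_pt w" by (auto simp: proj_space_def)
      \<comment> \<open>A fixed point only makes the vectors \<open>\<sigma> \<circ> v\<close> and
        \<open>v\<close> proportional; the factors cancel in the ratio of two coordinates.\<close>
      ultimately obtain a b where ab: "a \<noteq> 0" "v = (\<lambda>j. a * w j)" "b \<noteq> 0" "\<sigma> \<circ> v = (\<lambda>j. b * w j)"
        using v(1) by (auto simp: proj_pt_def)
      have w: "\<sigma> (v t) = b * w t" "v t = a * w t" for t using fun_cong[OF ab(4), of t] fun_cong[OF ab(2), of t] by auto
      have "\<sigma> (v r / v s) = w r / w s" using ab(3) by (simp add: AutD(12)[OF \<sigma>] w(1))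
      also have "\<dots> = v r / v s" using ab(1) by (simp add: w(2))
      finally show ?thesis .
    qed
    moreover have "s \<in># A" if "s \<in> S" for s using that assms(9) A(2) by (auto simp: poly_prod_mset prod_mset_zero_iff)
    then have "S \<subseteq> max_pro_ell k ell" using A(1) by auto
    ultimately show ?thesis
      using E(1,3) st(1) assms(12-14) G(1) \<zeta>(1)
      by (intro coordinate_in_max_pro_ell[where a = "v r / v s" and G = G and m = m]) (auto simp: E_def)
  qed
  moreover have "k \<subseteq> max_pro_ell k ell"
    using base_in_max_pro_ell[OF E(1)[unfolded E_def] ell] E(2) by (auto simp: E_def)
  ultimately show ?thesis
    unfolding ell_torsion_field_def
    by (intro generate_field_FR(3)) (auto simp: max_pro_ell_def generate_field_FR(1))
qed

end
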